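(* Let $(H,W,\mu)$ be an abstract Wiener space, let $\nu$ be a probability measure on $(W,\mathcal{B}(W))$ and let $\alpha\in\,]0,1]$. Assume that the convolution $\rho:=\mu\star\nu$ is absolutely continuous with respect to $\mu$ with density $\xi$ belonging to $\mathcal{G}_{\sqrt{2/(1+\alpha)}}$. Then for every $f\in\mathbb{D}^{1,3+\alpha}$ one has $$\int_W|f(w)|^2\,d\rho(w)-\int_W(f\circ_{\alpha}f)(w)\,d\rho(w)\leq (1-\alpha)\int_W\Vert Df(w)\Vert_H^2\,d\rho(w)$$ or equivalently, $$\int_W|f(w)|^2\,d\rho(w)-\int_W|(\Gamma(\sqrt{\alpha})f)(w)|^2\cdot(\Gamma(1/\sqrt{\alpha})\xi)(w)\,d\mu(w)\leq (1-\alpha)\int_W\Vert Df(w)\Vert_H^2\,d\rho(w).$$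
   Context: Abstract Wiener space: $(H,\langle\cdot,\cdot\rangle_H)$ is a real separable Hilbert space continuously and densely embedded in a real Banach space $W$, and $\mu$ is the Gaussian probability measure on the Borel sets $\mathcal{B}(W)$ with $\int_W e^{i\langle w,w^*\rangle}d\mu(w)=e^{-\frac12\Vert w^*\Vert_H^2}$ for all $w^*\in W^*$, where $W^*\subset H$ is the dual of $W$ (dense in $H$) and $\langle\cdot,\cdot\rangle$ is the pairing between $W$ and $W^*$. The isometry $W^*\ni w^*\mapsto\langle\cdot,w^*\rangle\in\mathcal{L}^2(W,\mu)$ extends to $H$ and so defines $\langle w,h\rangle$ for $h\in H$, for $\mu$-almost every $w$. Functions are real-valued; $\Vert\cdot\Vert_p$ is the norm of $\mathcal{L}^p(W,\mu)$. Convolution: $(\mu\star\nu)(A)=\int_W\mu(A-w)\,d\nu(w)$. Sobolev spaces: on smooth cylindrical functions $f(w)=\varphi(\langle w,h_1\rangle,\dots,\langle w,h_n\rangle)$ with $n\in\mathbb{N}$, $h_j\in H$, $\varphi\in C_0^\infty(\mathbb{R}^n)$, put $Df:=\sum_{j=1}^n\frac{\partial\varphi}{\partial x_j}(\langle w,h_1\rangle,\dots,\langle w,h_n\rangle)h_j$. $\mathbb{D}^{1,p}$ is the closure of these functions under $\Vert f\Vert_{1,p}=(\int_W|f|^pd\mu+\int_W\Vert Df\Vert_H^pd\mu)^{1/p}$, with $D$ extended by closure. Chaos expansion: each $f\in\mathcal{L}^2(W,\mu)$ has a unique orthogonal expansion $f=\sum_{n\ge0}\delta^n(f_n)$, with $f_n$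 in the symmetric tensor power $H^{\hat\otimes n}$ and $\delta^n$ the $n$-fold multiple Wiener-Itô integral; $\Vert f\Vert_2^2=\sum_{n\ge0} n!\Vert f_n\Vert^2_{H^{\otimes n}}$. For $\lambda>0$, $\mathcal{G}_\lambda$ is the Hilbert space of (formal, if $\lambda<1$) series $f=\sum_{n}\delta^n(f_n)$ with $\Vert f\Vert_{\mathcal{G}_\lambda}^2:=\sum_n n!\lambda^{2n}\Vert f_n\Vert^2_{H^{\otimes n}}<\infty$; for $\lambda\ge1$ it is a subspace of $\mathcal{L}^2(W,\mu)$. For $a>0$, $\Gamma(a)\sum_n\delta^n(f_n):=\sum_n a^n\delta^n(f_n)$. For $a=e^{-\tau}\in\,]0,1]$, $\Gamma(a)$ is the Ornstein-Uhlenbeck operator $f\mapsto\int_Wf(e^{-\tau}w+\sqrt{1-e^{-2\tau}}\,\tilde w)\,d\mu(\tilde w)$. $\alpha$-product: for $\alpha\in\,]0,1]$, $f\circ_\alpha g:=\Gamma(1/\sqrt\alpha)\big(\Gamma(\sqrt\alpha)f\cdot\Gamma(\sqrt\alpha)g\big)$. For $f\in\mathcal{L}^{3+\alpha}(W,\mu)$ it is known that $f\circ_\alpha f\in\mathcal{G}_{\sqrt{(1+\alpha)/2}}$. Interpretation of integrals: for $u\in\mathcal{G}_\lambda$ and $v\in\mathcal{G}_{1/\lambda}$, $\int_W u\,v\,d\mu$ denotes the duality pairing $\sum_n n!\langle u_n,v_n\rangle_{H^{\otimes n}}$ (equal to the ordinary integral when $u,v\in\mathcal{L}^2(W,\mu)$).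 Thus $\int_W(f\circ_\alpha f)\,d\rho$ means the pairing of $f\circ_\alpha f\in\mathcal{G}_{\sqrt{(1+\alpha)/2}}$ with $\xi\in\mathcal{G}_{\sqrt{2/(1+\alpha)}}$, and $\int_W|\Gamma(\sqrt\alpha)f|^2\cdot\Gamma(1/\sqrt\alpha)\xi\,d\mu$ means the pairing of $(\Gamma(\sqrt\alpha)f)^2\in\mathcal{G}_{\sqrt{(1+\alpha)/(2\alpha)}}$ with $\Gamma(1/\sqrt\alpha)\xi\in\mathcal{G}_{\sqrt{2\alpha/(1+\alpha)}}$. *)

theory Defs
  imports "HOL-Probability.Probability"
begin

section \<open>Lebesgue spaces\<close>

definition Lp_space :: "'w measure \<Rightarrow> real \<Rightarrow> ('w \<Rightarrow> 'b::{real_normed_vector, second_countable_topology}) set"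
  where "Lp_space M p = {f \<in> borel_measurable M. integrable M (\<lambda>w. norm (f w) powr p)}"

definition Lp_norm :: "'w measure \<Rightarrow> real \<Rightarrow> ('w \<Rightarrow> 'b::real_normed_vector) \<Rightarrow> real"
  where "Lp_norm M p f = (LINT w|M. norm (f w) powr p) powr (1 / p)"


section \<open>Abstract Wiener spaces\<close>

text \<open>
  The dual of W is embedded into H: a functional L on W corresponds to the Riesz representative
  of its restriction to H, where \<open>\<iota>\<close> is the embedding of H into W.
\<close>

definition dual_embed :: "('h::real_inner \<Rightarrow> 'w::real_normed_vector) \<Rightarrow> ('w \<Rightarrow>\<^sub>L real) \<Rightarrow> 'h"
  where "dual_embed \<iota> L = (THE h. \<forall>x. blinfun_apply L (\<iota> x) = inner h x)"

text \<open>
  The second countability of W in the sort is no extra hypothesis: it follows from the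
  separability of H and the density of the embedding (next lemma).
\<close>

locale abstract_wiener_space =
  fixes \<iota> :: "'h::{real_inner, banach, second_countable_topology}
              \<Rightarrow> 'w::{banach, second_countable_topology}"
    and \<mu> :: "'w measure"
  assumes embedding: "bounded_linear \<iota>" "inj \<iota>" "closure (range \<iota>) = UNIV"
    and prob: "prob_space \<mu>"
    and sets_borel: "sets \<mu> = sets borel"
    and gaussian: "\<And>L :: 'w \<Rightarrow>\<^sub>L real.
      (CLINT w|\<mu>. iexp (blinfun_apply L w)) = of_real (exp (- (norm (dual_embed \<iota> L))\<^sup>2 / 2))"

lemma separable_of_dense_embedding:
  fixes \<iota> :: "'h::{real_normed_vector, second_countable_topology} \<Rightarrow> 'w::real_normed_vector"
  assumes "bounded_linear \<iota>" "closure (range \<iota>) = UNIV"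
  shows "\<exists>D. countable D \<and> closure D = (UNIV :: 'w set)"
proof -
  obtain D :: "'h set" where D: "countable D" "UNIV \<subseteq> closure D"
    using separable[of "UNIV :: 'h set"] by auto
  have "continuous_on (closure D) \<iota>"
    using assms(1) by (simp add: linear_continuous_on)
  then have "\<iota> ` closure D \<subseteq> closure (\<iota> ` D)"
    by (rule image_closure_subset) (auto simp: closure_subset)
  then have "range \<iota> \<subseteq> closure (\<iota> ` D)"
    using D(2) by (metis top.extremum_uniqueI)
  then have "closure (range \<iota>) \<subseteq> closure (\<iota> ` D)"
    by (simp add: closure_minimal)
  then show ?thesis
    using D(1) assms(2) by (metis countable_image top.extremum_uniqueI)
qed

text \<open>
  The random variable \<open>w \<mapsto> \<langle>w, h\<rangle>\<close>: extension of the isometry from the dual of W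
  (with the norm of H) to \<open>L\<^sup>2\<close>. It is determined up to equality almost everywhere.
\<close>

definition wiener_pairing ::
    "('h::real_inner \<Rightarrow> 'w::real_normed_vector) \<Rightarrow> 'w measure \<Rightarrow> 'h \<Rightarrow> 'w \<Rightarrow> real"
  where "wiener_pairing \<iota> \<mu> h =
    (SOME X. X \<in> Lp_space \<mu> 2 \<and>
       (\<exists>L :: nat \<Rightarrow> 'w \<Rightarrow>\<^sub>L real.
          (\<lambda>k. dual_embed \<iota> (L k)) \<longlonglongrightarrow> h \<and>
          (\<lambda>k. Lp_norm \<mu> 2 (\<lambda>w. blinfun_apply (L k) w - X w)) \<longlonglongrightarrow> 0))"


section \<open>Convolution\<close>

text \<open>
  The library convolution is restricted to finite-dimensional spaces. The measure
  \<open>A \<mapsto> \<integral> M (A - w) dN(w)\<close>: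
\<close>

definition convolve :: "'w::real_normed_vector measure \<Rightarrow> 'w measure \<Rightarrow> 'w measure"
  where "convolve M N =
    measure_of UNIV (sets borel) (\<lambda>A. \<integral>\<^sup>+ w. emeasure M ((\<lambda>x. x - w) ` A) \<partial>N)"

lemma
  fixes M N :: "'w::{real_normed_vector, second_countable_topology} measure"
  assumes "prob_space M" "prob_space N"
    and sM [measurable_cong]: "sets M = sets borel" and sN [measurable_cong]: "sets N = sets borel"
  shows convolve_eq_distr: "convolve M N = distr (M \<Otimes>\<^sub>M N) borel (\<lambda>(x, y). x + y)"
    and emeasure_convolve: "A \<in> sets borel \<Longrightarrow>
      emeasure (convolve M N) A = (\<integral>\<^sup>+ w. emeasure M ((\<lambda>x. x - w) ` A) \<partial>N)"
proof -
  interpret M: prob_space M by fact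
  interpret N: prob_space N by fact
  interpret pair_sigma_finite M N ..
  let ?D = "distr (M \<Otimes>\<^sub>M N) borel (\<lambda>(x, y). x + y)"
  have spM: "space M = UNIV" and spN: "space N = UNIV"
    using sets_eq_imp_space_eq[OF sM] sets_eq_imp_space_eq[OF sN] by auto
  have D: "emeasure ?D A = (\<integral>\<^sup>+ w. emeasure M ((\<lambda>x. x - w) ` A) \<partial>N)" if [measurable]: "A \<in> sets borel" for A
  proof -
    have "emeasure ?D A = (\<integral>\<^sup>+ z. indicator A z \<partial>?D)"
      by simp
    also have "\<dots> = (\<integral>\<^sup>+ z. indicator A (fst z + snd z) \<partial>(M \<Otimes>\<^sub>M N))"
      by (subst nn_integral_distr) (auto simp: case_prod_beta)
    also have "\<dots> = (\<integral>\<^sup>+ w. (\<integral>\<^sup>+ x. indicator A (x + w) \<partial>M) \<partial>N)"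
      by (subst nn_integral_snd[symmetric]) auto
    also have "\<dots> = (\<integral>\<^sup>+ w. emeasure M ((\<lambda>x. x - w) ` A) \<partial>N)"
    proof (rule nn_integral_cong)
      fix w
      have eq: "(\<lambda>x. x - w) ` A = (\<lambda>x. x + w) -` A \<inter> space M"
        by (force simp: spM image_iff algebra_simps)
      have "(\<integral>\<^sup>+ x. indicator A (x + w) \<partial>M) = (\<integral>\<^sup>+ x. indicator ((\<lambda>x. x - w) ` A) x \<partial>M)"
        by (rule nn_integral_cong) (auto simp: eq spM indicator_def)
      also have "\<dots> = emeasure M ((\<lambda>x. x - w) ` A)"
        unfolding eq by (rule nn_integral_indicator) measurable
      finally show "(\<integral>\<^sup>+ x. indicator A (x + w) \<partial>M) = emeasure M ((\<lambda>x. x - w) ` A)" .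
    qed
    finally show ?thesis .
  qed
  have "?D = measure_of UNIV (sets borel) (emeasure ?D)"
    by (metis measure_of_of_measure sets_distr space_borel space_distr)
  also have "\<dots> = convolve M N"
    unfolding convolve_def
    by (rule measure_of_eq) (use sets.space_closed[of borel] sets.sigma_sets_eq[of borel] D in auto)
  finally show *: "convolve M N = ?D" ..
  show "A \<in> sets borel \<Longrightarrow>
      emeasure (convolve M N) A = (\<integral>\<^sup>+ w. emeasure M ((\<lambda>x. x - w) ` A) \<partial>N)"
    unfolding * by (rule D)
qed


section \<open>Sobolev spaces\<close>

text \<open>
  A function on \<open>\<real>\<^sup>n\<close> is a function of a sequence that depends on the first n
  entries only; in the product topology its continuity is continuity on \<open>\<real>\<^sup>n\<close>.
\<close>

definition partial_deriv :: "nat \<Rightarrow> ((nat \<Rightarrow> real) \<Rightarrow> real) \<Rightarrow> (nat \<Rightarrow> real) \<Rightarrow> real"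
  where "partial_deriv i \<phi> x = deriv (\<lambda>t. \<phi> (x(i := t))) (x i)"

definition iterated_partial :: "nat list \<Rightarrow> ((nat \<Rightarrow> real) \<Rightarrow> real) \<Rightarrow> (nat \<Rightarrow> real) \<Rightarrow> real"
  where "iterated_partial is \<phi> = fold partial_deriv is \<phi>"

definition C0_infinity :: "nat \<Rightarrow> ((nat \<Rightarrow> real) \<Rightarrow> real) set"
  where "C0_infinity n = {\<phi>.
    (\<forall>x y. (\<forall>i<n. x i = y i) \<longrightarrow> \<phi> x = \<phi> y) \<and>
    (\<forall>is. set is \<subseteq> {..<n} \<longrightarrow>
       continuous_on UNIV (iterated_partial is \<phi>) \<and>
       (\<forall>i<n. \<forall>x. (\<lambda>t. iterated_partial is \<phi> (x(i := t))) differentiable (at (x i)))) \<and>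
    (\<exists>R. \<forall>x. \<phi> x \<noteq> 0 \<longrightarrow> (\<forall>i<n. \<bar>x i\<bar> \<le> R))}"

text \<open>\<open>smooth_cylindrical \<iota> \<mu> f G\<close>: f is a smooth cylindrical function and G is a version of Df.\<close>

definition smooth_cylindrical ::
    "('h::real_inner \<Rightarrow> 'w::real_normed_vector) \<Rightarrow> 'w measure \<Rightarrow> ('w \<Rightarrow> real) \<Rightarrow> ('w \<Rightarrow> 'h) \<Rightarrow> bool"
  where "smooth_cylindrical \<iota> \<mu> f G \<longleftrightarrow>
    (\<exists>n \<phi>. \<exists>h :: nat \<Rightarrow> 'h. \<phi> \<in> C0_infinity n \<and>
       f = (\<lambda>w. \<phi> (\<lambda>i. wiener_pairing \<iota> \<mu> (h i) w)) \<and>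
       G = (\<lambda>w. \<Sum>j<n. partial_deriv j \<phi> (\<lambda>i. wiener_pairing \<iota> \<mu> (h i) w) *\<^sub>R h j))"

definition sobolev_norm :: "'w measure \<Rightarrow> real \<Rightarrow> ('w \<Rightarrow> real) \<Rightarrow> ('w \<Rightarrow> 'h::real_inner) \<Rightarrow> real"
  where "sobolev_norm \<mu> p f G =
    ((LINT w|\<mu>. \<bar>f w\<bar> powr p) + (LINT w|\<mu>. norm (G w) powr p)) powr (1 / p)"

text \<open>The closure of the graph of D.\<close>

definition has_malliavin_derivative ::
    "('h::{real_inner, second_countable_topology} \<Rightarrow> 'w::real_normed_vector) \<Rightarrow> 'w measure
     \<Rightarrow> real \<Rightarrow> ('w \<Rightarrow> real) \<Rightarrow> ('w \<Rightarrow> 'h) \<Rightarrow> bool"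
  where "has_malliavin_derivative \<iota> \<mu> p f G \<longleftrightarrow>
    f \<in> Lp_space \<mu> p \<and> G \<in> Lp_space \<mu> p \<and>
    (\<exists>F DF. (\<forall>k::nat. smooth_cylindrical \<iota> \<mu> (F k) (DF k)) \<and>
       (\<lambda>k. sobolev_norm \<mu> p (\<lambda>w. F k w - f w) (\<lambda>w. DF k w - G w)) \<longlonglongrightarrow> 0)"

definition sobolev_space ::
    "('h::{real_inner, second_countable_topology} \<Rightarrow> 'w::real_normed_vector) \<Rightarrow> 'w measure
     \<Rightarrow> real \<Rightarrow> ('w \<Rightarrow> real) set"
  where "sobolev_space \<iota> \<mu> p = {f. \<exists>G. has_malliavin_derivative \<iota> \<mu> p f G}"

definition malliavin_derivative ::
    "('h::{real_inner, second_countable_topology} \<Rightarrow> 'w::real_normed_vector) \<Rightarrow> 'w measure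
     \<Rightarrow> real \<Rightarrow> ('w \<Rightarrow> real) \<Rightarrow> 'w \<Rightarrow> 'h"
  where "malliavin_derivative \<iota> \<mu> p f = (SOME G. has_malliavin_derivative \<iota> \<mu> p f G)"


section \<open>Symmetric tensor powers\<close>

text \<open>
  Some orthonormal basis of H. It serves to write down Hilbert-Schmidt inner products and
  multiple integrals; the resulting notions do not depend on its choice.
\<close>

definition hilbert_basis :: "'h::real_inner set"
  where "hilbert_basis =
    (SOME B. pairwise orthogonal B \<and> (\<forall>b\<in>B. norm b = 1) \<and> closure (span B) = UNIV)"

definition basis_words :: "nat \<Rightarrow> 'h::real_inner list set"
  where "basis_words n = {l. length l = n \<and> set l \<subseteq> hilbert_basis}"

text \<open>
  The n-th Hilbert tensor power of H is realised as the space of Hilbert-Schmidt n-linear forms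
  on H, the elementary tensor of \<open>h\<^sub>1, \<dots>, h\<^sub>n\<close> being
  \<open>(x\<^sub>1, \<dots>, x\<^sub>n) \<mapsto> \<Prod>i. \<langle>h\<^sub>i, x\<^sub>i\<rangle>\<close>. Arguments are lists of length n
  (forms vanish on other lists, so that equality of forms is equality of functions).
\<close>

definition sym_tensor :: "nat \<Rightarrow> ('h::real_inner list \<Rightarrow> real) set"
  where "sym_tensor n = {T.
    (\<forall>l. length l \<noteq> n \<longrightarrow> T l = 0) \<and>
    (\<forall>l i. length l = n \<longrightarrow> i < n \<longrightarrow> bounded_linear (\<lambda>x. T (l[i := x]))) \<and>
    (\<forall>l l'. mset l = mset l' \<longrightarrow> T l = T l') \<and>
    (\<lambda>l. (T l)\<^sup>2) summable_on basis_words n}"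

definition tensor_inner :: "nat \<Rightarrow> ('h::real_inner list \<Rightarrow> real) \<Rightarrow> ('h list \<Rightarrow> real) \<Rightarrow> real"
  where "tensor_inner n S T = (\<Sum>\<^sub>\<infinity>l\<in>basis_words n. S l * T l)"

definition tensor_norm :: "nat \<Rightarrow> ('h::real_inner list \<Rightarrow> real) \<Rightarrow> real"
  where "tensor_norm n T = sqrt (tensor_inner n T T)"


section \<open>Multiple integrals and the chaos expansion\<close>

text \<open>The monic Hermite polynomials orthogonal for the standard Gaussian measure.\<close>

fun hermite :: "nat \<Rightarrow> real \<Rightarrow> real" where
  "hermite 0 x = 1"
| "hermite (Suc 0) x = x"
| "hermite (Suc (Suc n)) x = x * hermite (Suc n) x - real (Suc n) * hermite n x"

text \<open>
  The multiple integral of \<open>b\<^sub>1 \<otimes> \<dots> \<otimes> b\<^sub>n\<close> for a list of basis vectors: each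
  vector b occurring k times in the list contributes the factor \<open>hermite k \<langle>w, b\<rangle>\<close>.
\<close>

definition basis_integral ::
    "('h::real_inner \<Rightarrow> 'w::real_normed_vector) \<Rightarrow> 'w measure \<Rightarrow> 'h list \<Rightarrow> 'w \<Rightarrow> real"
  where "basis_integral \<iota> \<mu> l w =
    (\<Prod>b\<in>set l. hermite (count_list l b) (wiener_pairing \<iota> \<mu> b w))"

text \<open>
  The multiple Wiener-Ito integral extends this linearly and continuously: the series below
  converges unconditionally in \<open>L\<^sup>2\<close>, and its sum is determined almost everywhere.
\<close>

definition multiple_integral ::
    "('h::real_inner \<Rightarrow> 'w::real_normed_vector) \<Rightarrow> 'w measure \<Rightarrow> nat \<Rightarrow> ('h list \<Rightarrow> real) \<Rightarrow> 'w \<Rightarrow> real"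
  where "multiple_integral \<iota> \<mu> n T =
    (SOME F. F \<in> Lp_space \<mu> 2 \<and>
       ((\<lambda>S. Lp_norm \<mu> 2 (\<lambda>w. F w - (\<Sum>l\<in>S. T l * basis_integral \<iota> \<mu> l w))) \<longlongrightarrow> 0)
         (finite_subsets_at_top (basis_words n)))"

text \<open>A formal series \<open>\<Sum>n. \<delta>\<^sup>n(k\<^sub>n)\<close> is represented by the sequence of its kernels.\<close>

type_synonym 'h chaos = "nat \<Rightarrow> 'h list \<Rightarrow> real"

definition chaos_expansion ::
    "('h::real_inner \<Rightarrow> 'w::real_normed_vector) \<Rightarrow> 'w measure \<Rightarrow> ('w \<Rightarrow> real) \<Rightarrow> 'h chaos \<Rightarrow> bool"
  where "chaos_expansion \<iota> \<mu> f k \<longleftrightarrow>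
    f \<in> Lp_space \<mu> 2 \<and> (\<forall>n. k n \<in> sym_tensor n) \<and>
    (\<lambda>N. Lp_norm \<mu> 2 (\<lambda>w. f w - (\<Sum>n<N. multiple_integral \<iota> \<mu> n (k n) w))) \<longlonglongrightarrow> 0"

definition chaos_of ::
    "('h::real_inner \<Rightarrow> 'w::real_normed_vector) \<Rightarrow> 'w measure \<Rightarrow> ('w \<Rightarrow> real) \<Rightarrow> 'h chaos"
  where "chaos_of \<iota> \<mu> f = (THE k. chaos_expansion \<iota> \<mu> f k)"

definition fun_of_chaos ::
    "('h::real_inner \<Rightarrow> 'w::real_normed_vector) \<Rightarrow> 'w measure \<Rightarrow> 'h chaos \<Rightarrow> 'w \<Rightarrow> real"
  where "fun_of_chaos \<iota> \<mu> k = (SOME f. chaos_expansion \<iota> \<mu> f k)"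

definition G_space :: "real \<Rightarrow> 'h::real_inner chaos set"
  where "G_space lam = {k. (\<forall>n. k n \<in> sym_tensor n) \<and>
    summable (\<lambda>n. fact n * lam ^ (2 * n) * (tensor_norm n (k n))\<^sup>2)}"

text \<open>Membership of an actual function, for \<open>lam \<ge> 1\<close>.\<close>

definition fun_in_G ::
    "('h::real_inner \<Rightarrow> 'w::real_normed_vector) \<Rightarrow> 'w measure \<Rightarrow> real \<Rightarrow> ('w \<Rightarrow> real) \<Rightarrow> bool"
  where "fun_in_G \<iota> \<mu> lam f \<longleftrightarrow> (\<exists>k \<in> G_space lam. chaos_expansion \<iota> \<mu> f k)"

text \<open>The duality pairing \<open>\<integral> u v d\<mu>\<close> of \<open>G_space lam\<close> and \<open>G_space (1 / lam)\<close>.\<close>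

definition chaos_pairing :: "'h::real_inner chaos \<Rightarrow> 'h chaos \<Rightarrow> real"
  where "chaos_pairing u v = (\<Sum>n. fact n * tensor_inner n (u n) (v n))"

text \<open>
  Second quantization \<open>\<Gamma>(a)\<close> on formal series, and on square integrable functions
  (the latter only for \<open>0 < a \<le> 1\<close>, when the result is again square integrable).
\<close>

definition Gam :: "real \<Rightarrow> 'h chaos \<Rightarrow> 'h chaos"
  where "Gam a k = (\<lambda>n l. a ^ n * k n l)"

definition Gam_fun ::
    "('h::real_inner \<Rightarrow> 'w::real_normed_vector) \<Rightarrow> 'w measure \<Rightarrow> real \<Rightarrow> ('w \<Rightarrow> real) \<Rightarrow> 'w \<Rightarrow> real"
  where "Gam_fun \<iota> \<mu> a f = fun_of_chaos \<iota> \<mu> (Gam a (chaos_of \<iota> \<mu> f))"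

definition alpha_product ::
    "('h::real_inner \<Rightarrow> 'w::real_normed_vector) \<Rightarrow> 'w measure \<Rightarrow> real
     \<Rightarrow> ('w \<Rightarrow> real) \<Rightarrow> ('w \<Rightarrow> real) \<Rightarrow> 'h chaos"
  where "alpha_product \<iota> \<mu> \<alpha> f g =
    Gam (1 / sqrt \<alpha>)
      (chaos_of \<iota> \<mu> (\<lambda>w. Gam_fun \<iota> \<mu> (sqrt \<alpha>) f w * Gam_fun \<iota> \<mu> (sqrt \<alpha>) g w))"

end

theory Submission
  imports Defs "HOL-Real_Asymp.Real_Asymp" "HOL-Combinatorics.Multiset_Permutations"
begin

text \<open>
  For a trigonometric polynomial \<open>f w = \<Sum>i. u\<^sub>i cos (\<langle>w, h\<^sub>i\<rangle> + a\<^sub>i)\<close> and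
  \<open>\<rho> = \<mu> \<star> \<nu>\<close>, the integration over \<open>\<mu>\<close> can be carried out explicitly, and the difference of the
  two sides becomes an integral over \<open>\<nu>\<close> of quadratic forms in the even and odd parts of
  \<open>E \<langle>h\<^sub>i, h\<^sub>k\<rangle>\<close>, where \<open>E t = exp (\<alpha> t) - exp t + (1 - \<alpha>) t exp t\<close>. The Taylor coefficients of E are
  nonnegative by Bernoulli's inequality, so these forms are nonnegative by Schur's product theorem.

  To reach all f in the Sobolev space, let \<open>c\<^sup>2 = (1 + \<alpha>) / 2\<close> and \<open>s\<^sup>2 = (1 - \<alpha>) / 2\<close>. The
  \<open>\<alpha>\<close>-square of f is \<open>\<Gamma>(1 / c)\<close> applied to \<open>Q w = \<integral> f (c w + s b) f (c w - s b) d\<mu>(b)\<close>, and \<open>\<xi> = \<Gamma>(c) \<eta>\<close>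
  with \<open>\<eta>\<close> square integrable. By hypercontractivity \<open>\<Gamma>(c)\<close> maps \<open>L\<^sup>q\<close> to \<open>L\<^sup>2\<close> for
  \<open>q = 1 + c\<^sup>2 = (3 + \<alpha>) / 2\<close>, and the same estimate makes Q continuous from \<open>L\<^sup>2\<^sup>q\<close> to \<open>L\<^sup>2\<close>; hence every term
  of the inequality is continuous for the Sobolev norm with exponent \<open>3 + \<alpha>\<close>, for which the
  trigonometric polynomials are dense. Hypercontractivity itself is obtained from the two-point
  inequality by tensorization and the central limit theorem.
\<close>

section \<open>Hilbert spaces\<close>

text \<open>Trigonometric polynomials are the test class because they are bounded, closed under
  products, and every operation at stake (\<Gamma>, the \<alpha>-product, squared gradients,
  integration against \<mu> or \<rho>) acts on them by an explicit formula in frequencies and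
  phases. Two obstacles shape the argument. The pairing with h is defined only up to a null set
  depending on h, so it is replaced by a version \<open>Z\<close> that is linear in h for every w.
  Under \<nu> the pairing has no meaning for general h in H, so the integration over \<nu> is done
  for frequencies coming from the dual of W, and the result is extended by continuity. The three
  terms of E mirror those of the inequality: \<open>exp (\<alpha> t)\<close> comes from the
  \<alpha>-square, \<open>- exp t\<close> from the square of f,
  \<open>(1 - \<alpha>) t exp t\<close> from the gradient. The exponent is dictated by the density:
  controlling the squares of f and of its gradient against \<xi> takes exactly q - 1 = c^2, while
  the bound on Q asks for \<alpha> \<le> q - 1. The chaos expansion of f is obtained by closure: the
  functions that have an expansion form a closed set containing the cosines.\<close>

lemma exists_orthogonal_to_closed_subspace:
  fixes V :: "'h::{real_inner, banach} set"
  assumes "subspace V" "closed V" "x \<notin> V"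
  shows "\<exists>z. z \<noteq> 0 \<and> (\<forall>v\<in>V. inner z v = 0)"
proof -
  define d where "d = infdist x V"
  have V0: "0 \<in> V" using assms(1) by (rule subspace_0)
  have dle: "d \<le> norm (x - v)" if "v \<in> V" for v
    unfolding d_def using infdist_le[OF that, of x] by (simp add: dist_norm)
  have d0: "0 \<le> d" unfolding d_def by (rule infdist_nonneg)
  have "\<exists>v\<in>V. norm (x - v) < d + 1 / real (Suc n)" for n
  proof -
    have "infdist x V < d + 1 / real (Suc n)" by (simp add: d_def)
    moreover have "bdd_below (dist x ` V)" by (intro bdd_belowI[of _ 0]) auto
    ultimately show ?thesis using V0
      by (auto simp: infdist_def cINF_less_iff dist_norm split: if_splits)
  qed
  then obtain y where yV: "\<And>n. y n \<in> V" and yn: "\<And>n. norm (x - y n) < d + 1 / real (Suc n)"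
    by metis
  \<comment> \<open>Parallelogram law: the midpoint of two points of V is in V, hence at distance at
    least d from x. This makes every minimizing sequence Cauchy.\<close>
  have key: "(norm (y m - y n))\<^sup>2 \<le> 2 * ((norm (x - y m))\<^sup>2 - d\<^sup>2) + 2 * ((norm (x - y n))\<^sup>2 - d\<^sup>2)" for m n
  proof -
    define u where "u = (1/2) *\<^sub>R (y m + y n)"
    have "u \<in> V" unfolding u_def using assms(1) yV by (simp add: subspace_add subspace_scale)
    then have "d\<^sup>2 \<le> (norm (x - u))\<^sup>2" using dle d0 by (simp add: power_mono)
    moreover have "(norm (y m - y n))\<^sup>2 = 2 * (norm (x - y m))\<^sup>2 + 2 * (norm (x - y n))\<^sup>2 - 4 * (norm (x - u))\<^sup>2"
      unfolding u_def power2_norm_eq_inner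
      by (simp add: inner_diff_left inner_diff_right inner_add_left inner_add_right inner_commute algebra_simps)
    ultimately show ?thesis by simp
  qed
  have lim: "(\<lambda>n. (norm (x - y n))\<^sup>2 - d\<^sup>2) \<longlonglongrightarrow> 0"
  proof -
    have "(\<lambda>n. norm (x - y n)) \<longlonglongrightarrow> d"
    proof (rule tendsto_sandwich)
      show "(\<lambda>n. d) \<longlonglongrightarrow> d" by simp
      show "(\<lambda>n. d + 1 / real (Suc n)) \<longlonglongrightarrow> d" by real_asymp
    qed (use dle yV less_imp_le[OF yn] in \<open>auto intro!: always_eventually\<close>)
    then have "(\<lambda>n. (norm (x - y n))\<^sup>2 - d\<^sup>2) \<longlonglongrightarrow> d\<^sup>2 - d\<^sup>2" by (intro tendsto_intros)
    then show ?thesis by simp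
  qed
  have "Cauchy y"
  proof (rule metric_CauchyI)
    fix e :: real assume e: "0 < e"
    then have "\<forall>\<^sub>F n in sequentially. (norm (x - y n))\<^sup>2 - d\<^sup>2 < e\<^sup>2 / 4"
      using lim by (intro order_tendstoD(2)) auto
    then obtain N where N: "\<And>n. n \<ge> N \<Longrightarrow> (norm (x - y n))\<^sup>2 - d\<^sup>2 < e\<^sup>2 / 4"
      by (auto simp: eventually_sequentially)
    show "\<exists>M. \<forall>m\<ge>M. \<forall>n\<ge>M. dist (y m) (y n) < e"
    proof (intro exI[of _ N] allI impI)
      fix m n assume "m \<ge> N" "n \<ge> N"
      then have "(norm (y m - y n))\<^sup>2 < e\<^sup>2" using key[of m n] N[OF \<open>m \<ge> N\<close>] N[OF \<open>n \<ge> N\<close>] by argo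
      then show "dist (y m) (y n) < e" using e by (simp add: dist_norm power_less_imp_less_base)
    qed
  qed
  then obtain v where v: "y \<longlonglongrightarrow> v" using Cauchy_convergent convergent_def by blast
  have vV: "v \<in> V" using assms(2) yV v by (meson closed_sequentially)
  have "(\<lambda>n. (norm (x - y n))\<^sup>2) \<longlonglongrightarrow> (norm (x - v))\<^sup>2" using v by (intro tendsto_intros)
  moreover have "(\<lambda>n. (norm (x - y n))\<^sup>2) \<longlonglongrightarrow> d\<^sup>2" using lim by (simp add: LIM_zero_iff)
  ultimately have dv: "(norm (x - v))\<^sup>2 = d\<^sup>2" by (rule LIMSEQ_unique)
  define z where "z = x - v"
  have "inner z w = 0" if w: "w \<in> V" for w
  proof (cases "w = 0")
    case False
    \<comment> \<open>This t minimizes \<open>norm (z - t *\<^sub>R w)\<close>; since the norm of z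
      is already minimal, the gain \<open>(inner z w)\<^sup>2 / inner w w\<close> must
      vanish.\<close>
    define t where "t = inner z w / inner w w"
    have "v + t *\<^sub>R w \<in> V" using assms(1) vV w by (simp add: subspace_add subspace_scale)
    from dle[OF this] have "d\<^sup>2 \<le> (norm (z - t *\<^sub>R w))\<^sup>2"
      using d0 by (simp add: z_def algebra_simps power_mono)
    also have "\<dots> = (norm z)\<^sup>2 - (inner z w)\<^sup>2 / inner w w"
      using False unfolding power2_norm_eq_inner
      by (simp add: inner_diff_left inner_diff_right inner_commute t_def field_simps power2_eq_square)
    finally have "(inner z w)\<^sup>2 / inner w w \<le> 0" using dv by (simp add: z_def)
    then show ?thesis using False
      by (metis divide_le_0_iff inner_gt_zero_iff inner_ge_zero leD le_less power2_eq_iff_nonneg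
          zero_eq_power2 zero_le_power2 zero_less_power2)
  qed simp
  moreover have "z \<noteq> 0" using vV assms(3) by (auto simp: z_def)
  ultimately show ?thesis by blast
qed

lemma closure_is_subspace:
  fixes V :: "'h::real_normed_vector set"
  assumes "subspace V"
  shows "subspace (closure V)"
proof (rule subspaceI)
  show "0 \<in> closure V" using assms closure_subset subspace_0 by blast
next
  fix x y assume "x \<in> closure V" "y \<in> closure V"
  then obtain u v where "\<And>n. u n \<in> V" "u \<longlonglongrightarrow> x" "\<And>n. v n \<in> V" "v \<longlonglongrightarrow> y"
    unfolding closure_sequential by blast
  then have "(\<lambda>n. u n + v n) \<longlonglongrightarrow> x + y" "\<And>n. u n + v n \<in> V"
    using assms by (auto intro: tendsto_add subspace_add)
  then show "x + y \<in> closure V" unfolding closure_sequential by (intro exI[of _ "\<lambda>n. u n + v n"]) auto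
next
  fix c x assume "x \<in> closure V"
  then obtain u where "\<And>n. u n \<in> V" "u \<longlonglongrightarrow> x" unfolding closure_sequential by blast
  then have "(\<lambda>n. c *\<^sub>R u n) \<longlonglongrightarrow> c *\<^sub>R x" "\<And>n. c *\<^sub>R u n \<in> V"
    using assms by (auto intro: tendsto_intros subspace_scale)
  then show "c *\<^sub>R x \<in> closure V" unfolding closure_sequential by (intro exI[of _ "\<lambda>n. c *\<^sub>R u n"]) auto
qed

lemma dense_of_trivial_orthogonal:
  fixes V :: "'h::{real_inner, banach} set"
  assumes "subspace V" "\<And>z. (\<forall>v\<in>V. inner z v = 0) \<Longrightarrow> z = 0"
  shows "closure V = UNIV"
proof (rule ccontr)
  assume "closure V \<noteq> UNIV"
  then obtain x where "x \<notin> closure V" by auto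
  then obtain z where "z \<noteq> 0" "\<forall>v\<in>closure V. inner z v = 0"
    using exists_orthogonal_to_closed_subspace[of "closure V" x] assms(1) closed_closure closure_is_subspace by blast
  with assms(2)[of z] closure_subset[of V] show False by blast
qed

text \<open>A vector z orthogonal to the kernel of F represents F after scaling by F z / |z|^2,
  because y - (F y / F z) z always lies in the kernel.\<close>

lemma riesz_representation:
  fixes F :: "'h::{real_inner, banach} \<Rightarrow> real"
  assumes "bounded_linear F"
  shows "\<exists>!h. \<forall>x. F x = inner h x"
proof -
  interpret bounded_linear F by fact
  have ex: "\<exists>h. \<forall>x. F x = inner h x"
  proof (cases "\<forall>x. F x = 0")
    case False
    then obtain x where x: "F x \<noteq> 0" by auto
    have "subspace {x. F x = 0}" by (auto simp: subspace_def add scaleR zero)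
    moreover have "closed {x. F x = 0}"
      by (intro closed_Collect_eq continuous_intros assms linear_continuous_on)
    ultimately obtain z where z: "z \<noteq> 0" "\<And>v. F v = 0 \<Longrightarrow> inner z v = 0"
      using exists_orthogonal_to_closed_subspace[of "{x. F x = 0}" x] x by auto
    have Fz: "F z \<noteq> 0" using z(2)[of z] z(1) by auto
    have "F y = inner ((F z / inner z z) *\<^sub>R z) y" for y
    proof -
      have "F (y - (F y / F z) *\<^sub>R z) = 0" using Fz by (simp add: diff scaleR)
      from z(2)[OF this] show ?thesis using Fz z(1)
        by (simp add: inner_diff_right field_simps)
    qed
    then show ?thesis by blast
  qed (auto intro!: exI[of _ 0])
  then obtain h where h: "\<And>x. F x = inner h x" by auto
  show ?thesis
  proof (rule ex1I[of _ h])
    fix g assume "\<forall>x. F x = inner g x"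
    then have "inner (g - h) (g - h) = 0" using h by (simp add: inner_diff_left)
    then show "g = h" by simp
  qed (use h in auto)
qed

section \<open>The Hahn-Banach theorem\<close>

definition sublinear :: "('v::real_vector \<Rightarrow> real) \<Rightarrow> bool"
  where "sublinear p \<longleftrightarrow> (\<forall>x y. p (x + y) \<le> p x + p y) \<and> (\<forall>t x. 0 \<le> t \<longrightarrow> p (t *\<^sub>R x) = t * p x)"

text \<open>Sliding along y: the result is again sublinear and below p (take t = 0), and its value
  at - y is at most - p y (take t = 1). A minimal p therefore equals its own shift and is
  odd.\<close>

definition sublinear_shift :: "('v::real_vector \<Rightarrow> real) \<Rightarrow> 'v \<Rightarrow> 'v \<Rightarrow> real"
  where "sublinear_shift p y x = (INF t\<in>{0..}. p (x + t *\<^sub>R y) - t * p y)"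

lemma sublinear_neg: assumes "sublinear p" shows "- p (- x) \<le> p x"
proof -
  have "p (0 *\<^sub>R x) = 0" using assms unfolding sublinear_def by (metis mult_zero_left order_refl)
  moreover have "p (x + - x) \<le> p x + p (- x)" using assms unfolding sublinear_def by blast
  ultimately show ?thesis by simp
qed

lemma sublinear_shift_le:
  assumes "sublinear p" "0 \<le> t"
  shows "sublinear_shift p y x \<le> p (x + t *\<^sub>R y) - t * p y"
    and "bdd_below ((\<lambda>t. p (x + t *\<^sub>R y) - t * p y) ` {0..})"
proof -
  have "- p (- x) \<le> p (x + t *\<^sub>R y) - t * p y" if "0 \<le> t" for t
  proof -
    have "p (t *\<^sub>R y) \<le> p (x + t *\<^sub>R y) + p (- x)" 
      using assms(1) unfolding sublinear_def by (metis add.commute add.assoc minus_add_cancel)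
    then show ?thesis using assms(1) that unfolding sublinear_def by simp
  qed
  then show bdd: "bdd_below ((\<lambda>t. p (x + t *\<^sub>R y) - t * p y) ` {0..})"
    by (intro bdd_belowI[of _ "- p (- x)"]) auto
  show "sublinear_shift p y x \<le> p (x + t *\<^sub>R y) - t * p y"
    unfolding sublinear_shift_def using assms(2) by (intro cINF_lower bdd) auto
qed

text \<open>Shifts by s for a and by t for b combine to a shift by s + t for a + b; under scaling by
  c > 0 the shift parameter is scaled as well.\<close>

lemma sublinear_sublinear_shift:
  assumes p: "sublinear p"
  shows "sublinear (sublinear_shift p y)"
proof -
  have ge: "c \<le> sublinear_shift p y x" if "\<And>t. 0 \<le> t \<Longrightarrow> c \<le> p (x + t *\<^sub>R y) - t * p y" for c x
    unfolding sublinear_shift_def using that by (intro cINF_greatest) auto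
  have add: "sublinear_shift p y (a + b) \<le> sublinear_shift p y a + sublinear_shift p y b" for a b
  proof -
    have *: "sublinear_shift p y (a + b) \<le> (p (a + s *\<^sub>R y) - s * p y) + (p (b + t *\<^sub>R y) - t * p y)"
      if "0 \<le> s" "0 \<le> t" for s t
    proof -
      have "sublinear_shift p y (a + b) \<le> p (a + b + (s + t) *\<^sub>R y) - (s + t) * p y"
        using p that by (intro sublinear_shift_le) auto
      moreover have "a + b + (s + t) *\<^sub>R y = (a + s *\<^sub>R y) + (b + t *\<^sub>R y)" by (simp add: algebra_simps)
      moreover have "p ((a + s *\<^sub>R y) + (b + t *\<^sub>R y)) \<le> p (a + s *\<^sub>R y) + p (b + t *\<^sub>R y)"
        using p unfolding sublinear_def by blast
      ultimately show ?thesis by (simp add: algebra_simps)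
    qed
    have "sublinear_shift p y (a + b) - sublinear_shift p y b \<le> sublinear_shift p y a"
    proof (rule ge)
      fix s :: real assume s: "0 \<le> s"
      have "sublinear_shift p y (a + b) - (p (a + s *\<^sub>R y) - s * p y) \<le> sublinear_shift p y b"
        by (rule ge) (use *[OF s] in \<open>simp add: algebra_simps\<close>)
      then show "sublinear_shift p y (a + b) - sublinear_shift p y b \<le> p (a + s *\<^sub>R y) - s * p y" by simp
    qed
    then show ?thesis by simp
  qed
  have p0: "p 0 = 0" using p unfolding sublinear_def by (metis mult_zero_left order_refl scaleR_zero_left)
  have z: "sublinear_shift p y 0 = 0"
  proof (rule antisym)
    show "sublinear_shift p y 0 \<le> 0" using sublinear_shift_le(1)[OF p, of 0 y 0] p0 by simp
    show "0 \<le> sublinear_shift p y 0" by (rule ge) (use p in \<open>simp add: sublinear_def\<close>)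
  qed
  have le: "sublinear_shift p y (c *\<^sub>R x) \<le> c * sublinear_shift p y x" if c: "0 < c" for c x
  proof -
    have "sublinear_shift p y (c *\<^sub>R x) / c \<le> sublinear_shift p y x"
    proof (rule ge)
      fix t :: real assume t: "0 \<le> t"
      have "sublinear_shift p y (c *\<^sub>R x) \<le> p (c *\<^sub>R x + (c * t) *\<^sub>R y) - (c * t) * p y"
        using p t c by (intro sublinear_shift_le) auto
      also have "c *\<^sub>R x + (c * t) *\<^sub>R y = c *\<^sub>R (x + t *\<^sub>R y)" by (simp add: algebra_simps)
      also have "p (c *\<^sub>R (x + t *\<^sub>R y)) = c * p (x + t *\<^sub>R y)" using p c unfolding sublinear_def by simp
      finally show "sublinear_shift p y (c *\<^sub>R x) / c \<le> p (x + t *\<^sub>R y) - t * p y"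
        using c by (simp add: field_simps)
    qed
    then show ?thesis using c by (simp add: field_simps)
  qed
  have hom: "sublinear_shift p y (c *\<^sub>R x) = c * sublinear_shift p y x" if "0 \<le> c" for c x
  proof (cases "c = 0")
    case False
    with that have c: "0 < c" by simp
    have "sublinear_shift p y ((1/c) *\<^sub>R (c *\<^sub>R x)) \<le> (1/c) * sublinear_shift p y (c *\<^sub>R x)"
      using c by (intro le) simp
    then have "c * sublinear_shift p y x \<le> sublinear_shift p y (c *\<^sub>R x)" using c by (simp add: field_simps)
    with le[OF c, of x] show ?thesis by simp
  qed (simp add: z)
  show ?thesis unfolding sublinear_def using add hom by blast
qed

text \<open>Hahn-Banach via minimal sublinear functionals: a minimal one is invariant under every shift,
  hence odd, hence linear.\<close>

lemma exists_linear_le_sublinear: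
  assumes q: "sublinear q"
  shows "\<exists>l. linear l \<and> (\<forall>x. l x \<le> q x)"
proof -
  define A where "A = {p. sublinear p \<and> p \<le> q}"
  have "\<exists>m\<in>A. \<forall>a\<in>A. a \<le> m \<longrightarrow> a = m"
  proof (rule predicate_Zorn)
    show "partial_order_on A (relation_of (\<lambda>a b. b \<le> a) A)"
      by (rule partial_order_on_relation_ofI) auto
  next
    fix C assume C: "C \<in> Chains (relation_of (\<lambda>a b. b \<le> a) A)"
    show "\<exists>u\<in>A. \<forall>a\<in>C. u \<le> a"
    proof (cases "C = {}")
      case True then show ?thesis using q by (auto simp: A_def)
    next
      case False
      have CA: "C \<subseteq> A" using C by (auto simp: Chains_def relation_of_def)
      have sub: "sublinear p" if "p \<in> C" for p using that CA by (auto simp: A_def)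
      have tot: "a \<le> b \<or> b \<le> a" if "a \<in> C" "b \<in> C" for a b
        using C that by (auto simp: Chains_def relation_of_def)
      \<comment> \<open>The lower bound of the chain is its pointwise infimum, finite because each
        member is at least - q (- x) at x. Subadditivity uses that two members of a chain dominate a
        common one.\<close>
      define u where "u x = (INF p\<in>C. p x)" for x
      have bdd: "bdd_below ((\<lambda>p. p x) ` C)" for x
      proof (rule bdd_belowI[of _ "- q (- x)"])
        fix r assume "r \<in> (\<lambda>p. p x) ` C"
        then obtain p where p: "p \<in> C" "r = p x" by auto
        have "p (- x) \<le> q (- x)" using p CA by (auto simp: A_def le_fun_def)
        then show "- q (- x) \<le> r" using sublinear_neg[OF sub[OF p(1)], of x] p by simp
      qed
      have ule: "u x \<le> p x" if "p \<in> C" for p x unfolding u_def by (rule cINF_lower[OF bdd that])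
      have uge: "c \<le> u x" if "\<And>p. p \<in> C \<Longrightarrow> c \<le> p x" for c x
        unfolding u_def using False that by (rule cINF_greatest)
      have "u (x + y) \<le> u x + u y" for x y
      proof -
        have *: "u (x + y) \<le> p x + p' y" if pp: "p \<in> C" "p' \<in> C" for p p'
        proof -
          obtain r where r: "r \<in> C" "r \<le> p" "r \<le> p'" using tot[OF pp] pp by blast
          have "u (x + y) \<le> r (x + y)" by (rule ule[OF r(1)])
          also have "\<dots> \<le> r x + r y" using sub[OF r(1)] unfolding sublinear_def by blast
          also have "\<dots> \<le> p x + p' y" using r by (intro add_mono) (auto simp: le_fun_def)
          finally show ?thesis .
        qed
        have "u (x + y) - u y \<le> u x"
        proof (rule uge)
          fix p assume p: "p \<in> C"
          have "u (x + y) - p x \<le> u y" by (rule uge) (use *[OF p] in \<open>simp add: algebra_simps\<close>)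
          then show "u (x + y) - u y \<le> p x" by simp
        qed
        then show ?thesis by simp
      qed
      moreover have "u (t *\<^sub>R x) = t * u x" if t: "0 \<le> t" for t x
      proof (cases "t = 0")
        case True
        have "p 0 = 0" if "p \<in> C" for p
          using sub[OF that] unfolding sublinear_def by (metis mult_zero_left order_refl scaleR_zero_left)
        then have "u 0 = 0" using uge[of 0 0] ule[of _ 0] False by fastforce
        then show ?thesis using True by simp
      next
        case nz: False
        show ?thesis
        proof (rule antisym)
          have "u (t *\<^sub>R x) / t \<le> u x"
          proof (rule uge)
            fix p assume p: "p \<in> C"
            have "u (t *\<^sub>R x) \<le> t * p x" using ule[OF p, of "t *\<^sub>R x"] sub[OF p] t unfolding sublinear_def by simp
            then show "u (t *\<^sub>R x) / t \<le> p x" using t nz by (simp add: field_simps)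
          qed
          then show "u (t *\<^sub>R x) \<le> t * u x" using t nz by (simp add: field_simps)
          show "t * u x \<le> u (t *\<^sub>R x)"
          proof (rule uge)
            fix p assume p: "p \<in> C"
            show "t * u x \<le> p (t *\<^sub>R x)" using ule[OF p, of x] sub[OF p] t unfolding sublinear_def
              by (simp add: mult_left_mono)
          qed
        qed
      qed
      ultimately have "sublinear u" unfolding sublinear_def by blast
      moreover have "u \<le> q"
      proof -
        obtain p where p: "p \<in> C" using False by blast
        have "u \<le> p" using ule[OF p] by (auto simp: le_fun_def)
        also have "p \<le> q" using CA p by (auto simp: A_def)
        finally show ?thesis .
      qed
      ultimately show ?thesis using ule by (auto simp: A_def le_fun_def intro!: bexI[of _ u])
    qed
  qed
  then obtain m where m: "sublinear m" "m \<le> q" and min: "\<And>a. sublinear a \<Longrightarrow> a \<le> m \<Longrightarrow> a = m"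
    unfolding A_def using order_trans by blast
  have odd: "m (- y) = - m y" for y
  proof -
    have "sublinear_shift m y x \<le> m x" for x using sublinear_shift_le(1)[OF m(1), of 0 y x] by simp
    then have "sublinear_shift m y = m"
      using sublinear_sublinear_shift[OF m(1)] by (intro min) (auto simp: le_fun_def)
    moreover have "m 0 = 0"
      using m(1) unfolding sublinear_def by (metis mult_zero_left order_refl scaleR_zero_left)
    ultimately have "m (- y) \<le> - m y" using sublinear_shift_le(1)[OF m(1), of 1 y "- y"] by simp
    then show ?thesis using sublinear_neg[OF m(1), of y] by simp
  qed
  have "linear m"
  proof (rule linearI)
    fix x y
    have "m (x + y) \<le> m x + m y" "m (- x + - y) \<le> m (- x) + m (- y)"
      using m(1) unfolding sublinear_def by blast+
    then show "m (x + y) = m x + m y" using odd[of "x + y"] odd[of x] odd[of y] by simp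
  next
    fix c x
    have pos: "m (c *\<^sub>R x) = c * m x" if "0 \<le> c" for c x using m(1) that unfolding sublinear_def by simp
    show "m (c *\<^sub>R x) = c *\<^sub>R m x"
      using pos[of c x] pos[of "- c" x] odd[of "c *\<^sub>R x"] by (cases "0 \<le> c") auto
  qed
  with m(2) show ?thesis by (auto simp: le_fun_def)
qed

text \<open>Instead of extending a functional from the line through v, the theorem is applied to the
  norm shifted along v: then l (- v) \<le> - norm v, so l v is nonzero, and l stays below the norm,
  hence is bounded.\<close>

lemma exists_nonzero_functional:
  fixes v :: "'w::real_normed_vector"
  assumes "v \<noteq> 0"
  shows "\<exists>L :: 'w \<Rightarrow>\<^sub>L real. blinfun_apply L v \<noteq> 0"
proof -
  have n: "sublinear (norm :: 'w \<Rightarrow> real)" by (auto simp: sublinear_def norm_triangle_ineq)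
  from exists_linear_le_sublinear[OF sublinear_sublinear_shift[OF n, of v]]
  obtain l where l: "linear l" "\<And>x. l x \<le> sublinear_shift norm v x" by auto
  have "l (- v) \<le> - norm v" using l(2)[of "- v"] sublinear_shift_le(1)[OF n, of 1 v "- v"] by simp
  then have nz: "l v \<noteq> 0" using assms l(1) by (auto simp: linear_neg)
  have le: "l x \<le> norm x" for x using l(2)[of x] sublinear_shift_le(1)[OF n, of 0 v x] by simp
  have "bounded_linear l"
  proof (rule bounded_linear_intro[where K = 1])
    fix x
    have "- l x \<le> norm x" using le[of "- x"] l(1) by (simp add: linear_neg)
    then show "norm (l x) \<le> norm x * 1" using le[of x] by simp
  qed (use l(1) in \<open>auto simp: linear_add linear_scale\<close>)
  then show ?thesis using nz by (intro exI[of _ "Blinfun l"]) (simp add: bounded_linear_Blinfun_apply)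
qed

section \<open>Orthonormal bases and Fourier expansions\<close>

lemma exists_hilbert_basis:
  "\<exists>B :: 'h::{real_inner, banach} set. pairwise orthogonal B \<and> (\<forall>b\<in>B. norm b = 1) \<and> closure (span B) = UNIV"
proof -
  define A where "A = {B :: 'h set. pairwise orthogonal B \<and> (\<forall>b\<in>B. norm b = 1)}"
  have "\<exists>M\<in>A. \<forall>X\<in>A. M \<subseteq> X \<longrightarrow> X = M"
  proof (rule subset_Zorn')
    fix C assume C: "subset.chain A C"
    then have CA: "C \<subseteq> A" by (auto simp: subset.chain_def)
    have "pairwise orthogonal (\<Union>C)"
    proof (rule pairwise_chain_Union)
      show "chain\<^sub>\<subseteq> C" using C unfolding subset.chain_def chain_subset_def by (metis sup2CI psubset_imp_subset subset_refl sup2E)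
    qed (use CA in \<open>auto simp: A_def\<close>)
    then show "\<Union>C \<in> A" using CA by (auto simp: A_def)
  qed
  then obtain M where M: "pairwise orthogonal M" "\<And>b. b \<in> M \<Longrightarrow> norm b = 1"
    and max: "\<And>X. X \<in> A \<Longrightarrow> M \<subseteq> X \<Longrightarrow> X = M" by (auto simp: A_def)
  have "closure (span M) = UNIV"
  proof (rule dense_of_trivial_orthogonal)
    fix z assume z: "\<forall>v\<in>span M. inner z v = 0"
    show "z = 0"
    proof (rule ccontr)
      assume "z \<noteq> 0"
      define y where "y = (1 / norm z) *\<^sub>R z"
      have y: "norm y = 1" using \<open>z \<noteq> 0\<close> by (simp add: y_def)
      have orth: "inner y v = 0" if "v \<in> span M" for v using z that by (simp add: y_def)
      have "insert y M \<in> A" unfolding A_def using M y orth span_base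
        by (auto simp: pairwise_insert orthogonal_def inner_commute)
      then have "y \<in> M" using max by blast
      then have "inner y y = 0" using orth span_base by blast
      then show False using y by simp
    qed
  qed simp
  with M show ?thesis by blast
qed

lemma
  shows pairwise_orthogonal_hilbert_basis: "pairwise orthogonal (hilbert_basis :: 'h::{real_inner, banach} set)"
    and norm_hilbert_basis: "\<And>b :: 'h. b \<in> hilbert_basis \<Longrightarrow> norm b = 1"
    and closure_span_hilbert_basis: "closure (span (hilbert_basis :: 'h set)) = UNIV"
  using someI_ex[OF exists_hilbert_basis[where 'h = 'h]] by (auto simp: hilbert_basis_def)

lemma inner_hilbert_basis:
  "a \<in> hilbert_basis \<Longrightarrow> b \<in> hilbert_basis \<Longrightarrow> inner a b = (if a = b then 1 else (0::real))"
  for a b :: "'h::{real_inner, banach}"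
  using pairwise_orthogonal_hilbert_basis[where 'h = 'h] norm_hilbert_basis[of a]
  by (auto simp: pairwise_def orthogonal_def norm_eq_1)

text \<open>The residual is orthogonal to the span of S, so Pythagoras makes the Fourier sum the
  best approximation from that span.\<close>

lemma norm_diff_fourier_le:
  fixes x y :: "'h::{real_inner, banach}"
  assumes "finite S" "S \<subseteq> hilbert_basis" "y \<in> span S"
  shows "norm (x - (\<Sum>b\<in>S. inner x b *\<^sub>R b)) \<le> norm (x - y)"
proof -
  define z where "z = x - (\<Sum>b\<in>S. inner x b *\<^sub>R b)"
  have zb: "inner z b = 0" if "b \<in> S" for b
  proof -
    have "inner (\<Sum>c\<in>S. inner x c *\<^sub>R c) b = (\<Sum>c\<in>S. if c = b then inner x b else 0)"
      unfolding inner_sum_left by (rule sum.cong) (use that assms(2) in \<open>auto simp: inner_hilbert_basis subset_iff\<close>)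
    then show ?thesis using that assms(1) by (simp add: z_def inner_diff_left)
  qed
  have "(\<Sum>b\<in>S. inner x b *\<^sub>R b) - y \<in> span S"
    by (rule span_diff[OF _ assms(3)]) (intro span_sum span_scale span_base)
  then have "inner z ((\<Sum>b\<in>S. inner x b *\<^sub>R b) - y) = 0"
    by (rule span_induct[where P = "\<lambda>v. inner z v = 0"]) (auto simp: subspace_def inner_add_right zb)
  then have "(norm (z + ((\<Sum>b\<in>S. inner x b *\<^sub>R b) - y)))\<^sup>2 = (norm z)\<^sup>2 + (norm ((\<Sum>b\<in>S. inner x b *\<^sub>R b) - y))\<^sup>2"
    by (intro norm_add_Pythagorean) (simp add: orthogonal_def)
  then have "(norm z)\<^sup>2 \<le> (norm (x - y))\<^sup>2" by (simp add: z_def)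
  then show ?thesis unfolding z_def using power2_le_imp_le by auto
qed

text \<open>One good finite combination over S suffices: for every finite Y containing S the Fourier
  sum over Y is at least as close. This is convergence along the net of finite subsets, without any
  enumeration of the basis.\<close>

lemma has_sum_fourier:
  fixes x :: "'h::{real_inner, banach}"
  shows "((\<lambda>b. inner x b *\<^sub>R b) has_sum x) hilbert_basis"
  unfolding has_sum_def tendsto_iff eventually_finite_subsets_at_top
proof (intro allI impI)
  fix e :: real assume "e > 0"
  moreover have "x \<in> closure (span hilbert_basis)" by (simp add: closure_span_hilbert_basis)
  ultimately obtain y where y: "y \<in> span hilbert_basis" "dist y x < e" unfolding closure_approachable by blast
  then obtain S r where S: "finite S" "S \<subseteq> hilbert_basis" "y = (\<Sum>b\<in>S. r b *\<^sub>R b)"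
    unfolding span_explicit by blast
  show "\<exists>X. finite X \<and> X \<subseteq> hilbert_basis \<and>
      (\<forall>Y. finite Y \<and> X \<subseteq> Y \<and> Y \<subseteq> hilbert_basis \<longrightarrow> dist (\<Sum>b\<in>Y. inner x b *\<^sub>R b) x < e)"
  proof (intro exI[of _ S] conjI allI impI S(1,2))
    fix Y assume Y: "finite Y \<and> S \<subseteq> Y \<and> Y \<subseteq> (hilbert_basis :: 'h set)"
    have "y \<in> span Y" unfolding S(3) using Y by (intro span_sum span_scale span_base) auto
    then have "norm (x - (\<Sum>b\<in>Y. inner x b *\<^sub>R b)) \<le> norm (x - y)" using Y by (intro norm_diff_fourier_le) auto
    then show "dist (\<Sum>b\<in>Y. inner x b *\<^sub>R b) x < e" using y(2) by (simp add: dist_norm norm_minus_commute)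
  qed
qed

lemma has_sum_bounded_linear_fourier:
  fixes x :: "'h::{real_inner, banach}" and F :: "'h \<Rightarrow> 'v::real_normed_vector"
  assumes "bounded_linear F"
  shows "((\<lambda>b. inner x b *\<^sub>R F b) has_sum F x) hilbert_basis"
  using has_sum_bounded_linear[OF assms has_sum_fourier[of x]] assms
  by (simp add: o_def linear_simps)

lemma has_sum_parseval:
  fixes x y :: "'h::{real_inner, banach}"
  shows "((\<lambda>b. inner x b * inner y b) has_sum inner x y) hilbert_basis"
  using has_sum_bounded_linear_fourier[OF bounded_linear_inner_right[of y], of x] by (simp add: inner_commute)

section \<open>Square integrable functions\<close>

abbreviation L2 :: "'a measure \<Rightarrow> ('a \<Rightarrow> real) set" where "L2 M \<equiv> Lp_space M 2"
abbreviation n2 :: "'a measure \<Rightarrow> ('a \<Rightarrow> real) \<Rightarrow> real" where "n2 M \<equiv> Lp_norm M 2"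

lemma powr_2_abs: "\<bar>x\<bar> powr 2 = x\<^sup>2" for x :: real
  by (cases "x = 0") auto

lemma L2_iff: "f \<in> L2 M \<longleftrightarrow> f \<in> borel_measurable M \<and> integrable M (\<lambda>x. (f x)\<^sup>2)"
  by (simp add: Lp_space_def powr_2_abs)

lemma n2_eq: "n2 M f = sqrt (LINT x|M. (f x)\<^sup>2)"
  by (simp add: Lp_norm_def powr_2_abs powr_half_sqrt)

lemma n2_nonneg [simp]: "0 \<le> n2 M f" by (simp add: n2_eq)

lemma n2_power2: "(n2 M f)\<^sup>2 = (LINT x|M. (f x)\<^sup>2)" by (simp add: n2_eq)

lemma L2_mult_integrable: assumes "f \<in> L2 M" "g \<in> L2 M" shows "integrable M (\<lambda>x. f x * g x)"
proof (rule Bochner_Integration.integrable_bound)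
  show "integrable M (\<lambda>x. (f x)\<^sup>2 + (g x)\<^sup>2)" using assms by (auto simp: L2_iff)
  have "\<bar>a * b\<bar> \<le> a\<^sup>2 + b\<^sup>2" for a b :: real
    using sum_squares_bound[of a b] sum_squares_bound[of a "-b"] by (auto simp: abs_if)
  then show "AE x in M. norm (f x * g x) \<le> norm ((f x)\<^sup>2 + (g x)\<^sup>2)" by auto
qed (use assms in \<open>auto simp: L2_iff\<close>)

lemma L2_lincomb: assumes "f \<in> L2 M" "g \<in> L2 M" shows "(\<lambda>x. a * f x + b * g x) \<in> L2 M"
proof -
  have "integrable M (\<lambda>x. a\<^sup>2 * (f x)\<^sup>2 + b\<^sup>2 * (g x)\<^sup>2 + 2 * a * b * (f x * g x))"
    using assms L2_mult_integrable[OF assms] by (auto simp: L2_iff)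
  moreover have "(\<lambda>x. (a * f x + b * g x)\<^sup>2) = (\<lambda>x. a\<^sup>2 * (f x)\<^sup>2 + b\<^sup>2 * (g x)\<^sup>2 + 2 * a * b * (f x * g x))"
    by (auto simp: power2_eq_square algebra_simps)
  ultimately show ?thesis using assms by (auto simp: L2_iff)
qed

lemma L2_add: "f \<in> L2 M \<Longrightarrow> g \<in> L2 M \<Longrightarrow> (\<lambda>x. f x + g x) \<in> L2 M"
  using L2_lincomb[of f M g 1 1] by simp

lemma L2_diff: "f \<in> L2 M \<Longrightarrow> g \<in> L2 M \<Longrightarrow> (\<lambda>x. f x - g x) \<in> L2 M"
  using L2_lincomb[of f M g 1 "-1"] by simp

lemma L2_zero: "(\<lambda>x. 0) \<in> L2 M" by (simp add: L2_iff)

lemma L2_cmult: "f \<in> L2 M \<Longrightarrow> (\<lambda>x. c * f x) \<in> L2 M"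
  using L2_lincomb[of f M "\<lambda>x. 0" c 1] by (simp add: L2_zero)

lemma L2_sum: "(\<And>i. i \<in> I \<Longrightarrow> f i \<in> L2 M) \<Longrightarrow> (\<lambda>x. \<Sum>i\<in>I. f i x) \<in> L2 M"
  by (induction I rule: infinite_finite_induct) (auto intro: L2_add L2_zero)

lemma L2_AE_cong: assumes "f \<in> L2 M" "g \<in> borel_measurable M" "AE x in M. f x = g x" shows "g \<in> L2 M"
proof -
  have "integrable M (\<lambda>x. (f x)\<^sup>2) \<longleftrightarrow> integrable M (\<lambda>x. (g x)\<^sup>2)"
    using assms by (intro integrable_cong_AE) (auto simp: L2_iff)
  then show ?thesis using assms by (simp add: L2_iff)
qed

lemma n2_AE_cong:
  "f \<in> borel_measurable M \<Longrightarrow> g \<in> borel_measurable M \<Longrightarrow> AE x in M. f x = g x \<Longrightarrow> n2 M f = n2 M g"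
  unfolding n2_eq by (intro arg_cong[where f = sqrt] integral_cong_AE) auto

lemma n2_cmult: "n2 M (\<lambda>x. c * f x) = \<bar>c\<bar> * n2 M f"
  by (simp add: n2_eq power_mult_distrib real_sqrt_mult)

lemma n2_diff_commute: "n2 M (\<lambda>x. f x - g x) = n2 M (\<lambda>x. g x - f x)"
  by (simp add: n2_eq power2_commute)

lemma n2_zero [simp]: "n2 M (\<lambda>x. 0) = 0" by (simp add: n2_eq)

lemma n2_power2_lincomb:
  assumes "f \<in> L2 M" "g \<in> L2 M"
  shows "(n2 M (\<lambda>x. a * f x + b * g x))\<^sup>2 = a\<^sup>2 * (n2 M f)\<^sup>2 + b\<^sup>2 * (n2 M g)\<^sup>2 + 2 * a * b * (LINT x|M. f x * g x)"
proof -
  have "(LINT x|M. (a * f x + b * g x)\<^sup>2) = (LINT x|M. a\<^sup>2 * (f x)\<^sup>2 + b\<^sup>2 * (g x)\<^sup>2 + 2 * a * b * (f x * g x))"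
    by (auto simp: power2_eq_square algebra_simps intro!: Bochner_Integration.integral_cong)
  then show ?thesis using assms L2_mult_integrable[OF assms]
    by (auto simp: L2_iff n2_power2)
qed

text \<open>Discriminant of the nonnegative quadratic function t -> |f + t g|^2; the case of g with
  norm 0 is separate because the function is then affine in t.\<close>

lemma cauchy_schwarz_L2:
  assumes "f \<in> L2 M" "g \<in> L2 M"
  shows "\<bar>LINT x|M. f x * g x\<bar> \<le> n2 M f * n2 M g"
proof -
  define C where "C = (LINT x|M. f x * g x)"
  have q: "0 \<le> (n2 M f)\<^sup>2 + t\<^sup>2 * (n2 M g)\<^sup>2 + 2 * t * C" for t
    using n2_power2_lincomb[OF assms, of 1 t] zero_le_power2[of "n2 M (\<lambda>x. 1 * f x + t * g x)"]
    unfolding C_def by simp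
  have "C\<^sup>2 \<le> (n2 M f * n2 M g)\<^sup>2"
  proof (cases "n2 M g = 0")
    case True
    have "C = 0"
    proof (rule ccontr)
      assume "C \<noteq> 0"
      \<comment> \<open>At this t the affine function takes the value - 1.\<close>
      then show False using q[of "- ((n2 M f)\<^sup>2 + 1) / (2 * C)"] True by (simp add: field_simps)
    qed
    then show ?thesis by simp
  next
    case False
    define G where "G = (n2 M g)\<^sup>2"
    have G: "0 < G" using False by (simp add: G_def)
    have "(- C / G)\<^sup>2 * G + 2 * (- C / G) * C = - (C\<^sup>2 / G)"
      using G by (simp add: power2_eq_square field_simps)
    then have "0 \<le> (n2 M f)\<^sup>2 - C\<^sup>2 / (n2 M g)\<^sup>2" using q[of "- C / G"] by (simp add: G_def)
    then show ?thesis using False by (simp add: field_simps power_mult_distrib)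
  qed
  then have "\<bar>C\<bar> \<le> n2 M f * n2 M g" by (simp add: abs_le_square_iff[symmetric] abs_mult del: power_mult_distrib)
  then show ?thesis by (simp add: C_def)
qed

lemma n2_triangle:
  assumes "f \<in> L2 M" "g \<in> L2 M"
  shows "n2 M (\<lambda>x. f x + g x) \<le> n2 M f + n2 M g"
proof -
  have "(n2 M (\<lambda>x. f x + g x))\<^sup>2 \<le> (n2 M f + n2 M g)\<^sup>2"
    using n2_power2_lincomb[OF assms, of 1 1] cauchy_schwarz_L2[OF assms] by (simp add: power2_sum)
  then show ?thesis by (rule power2_le_imp_le) simp
qed

lemma n2_triangle_diff:
  assumes "f \<in> L2 M" "g \<in> L2 M" "h \<in> L2 M"
  shows "n2 M (\<lambda>x. f x - h x) \<le> n2 M (\<lambda>x. f x - g x) + n2 M (\<lambda>x. g x - h x)"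
  using n2_triangle[OF L2_diff[OF assms(1,2)] L2_diff[OF assms(2,3)]] by simp

lemma n2_diff_abs_le:
  assumes "f \<in> L2 M" "g \<in> L2 M"
  shows "\<bar>n2 M f - n2 M g\<bar> \<le> n2 M (\<lambda>x. f x - g x)"
  using n2_triangle[OF L2_diff[OF assms] assms(2)] n2_triangle[OF L2_diff[OF assms(2,1)] assms(1)]
    n2_diff_commute[of M f g] by simp

text \<open>A general filter is used because the limit is taken along sequences, along the net of
  finite sets of basis words, and in the frequency of a cosine.\<close>

lemma integral_mult_tendsto_L2:
  assumes f: "\<forall>\<^sub>F n in E. f n \<in> L2 M" and F: "F \<in> L2 M" and g: "g \<in> L2 M"
    and lim: "((\<lambda>n. n2 M (\<lambda>x. F x - f n x)) \<longlongrightarrow> 0) E"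
  shows "((\<lambda>n. LINT x|M. f n x * g x) \<longlongrightarrow> (LINT x|M. F x * g x)) E"
proof (rule Lim_transform2[OF tendsto_const])
  have lim': "((\<lambda>n. n2 M (\<lambda>x. F x - f n x) * n2 M g) \<longlongrightarrow> 0) E" using tendsto_mult_left_zero[OF lim] .
  have le: "\<forall>\<^sub>F n in E. norm ((LINT x|M. F x * g x) - (LINT x|M. f n x * g x)) \<le> n2 M (\<lambda>x. F x - f n x) * n2 M g"
    using f
  proof eventually_elim
    fix n assume fn: "f n \<in> L2 M"
    have "(LINT x|M. F x * g x) - (LINT x|M. f n x * g x) = (LINT x|M. (F x - f n x) * g x)"
      using L2_mult_integrable[OF F g] L2_mult_integrable[OF fn g]
      by (subst Bochner_Integration.integral_diff[symmetric]) (auto simp: algebra_simps)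
    then show "norm ((LINT x|M. F x * g x) - (LINT x|M. f n x * g x)) \<le> n2 M (\<lambda>x. F x - f n x) * n2 M g"
      using cauchy_schwarz_L2[OF L2_diff[OF F fn] g] by simp
  qed
  show "((\<lambda>n. (LINT x|M. F x * g x) - (LINT x|M. f n x * g x)) \<longlongrightarrow> 0) E"
    by (rule Lim_null_comparison[OF le lim'])
qed

lemma n2_tendsto:
  assumes "\<And>n. f n \<in> L2 M" "F \<in> L2 M" "((\<lambda>n. n2 M (\<lambda>x. F x - f n x)) \<longlongrightarrow> 0) E"
  shows "((\<lambda>n. n2 M (f n)) \<longlongrightarrow> n2 M F) E"
proof (rule Lim_transform2[OF tendsto_const])
  show "((\<lambda>n. n2 M F - n2 M (f n)) \<longlongrightarrow> 0) E"
    by (rule Lim_null_comparison[OF _ assms(3)]) (use n2_diff_abs_le[OF assms(2,1)] in \<open>auto intro!: always_eventually\<close>)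
qed

lemma n2_eq_0_AE: assumes "f \<in> L2 M" "n2 M f = 0" shows "AE x in M. f x = 0"
proof -
  have "(LINT x|M. (f x)\<^sup>2) = 0" using assms(2) n2_power2[of M f] by simp
  then show ?thesis using assms(1) integral_nonneg_eq_0_iff_AE[of M "\<lambda>x. (f x)\<^sup>2"] by (auto simp: L2_iff)
qed

section \<open>Completeness of L^2\<close>

context prob_space
begin

lemma L2_const: "(\<lambda>x. c) \<in> L2 M" by (simp add: L2_iff)

lemma L2_bounded: "f \<in> borel_measurable M \<Longrightarrow> (\<And>x. \<bar>f x\<bar> \<le> K) \<Longrightarrow> f \<in> L2 M"
proof -
  assume [measurable]: "f \<in> borel_measurable M" and b: "\<And>x. \<bar>f x\<bar> \<le> K"
  have "(f x)\<^sup>2 \<le> K\<^sup>2" for x using power_mono[OF b, of x 2] by simp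
  then have "integrable M (\<lambda>x. (f x)\<^sup>2)" by (intro integrable_const_bound[where B = "K\<^sup>2"]) auto
  then show ?thesis by (simp add: L2_iff)
qed

lemma L2_integrable: "f \<in> L2 M \<Longrightarrow> integrable M f"
  using L2_mult_integrable[OF _ L2_const[of 1]] by simp

lemma integral_abs_le_n2: assumes "f \<in> L2 M" shows "(LINT x|M. \<bar>f x\<bar>) \<le> n2 M f"
proof -
  have "(\<lambda>x. \<bar>f x\<bar>) \<in> L2 M" using assms by (auto simp: L2_iff)
  from cauchy_schwarz_L2[OF this L2_const[of 1]] show ?thesis
    by (simp add: n2_eq prob_space)
qed

text \<open>An almost everywhere convergent subsequence exists; Fatou's lemma identifies its limit.\<close>

lemma L2_complete:
  assumes f: "\<And>n. f n \<in> L2 M"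
    and cauchy: "\<And>e. 0 < e \<Longrightarrow> \<exists>N. \<forall>i\<ge>N. \<forall>j\<ge>N. n2 M (\<lambda>x. f i x - f j x) < e"
  obtains F where "F \<in> L2 M" "(\<lambda>n. n2 M (\<lambda>x. F x - f n x)) \<longlonglongrightarrow> 0"
proof -
  have [measurable]: "f n \<in> borel_measurable M" for n using f by (simp add: L2_iff)
  obtain r where r: "strict_mono r" "AE x in M. Cauchy (\<lambda>i. f (r i) x)"
  proof (rule cauchy_L1_AE_cauchy_subseq)
    show "integrable M (f n)" for n using f by (rule L2_integrable)
    fix e :: real assume "0 < e"
    from cauchy[OF this] obtain N where N: "\<And>i j. i \<ge> N \<Longrightarrow> j \<ge> N \<Longrightarrow> n2 M (\<lambda>x. f i x - f j x) < e" by blast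
    show "\<exists>N. \<forall>i\<ge>N. \<forall>j\<ge>N. (LINT x|M. norm (f i x - f j x)) < e"
    proof (intro exI[of _ N] allI impI)
      fix i j assume "i \<ge> N" "j \<ge> N"
      then show "(LINT x|M. norm (f i x - f j x)) < e"
        using integral_abs_le_n2[OF L2_diff[OF f f], of i j] N[of i j] by simp
    qed
  qed
  define F where "F x = lim (\<lambda>i. f (r i) x)" for x
  have [measurable]: "F \<in> borel_measurable M" unfolding F_def by measurable
  have AEF: "AE x in M. (\<lambda>i. f (r i) x) \<longlonglongrightarrow> F x"
    using r(2) by eventually_elim (simp add: F_def Cauchy_convergent_iff convergent_LIMSEQ_iff)
  have key: "integrable M (\<lambda>x. (F x - f j x)\<^sup>2) \<and> n2 M (\<lambda>x. F x - f j x) \<le> e"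
    if e: "0 < e" and N: "\<And>i j. i \<ge> N \<Longrightarrow> j \<ge> N \<Longrightarrow> n2 M (\<lambda>x. f i x - f j x) < e" and j: "j \<ge> N" for e N j
  proof -
    have "(\<integral>\<^sup>+x. ennreal ((F x - f j x)\<^sup>2) \<partial>M) = (\<integral>\<^sup>+x. liminf (\<lambda>i. ennreal ((f (r i) x - f j x)\<^sup>2)) \<partial>M)"
    proof (rule nn_integral_cong_AE)
      show "AE x in M. ennreal ((F x - f j x)\<^sup>2) = liminf (\<lambda>i. ennreal ((f (r i) x - f j x)\<^sup>2))"
        using AEF
      proof eventually_elim
        fix x assume "(\<lambda>i. f (r i) x) \<longlonglongrightarrow> F x"
        then have "(\<lambda>i. ennreal ((f (r i) x - f j x)\<^sup>2)) \<longlonglongrightarrow> ennreal ((F x - f j x)\<^sup>2)"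
          by (intro tendsto_intros)
        then show "ennreal ((F x - f j x)\<^sup>2) = liminf (\<lambda>i. ennreal ((f (r i) x - f j x)\<^sup>2))"
          using lim_imp_Liminf[OF sequentially_bot] by metis
      qed
    qed
    also have "\<dots> \<le> liminf (\<lambda>i. \<integral>\<^sup>+x. ennreal ((f (r i) x - f j x)\<^sup>2) \<partial>M)"
      by (rule nn_integral_liminf) measurable
    also have "\<dots> \<le> ennreal (e\<^sup>2)"
    proof (rule Liminf_le)
      show "\<forall>\<^sub>F i in sequentially. (\<integral>\<^sup>+x. ennreal ((f (r i) x - f j x)\<^sup>2) \<partial>M) \<le> ennreal (e\<^sup>2)"
        unfolding eventually_sequentially
      proof (intro exI[of _ N] allI impI)
        fix i assume "i \<ge> N"
        then have "r i \<ge> N" using r(1) by (meson order_trans seq_suble)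
        have "(\<integral>\<^sup>+x. ennreal ((f (r i) x - f j x)\<^sup>2) \<partial>M) = ennreal ((n2 M (\<lambda>x. f (r i) x - f j x))\<^sup>2)"
          unfolding n2_power2 using L2_diff[OF f f, of "r i" j] by (intro nn_integral_eq_integral) (auto simp: L2_iff)
        also have "\<dots> \<le> ennreal (e\<^sup>2)" using N[OF \<open>r i \<ge> N\<close> j] by (intro ennreal_leI power_mono) auto
        finally show "(\<integral>\<^sup>+x. ennreal ((f (r i) x - f j x)\<^sup>2) \<partial>M) \<le> ennreal (e\<^sup>2)" .
      qed
    qed simp
    finally have le: "(\<integral>\<^sup>+x. ennreal ((F x - f j x)\<^sup>2) \<partial>M) \<le> ennreal (e\<^sup>2)" .
    have int: "integrable M (\<lambda>x. (F x - f j x)\<^sup>2)"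
      by (rule integrableI_bounded) (use le in \<open>auto intro: le_less_trans\<close>)
    then have "ennreal (LINT x|M. (F x - f j x)\<^sup>2) \<le> ennreal (e\<^sup>2)"
      using le by (subst nn_integral_eq_integral[symmetric]) auto
    then have "(n2 M (\<lambda>x. F x - f j x))\<^sup>2 \<le> e\<^sup>2" unfolding n2_power2 by (simp add: ennreal_le_iff)
    then have "n2 M (\<lambda>x. F x - f j x) \<le> e" by (rule power2_le_imp_le) (use e in simp)
    with int show ?thesis by blast
  qed
  have FL2: "F \<in> L2 M"
  proof -
    obtain N where N: "\<And>i j. i \<ge> N \<Longrightarrow> j \<ge> N \<Longrightarrow> n2 M (\<lambda>x. f i x - f j x) < 1" using cauchy[of 1] by auto
    have "(\<lambda>x. F x - f N x) \<in> L2 M" using key[of 1 N N] N by (auto simp: L2_iff)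
    from L2_add[OF this f[of N]] show ?thesis by simp
  qed
  have "(\<lambda>n. n2 M (\<lambda>x. F x - f n x)) \<longlonglongrightarrow> 0"
  proof (rule LIMSEQ_I)
    fix e :: real assume "0 < e"
    then obtain N where N: "\<And>i j. i \<ge> N \<Longrightarrow> j \<ge> N \<Longrightarrow> n2 M (\<lambda>x. f i x - f j x) < e / 2"
      using cauchy[of "e / 2"] by auto
    show "\<exists>no. \<forall>n\<ge>no. norm (n2 M (\<lambda>x. F x - f n x) - 0) < e"
    proof (intro exI[of _ N] allI impI)
      fix n assume "n \<ge> N"
      with key[of "e / 2" N n] N \<open>0 < e\<close> show "norm (n2 M (\<lambda>x. F x - f n x) - 0) < e" by simp
    qed
  qed
  with FL2 show ?thesis using that by blast
qed

text \<open>Beyond S k the net oscillates by less than 1 / (k + 1); along the increasing unions U k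
  it becomes a Cauchy sequence, and the limit of that sequence is the limit of the whole net. This
  yields the unconditional convergence of the series for multiple integrals.\<close>

lemma L2_net_complete:
  assumes P: "\<And>F. finite F \<Longrightarrow> F \<subseteq> A \<Longrightarrow> P F \<in> L2 M"
    and c: "\<And>e. 0 < e \<Longrightarrow> \<exists>S. finite S \<and> S \<subseteq> A \<and>
      (\<forall>F G. finite F \<and> S \<subseteq> F \<and> F \<subseteq> A \<and> finite G \<and> S \<subseteq> G \<and> G \<subseteq> A \<longrightarrow> n2 M (\<lambda>x. P F x - P G x) < e)"
  obtains I where "I \<in> L2 M" "((\<lambda>F. n2 M (\<lambda>x. I x - P F x)) \<longlongrightarrow> 0) (finite_subsets_at_top A)"
proof -
  have "\<exists>S. finite S \<and> S \<subseteq> A \<and> (\<forall>F G. finite F \<and> S \<subseteq> F \<and> F \<subseteq> A \<and> finite G \<and> S \<subseteq> G \<and> G \<subseteq> A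
      \<longrightarrow> n2 M (\<lambda>x. P F x - P G x) < 1 / real (Suc k))" for k
    by (rule c) simp
  then obtain S where S: "\<And>k. finite (S k)" "\<And>k. S k \<subseteq> A"
    and SP: "\<And>k F G. finite F \<Longrightarrow> S k \<subseteq> F \<Longrightarrow> F \<subseteq> A \<Longrightarrow> finite G \<Longrightarrow> S k \<subseteq> G \<Longrightarrow> G \<subseteq> A
      \<Longrightarrow> n2 M (\<lambda>x. P F x - P G x) < 1 / real (Suc k)" by metis
  define U where "U k = (\<Union>i\<le>k. S i)" for k
  have U: "finite (U k)" "U k \<subseteq> A" for k using S by (auto simp: U_def)
  have SU: "S i \<subseteq> U k" if "i \<le> k" for i k using that by (auto simp: U_def)
  have PU: "P (U k) \<in> L2 M" for k by (rule P[OF U])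
  obtain I where I: "I \<in> L2 M" "(\<lambda>k. n2 M (\<lambda>x. I x - P (U k) x)) \<longlonglongrightarrow> 0"
  proof (rule L2_complete[of "\<lambda>k. P (U k)"])
    show "P (U k) \<in> L2 M" for k by (rule PU)
    fix e :: real assume "0 < e"
    then obtain N where N: "1 / real (Suc N) < e" using nat_approx_posE by blast
    show "\<exists>N. \<forall>i\<ge>N. \<forall>k\<ge>N. n2 M (\<lambda>x. P (U i) x - P (U k) x) < e"
    proof (intro exI[of _ N] allI impI)
      fix i k assume ik: "N \<le> i" "N \<le> k"
      show "n2 M (\<lambda>x. P (U i) x - P (U k) x) < e"
        using SP[OF U(1) SU[OF ik(1)] U(2) U(1) SU[OF ik(2)] U(2)] N by linarith
    qed
  qed blast
  have "((\<lambda>F. n2 M (\<lambda>x. I x - P F x)) \<longlongrightarrow> 0) (finite_subsets_at_top A)"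
  proof (rule tendstoI)
    fix e :: real assume e: "0 < e"
    then have "0 < e / 2" by simp
    then obtain N where N: "1 / real (Suc N) < e / 2" using nat_approx_posE by blast
    have "\<forall>\<^sub>F k in sequentially. n2 M (\<lambda>x. I x - P (U k) x) < e / 2"
      using order_tendstoD(2)[OF I(2), of "e / 2"] e by simp
    then obtain m where m: "N \<le> m" "n2 M (\<lambda>x. I x - P (U m) x) < e / 2"
      unfolding eventually_sequentially by (meson max.cobounded1 max.cobounded2)
    show "\<forall>\<^sub>F F in finite_subsets_at_top A. dist (n2 M (\<lambda>x. I x - P F x)) 0 < e"
      unfolding eventually_finite_subsets_at_top
    proof (intro exI[of _ "S N"] conjI S allI impI)
      fix F assume F: "finite F \<and> S N \<subseteq> F \<and> F \<subseteq> A"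
      then have "n2 M (\<lambda>x. P (U m) x - P F x) < 1 / real (Suc N)"
        using SP[OF U(1) SU[OF m(1)] U(2)] by blast
      moreover have "n2 M (\<lambda>x. I x - P F x) \<le> n2 M (\<lambda>x. I x - P (U m) x) + n2 M (\<lambda>x. P (U m) x - P F x)"
        using F by (intro n2_triangle_diff I PU P) auto
      ultimately show "dist (n2 M (\<lambda>x. I x - P F x)) 0 < e" using N m(2) by (simp add: dist_real_def)
    qed
  qed
  with I(1) show ?thesis by (rule that)
qed

end

section \<open>Gaussian random variables on an abstract Wiener space\<close>

text \<open>Phrased through the characteristic function, so that the degenerate case s = 0 is
  included and the property passes to limits in L^2.\<close>

definition (in prob_space) centered_gaussian :: "('a \<Rightarrow> real) \<Rightarrow> real \<Rightarrow> bool"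
  where "centered_gaussian X s \<longleftrightarrow> X \<in> borel_measurable M \<and>
    (\<forall>t. (CLINT w|M. iexp (t * X w)) = of_real (exp (- (t * s)\<^sup>2 / 2)))"

context prob_space
begin

text \<open>Levy's uniqueness theorem; all moments are then those of the standard normal law, up to
  powers of s.\<close>

lemma distr_centered_gaussian:
  assumes "centered_gaussian X s"
  shows "distr M borel X = distr std_normal_distribution borel (\<lambda>x. s * x)"
proof (rule Levy_uniqueness)
  have [measurable]: "X \<in> borel_measurable M" using assms by (simp add: centered_gaussian_def)
  show "real_distribution (distr M borel X)" by (rule real_distribution_distr) simp
  interpret N: real_distribution std_normal_distribution by (rule real_dist_normal_dist)
  show "real_distribution (distr std_normal_distribution borel (\<lambda>x. s * x))"
    by (rule N.real_distribution_distr) simp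
  show "char (distr M borel X) = char (distr std_normal_distribution borel (\<lambda>x. s * x))"
  proof
    fix t
    have "char (distr M borel X) t = (CLINT w|M. iexp (t * X w))"
      unfolding char_def by (subst integral_distr) auto
    also have "\<dots> = char std_normal_distribution (t * s)"
      using assms by (simp add: centered_gaussian_def char_std_normal_distribution)
    also have "\<dots> = char (distr std_normal_distribution borel (\<lambda>x. s * x)) t"
      unfolding char_def by (subst integral_distr) (auto simp: mult.assoc)
    finally show "char (distr M borel X) t = char (distr std_normal_distribution borel (\<lambda>x. s * x)) t" .
  qed
qed

lemma centered_gaussian_moments:
  assumes "centered_gaussian X s"
  shows "integrable M (\<lambda>w. \<bar>X w\<bar> ^ k)" "(LINT w|M. (X w)\<^sup>2) = s\<^sup>2"
proof -
  have [measurable]: "X \<in> borel_measurable M" using assms by (simp add: centered_gaussian_def)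
  have "integrable std_normal_distribution (\<lambda>x. \<bar>x ^ k\<bar>)"
    by (intro integrable_abs integrable_std_normal_distribution_moment)
  then have "integrable std_normal_distribution (\<lambda>x. \<bar>s\<bar> ^ k * \<bar>x ^ k\<bar>)" by (intro integrable_mult_right)
  then have "integrable (distr std_normal_distribution borel (\<lambda>x. s * x)) (\<lambda>x. \<bar>x\<bar> ^ k)"
    by (subst integrable_distr_eq) (auto simp: abs_mult power_mult_distrib power_abs)
  then have "integrable (distr M borel X) (\<lambda>x. \<bar>x\<bar> ^ k)" by (simp add: distr_centered_gaussian[OF assms])
  then show "integrable M (\<lambda>w. \<bar>X w\<bar> ^ k)" by (subst (asm) integrable_distr_eq) auto
  have "(LINT w|M. (X w)\<^sup>2) = (LINT x|distr M borel X. x\<^sup>2)" by (subst integral_distr) auto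
  also have "\<dots> = (LINT x|std_normal_distribution. s\<^sup>2 * x ^ (2 * 1))"
    unfolding distr_centered_gaussian[OF assms] by (subst integral_distr) (auto simp: power_mult_distrib)
  also have "\<dots> = s\<^sup>2" by (subst integral_mult_right_zero, subst std_normal_distribution_even_moments) auto
  finally show "(LINT w|M. (X w)\<^sup>2) = s\<^sup>2" .
qed

lemma centered_gaussian_L2: "centered_gaussian X s \<Longrightarrow> X \<in> L2 M"
  unfolding L2_iff using centered_gaussian_moments(1)[of X s 2] by (auto simp: centered_gaussian_def)

lemma centered_gaussian_n2: "centered_gaussian X s \<Longrightarrow> n2 M X = \<bar>s\<bar>"
  by (simp add: n2_eq centered_gaussian_moments(2))

lemma centered_gaussian_cos:
  assumes "centered_gaussian X s"
  shows "(LINT w|M. cos (X w + a)) = exp (- s\<^sup>2 / 2) * cos a"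
proof -
  have [measurable]: "X \<in> borel_measurable M" using assms by (simp add: centered_gaussian_def)
  have e: "(CLINT w|M. iexp (X w)) = of_real (exp (- s\<^sup>2 / 2))"
    using spec[OF conjunct2[OF assms[unfolded centered_gaussian_def]], of 1] by simp
  have int: "integrable M (\<lambda>w. iexp (X w))"
    by (rule integrable_const_bound[where B = 1]) auto
  have c: "(LINT w|M. cos (X w)) = exp (- s\<^sup>2 / 2)"
    using arg_cong[OF e, of Re] integral_Re[OF int] by (simp add: Re_exp)
  have si: "(LINT w|M. sin (X w)) = 0"
    using arg_cong[OF e, of Im] integral_Im[OF int] by (simp add: Im_exp)
  have ic: "integrable M (\<lambda>w. cos (X w))" "integrable M (\<lambda>w. sin (X w))"
    by (auto intro!: integrable_const_bound[where B = 1])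
  have "(LINT w|M. cos (X w + a)) = (LINT w|M. cos (X w) * cos a - sin (X w) * sin a)"
    by (simp add: cos_add)
  also have "\<dots> = exp (- s\<^sup>2 / 2) * cos a" using ic by (simp add: c si)
  finally show ?thesis .
qed

text \<open>The exponential is 1-Lipschitz on the imaginary axis and the L^1 norm is at most the L^2
  norm. It carries the Gaussian law from the dual of W over to limits in H.\<close>

lemma iexp_integral_tendsto:
  assumes "\<And>n. X n \<in> L2 M" "Y \<in> L2 M" "((\<lambda>n. n2 M (\<lambda>w. X n w - Y w)) \<longlongrightarrow> 0) F"
  shows "((\<lambda>n. CLINT w|M. iexp (X n w)) \<longlongrightarrow> (CLINT w|M. iexp (Y w))) F"
proof -
  have [measurable]: "X n \<in> borel_measurable M" "Y \<in> borel_measurable M" for n using assms by (auto simp: L2_iff)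
  have le: "norm ((CLINT w|M. iexp (X n w)) - (CLINT w|M. iexp (Y w))) \<le> n2 M (\<lambda>w. X n w - Y w)" for n
  proof -
    have int: "integrable M (\<lambda>w. iexp (X n w))" "integrable M (\<lambda>w. iexp (Y w))"
      by (auto intro!: integrable_const_bound[where B = 1])
    have "norm ((CLINT w|M. iexp (X n w)) - (CLINT w|M. iexp (Y w))) = norm (CLINT w|M. iexp (X n w) - iexp (Y w))"
      using int by simp
    also have "\<dots> \<le> (LINT w|M. norm (iexp (X n w) - iexp (Y w)))" by (rule integral_norm_bound)
    also have "\<dots> \<le> (LINT w|M. \<bar>X n w - Y w\<bar>)"
    proof (rule integral_mono)
      show "integrable M (\<lambda>w. norm (iexp (X n w) - iexp (Y w)))" using int by simp
      show "integrable M (\<lambda>w. \<bar>X n w - Y w\<bar>)" using L2_integrable[OF L2_diff[OF assms(1,2)]] by simp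
      fix w
      have "iexp (X n w) = iexp (X n w - Y w) * iexp (Y w)" by (simp add: exp_add[symmetric] algebra_simps)
      then have "norm (iexp (X n w) - iexp (Y w)) = norm ((iexp (X n w - Y w) - 1) * iexp (Y w))"
        by (simp add: algebra_simps)
      also have "\<dots> \<le> \<bar>X n w - Y w\<bar>" 
        using iexp_approx1[of "X n w - Y w" 0] by (simp add: norm_mult)
      finally show "norm (iexp (X n w) - iexp (Y w)) \<le> \<bar>X n w - Y w\<bar>" .
    qed
    also have "\<dots> \<le> n2 M (\<lambda>w. X n w - Y w)" by (rule integral_abs_le_n2[OF L2_diff[OF assms(1,2)]])
    finally show ?thesis .
  qed
  show ?thesis by (rule LIM_zero_cancel) (rule Lim_null_comparison[OF _ assms(3)], intro always_eventually allI le)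
qed

end

section \<open>The Gaussian variables attached to vectors of H\<close>

context abstract_wiener_space
begin

sublocale prob_space \<mu> by (rule prob)

abbreviation j :: "('w \<Rightarrow>\<^sub>L real) \<Rightarrow> 'h" where "j \<equiv> dual_embed \<iota>"

lemma dual_embed: "blinfun_apply L (\<iota> x) = inner (j L) x"
proof -
  have "bounded_linear (\<lambda>x. blinfun_apply L (\<iota> x))"
    using embedding(1) by (intro bounded_linear_intros)
  from theI'[OF riesz_representation[OF this]] show ?thesis unfolding dual_embed_def by (rule spec)
qed

lemma dual_embed_eqI: assumes "\<And>x. blinfun_apply L (\<iota> x) = inner h x" shows "j L = h"
proof -
  have "inner (j L - h) (j L - h) = 0" using assms dual_embed by (simp add: inner_diff_left)
  then show ?thesis by simp
qed

lemma dual_embed_lincomb: "j (a *\<^sub>R L + b *\<^sub>R K) = a *\<^sub>R j L + b *\<^sub>R j K"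
proof (rule dual_embed_eqI)
  fix x
  show "blinfun_apply (a *\<^sub>R L + b *\<^sub>R K) (\<iota> x) = inner (a *\<^sub>R j L + b *\<^sub>R j K) x"
    unfolding blinfun.add_left blinfun.scaleR_left inner_add_left inner_scaleR_left
    unfolding dual_embed by simp
qed

lemma dual_embed_diff: "j (L - K) = j L - j K"
  using dual_embed_lincomb[of 1 L "-1" K] by simp

text \<open>A vector z orthogonal to the image is annihilated, as an element of W, by every
  continuous functional; Hahn-Banach and the injectivity of the embedding give z = 0.\<close>

lemma closure_range_dual_embed: "closure (range j) = UNIV"
proof (rule dense_of_trivial_orthogonal)
  have z: "j 0 = 0" using dual_embed_lincomb[of 0 0 0 0] by simp
  show "subspace (range j)"
    unfolding subspace_def
    using z dual_embed_lincomb[of 1 _ 1] dual_embed_lincomb[of _ _ 0 0]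
    by (auto simp: image_iff) (metis scaleR_one, metis add.right_neutral scaleR_zero_left)
  fix z assume "\<forall>v\<in>range j. inner z v = 0"
  then have "inner z (j L) = 0" for L by blast
  then have "blinfun_apply L (\<iota> z) = 0" for L :: "'w \<Rightarrow>\<^sub>L real" using dual_embed[of L z] inner_commute[of z "j L"] by simp
  then have "\<not> (\<exists>L :: 'w \<Rightarrow>\<^sub>L real. blinfun_apply L (\<iota> z) \<noteq> 0)" by simp
  then have "\<iota> z = 0" using exists_nonzero_functional[of "\<iota> z"] by argo
  moreover have "\<iota> 0 = 0" using embedding(1) by (rule linear_simps)
  ultimately show "z = 0" using injD[OF embedding(2), of z 0] by simp
qed

lemma borel_measurable_eq: "borel_measurable \<mu> = borel_measurable borel"
  by (rule measurable_cong_sets[OF sets_borel refl])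

lemma measurable_blinfun [measurable]: "blinfun_apply (L :: 'w \<Rightarrow>\<^sub>L real) \<in> borel_measurable \<mu>"
  unfolding borel_measurable_eq by (intro borel_measurable_continuous_onI linear_continuous_on blinfun.bounded_linear_right)

lemma gaussian_blinfun: "centered_gaussian (blinfun_apply L) (norm (j L))"
  unfolding centered_gaussian_def
proof (intro conjI allI)
  fix t
  have "j (t *\<^sub>R L) = t *\<^sub>R j L" using dual_embed_lincomb[of t L 0 0] by simp
  then show "(CLINT w|\<mu>. iexp (t * blinfun_apply L w)) = of_real (exp (- (t * norm (j L))\<^sup>2 / 2))"
    using gaussian[of "t *\<^sub>R L"] by (simp add: blinfun.bilinear_simps power_mult_distrib)
qed measurable

lemma n2_blinfun: "n2 \<mu> (blinfun_apply L) = norm (j L)"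
  by (simp add: centered_gaussian_n2[OF gaussian_blinfun])

lemma L2_blinfun: "blinfun_apply (L :: 'w \<Rightarrow>\<^sub>L real) \<in> L2 \<mu>"
  by (rule centered_gaussian_L2[OF gaussian_blinfun])

lemma n2_blinfun_diff: "n2 \<mu> (\<lambda>w. blinfun_apply L w - blinfun_apply K w) = norm (j L - j K)"
proof -
  have "blinfun_apply (L - K) = (\<lambda>w. blinfun_apply L w - blinfun_apply K w)"
    by (auto simp: blinfun.diff_left)
  then show ?thesis using n2_blinfun[of "L - K"] by (simp add: dual_embed_diff)
qed

abbreviation X :: "'h \<Rightarrow> 'w \<Rightarrow> real" where "X \<equiv> wiener_pairing \<iota> \<mu>"

lemma exists_dual_seq: obtains L where "(\<lambda>k. j (L k)) \<longlonglongrightarrow> h"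
proof -
  have "h \<in> closure (range j)" by (simp add: closure_range_dual_embed)
  then obtain x where x: "\<forall>n. x n \<in> range j" "x \<longlonglongrightarrow> h" unfolding closure_sequential by auto
  then have "\<forall>n. \<exists>L. x n = j L" by blast
  then obtain L where "\<forall>n. x n = j (L n)" using choice by metis
  then have "x = (\<lambda>n. j (L n))" by auto
  with x(2) show ?thesis using that[of L] by simp
qed

text \<open>The variance of a functional L is |j L|^2, so functionals converging in H are Cauchy in
  L^2; completeness supplies a witness for the choice in the definition.\<close>

lemma wiener_pairing_spec:
  "X h \<in> L2 \<mu> \<and> (\<exists>L. (\<lambda>k. j (L k)) \<longlonglongrightarrow> h \<and> (\<lambda>k. n2 \<mu> (\<lambda>w. blinfun_apply (L k) w - X h w)) \<longlonglongrightarrow> 0)"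
  unfolding wiener_pairing_def
proof (rule someI_ex[where P = "\<lambda>F. F \<in> L2 \<mu> \<and> (\<exists>L. (\<lambda>k. j (L k)) \<longlonglongrightarrow> h \<and> (\<lambda>k. n2 \<mu> (\<lambda>w. blinfun_apply (L k) w - F w)) \<longlonglongrightarrow> 0)"])
  obtain L where L: "(\<lambda>k. j (L k)) \<longlonglongrightarrow> h" by (rule exists_dual_seq)
  then have "Cauchy (\<lambda>k. j (L k))" by (rule LIMSEQ_imp_Cauchy)
  then have "\<exists>N. \<forall>i\<ge>N. \<forall>k\<ge>N. n2 \<mu> (\<lambda>w. blinfun_apply (L i) w - blinfun_apply (L k) w) < e" if "0 < e" for e
    using that by (simp add: n2_blinfun_diff Cauchy_iff)
  from L2_complete[OF L2_blinfun this]
  obtain F where "F \<in> L2 \<mu>" "(\<lambda>k. n2 \<mu> (\<lambda>w. F w - blinfun_apply (L k) w)) \<longlonglongrightarrow> 0" by blast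
  with L show "\<exists>F. F \<in> L2 \<mu> \<and> (\<exists>L. (\<lambda>k. j (L k)) \<longlonglongrightarrow> h \<and> (\<lambda>k. n2 \<mu> (\<lambda>w. blinfun_apply (L k) w - F w)) \<longlonglongrightarrow> 0)"
    by (auto simp: n2_diff_commute[of \<mu> F])
qed

lemma L2_X: "X h \<in> L2 \<mu>" using wiener_pairing_spec by blast

lemma measurable_X [measurable]: "X h \<in> borel_measurable \<mu>" using L2_X by (simp add: L2_iff)

text \<open>The choice in the definition comes with one approximating sequence; by the isometry
  every other one has the same limit.\<close>

lemma n2_blinfun_X_tendsto:
  assumes "(\<lambda>k. j (L k)) \<longlonglongrightarrow> h"
  shows "(\<lambda>k. n2 \<mu> (\<lambda>w. blinfun_apply (L k) w - X h w)) \<longlonglongrightarrow> 0"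
proof -
  obtain K where K: "(\<lambda>k. j (K k)) \<longlonglongrightarrow> h" "(\<lambda>k. n2 \<mu> (\<lambda>w. blinfun_apply (K k) w - X h w)) \<longlonglongrightarrow> 0"
    using wiener_pairing_spec by blast
  have "(\<lambda>k. norm (j (L k) - j (K k)) + n2 \<mu> (\<lambda>w. blinfun_apply (K k) w - X h w)) \<longlonglongrightarrow> norm (h - h) + 0"
    by (intro tendsto_intros assms K)
  then have lim: "(\<lambda>k. norm (j (L k) - j (K k)) + n2 \<mu> (\<lambda>w. blinfun_apply (K k) w - X h w)) \<longlonglongrightarrow> 0" by simp
  show ?thesis
  proof (rule Lim_null_comparison[OF _ lim], intro always_eventually allI)
    fix k
    show "norm (n2 \<mu> (\<lambda>w. blinfun_apply (L k) w - X h w)) \<le> norm (j (L k) - j (K k)) + n2 \<mu> (\<lambda>w. blinfun_apply (K k) w - X h w)"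
      using n2_triangle_diff[OF L2_blinfun[of "L k"] L2_blinfun[of "K k"] L2_X[of h]] by (simp add: n2_blinfun_diff)
  qed
qed

text \<open>The exceptional null set depends on a, b, h and k, so this does not give a linear map
  for any fixed w.\<close>

lemma X_lincomb_AE: "AE w in \<mu>. X (a *\<^sub>R h + b *\<^sub>R k) w = a * X h w + b * X k w"
proof -
  obtain L where L: "(\<lambda>n. j (L n)) \<longlonglongrightarrow> h" by (rule exists_dual_seq)
  obtain K where K: "(\<lambda>n. j (K n)) \<longlonglongrightarrow> k" by (rule exists_dual_seq)
  have "(\<lambda>n. j (a *\<^sub>R L n + b *\<^sub>R K n)) \<longlonglongrightarrow> a *\<^sub>R h + b *\<^sub>R k"
    unfolding dual_embed_lincomb by (intro tendsto_intros L K)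
  note lims = n2_blinfun_X_tendsto[OF L] n2_blinfun_X_tendsto[OF K] n2_blinfun_X_tendsto[OF this]
  define D where "D w = (a * X h w + b * X k w) - X (a *\<^sub>R h + b *\<^sub>R k) w" for w
  have DL2: "D \<in> L2 \<mu>" unfolding D_def by (intro L2_diff L2_lincomb L2_X)
  have "n2 \<mu> D \<le> \<bar>a\<bar> * n2 \<mu> (\<lambda>w. blinfun_apply (L n) w - X h w) + \<bar>b\<bar> * n2 \<mu> (\<lambda>w. blinfun_apply (K n) w - X k w)
      + n2 \<mu> (\<lambda>w. blinfun_apply (a *\<^sub>R L n + b *\<^sub>R K n) w - X (a *\<^sub>R h + b *\<^sub>R k) w)" (is "_ \<le> ?r n") for n
  proof -
    have "n2 \<mu> D = n2 \<mu> (\<lambda>w. ((- a) * (blinfun_apply (L n) w - X h w) + (- b) * (blinfun_apply (K n) w - X k w))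
        + (blinfun_apply (a *\<^sub>R L n + b *\<^sub>R K n) w - X (a *\<^sub>R h + b *\<^sub>R k) w))"
      unfolding D_def by (simp add: blinfun.bilinear_simps algebra_simps)
    also have "\<dots> \<le> n2 \<mu> (\<lambda>w. (- a) * (blinfun_apply (L n) w - X h w) + (- b) * (blinfun_apply (K n) w - X k w))
        + n2 \<mu> (\<lambda>w. blinfun_apply (a *\<^sub>R L n + b *\<^sub>R K n) w - X (a *\<^sub>R h + b *\<^sub>R k) w)"
      by (intro n2_triangle L2_lincomb L2_diff L2_blinfun L2_X)
    also have "n2 \<mu> (\<lambda>w. (- a) * (blinfun_apply (L n) w - X h w) + (- b) * (blinfun_apply (K n) w - X k w))
        \<le> n2 \<mu> (\<lambda>w. (- a) * (blinfun_apply (L n) w - X h w)) + n2 \<mu> (\<lambda>w. (- b) * (blinfun_apply (K n) w - X k w))"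
      by (intro n2_triangle L2_cmult L2_diff L2_blinfun L2_X)
    finally show ?thesis by (simp only: n2_cmult abs_minus) 
  qed
  moreover have "?r \<longlonglongrightarrow> \<bar>a\<bar> * 0 + \<bar>b\<bar> * 0 + 0" by (intro tendsto_intros lims)
  ultimately have "n2 \<mu> D \<le> 0" by (intro LIMSEQ_le_const[of ?r]) auto
  then have "n2 \<mu> D = 0" using n2_nonneg[of \<mu> D] by linarith
  from n2_eq_0_AE[OF DL2 this] show ?thesis by (auto simp: D_def)
qed

lemma X_dual_embed_AE: "AE w in \<mu>. X (j L) w = blinfun_apply L w"
proof -
  have "(\<lambda>k::nat. n2 \<mu> (\<lambda>w. blinfun_apply L w - X (j L) w)) \<longlonglongrightarrow> 0"
    by (rule n2_blinfun_X_tendsto) simp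
  then have "n2 \<mu> (\<lambda>w. blinfun_apply L w - X (j L) w) = 0" by (simp add: LIMSEQ_const_iff)
  from n2_eq_0_AE[OF L2_diff[OF L2_blinfun L2_X] this] show ?thesis by auto
qed

lemma gaussian_X: "centered_gaussian (X h) (norm h)"
  unfolding centered_gaussian_def
proof (intro conjI allI)
  show "X h \<in> borel_measurable \<mu>" by measurable
  fix t
  obtain L where L: "(\<lambda>k. j (L k)) \<longlonglongrightarrow> h" by (rule exists_dual_seq)
  have "(\<lambda>k. \<bar>t\<bar> * n2 \<mu> (\<lambda>w. blinfun_apply (L k) w - X h w)) \<longlonglongrightarrow> \<bar>t\<bar> * 0"
    by (intro tendsto_intros n2_blinfun_X_tendsto L)
  then have "(\<lambda>k. n2 \<mu> (\<lambda>w. t * blinfun_apply (L k) w - t * X h w)) \<longlonglongrightarrow> 0"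
    by (simp add: n2_cmult[symmetric] algebra_simps)
  from iexp_integral_tendsto[OF L2_cmult[OF L2_blinfun] L2_cmult[OF L2_X] this]
  have "(\<lambda>k. CLINT w|\<mu>. iexp (t * blinfun_apply (L k) w)) \<longlonglongrightarrow> (CLINT w|\<mu>. iexp (t * X h w))" .
  moreover have "(\<lambda>k. CLINT w|\<mu>. iexp (t * blinfun_apply (L k) w)) = (\<lambda>k. of_real (exp (- (t * norm (j (L k)))\<^sup>2 / 2)))"
    using gaussian_blinfun by (simp add: centered_gaussian_def)
  moreover have "(\<lambda>k. complex_of_real (exp (- (t * norm (j (L k)))\<^sup>2 / 2))) \<longlonglongrightarrow> of_real (exp (- (t * norm h)\<^sup>2 / 2))"
    by (intro tendsto_intros L) simp
  ultimately show "(CLINT w|\<mu>. iexp (t * X h w)) = of_real (exp (- (t * norm h)\<^sup>2 / 2))"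
    by (metis LIMSEQ_unique)
qed

text \<open>A version of the pairing that is linear in the second argument for every single w:
  prescribe it on a Hamel basis of H.\<close>

definition Z :: "'w \<Rightarrow> 'h \<Rightarrow> real"
  where "Z w = real_vector.construct (extend_basis {}) (\<lambda>b. X b w)"

lemma independent_hamel: "independent (extend_basis {} :: 'h set)"
  by (simp add: independent_extend_basis independent_empty)

lemma linear_Z: "linear (Z w)"
  unfolding Z_def by (rule real_vector.linear_construct[OF independent_hamel])

lemma Z_add: "Z w (h + k) = Z w h + Z w k" using linear_Z by (rule linear_add)
lemma Z_scale: "Z w (c *\<^sub>R h) = c * Z w h" using linear_Z by (simp add: linear_scale)
lemma Z_diff: "Z w (h - k) = Z w h - Z w k" using linear_Z by (rule linear_diff)
lemma Z_zero [simp]: "Z w 0 = 0" using linear_Z by (rule linear_0)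
text \<open>Every h is a finite combination of Hamel basis vectors, on which \<open>Z\<close> and
  the pairing agree everywhere; for each h finitely many null sets are discarded.\<close>

lemma Z_X_AE: "(\<lambda>w. Z w h) \<in> borel_measurable \<mu> \<and> (AE w in \<mu>. Z w h = X h w)"
proof -
  have "h \<in> span (extend_basis {})" by (simp add: span_extend_basis independent_empty)
  then show ?thesis
  proof (induction rule: span_induct_alt)
    case base
    have "AE w in \<mu>. X 0 w = 0" using X_lincomb_AE[of 0 0 0 0] by simp
    then show ?case by (auto elim: eventually_mono)
  next
    case (step c x y)
    have [measurable]: "(\<lambda>w. Z w y) \<in> borel_measurable \<mu>" using step by blast
    have eq: "Z w (c *\<^sub>R x + y) = c * X x w + Z w y" for w
    proof -
      have "Z w x = X x w" unfolding Z_def by (rule real_vector.construct_basis[OF independent_hamel step(1)])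
      then show ?thesis by (simp add: Z_add Z_scale)
    qed
    have "AE w in \<mu>. X (c *\<^sub>R x + 1 *\<^sub>R y) w = c * X x w + 1 * X y w" by (rule X_lincomb_AE)
    moreover have "AE w in \<mu>. Z w y = X y w" using step by blast
    ultimately have "AE w in \<mu>. Z w (c *\<^sub>R x + y) = X (c *\<^sub>R x + y) w"
      by eventually_elim (simp add: eq)
    moreover have "(\<lambda>w. Z w (c *\<^sub>R x + y)) \<in> borel_measurable \<mu>" unfolding eq by measurable
    ultimately show ?case by blast
  qed
qed

lemma measurable_Z [measurable]: "(\<lambda>w. Z w h) \<in> borel_measurable \<mu>" using Z_X_AE by blast
lemma Z_AE: "AE w in \<mu>. Z w h = X h w" using Z_X_AE by blast

lemma gaussian_Z: "centered_gaussian (\<lambda>w. Z w h) (norm h)"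
proof -
  have "(CLINT w|\<mu>. iexp (t * Z w h)) = (CLINT w|\<mu>. iexp (t * X h w))" for t
    by (intro integral_cong_AE) (use Z_AE[of h] in auto)
  then show ?thesis using gaussian_X[of h] by (simp add: centered_gaussian_def)
qed

lemma integral_cos_Z: "(LINT w|\<mu>. cos (Z w h + a)) = exp (- (norm h)\<^sup>2 / 2) * cos a"
  by (rule centered_gaussian_cos[OF gaussian_Z])

lemma integrable_Z_power: "integrable \<mu> (\<lambda>w. \<bar>Z w h\<bar> ^ k)"
  by (rule centered_gaussian_moments[OF gaussian_Z])

lemma L2_Z: "(\<lambda>w. Z w h) \<in> L2 \<mu>" by (rule centered_gaussian_L2[OF gaussian_Z])

lemma n2_Z: "n2 \<mu> (\<lambda>w. Z w h) = norm h" by (simp add: centered_gaussian_n2[OF gaussian_Z])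

end

section \<open>Gaussian integration by parts and Hermite polynomials\<close>

context abstract_wiener_space
begin

text \<open>An algebra of functions containing constants, cosines and Gaussian variables, in which
  every product is integrable. It takes care of the integrability conditions in the integration by
  parts.\<close>

definition all_moments :: "('w \<Rightarrow> real) \<Rightarrow> bool"
  where "all_moments f \<longleftrightarrow> f \<in> borel_measurable \<mu> \<and> (\<forall>k. integrable \<mu> (\<lambda>w. \<bar>f w\<bar> ^ k))"

lemma all_moments_measurable: "all_moments f \<Longrightarrow> f \<in> borel_measurable \<mu>"
  by (simp add: all_moments_def)

lemma all_moments_bounded: 
  assumes [measurable]: "f \<in> borel_measurable \<mu>" and "\<And>w. \<bar>f w\<bar> \<le> K" shows "all_moments f"
  unfolding all_moments_def
proof (intro conjI allI assms(1))
  fix k show "integrable \<mu> (\<lambda>w. \<bar>f w\<bar> ^ k)"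
    using power_mono[OF assms(2)] by (intro integrable_const_bound[where B = "K ^ k"]) (auto simp: power_abs)
qed

lemma all_moments_const: "all_moments (\<lambda>w. c)" by (rule all_moments_bounded[of _ "\<bar>c\<bar>"]) auto

lemma all_moments_cos: "all_moments (\<lambda>w. cos (Z w h + a))" by (rule all_moments_bounded[of _ 1]) auto

lemma all_moments_Z: "all_moments (\<lambda>w. Z w h)"
  by (simp add: all_moments_def integrable_Z_power)

lemma all_moments_mult: assumes "all_moments f" "all_moments g" shows "all_moments (\<lambda>w. f w * g w)"
  unfolding all_moments_def
proof (intro conjI allI)
  have [measurable]: "f \<in> borel_measurable \<mu>" "g \<in> borel_measurable \<mu>" using assms by (auto simp: all_moments_def)
  show "(\<lambda>w. f w * g w) \<in> borel_measurable \<mu>" by measurable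
  fix k
  show "integrable \<mu> (\<lambda>w. \<bar>f w * g w\<bar> ^ k)"
  proof (rule Bochner_Integration.integrable_bound)
    show "integrable \<mu> (\<lambda>w. \<bar>f w\<bar> ^ (k * 2) + \<bar>g w\<bar> ^ (k * 2))"
      using assms unfolding all_moments_def by (intro Bochner_Integration.integrable_add) blast+
    have "\<bar>x * y\<bar> ^ k \<le> \<bar>x\<bar> ^ (k * 2) + \<bar>y\<bar> ^ (k * 2)" for x y :: real
    proof -
      have "2 * (\<bar>x\<bar> ^ k * \<bar>y\<bar> ^ k) \<le> (\<bar>x\<bar> ^ k)\<^sup>2 + (\<bar>y\<bar> ^ k)\<^sup>2"
        using sum_squares_bound[of "\<bar>x\<bar> ^ k" "\<bar>y\<bar> ^ k"] by simp
      moreover have "0 \<le> \<bar>x\<bar> ^ k * \<bar>y\<bar> ^ k" by simp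
      ultimately have "\<bar>x\<bar> ^ k * \<bar>y\<bar> ^ k \<le> (\<bar>x\<bar> ^ k)\<^sup>2 + (\<bar>y\<bar> ^ k)\<^sup>2" by argo
      then show ?thesis by (simp only: abs_mult power_mult_distrib power_mult)
    qed
    then show "AE w in \<mu>. norm (\<bar>f w * g w\<bar> ^ k) \<le> norm (\<bar>f w\<bar> ^ (k * 2) + \<bar>g w\<bar> ^ (k * 2))"
      by (intro AE_I2) simp
  qed measurable
qed

lemma all_moments_add: assumes "all_moments f" "all_moments g" shows "all_moments (\<lambda>w. f w + g w)"
  unfolding all_moments_def
proof (intro conjI allI)
  have [measurable]: "f \<in> borel_measurable \<mu>" "g \<in> borel_measurable \<mu>" using assms by (auto simp: all_moments_def)
  show "(\<lambda>w. f w + g w) \<in> borel_measurable \<mu>" by measurable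
  fix k
  show "integrable \<mu> (\<lambda>w. \<bar>f w + g w\<bar> ^ k)"
  proof (rule Bochner_Integration.integrable_bound)
    show "integrable \<mu> (\<lambda>w. 2 ^ k * (\<bar>f w\<bar> ^ k + \<bar>g w\<bar> ^ k))"
      using assms unfolding all_moments_def
      by (intro integrable_mult_right Bochner_Integration.integrable_add) blast+
    have "\<bar>x + y\<bar> ^ k \<le> 2 ^ k * (\<bar>x\<bar> ^ k + \<bar>y\<bar> ^ k)" for x y :: real
    proof -
      have "\<bar>x + y\<bar> ^ k \<le> (2 * max \<bar>x\<bar> \<bar>y\<bar>) ^ k" by (intro power_mono) auto
      also have "\<dots> = 2 ^ k * (max \<bar>x\<bar> \<bar>y\<bar>) ^ k" by (simp add: power_mult_distrib)
      also have "(max \<bar>x\<bar> \<bar>y\<bar>) ^ k \<le> \<bar>x\<bar> ^ k + \<bar>y\<bar> ^ k" by (auto simp: max_def)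
      finally show ?thesis by simp
    qed
    then show "AE w in \<mu>. norm (\<bar>f w + g w\<bar> ^ k) \<le> norm (2 ^ k * (\<bar>f w\<bar> ^ k + \<bar>g w\<bar> ^ k))"
      by (intro AE_I2) simp
  qed measurable
qed

lemma all_moments_cmult: "all_moments f \<Longrightarrow> all_moments (\<lambda>w. c * f w)"
  by (intro all_moments_mult all_moments_const)

lemma all_moments_integrable: "all_moments f \<Longrightarrow> integrable \<mu> f"
proof -
  assume f: "all_moments f"
  then have "integrable \<mu> (\<lambda>w. \<bar>f w\<bar> ^ 1)" unfolding all_moments_def by blast
  then have "integrable \<mu> (\<lambda>w. norm (f w))" by simp
  then show ?thesis by (rule integrable_norm_cancel) (rule all_moments_measurable[OF f])
qed

lemma all_moments_L2: "all_moments f \<Longrightarrow> f \<in> L2 \<mu>"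
  using all_moments_integrable[OF all_moments_mult, of f f]
  by (simp add: L2_iff power2_eq_square all_moments_measurable)

lemmas all_moments_intros = all_moments_const all_moments_cos all_moments_Z all_moments_mult all_moments_add all_moments_cmult

text \<open>The derivative of the cosine is written as a shift of phase by pi / 2, so that
  differentiation never leaves the family of cosines.\<close>

lemma cos_taylor2: "\<bar>cos (a + x) - cos a - x * cos (a + pi / 2)\<bar> \<le> x\<^sup>2" for x :: real
proof -
  have "norm (iexp x - 1 - \<i> * x) \<le> x\<^sup>2 / 2" using iexp_approx1[of x 1] by (simp add: power2_eq_square algebra_simps)
  then have "\<bar>Re (iexp x - 1 - \<i> * x)\<bar> \<le> x\<^sup>2 / 2" "\<bar>Im (iexp x - 1 - \<i> * x)\<bar> \<le> x\<^sup>2 / 2"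
    using abs_Re_le_cmod abs_Im_le_cmod order_trans by blast+
  then have 1: "\<bar>cos x - 1\<bar> \<le> x\<^sup>2 / 2" and 2: "\<bar>sin x - x\<bar> \<le> x\<^sup>2 / 2" by (auto simp: Re_exp Im_exp)
  have "\<bar>cos a * (cos x - 1) - sin a * (sin x - x)\<bar> \<le> \<bar>cos a * (cos x - 1)\<bar> + \<bar>sin a * (sin x - x)\<bar>"
    by (rule abs_triangle_ineq4)
  also have "\<dots> \<le> 1 * (x\<^sup>2 / 2) + 1 * (x\<^sup>2 / 2)"
    unfolding abs_mult by (intro add_mono mult_mono 1 2) auto
  finally have "\<bar>cos a * (cos x - 1) - sin a * (sin x - x)\<bar> \<le> x\<^sup>2" by simp
  moreover have "cos (a + x) - cos a - x * cos (a + pi / 2) = cos a * (cos x - 1) - sin a * (sin x - x)"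
    by (simp add: cos_add algebra_simps)
  ultimately show ?thesis by metis
qed

text \<open>Differentiation under the integral by the second-order Taylor bound, with integrable
  majorant \<open>\<bar>f w\<bar> * (Z w k)\<^sup>2\<close>. Moving h along k brings down a factor
  \<open>Z w k\<close> and advances the phase.\<close>

lemma deriv_integral_cos:
  assumes "all_moments f"
  shows "((\<lambda>t. LINT w|\<mu>. f w * cos (Z w (h + t *\<^sub>R k) + a)) has_real_derivative
    (LINT w|\<mu>. f w * Z w k * cos (Z w h + a + pi / 2))) (at 0)"
proof -
  define F where "F t = (LINT w|\<mu>. f w * cos (Z w (h + t *\<^sub>R k) + a))" for t
  define D where "D = (LINT w|\<mu>. f w * Z w k * cos (Z w h + a + pi / 2))"
  define C where "C = (LINT w|\<mu>. \<bar>f w\<bar> * (Z w k)\<^sup>2)"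
  have [measurable]: "f \<in> borel_measurable \<mu>" by (rule all_moments_measurable[OF assms])
  have i1: "integrable \<mu> (\<lambda>w. f w * cos (Z w (h + t *\<^sub>R k) + a))" for t
    by (intro all_moments_integrable all_moments_intros assms)
  have i2: "integrable \<mu> (\<lambda>w. f w * Z w k * cos (Z w h + a + pi / 2))"
    using all_moments_integrable[OF all_moments_mult[OF all_moments_mult[OF assms all_moments_Z[of k]] all_moments_cos[of h "a + pi / 2"]]]
    by (simp add: add.assoc)
  have "all_moments (\<lambda>w. f w * (Z w k * Z w k))" by (intro all_moments_intros assms)
  then have i3: "integrable \<mu> (\<lambda>w. \<bar>f w\<bar> * (Z w k)\<^sup>2)"
    using integrable_abs[OF all_moments_integrable] by (fastforce simp: abs_mult power2_eq_square)
  have bound: "\<bar>F t - F 0 - t * D\<bar> \<le> t\<^sup>2 * C" for t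
  proof -
    have eq: "F t - F 0 - t * D = (LINT w|\<mu>. f w * cos (Z w (h + t *\<^sub>R k) + a) - f w * cos (Z w h + a)
        - t * (f w * Z w k * cos (Z w h + a + pi / 2)))"
      unfolding F_def D_def using i1[of t] i1[of 0] i2 by simp
    have "\<bar>LINT w|\<mu>. f w * cos (Z w (h + t *\<^sub>R k) + a) - f w * cos (Z w h + a)
        - t * (f w * Z w k * cos (Z w h + a + pi / 2))\<bar> \<le> (LINT w|\<mu>. t\<^sup>2 * (\<bar>f w\<bar> * (Z w k)\<^sup>2))"
    proof (rule integral_abs_bound[THEN order_trans], rule integral_mono)
      show "integrable \<mu> (\<lambda>w. \<bar>f w * cos (Z w (h + t *\<^sub>R k) + a) - f w * cos (Z w h + a)
          - t * (f w * Z w k * cos (Z w h + a + pi / 2))\<bar>)"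
        using i1[of t] i1[of 0] i2 by simp
      show "integrable \<mu> (\<lambda>w. t\<^sup>2 * (\<bar>f w\<bar> * (Z w k)\<^sup>2))" using i3 by simp
      fix w
      have "f w * cos (Z w (h + t *\<^sub>R k) + a) - f w * cos (Z w h + a) - t * (f w * Z w k * cos (Z w h + a + pi / 2))
        = f w * (cos ((Z w h + a) + t * Z w k) - cos (Z w h + a) - (t * Z w k) * cos ((Z w h + a) + pi / 2))"
        by (simp add: Z_add Z_scale algebra_simps)
      also have "\<bar>\<dots>\<bar> \<le> \<bar>f w\<bar> * (t * Z w k)\<^sup>2" unfolding abs_mult[of "f w"] by (intro mult_left_mono cos_taylor2) simp
      finally show "\<bar>f w * cos (Z w (h + t *\<^sub>R k) + a) - f w * cos (Z w h + a)
          - t * (f w * Z w k * cos (Z w h + a + pi / 2))\<bar> \<le> t\<^sup>2 * (\<bar>f w\<bar> * (Z w k)\<^sup>2)"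
        by (simp add: power_mult_distrib mult_ac)
    qed
    then show ?thesis unfolding eq C_def by simp
  qed
  have "(F has_real_derivative D) (at 0)"
    unfolding DERIV_def
  proof (rule LIM_zero_cancel, rule Lim_null_comparison)
    show "\<forall>\<^sub>F t in at 0. norm ((F (0 + t) - F 0) / t - D) \<le> \<bar>t\<bar> * C"
    proof (rule eventually_at_ball'[of 1, THEN eventually_mono])
      fix t :: real assume "t \<in> ball 0 1 \<and> t \<noteq> 0 \<and> t \<in> UNIV"
      then have t: "t \<noteq> 0" by simp
      have "(F (0 + t) - F 0) / t - D = (F t - F 0 - t * D) / t" using t by (simp add: field_simps)
      then have "norm ((F (0 + t) - F 0) / t - D) \<le> t\<^sup>2 * C / \<bar>t\<bar>"
        using bound[of t] by (simp add: divide_right_mono)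
      also have "\<dots> = \<bar>t\<bar> * C" using t by (simp add: power2_eq_square abs_if)
      finally show "norm ((F (0 + t) - F 0) / t - D) \<le> \<bar>t\<bar> * C" .
    qed simp
    show "((\<lambda>t. \<bar>t\<bar> * C) \<longlongrightarrow> 0) (at 0)" by (auto intro!: tendsto_eq_intros)
  qed
  then show ?thesis by (simp add: F_def[abs_def] D_def)
qed

text \<open>D is the Malliavin derivative of f in the directions of the orthonormal basis; the
  modulation by cosines makes the property stable under multiplication of f by Gaussian variables.\<close>

definition ibp :: "('w \<Rightarrow> real) \<Rightarrow> ('h \<Rightarrow> 'w \<Rightarrow> real) \<Rightarrow> bool"
  where "ibp f D \<longleftrightarrow> all_moments f \<and> (\<forall>b\<in>hilbert_basis. all_moments (D b)) \<and>
    (\<forall>b\<in>hilbert_basis. \<forall>h a. (LINT w|\<mu>. Z w b * f w * cos (Z w h + a)) =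
      (LINT w|\<mu>. D b w * cos (Z w h + a)) + inner b h * (LINT w|\<mu>. f w * cos (Z w h + a + pi / 2)))"

lemma ibp_all_moments: "ibp f D \<Longrightarrow> all_moments f" by (simp add: ibp_def)
lemma ibp_all_moments_deriv: "ibp f D \<Longrightarrow> b \<in> hilbert_basis \<Longrightarrow> all_moments (D b)" by (simp add: ibp_def)

lemma ibp_eq: "ibp f D \<Longrightarrow> b \<in> hilbert_basis \<Longrightarrow> (LINT w|\<mu>. Z w b * f w * cos (Z w h + a)) =
      (LINT w|\<mu>. D b w * cos (Z w h + a)) + inner b h * (LINT w|\<mu>. f w * cos (Z w h + a + pi / 2))"
  unfolding ibp_def by blast

lemma ibp_cong:
  assumes "ibp f D" "\<And>w. f w = g w" "\<And>b w. b \<in> hilbert_basis \<Longrightarrow> D b w = E b w"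
  shows "ibp g E"
proof -
  have "f = g" using assms(2) by auto
  moreover have "D b = E b" if "b \<in> hilbert_basis" for b using assms(3)[OF that] by auto
  ultimately show ?thesis using assms(1) unfolding ibp_def by simp
qed

text \<open>For f = 1 the integrals of cosines are explicit Gaussian factors, and their derivative
  along b is computed in two ways.\<close>

lemma ibp_one: "ibp (\<lambda>w. 1) (\<lambda>b w. 0)"
  unfolding ibp_def
proof (intro conjI ballI allI all_moments_const)
  fix b h :: 'h and a :: real
  \<comment> \<open>The phase starts at a - pi / 2 because differentiation adds pi / 2.\<close>
  have "((\<lambda>t. LINT w|\<mu>. 1 * cos (Z w (h + t *\<^sub>R b) + (a - pi / 2))) has_real_derivative
    (LINT w|\<mu>. 1 * Z w b * cos (Z w h + (a - pi / 2) + pi / 2))) (at 0)"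
    by (rule deriv_integral_cos[OF all_moments_const])
  then have d1: "((\<lambda>t. exp (- (norm (h + t *\<^sub>R b))\<^sup>2 / 2) * cos (a - pi / 2)) has_real_derivative
    (LINT w|\<mu>. Z w b * cos (Z w h + a))) (at 0)" by (simp add: integral_cos_Z)
  have "(norm (h + t *\<^sub>R b))\<^sup>2 = inner h h + 2 * t * inner h b + t\<^sup>2 * inner b b" for t
    unfolding power2_norm_eq_inner
    by (simp add: inner_add_left inner_add_right inner_commute power2_eq_square algebra_simps)
  moreover have "((\<lambda>t. exp (- (inner h h + 2 * t * inner h b + t\<^sup>2 * inner b b) / 2) * cos (a - pi / 2)) has_real_derivative
      exp (- inner h h / 2) * (- inner h b) * cos (a - pi / 2)) (at 0)"
    by (auto intro!: derivative_eq_intros)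
  ultimately have d2: "((\<lambda>t. exp (- (norm (h + t *\<^sub>R b))\<^sup>2 / 2) * cos (a - pi / 2)) has_real_derivative
      exp (- inner h h / 2) * (- inner h b) * cos (a - pi / 2)) (at 0)" by simp
  have "(LINT w|\<mu>. Z w b * cos (Z w h + a)) = exp (- inner h h / 2) * (- inner h b) * cos (a - pi / 2)"
    by (rule DERIV_unique[OF d1 d2])
  moreover have "cos (a - pi / 2) = - cos (a + pi / 2)" by (simp add: cos_add cos_diff)
  moreover have "(LINT w|\<mu>. cos (Z w h + a + pi / 2)) = exp (- inner h h / 2) * cos (a + pi / 2)"
    using integral_cos_Z[of h "a + pi / 2"] by (simp add: add.assoc power2_norm_eq_inner)
  ultimately show "(LINT w|\<mu>. Z w b * 1 * cos (Z w h + a)) =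
      (LINT w|\<mu>. 0 * cos (Z w h + a)) + inner b h * (LINT w|\<mu>. 1 * cos (Z w h + a + pi / 2))"
    by (simp add: inner_commute)
qed

text \<open>The identity for f holds for all h, so it can be differentiated in h along k. Each
  integral acquires a factor \<open>Z w k\<close>, and the coefficient \<open>inner b h\<close>
  contributes the new term \<open>inner b k\<close>.\<close>

lemma ibp_mult_Z:
  assumes "ibp f D"
  shows "ibp (\<lambda>w. Z w k * f w) (\<lambda>b w. Z w k * D b w + inner b k * f w)"
  unfolding ibp_def
proof (intro conjI ballI allI)
  note am = ibp_all_moments[OF assms] ibp_all_moments_deriv[OF assms]
  show "all_moments (\<lambda>w. Z w k * f w)" by (intro all_moments_intros am)
  fix b :: 'h assume b: "b \<in> hilbert_basis"
  show amD: "all_moments (\<lambda>w. Z w k * D b w + inner b k * f w)" by (intro all_moments_intros am b)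
  fix h a
  define a' where "a' = a - pi / 2"
  have amb: "all_moments (\<lambda>w. Z w b * f w)" by (intro all_moments_intros am)
  have d1: "((\<lambda>t. LINT w|\<mu>. Z w b * f w * cos (Z w (h + t *\<^sub>R k) + a')) has_real_derivative
      (LINT w|\<mu>. Z w b * f w * Z w k * cos (Z w h + a' + pi / 2))) (at 0)"
    by (rule deriv_integral_cos[OF amb])
  have dA: "((\<lambda>t. inner b (h + t *\<^sub>R k)) has_real_derivative inner b k) (at 0)"
    by (auto simp: inner_add_right intro!: derivative_eq_intros)
  have "((\<lambda>t. (LINT w|\<mu>. D b w * cos (Z w (h + t *\<^sub>R k) + a'))
        + inner b (h + t *\<^sub>R k) * (LINT w|\<mu>. f w * cos (Z w (h + t *\<^sub>R k) + (a' + pi / 2)))) has_real_derivative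
      (LINT w|\<mu>. D b w * Z w k * cos (Z w h + a' + pi / 2))
        + (inner b k * (LINT w|\<mu>. f w * cos (Z w (h + 0 *\<^sub>R k) + (a' + pi / 2)))
          + (LINT w|\<mu>. f w * Z w k * cos (Z w h + (a' + pi / 2) + pi / 2)) * inner b (h + 0 *\<^sub>R k))) (at 0)"
    by (intro DERIV_add DERIV_mult dA deriv_integral_cos am b)
  then have d2: "((\<lambda>t. LINT w|\<mu>. Z w b * f w * cos (Z w (h + t *\<^sub>R k) + a')) has_real_derivative
      (LINT w|\<mu>. D b w * Z w k * cos (Z w h + a' + pi / 2))
        + (inner b k * (LINT w|\<mu>. f w * cos (Z w (h + 0 *\<^sub>R k) + (a' + pi / 2)))
          + (LINT w|\<mu>. f w * Z w k * cos (Z w h + (a' + pi / 2) + pi / 2)) * inner b (h + 0 *\<^sub>R k))) (at 0)"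
    by (simp only: ibp_eq[OF assms b] add.assoc)
  have i: "integrable \<mu> (\<lambda>w. D b w * Z w k * cos (Z w h + a))" "integrable \<mu> (\<lambda>w. f w * cos (Z w h + a))"
    by (intro all_moments_integrable all_moments_intros am b)+
  have "(LINT w|\<mu>. Z w b * (Z w k * f w) * cos (Z w h + a)) = (LINT w|\<mu>. Z w b * f w * Z w k * cos (Z w h + a' + pi / 2))"
    by (simp add: a'_def mult_ac)
  also have "\<dots> = (LINT w|\<mu>. D b w * Z w k * cos (Z w h + a)) + inner b k * (LINT w|\<mu>. f w * cos (Z w h + a))
      + inner b h * (LINT w|\<mu>. Z w k * f w * cos (Z w h + a + pi / 2))"
    using DERIV_unique[OF d1 d2] by (simp add: a'_def mult_ac)
  also have "(LINT w|\<mu>. D b w * Z w k * cos (Z w h + a)) + inner b k * (LINT w|\<mu>. f w * cos (Z w h + a))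
      = (LINT w|\<mu>. (Z w k * D b w + inner b k * f w) * cos (Z w h + a))"
  proof -
    have e: "(Z w k * D b w + inner b k * f w) * cos (Z w h + a)
        = D b w * Z w k * cos (Z w h + a) + inner b k * (f w * cos (Z w h + a))" for w by (simp add: algebra_simps)
    show ?thesis unfolding e using i by simp
  qed
  finally show "(LINT w|\<mu>. Z w b * (Z w k * f w) * cos (Z w h + a)) =
      (LINT w|\<mu>. (Z w k * D b w + inner b k * f w) * cos (Z w h + a))
      + inner b h * (LINT w|\<mu>. Z w k * f w * cos (Z w h + a + pi / 2))" .
qed

lemma ibp_diff:
  assumes "ibp f D" "ibp g E"
  shows "ibp (\<lambda>w. f w - c * g w) (\<lambda>b w. D b w - c * E b w)"
proof -
  note am = ibp_all_moments[OF assms(1)] ibp_all_moments_deriv[OF assms(1)]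
    ibp_all_moments[OF assms(2)] ibp_all_moments_deriv[OF assms(2)]
  have amd: "all_moments (\<lambda>w. u w - c * v w)" if "all_moments u" "all_moments v" for u v
    using all_moments_add[OF that(1) all_moments_cmult[OF that(2), of "-c"]] by simp
  have lin: "(LINT w|\<mu>. (u w - c * v w) * cos (Z w h + a)) = (LINT w|\<mu>. u w * cos (Z w h + a)) - c * (LINT w|\<mu>. v w * cos (Z w h + a))"
    if "all_moments u" "all_moments v" for u v h a
  proof -
    have "integrable \<mu> (\<lambda>w. u w * cos (Z w h + a))" "integrable \<mu> (\<lambda>w. v w * cos (Z w h + a))"
      by (intro all_moments_integrable all_moments_intros that)+
    then show ?thesis by (simp add: left_diff_distrib mult.assoc)
  qed
  show ?thesis unfolding ibp_def
  proof (intro conjI ballI allI amd am)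
    fix b h :: 'h and a assume b: "b \<in> hilbert_basis"
    have "(LINT w|\<mu>. Z w b * (f w - c * g w) * cos (Z w h + a)) = (LINT w|\<mu>. (Z w b * f w - c * (Z w b * g w)) * cos (Z w h + a))"
      by (simp add: algebra_simps)
    also have "\<dots> = (LINT w|\<mu>. Z w b * f w * cos (Z w h + a)) - c * (LINT w|\<mu>. Z w b * g w * cos (Z w h + a))"
      by (intro lin all_moments_intros am)
    also have "\<dots> = (LINT w|\<mu>. (D b w - c * E b w) * cos (Z w h + a))
        + inner b h * (LINT w|\<mu>. (f w - c * g w) * cos (Z w h + (a + pi / 2)))"
      unfolding ibp_eq[OF assms(1) b] ibp_eq[OF assms(2) b]
      by (subst lin, intro am b, intro am b, subst lin, intro am, intro am) (simp add: algebra_simps)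
    finally show "(LINT w|\<mu>. Z w b * (f w - c * g w) * cos (Z w h + a)) = (LINT w|\<mu>. (D b w - c * E b w) * cos (Z w h + a))
        + inner b h * (LINT w|\<mu>. (f w - c * g w) * cos (Z w h + a + pi / 2))" by (simp add: add.assoc)
  qed
qed

end

text \<open>For n = 0 the truncated n - 1 is harmless because its coefficient is 0.\<close>

lemma hermite_Suc: "hermite (Suc n) x = x * hermite n x - real n * hermite (n - 1) x"
  by (cases n) auto

text \<open>This is the squared L^2 norm of the Hermite function of the word l, and also the number
  of permutations of positions that leave l unchanged.\<close>

definition count_fact :: "'a list \<Rightarrow> nat"
  where "count_fact l = (\<Prod>b\<in>set l. fact (count_list l b))"

lemma count_list_eq_0: "b \<notin> set l \<Longrightarrow> count_list l b = 0"
  by (simp add: count_list_0_iff)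

lemma count_fact_superset: "finite S \<Longrightarrow> set l \<subseteq> S \<Longrightarrow> count_fact l = (\<Prod>b\<in>S. fact (count_list l b))"
  unfolding count_fact_def by (intro prod.mono_neutral_left) (auto simp: count_list_eq_0)

lemma count_fact_Nil [simp]: "count_fact [] = 1" by (simp add: count_fact_def)

lemma count_fact_Cons: "count_fact (b # l) = Suc (count_list l b) * count_fact l"
proof -
  have "count_fact (b # l) = (\<Prod>c\<in>insert b (set l). fact (count_list (b # l) c))"
    by (rule count_fact_superset) auto
  also have "\<dots> = fact (Suc (count_list l b)) * (\<Prod>c\<in>set l - {b}. fact (count_list (b # l) c))"
    by (simp add: prod.insert_remove)
  also have "(\<Prod>c\<in>set l - {b}. fact (count_list (b # l) c)) = (\<Prod>c\<in>set l - {b}. fact (count_list l c))"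
    by (intro prod.cong) auto
  also have "fact (Suc (count_list l b)) * (\<Prod>c\<in>set l - {b}. fact (count_list l c))
      = Suc (count_list l b) * (\<Prod>c\<in>insert b (set l). fact (count_list l c))"
    by (simp add: prod.insert_remove algebra_simps)
  also have "(\<Prod>c\<in>insert b (set l). fact (count_list l c)) = count_fact l"
    by (rule count_fact_superset[symmetric]) auto
  finally show ?thesis .
qed

text \<open>Orbit times stabilizer under permutations of positions. It turns sums over the
  rearrangements of a word into the factor n!.\<close>

lemma card_permutations_times_count_fact: "card {l'. mset l' = mset l} * count_fact l = fact (length l)"
proof -
  have e: "(\<Prod>x\<in>set_mset (mset l). fact (count (mset l) x)) = count_fact l"
    by (simp add: count_fact_def count_mset)
  have "card {l'. mset l' = mset l} = fact (length l) div count_fact l"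
    using card_permutations_of_multiset(1)[of "mset l"] by (simp add: e permutations_of_multiset_def del: set_mset_mset)
  moreover have "count_fact l dvd fact (length l)"
    using card_permutations_of_multiset(2)[of "mset l"] by (simp add: e del: set_mset_mset)
  ultimately show ?thesis by (simp only: dvd_div_mult_self)
qed

section \<open>Hermite functions indexed by words in the basis\<close>

context abstract_wiener_space
begin

text \<open>This is \<open>basis_integral\<close> computed with the everywhere linear version
  \<open>Z\<close>; the two agree almost everywhere.\<close>

definition H :: "'h list \<Rightarrow> 'w \<Rightarrow> real"
  where "H l w = (\<Prod>b\<in>set l. hermite (count_list l b) (Z w b))"

lemma H_superset: "finite S \<Longrightarrow> set l \<subseteq> S \<Longrightarrow> H l w = (\<Prod>b\<in>S. hermite (count_list l b) (Z w b))"
  unfolding H_def by (intro prod.mono_neutral_left) (auto simp: count_list_eq_0)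

lemma H_Nil [simp]: "H [] w = 1" by (simp add: H_def)

lemma H_mset_cong: assumes "mset l = mset l'" shows "H l = H l'"
proof -
  have "set l = set l'" using assms by (metis set_mset_mset)
  moreover have "count_list l b = count_list l' b" for b using assms by (metis count_mset)
  ultimately show ?thesis by (auto simp: H_def fun_eq_iff)
qed

lemma H_Cons: "H (b # l) w = Z w b * H l w - real (count_list l b) * H (remove1 b l) w"
proof -
  define S where "S = set l - {b}"
  define R where "R = (\<Prod>c\<in>S. hermite (count_list l c) (Z w c))"
  have S: "finite S" "b \<notin> S" "insert b (set l) = insert b S" by (auto simp: S_def)
  have "H (b # l) w = (\<Prod>c\<in>insert b S. hermite (count_list (b # l) c) (Z w c))"
    by (rule H_superset) (auto simp: S_def)
  also have "\<dots> = hermite (Suc (count_list l b)) (Z w b) * (\<Prod>c\<in>S. hermite (count_list (b # l) c) (Z w c))"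
    using S by simp
  also have "(\<Prod>c\<in>S. hermite (count_list (b # l) c) (Z w c)) = R"
    unfolding R_def using S by (intro prod.cong) auto
  finally have 1: "H (b # l) w = hermite (Suc (count_list l b)) (Z w b) * R" .
  have "H l w = (\<Prod>c\<in>insert b S. hermite (count_list l c) (Z w c))"
    by (rule H_superset) (auto simp: S_def)
  then have 2: "H l w = hermite (count_list l b) (Z w b) * R" unfolding R_def using S by simp
  have "H (remove1 b l) w = (\<Prod>c\<in>insert b S. hermite (count_list (remove1 b l) c) (Z w c))"
    by (rule H_superset) (use set_remove1_subset[of b l] in \<open>auto simp: S_def\<close>)
  also have "\<dots> = hermite (count_list l b - 1) (Z w b) * (\<Prod>c\<in>S. hermite (count_list (remove1 b l) c) (Z w c))"
    using S by (simp add: count_list_remove1)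
  also have "(\<Prod>c\<in>S. hermite (count_list (remove1 b l) c) (Z w c)) = R"
    unfolding R_def using S by (intro prod.cong) (auto simp: count_list_remove1)
  finally have 3: "H (remove1 b l) w = hermite (count_list l b - 1) (Z w b) * R" .
  show ?thesis unfolding 1 2 3 hermite_Suc by (simp add: algebra_simps)
qed

text \<open>Differentiating \<open>H l\<close> along c removes one letter c, with multiplicity. The
  induction is on the length, because the recurrence for b # l' also involves
  \<open>remove1 b l'\<close>. The extra factor f allows a product of two Hermite functions to be
  treated: once with f = 1, then again with the result as f.\<close>

lemma ibp_H_mult:
  assumes f: "ibp f E" and "set l \<subseteq> hilbert_basis"
  shows "ibp (\<lambda>w. H l w * f w) (\<lambda>c w. real (count_list l c) * H (remove1 c l) w * f w + H l w * E c w)"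
  using assms(2)
proof (induction "length l" arbitrary: l rule: less_induct)
  case less
  show ?case
  proof (cases l)
    case Nil
    show ?thesis by (rule ibp_cong[OF f]) (auto simp: Nil)
  next
    case (Cons b l')
    define n where "n = count_list l' b"
    have bl: "b \<in> hilbert_basis" "set l' \<subseteq> hilbert_basis" using less.prems Cons by auto
    have len: "length l' < length l" "length (remove1 b l') < length l"
      by (auto simp: Cons length_remove1)
    have sub: "set (remove1 b l') \<subseteq> hilbert_basis" by (rule order_trans[OF set_remove1_subset bl(2)])
    note IH1 = less.hyps[OF len(1) bl(2)] and IH2 = less.hyps[OF len(2) sub]
    show ?thesis
    proof (rule ibp_cong[OF ibp_diff[OF ibp_mult_Z[OF IH1, of b] IH2, of "real n"]])
      fix w
      show "Z w b * (H l' w * f w) - real n * (H (remove1 b l') w * f w) = H l w * f w"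
        by (simp add: Cons H_Cons n_def algebra_simps)
    next
      fix c :: 'h and w assume c: "c \<in> hilbert_basis"
      have "Z w b * (real (count_list l' c) * H (remove1 c l') w) + inner c b * H l' w
          - real n * (real (count_list (remove1 b l') c) * H (remove1 c (remove1 b l')) w)
          = real (count_list l c) * H (remove1 c l) w"
      proof (cases "c = b")
        case True
        show ?thesis
        proof (cases "n = 0")
          case n0: True
          then show ?thesis using True inner_hilbert_basis[OF bl(1) bl(1)] by (simp add: Cons n_def)
        next
          case False
          then have "b \<in> set l'" by (metis count_list_0_iff n_def)
          \<comment> \<open>The word l' is rearranged to begin with b, so that the recurrence can be
            used once more, now for \<open>H l'\<close> itself.\<close>
          then have "H l' = H (b # remove1 b l')" by (intro H_mset_cong) simp
          then have e: "H l' w = Z w b * H (remove1 b l') w - (real n - 1) * H (remove1 b (remove1 b l')) w"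
            using False by (simp add: H_Cons count_list_remove1 n_def of_nat_diff)
          show ?thesis using True inner_hilbert_basis[OF bl(1) bl(1)] False
            by (simp add: Cons count_list_remove1 of_nat_diff n_def[symmetric]) (simp add: e algebra_simps)
        qed
      next
        case False
        have e: "H (remove1 c l) w = Z w b * H (remove1 c l') w - real n * H (remove1 b (remove1 c l')) w"
          using False by (simp add: Cons H_Cons count_list_remove1 n_def)
        have e': "remove1 c (remove1 b l') = remove1 b (remove1 c l')" by (rule remove1_commute)
        show ?thesis using False inner_hilbert_basis[OF c bl(1)]
          by (simp add: e e' count_list_remove1) (simp add: Cons algebra_simps)
      qed
      then have "(Z w b * (real (count_list l' c) * H (remove1 c l') w) + inner c b * H l' w
          - real n * (real (count_list (remove1 b l') c) * H (remove1 c (remove1 b l')) w)) * f w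
          + (Z w b * H l' w - real n * H (remove1 b l') w) * E c w
          = real (count_list l c) * H (remove1 c l) w * f w + H l w * E c w"
        by (simp add: Cons H_Cons n_def)
      then show "Z w b * (real (count_list l' c) * H (remove1 c l') w * f w + H l' w * E c w) + inner c b * (H l' w * f w)
          - real n * (real (count_list (remove1 b l') c) * H (remove1 c (remove1 b l')) w * f w + H (remove1 b l') w * E c w)
          = real (count_list l c) * H (remove1 c l) w * f w + H l w * E c w"
        by (simp add: algebra_simps)
    qed
  qed
qed

lemma ibp_H:
  assumes "set l \<subseteq> hilbert_basis"
  shows "ibp (H l) (\<lambda>c w. real (count_list l c) * H (remove1 c l) w)"
  using ibp_H_mult[OF ibp_one assms] by simp

lemma all_moments_H: "set l \<subseteq> hilbert_basis \<Longrightarrow> all_moments (H l)"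
  by (rule ibp_all_moments[OF ibp_H])

lemma L2_H: "set l \<subseteq> hilbert_basis \<Longrightarrow> H l \<in> L2 \<mu>"
  by (rule all_moments_L2[OF all_moments_H])

text \<open>Adding a letter is adjoint to removing it: the part of the product rule that hits
  \<open>H l\<close> is cancelled by the second term of the Hermite recurrence.\<close>

lemma integral_H_Cons_H:
  assumes "set (b # l) \<subseteq> hilbert_basis" "set l' \<subseteq> hilbert_basis"
  shows "(LINT w|\<mu>. H (b # l) w * H l' w) = real (count_list l' b) * (LINT w|\<mu>. H l w * H (remove1 b l') w)"
proof -
  have b: "b \<in> hilbert_basis" and l: "set l \<subseteq> hilbert_basis" using assms by auto
  have sub: "set (remove1 b l) \<subseteq> hilbert_basis" "set (remove1 b l') \<subseteq> hilbert_basis"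
    by (rule order_trans[OF set_remove1_subset l], rule order_trans[OF set_remove1_subset assms(2)])
  \<comment> \<open>At h = 0 and a = 0 the modulating cosine is 1 and the term with
    \<open>inner b h\<close> vanishes.\<close>
  have "(LINT w|\<mu>. Z w b * (H l w * H l' w)) = (LINT w|\<mu>. real (count_list l b) * H (remove1 b l) w * H l' w
      + H l w * (real (count_list l' b) * H (remove1 b l') w))"
    using ibp_eq[OF ibp_H_mult[OF ibp_H[OF assms(2)] l] b, of 0 0] by simp
  also have "\<dots> = real (count_list l b) * (LINT w|\<mu>. H (remove1 b l) w * H l' w)
      + real (count_list l' b) * (LINT w|\<mu>. H l w * H (remove1 b l') w)"
  proof -
    have "integrable \<mu> (\<lambda>w. H (remove1 b l) w * H l' w)" "integrable \<mu> (\<lambda>w. H l w * H (remove1 b l') w)"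
      using L2_H l assms(2) sub by (auto intro!: L2_mult_integrable)
    then show ?thesis by (simp add: mult.assoc mult.left_commute)
  qed
  finally have 1: "(LINT w|\<mu>. Z w b * (H l w * H l' w)) = real (count_list l b) * (LINT w|\<mu>. H (remove1 b l) w * H l' w)
      + real (count_list l' b) * (LINT w|\<mu>. H l w * H (remove1 b l') w)" .
  have i: "integrable \<mu> (\<lambda>w. Z w b * (H l w * H l' w))" "integrable \<mu> (\<lambda>w. H (remove1 b l) w * H l' w)"
    by (intro all_moments_integrable all_moments_intros all_moments_H l assms(2) sub)+
  have "(LINT w|\<mu>. H (b # l) w * H l' w)
      = (LINT w|\<mu>. Z w b * (H l w * H l' w) - real (count_list l b) * (H (remove1 b l) w * H l' w))"
    by (simp add: H_Cons algebra_simps)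
  also have "\<dots> = real (count_list l' b) * (LINT w|\<mu>. H l w * H (remove1 b l') w)"
    using i 1 by simp
  finally show ?thesis .
qed

text \<open>Letters of l are removed from l' one by one, and the counts met on the way multiply up
  to \<open>count_fact\<close>. For different multisets some letter is left unmatched and produces
  0.\<close>

lemma integral_H_H:
  assumes "set l \<subseteq> hilbert_basis" "set l' \<subseteq> hilbert_basis"
  shows "(LINT w|\<mu>. H l w * H l' w) = (if mset l = mset l' then real (count_fact l) else 0)"
  using assms
proof (induction l arbitrary: l')
  case Nil
  show ?case
  proof (cases l')
    case (Cons b l'')
    have "(LINT w|\<mu>. H [] w * H l' w) = (LINT w|\<mu>. H l' w * H [] w)" by (simp add: mult.commute)
    also have "\<dots> = 0" unfolding Cons by (subst integral_H_Cons_H) (use Nil Cons in auto)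
    finally show ?thesis by (simp add: Cons)
  qed (simp add: prob_space)
next
  case (Cons b l)
  have sub: "set (remove1 b l') \<subseteq> hilbert_basis" by (rule order_trans[OF set_remove1_subset Cons.prems(2)])
  have 1: "(LINT w|\<mu>. H (b # l) w * H l' w) = real (count_list l' b) * (if mset l = mset (remove1 b l') then real (count_fact l) else 0)"
    using integral_H_Cons_H[OF Cons.prems] Cons.IH[OF _ sub] Cons.prems by simp
  show ?case
  proof (cases "mset (b # l) = mset l'")
    case True
    then have "mset l = mset (remove1 b l')" by (metis add_mset_remove_trivial mset.simps(2) mset_remove1)
    moreover have "count_list l' b = Suc (count_list l b)"
      using arg_cong[OF True, of "\<lambda>m. count m b"] by (simp add: count_mset)
    ultimately show ?thesis using True by (simp add: 1 count_fact_Cons distrib_right)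
  next
    case False
    have "mset (b # l) = mset l'" if "b \<in> set l'" "mset l = mset (remove1 b l')"
      using that by simp
    then have "count_list l' b = 0 \<or> mset l \<noteq> mset (remove1 b l')"
      using False count_list_eq_0[of b l'] by blast
    then show ?thesis using False 1 by auto
  qed
qed

text \<open>Each letter b contributes a factor \<open>inner b h\<close> and a phase pi / 2, since
  the cosine is differentiated once per letter. Divided by n!, these integrals are the chaos
  coefficients of the cosine.\<close>

lemma integral_H_cos:
  assumes "set l \<subseteq> hilbert_basis"
  shows "(LINT w|\<mu>. H l w * cos (Z w h + a)) = exp (- (norm h)\<^sup>2 / 2) * (\<Prod>x\<leftarrow>l. inner x h) * cos (a + real (length l) * (pi / 2))"
  using assms
proof (induction l arbitrary: a)
  case (Cons b l)
  have b: "b \<in> hilbert_basis" and l: "set l \<subseteq> hilbert_basis" using Cons.prems by auto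
  have sub: "set (remove1 b l) \<subseteq> hilbert_basis" by (rule order_trans[OF set_remove1_subset l])
  have i: "integrable \<mu> (\<lambda>w. Z w b * H l w * cos (Z w h + a))" "integrable \<mu> (\<lambda>w. H (remove1 b l) w * cos (Z w h + a))"
    by (intro all_moments_integrable all_moments_intros all_moments_H l sub)+
  have "(LINT w|\<mu>. H (b # l) w * cos (Z w h + a))
      = (LINT w|\<mu>. Z w b * H l w * cos (Z w h + a) - real (count_list l b) * (H (remove1 b l) w * cos (Z w h + a)))"
    by (simp add: H_Cons algebra_simps)
  also have "\<dots> = inner b h * (LINT w|\<mu>. H l w * cos (Z w h + (a + pi / 2)))"
    using i ibp_eq[OF ibp_H[OF l] b, of h a] by (simp add: mult.assoc add.assoc)
  also have "\<dots> = exp (- (norm h)\<^sup>2 / 2) * (\<Prod>x\<leftarrow>b # l. inner x h) * cos (a + real (length (b # l)) * (pi / 2))"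
    unfolding Cons.IH[OF l] by (simp add: algebra_simps add_divide_distrib)
  finally show ?case .
qed (simp add: integral_cos_Z)

end

section \<open>Symmetric tensors and their coefficients\<close>

definition tensor_prod :: "'h::real_inner list \<Rightarrow> 'h list \<Rightarrow> real"
  where "tensor_prod x w = (\<Prod>i<length x. inner (x ! i) (w ! i))"

lemma tensor_prod_Cons: "tensor_prod (a # x) (b # w) = inner a b * tensor_prod x w"
  unfolding tensor_prod_def length_Cons prod.lessThan_Suc_shift by simp

lemma basis_words_0: "basis_words 0 = {[]}"
  by (auto simp: basis_words_def)

lemma basis_words_Suc: "basis_words (Suc n) = (\<lambda>(b, w). b # w) ` (hilbert_basis \<times> basis_words n)"
  by (auto simp: basis_words_def length_Suc_conv image_iff)

lemma has_sum_nonneg_product: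
  fixes f :: "'a \<Rightarrow> real" and g :: "'b \<Rightarrow> real"
  assumes "(f has_sum a) A" "(g has_sum b) B" "\<And>x. 0 \<le> f x" "\<And>y. 0 \<le> g y"
  shows "((\<lambda>(x, y). f x * g y) has_sum a * b) (A \<times> B)"
proof -
  have inner: "((\<lambda>y. f x * g y) has_sum f x * b) B" for x
    by (rule has_sum_cmult_right[OF assms(2)])
  have outer: "((\<lambda>x. f x * b) has_sum a * b) A" by (rule has_sum_cmult_left[OF assms(1)])
  have "b = infsum g B" using assms(2) by (simp add: infsumI)
  then have b: "0 \<le> b" using assms(4) by (simp add: infsum_nonneg)
  have "(\<lambda>z. norm ((\<lambda>(x, y). f x * g y) z)) summable_on A \<times> B"
  proof (rule Infinite_Sum.abs_summable_on_Sigma_iff[THEN iffD2], intro conjI ballI)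
    have e: "norm ((\<lambda>(x, y). f x * g y) (x, y)) = f x * g y" for x y using assms(3,4) by simp
    show "(\<lambda>y. norm ((\<lambda>(x, y). f x * g y) (x, y))) summable_on B" for x
      unfolding e using inner[of x] by (simp add: has_sum_iff)
    show "(\<lambda>x. norm (infsum (\<lambda>y. norm ((\<lambda>(x, y). f x * g y) (x, y))) B)) summable_on A"
      unfolding e infsumI[OF inner] using outer assms(3) b by (simp add: has_sum_iff)
  qed
  then have "(\<lambda>(x, y). f x * g y) summable_on A \<times> B" by (rule abs_summable_summable)
  then show ?thesis by (intro has_sum_SigmaI[OF _ outer]) (use inner in auto)
qed

text \<open>Parseval's identity in each slot; positivity allows the product of the sums to be summed
  over words.\<close>

lemma has_sum_tensor_prod_power2:
  fixes x :: "'h::{real_inner, banach} list"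
  shows "((\<lambda>w. (tensor_prod x w)\<^sup>2) has_sum (\<Prod>i<length x. (norm (x ! i))\<^sup>2)) (basis_words (length x))"
proof (induction x)
  case Nil
  show ?case by (simp add: basis_words_0 tensor_prod_def has_sum_finite_iff)
next
  case (Cons a x)
  have "((\<lambda>b. (inner a b)\<^sup>2) has_sum (norm a)\<^sup>2) hilbert_basis"
    unfolding power2_norm_eq_inner using has_sum_parseval[of a a] by (simp add: power2_eq_square)
  from has_sum_nonneg_product[OF this Cons.IH]
  have "((\<lambda>(b, w). (inner a b)\<^sup>2 * (tensor_prod x w)\<^sup>2) has_sum (norm a)\<^sup>2 * (\<Prod>i<length x. (norm (x ! i))\<^sup>2)) (hilbert_basis \<times> basis_words (length x))"
    by simp
  moreover have "inj_on (\<lambda>(b, w). b # w) (hilbert_basis \<times> basis_words (length x))" by (auto simp: inj_on_def)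
  ultimately show ?case
    unfolding length_Cons basis_words_Suc prod.lessThan_Suc_shift
    by (subst has_sum_reindex) (auto simp: o_def case_prod_unfold tensor_prod_Cons power_mult_distrib)
qed

lemma tensor_prod_basis_words:
  fixes v w :: "'h::{real_inner, banach} list"
  assumes "v \<in> basis_words n" "w \<in> basis_words n"
  shows "tensor_prod v w = (if v = w then 1 else 0)"
proof -
  have e: "inner (v ! i) (w ! i) = (if v ! i = w ! i then 1 else (0::real))" if "i < n" for i
    using that assms by (intro inner_hilbert_basis) (auto simp: basis_words_def)
  show ?thesis
  proof (cases "v = w")
    case True
    then show ?thesis using assms e by (simp add: tensor_prod_def basis_words_def)
  next
    case False
    then obtain i where "i < n" "v ! i \<noteq> w ! i"
      using assms by (auto simp: basis_words_def list_eq_iff_nth_eq)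
    then have "tensor_prod v w = 0"
      unfolding tensor_prod_def using assms e by (intro prod_zero) (auto simp: basis_words_def intro!: bexI[of _ i])
    then show ?thesis using False by simp
  qed
qed

lemma tensor_prod_update:
  assumes "length w = length x" "i < length x"
  shows "tensor_prod (x[i := y]) w = inner y (w ! i) * (\<Prod>k\<in>{..<length x} - {i}. inner (x ! k) (w ! k))"
proof -
  have "tensor_prod (x[i := y]) w = inner (x[i := y] ! i) (w ! i) * (\<Prod>k\<in>{..<length x} - {i}. inner (x[i := y] ! k) (w ! k))"
    unfolding tensor_prod_def using assms(2) by (subst prod.remove[of _ i]) auto
  also have "(\<Prod>k\<in>{..<length x} - {i}. inner (x[i := y] ! k) (w ! k)) = (\<Prod>k\<in>{..<length x} - {i}. inner (x ! k) (w ! k))"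
    by (intro prod.cong) auto
  finally show ?thesis using assms by simp
qed

lemma tensor_prod_permute:
  assumes "p permutes {..<length x}" "length w = length x"
  shows "tensor_prod (permute_list p x) (permute_list p w) = tensor_prod x w"
proof -
  have "tensor_prod (permute_list p x) (permute_list p w) = (\<Prod>i<length x. inner (x ! p i) (w ! p i))"
    unfolding tensor_prod_def using assms by (auto simp: permute_list_nth intro!: prod.cong)
  also have "\<dots> = tensor_prod x w" unfolding tensor_prod_def
    by (rule prod.permute[OF assms(1), symmetric, unfolded o_def])
  finally show ?thesis .
qed

lemma real_summable_mult:
  fixes f g :: "'a \<Rightarrow> real"
  assumes "(\<lambda>x. (f x)\<^sup>2) summable_on A" "(\<lambda>x. (g x)\<^sup>2) summable_on A"
  shows "(\<lambda>x. f x * g x) summable_on A"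
    and "\<bar>infsum (\<lambda>x. f x * g x) A\<bar> \<le> sqrt (infsum (\<lambda>x. (f x)\<^sup>2) A) * sqrt (infsum (\<lambda>x. (g x)\<^sup>2) A)"
proof -
  have s: "(\<lambda>x. (f x)\<^sup>2 + (g x)\<^sup>2) summable_on A" using assms by (rule summable_on_add)
  have "\<bar>a * b\<bar> \<le> a\<^sup>2 + b\<^sup>2" for a b :: real
    using sum_squares_bound[of a b] sum_squares_bound[of a "-b"] by (auto simp: abs_if)
  then have "(\<lambda>x. norm (f x * g x)) summable_on A"
    using s by (intro summable_on_comparison_test[OF s]) auto
  then show sm: "(\<lambda>x. f x * g x) summable_on A" by (rule abs_summable_summable)
  have le: "norm (sum (\<lambda>x. f x * g x) F) \<le> sqrt (infsum (\<lambda>x. (f x)\<^sup>2) A) * sqrt (infsum (\<lambda>x. (g x)\<^sup>2) A)"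
    if F: "finite F" "F \<subseteq> A" for F
  proof -
    have "\<bar>\<Sum>x\<in>F. f x * g x\<bar> \<le> L2_set f F * L2_set g F"
      by (rule order_trans[OF sum_abs]) (simp add: abs_mult L2_set_mult_ineq)
    also have "\<dots> \<le> sqrt (infsum (\<lambda>x. (f x)\<^sup>2) A) * sqrt (infsum (\<lambda>x. (g x)\<^sup>2) A)"
      unfolding L2_set_def using F assms by (intro mult_mono real_sqrt_le_mono finite_sum_le_infsum) (auto intro: sum_nonneg infsum_nonneg)
    finally show ?thesis by simp
  qed
  have "((\<lambda>F. norm (sum (\<lambda>x. f x * g x) F)) \<longlongrightarrow> norm (infsum (\<lambda>x. f x * g x) A)) (finite_subsets_at_top A)"
    using infsum_tendsto[OF sm] by (rule tendsto_norm)
  then show "\<bar>infsum (\<lambda>x. f x * g x) A\<bar> \<le> sqrt (infsum (\<lambda>x. (f x)\<^sup>2) A) * sqrt (infsum (\<lambda>x. (g x)\<^sup>2) A)"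
    using le by (intro tendsto_upperbound[where F = "finite_subsets_at_top A"]) auto
qed

text \<open>T is the sum of the elementary tensors of basis words with weights c. Cauchy-Schwarz
  gives convergence and boundedness in each slot; orthonormality gives back the
  coefficients.\<close>

lemma sym_tensor_of_coefficients:
  fixes c :: "'h::{real_inner, banach} list \<Rightarrow> real"
  assumes c: "(\<lambda>w. (c w)\<^sup>2) summable_on basis_words n"
    and sym: "\<And>w w'. w \<in> basis_words n \<Longrightarrow> mset w = mset w' \<Longrightarrow> c w = c w'"
  obtains T where "T \<in> sym_tensor n" "\<And>w. w \<in> basis_words n \<Longrightarrow> T w = c w"
proof -
  define T where "T x = (if length x = n then infsum (\<lambda>w. c w * tensor_prod x w) (basis_words n) else 0)" for x
  have tp: "(\<lambda>w. (tensor_prod x w)\<^sup>2) summable_on basis_words n" 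
    "infsum (\<lambda>w. (tensor_prod x w)\<^sup>2) (basis_words n) = (\<Prod>i<n. (norm (x ! i))\<^sup>2)" if "length x = n" for x :: "'h list"
    using has_sum_tensor_prod_power2[of x] that by (auto simp: has_sum_iff)
  have sm: "(\<lambda>w. c w * tensor_prod x w) summable_on basis_words n" if "length x = n" for x
    by (rule real_summable_mult[OF c tp(1)[OF that]])
  have Tw: "T w = c w" if w: "w \<in> basis_words n" for w
  proof -
    have "T w = infsum (\<lambda>v. c v * tensor_prod w v) (basis_words n)" using w by (simp add: T_def basis_words_def)
    also have "\<dots> = infsum (\<lambda>v. c v * tensor_prod w v) {w}"
      using w by (intro infsum_cong_neutral) (auto simp: tensor_prod_basis_words)
    finally show ?thesis using w by (simp add: tensor_prod_basis_words)
  qed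
  have "T \<in> sym_tensor n"
    unfolding sym_tensor_def
  proof (intro CollectI conjI allI impI)
    show "T l = 0" if "length l \<noteq> n" for l using that by (simp add: T_def)
    show "(\<lambda>l. (T l)\<^sup>2) summable_on basis_words n" using c by (rule summable_on_cong[THEN iffD1, rotated]) (simp add: Tw)
  next
    fix l l' :: "'h list" assume m: "mset l = mset l'"
    then have len: "length l = length l'" by (rule mset_eq_length)
    show "T l = T l'"
    proof (cases "length l = n")
      case True
      \<comment> \<open>A rearrangement of the arguments is moved onto the summation index, where
        the symmetry of c absorbs it.\<close>
      obtain p where p: "p permutes {..<length l'}" "permute_list p l' = l" using m by (rule mset_eq_permutation)
      have bij: "bij_betw (permute_list p) (basis_words n) (basis_words n :: 'h list set)"
      proof (rule bij_betwI)
        show "permute_list p \<in> basis_words n \<rightarrow> (basis_words n :: 'h list set)"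
          using p(1) True len by (auto simp: basis_words_def)
        show "permute_list (inv p) \<in> basis_words n \<rightarrow> (basis_words n :: 'h list set)"
          using permutes_inv[OF p(1)] True len by (auto simp: basis_words_def)
        show "permute_list (inv p) (permute_list p x) = x" "permute_list p (permute_list (inv p) x) = x"
          if "x \<in> basis_words n" for x :: "'h list"
          using that p(1) True len permutes_inv[OF p(1)]
          by (simp_all add: basis_words_def permute_list_compose[symmetric] permutes_inv_o)
      qed
      have "T l = infsum (\<lambda>w. c w * tensor_prod l w) (basis_words n)" using True by (simp add: T_def)
      also have "\<dots> = infsum (\<lambda>w. c (permute_list p w) * tensor_prod l (permute_list p w)) (basis_words n)"
        by (rule infsum_reindex_bij_betw[OF bij, symmetric])
      also have "\<dots> = infsum (\<lambda>w. c w * tensor_prod l' w) (basis_words n)"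
      proof (rule infsum_cong)
        fix w :: "'h list" assume w: "w \<in> basis_words n"
        then have pw: "p permutes {..<length w}" "length w = length l'" using p(1) True len by (auto simp: basis_words_def)
        have "c (permute_list p w) = c w" using sym[OF w, of "permute_list p w"] pw(1) by simp
        moreover have "tensor_prod l (permute_list p w) = tensor_prod l' w"
          using tensor_prod_permute[OF p(1), of w] pw p(2) by simp
        ultimately show "c (permute_list p w) * tensor_prod l (permute_list p w) = c w * tensor_prod l' w" by simp
      qed
      also have "\<dots> = T l'" using True len by (simp add: T_def)
      finally show ?thesis .
    qed (use len in \<open>simp add: T_def\<close>)
  next
    fix l :: "'h list" and i assume l: "length l = n" "i < n"
    \<comment> \<open>The Cauchy-Schwarz constant: the norm of c times the norms of the arguments in
      the other slots.\<close>
    define K where "K = sqrt (infsum (\<lambda>w. (c w)\<^sup>2) (basis_words n)) * sqrt (\<Prod>k\<in>{..<n} - {i}. (norm (l ! k))\<^sup>2)"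
    have up: "tensor_prod (l[i := y]) w = inner y (w ! i) * (\<Prod>k\<in>{..<n} - {i}. inner (l ! k) (w ! k))"
      if "w \<in> basis_words n" for w y using tensor_prod_update[of w l i y] l that by (simp add: basis_words_def)
    show "bounded_linear (\<lambda>x. T (l[i := x]))"
    proof (rule bounded_linear_intro[where K = K])
      fix x y
      have "T (l[i := x + y]) = infsum (\<lambda>w. c w * tensor_prod (l[i := x]) w + c w * tensor_prod (l[i := y]) w) (basis_words n)"
        unfolding T_def using l by (auto simp: up inner_add_left algebra_simps intro!: infsum_cong)
      also have "\<dots> = T (l[i := x]) + T (l[i := y])"
        unfolding T_def using l by (simp add: infsum_add sm)
      finally show "T (l[i := x + y]) = T (l[i := x]) + T (l[i := y])" .
    next
      fix r x
      have "T (l[i := r *\<^sub>R x]) = infsum (\<lambda>w. r * (c w * tensor_prod (l[i := x]) w)) (basis_words n)"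
        unfolding T_def using l by (auto simp: up algebra_simps intro!: infsum_cong)
      also have "\<dots> = r *\<^sub>R T (l[i := x])"
        unfolding T_def using l by (simp add: infsum_cmult_right')
      finally show "T (l[i := r *\<^sub>R x]) = r *\<^sub>R T (l[i := x])" .
    next
      fix x
      have "\<bar>T (l[i := x])\<bar> \<le> sqrt (infsum (\<lambda>w. (c w)\<^sup>2) (basis_words n)) * sqrt (infsum (\<lambda>w. (tensor_prod (l[i := x]) w)\<^sup>2) (basis_words n))"
        using real_summable_mult(2)[OF c tp(1)[of "l[i := x]"]] l by (simp add: T_def)
      also have "infsum (\<lambda>w. (tensor_prod (l[i := x]) w)\<^sup>2) (basis_words n) = (\<Prod>k<n. (norm (l[i := x] ! k))\<^sup>2)"
        using tp(2)[of "l[i := x]"] l by simp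
      also have "\<dots> = (norm x)\<^sup>2 * (\<Prod>k\<in>{..<n} - {i}. (norm (l[i := x] ! k))\<^sup>2)"
        using l by (subst prod.remove[of _ i]) auto
      also have "(\<Prod>k\<in>{..<n} - {i}. (norm (l[i := x] ! k))\<^sup>2) = (\<Prod>k\<in>{..<n} - {i}. (norm (l ! k))\<^sup>2)"
        by (intro prod.cong) auto
      finally show "norm (T (l[i := x])) \<le> norm x * K" by (simp add: K_def real_sqrt_mult mult_ac)
    qed
  qed
  then show ?thesis using that Tw by blast
qed

lemma sym_tensorD:
  assumes "T \<in> sym_tensor n"
  shows "length l \<noteq> n \<Longrightarrow> T l = 0"
    and "length l = n \<Longrightarrow> i < n \<Longrightarrow> bounded_linear (\<lambda>x. T (l[i := x]))"
    and "mset l = mset l' \<Longrightarrow> T l = T l'"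
    and "(\<lambda>l. (T l)\<^sup>2) summable_on basis_words n"
  using assms unfolding sym_tensor_def by blast+

lemma bounded_linear_eq_on_hilbert_basis:
  fixes f g :: "'h::{real_inner, banach} \<Rightarrow> real"
  assumes "bounded_linear f" "bounded_linear g" "\<And>b. b \<in> hilbert_basis \<Longrightarrow> f b = g b"
  shows "f x = g x"
proof -
  have "((\<lambda>b. inner x b *\<^sub>R f b) has_sum f x) hilbert_basis" by (rule has_sum_bounded_linear_fourier[OF assms(1)])
  moreover have "((\<lambda>b. inner x b *\<^sub>R g b) has_sum g x) hilbert_basis" by (rule has_sum_bounded_linear_fourier[OF assms(2)])
  then have "((\<lambda>b. inner x b *\<^sub>R f b) has_sum g x) hilbert_basis"
    by (rule has_sum_cong[THEN iffD1, rotated]) (simp add: assms(3))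
  ultimately show ?thesis by (rule has_sum_unique)
qed

text \<open>The first m slots are freed from the basis one at a time, each step using linearity and
  continuity in that slot.\<close>

lemma sym_tensor_eqI:
  fixes S T :: "'h::{real_inner, banach} list \<Rightarrow> real"
  assumes S: "S \<in> sym_tensor n" and T: "T \<in> sym_tensor n" and eq: "\<And>w. w \<in> basis_words n \<Longrightarrow> S w = T w"
  shows "S = T"
proof -
  have "S l = T l" if "m \<le> n" "length l = n" "\<And>i. m \<le> i \<Longrightarrow> i < n \<Longrightarrow> l ! i \<in> hilbert_basis" for m l
    using that
  proof (induction m arbitrary: l)
    case 0
    then have "l \<in> basis_words n" by (auto simp: basis_words_def set_conv_nth)
    then show ?case by (rule eq)
  next
    case (Suc m)
    have "S (l[m := l ! m]) = T (l[m := l ! m])"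
    proof (rule bounded_linear_eq_on_hilbert_basis[where f = "\<lambda>x. S (l[m := x])" and g = "\<lambda>x. T (l[m := x])"])
      show "bounded_linear (\<lambda>x. S (l[m := x]))" "bounded_linear (\<lambda>x. T (l[m := x]))"
        using Suc.prems sym_tensorD(2)[OF S, of l m] sym_tensorD(2)[OF T, of l m] by auto
      fix b :: 'h assume b: "b \<in> hilbert_basis"
      show "S (l[m := b]) = T (l[m := b])"
      proof (rule Suc.IH)
        fix i assume i: "m \<le> i" "i < n"
        show "l[m := b] ! i \<in> hilbert_basis"
          using i b Suc.prems by (cases "i = m") auto
      qed (use Suc.prems in auto)
    qed
    then show ?case by simp
  qed
  from this[of n] have "S l = T l" if "length l = n" for l using that by simp
  moreover have "S l = T l" if "length l \<noteq> n" for l using that sym_tensorD(1)[OF S] sym_tensorD(1)[OF T] by simp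
  ultimately show ?thesis by auto
qed

section \<open>Multiple integrals and chaos expansions\<close>

lemma hermite_measurable [measurable]: "hermite n \<in> borel_measurable borel"
proof (induction n rule: less_induct)
  case (less n)
  show ?case
  proof (cases n)
    case 0
    then have "hermite n = (\<lambda>x. 1)" by auto
    then show ?thesis by simp
  next
    case (Suc m)
    have [measurable]: "hermite m \<in> borel_measurable borel" "hermite (m - 1) \<in> borel_measurable borel"
      using less[of m] less[of "m - 1"] Suc by auto
    have e: "hermite n = (\<lambda>x. x * hermite m x - real m * hermite (m - 1) x)"
      unfolding Suc using hermite_Suc by blast
    show ?thesis unfolding e by measurable
  qed
qed

lemma tensor_inner_commute: "tensor_inner n S T = tensor_inner n T S"
  by (simp add: tensor_inner_def mult.commute)

lemma tensor_norm_power2: "(tensor_norm n T)\<^sup>2 = tensor_inner n T T"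
  unfolding tensor_norm_def tensor_inner_def by (subst real_sqrt_pow2) (auto intro!: infsum_nonneg)

lemma tensor_inner_self_nonneg: "0 \<le> tensor_inner n T T"
  unfolding tensor_inner_def by (auto intro!: infsum_nonneg)

lemma sym_tensor_summable_mult:
  assumes "S \<in> sym_tensor n" "T \<in> sym_tensor n"
  shows "(\<lambda>l. S l * T l) summable_on basis_words n"
  by (rule real_summable_mult[OF sym_tensorD(4)[OF assms(1)] sym_tensorD(4)[OF assms(2)]])

lemma sym_tensor_lincomb:
  assumes S: "S \<in> sym_tensor n" and T: "T \<in> sym_tensor n"
  shows "(\<lambda>l. a * S l + b * T l) \<in> sym_tensor n"
  unfolding sym_tensor_def
proof (intro CollectI conjI allI impI)
  fix l :: "'a list" and i assume "length l = n" "i < n"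
  then have bl: "bounded_linear (\<lambda>x. S (l[i := x]))" "bounded_linear (\<lambda>x. T (l[i := x]))"
    using sym_tensorD(2)[OF S] sym_tensorD(2)[OF T] by auto
  show "bounded_linear (\<lambda>x. a * S (l[i := x]) + b * T (l[i := x]))"
    by (intro bounded_linear_add bounded_linear_const_mult bl)
next
  have "(\<lambda>l. a\<^sup>2 * (S l * S l) + b\<^sup>2 * (T l * T l) + 2 * a * b * (S l * T l)) summable_on basis_words n"
    by (intro summable_on_add summable_on_cmult_right sym_tensor_summable_mult S T)
  then show "(\<lambda>l. (a * S l + b * T l)\<^sup>2) summable_on basis_words n"
    by (simp add: power2_eq_square algebra_simps)
next
  fix l :: "'a list" assume "length l \<noteq> n"
  then show "a * S l + b * T l = 0" using sym_tensorD(1)[OF S, of l] sym_tensorD(1)[OF T, of l] by simp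
next
  fix l l' :: "'a list" assume m: "mset l = mset l'"
  show "a * S l + b * T l = a * S l' + b * T l'"
    by (simp only: sym_tensorD(3)[OF S m] sym_tensorD(3)[OF T m])
qed

lemma sym_tensor_scale: "T \<in> sym_tensor n \<Longrightarrow> (\<lambda>l. a * T l) \<in> sym_tensor n"
  using sym_tensor_lincomb[of T n T a 0] by simp

lemma tensor_inner_lincomb_left:
  assumes "S \<in> sym_tensor n" "T \<in> sym_tensor n" "U \<in> sym_tensor n"
  shows "tensor_inner n (\<lambda>l. a * S l + b * T l) U = a * tensor_inner n S U + b * tensor_inner n T U"
proof -
  have "tensor_inner n (\<lambda>l. a * S l + b * T l) U = infsum (\<lambda>l. a * (S l * U l) + b * (T l * U l)) (basis_words n)"
    unfolding tensor_inner_def by (simp add: algebra_simps)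
  also have "\<dots> = infsum (\<lambda>l. a * (S l * U l)) (basis_words n) + infsum (\<lambda>l. b * (T l * U l)) (basis_words n)"
    by (intro infsum_add summable_on_cmult_right sym_tensor_summable_mult assms)
  finally show ?thesis by (simp add: infsum_cmult_right' tensor_inner_def)
qed

lemma tensor_inner_scale: "tensor_inner n (\<lambda>l. a * S l) (\<lambda>l. b * T l) = a * b * tensor_inner n S T"
  unfolding tensor_inner_def by (subst infsum_cmult_right'[symmetric]) (simp add: mult_ac)

section \<open>Convergence and isometry of multiple integrals\<close>

context abstract_wiener_space
begin

lemma measurable_basis_integral [measurable]: "basis_integral \<iota> \<mu> l \<in> borel_measurable \<mu>"
  unfolding basis_integral_def by measurable

lemma basis_integral_AE: "AE w in \<mu>. basis_integral \<iota> \<mu> l w = H l w"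
proof -
  have "AE w in \<mu>. \<forall>b\<in>set l. Z w b = X b w" by (intro AE_finite_allI) (auto intro: Z_AE)
  then show ?thesis by eventually_elim (auto simp: basis_integral_def H_def)
qed

lemma measurable_H [measurable]: "H l \<in> borel_measurable \<mu>"
  unfolding H_def[abs_def] by measurable

lemma finite_mset_eq: "finite {l'. mset l' = M}"
  using finite_permutations_of_multiset[of M] by (simp add: permutations_of_multiset_def)

text \<open>Rearranged words share their Hermite function, so the family is not orthogonal. Its Gram
  matrix has nonnegative entries, and each row sums to at most \<open>count_fact l\<close> times the
  number of rearrangements of l, which is n!. The bound x y \<le> (x^2 + y^2) / 2 on the
  coefficients then suffices.\<close>

lemma n2_sum_H_le:
  assumes F: "finite F" "F \<subseteq> basis_words n"
  shows "(n2 \<mu> (\<lambda>w. \<Sum>l\<in>F. a l * H l w))\<^sup>2 \<le> fact n * (\<Sum>l\<in>F. (a l)\<^sup>2)"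
proof -
  have sub: "set l \<subseteq> hilbert_basis" "length l = n" if "l \<in> F" for l using that F by (auto simp: basis_words_def)
  have "(n2 \<mu> (\<lambda>w. \<Sum>l\<in>F. a l * H l w))\<^sup>2 = (LINT w|\<mu>. (\<Sum>l\<in>F. \<Sum>l'\<in>F. a l * a l' * (H l w * H l' w)))"
    unfolding n2_power2 by (simp add: power2_eq_square sum_product mult_ac)
  also have "\<dots> = (\<Sum>l\<in>F. \<Sum>l'\<in>F. a l * a l' * (LINT w|\<mu>. H l w * H l' w))"
  proof -
    have i: "integrable \<mu> (\<lambda>w. H l w * H l' w)" if "l \<in> F" "l' \<in> F" for l l'
      by (intro L2_mult_integrable L2_H sub that)
    have "(LINT w|\<mu>. (\<Sum>l\<in>F. \<Sum>l'\<in>F. a l * a l' * (H l w * H l' w)))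
        = (\<Sum>l\<in>F. LINT w|\<mu>. (\<Sum>l'\<in>F. a l * a l' * (H l w * H l' w)))"
      by (rule Bochner_Integration.integral_sum) (intro Bochner_Integration.integrable_sum integrable_mult_right i)
    also have "\<dots> = (\<Sum>l\<in>F. \<Sum>l'\<in>F. LINT w|\<mu>. a l * a l' * (H l w * H l' w))"
      by (intro sum.cong refl Bochner_Integration.integral_sum integrable_mult_right i)
    finally show ?thesis by simp
  qed
  also have "\<dots> \<le> (\<Sum>l\<in>F. \<Sum>l'\<in>F. ((a l)\<^sup>2 + (a l')\<^sup>2) / 2 * (LINT w|\<mu>. H l w * H l' w))"
  proof (intro sum_mono mult_right_mono)
    fix l l' assume "l \<in> F" "l' \<in> F"
    show "a l * a l' \<le> ((a l)\<^sup>2 + (a l')\<^sup>2) / 2" using sum_squares_bound[of "a l" "a l'"] by simp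
    show "0 \<le> (LINT w|\<mu>. H l w * H l' w)" using integral_H_H[of l l'] sub[OF \<open>l \<in> F\<close>] sub[OF \<open>l' \<in> F\<close>] by simp
  qed
  also have "\<dots> = (\<Sum>l\<in>F. (a l)\<^sup>2 * (\<Sum>l'\<in>F. (LINT w|\<mu>. H l w * H l' w)))"
  proof -
    have "(\<Sum>l\<in>F. \<Sum>l'\<in>F. (a l')\<^sup>2 * (LINT w|\<mu>. H l w * H l' w)) = (\<Sum>l'\<in>F. \<Sum>l\<in>F. (a l')\<^sup>2 * (LINT w|\<mu>. H l w * H l' w))"
      by (rule sum.swap)
    also have "\<dots> = (\<Sum>l\<in>F. \<Sum>l'\<in>F. (a l)\<^sup>2 * (LINT w|\<mu>. H l w * H l' w))" by (simp add: mult.commute)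
    finally show ?thesis
      by (simp add: add_divide_distrib distrib_right sum.distrib sum_distrib_left sum_divide_distrib[symmetric])
  qed
  also have "\<dots> \<le> (\<Sum>l\<in>F. (a l)\<^sup>2 * fact n)"
  proof (intro sum_mono mult_left_mono)
    fix l assume l: "l \<in> F"
    have "(\<Sum>l'\<in>F. (LINT w|\<mu>. H l w * H l' w)) = (\<Sum>l'\<in>F. if mset l = mset l' then real (count_fact l) else 0)"
      by (intro sum.cong refl integral_H_H sub l)
    also have "\<dots> = real (card {l'\<in>F. mset l = mset l'}) * real (count_fact l)"
      using F(1) by (simp add: sum.If_cases Int_def)
    also have "\<dots> \<le> real (card {l'. mset l' = mset l}) * real (count_fact l)"
      by (intro mult_right_mono of_nat_mono card_mono finite_mset_eq) auto
    also have "\<dots> = fact n" using card_permutations_times_count_fact[of l] sub[OF l] by (metis of_nat_fact of_nat_mult)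
    finally show "(\<Sum>l'\<in>F. (LINT w|\<mu>. H l w * H l' w)) \<le> fact n" .
  qed simp
  finally show ?thesis by (simp add: sum_distrib_left mult.commute)
qed

abbreviation II :: "nat \<Rightarrow> ('h list \<Rightarrow> real) \<Rightarrow> 'w \<Rightarrow> real" where "II \<equiv> multiple_integral \<iota> \<mu>"

lemma L2_partial: "F \<subseteq> basis_words n \<Longrightarrow> (\<lambda>w. \<Sum>l\<in>F. a l * H l w) \<in> L2 \<mu>"
  by (intro L2_sum L2_cmult L2_H) (auto simp: basis_words_def)

text \<open>Sums over finite sets beyond S differ by terms outside S, whose norm is controlled by
  the tail of the square-summable coefficients. Hence the choice in the definition has a witness,
  and \<open>H\<close> may replace \<open>basis_integral\<close>.\<close>

lemma multiple_integral_spec: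
  assumes T: "T \<in> sym_tensor n"
  shows "II n T \<in> L2 \<mu>"
    and "((\<lambda>S. n2 \<mu> (\<lambda>w. II n T w - (\<Sum>l\<in>S. T l * H l w))) \<longlongrightarrow> 0) (finite_subsets_at_top (basis_words n))"
proof -
  have same: "n2 \<mu> (\<lambda>w. F w - (\<Sum>l\<in>S. T l * basis_integral \<iota> \<mu> l w)) = n2 \<mu> (\<lambda>w. F w - (\<Sum>l\<in>S. T l * H l w))"
    if F: "F \<in> L2 \<mu>" for F S
  proof (cases "finite S")
    case True
    have [measurable]: "F \<in> borel_measurable \<mu>" using F by (simp add: L2_iff)
    have "AE w in \<mu>. \<forall>l\<in>S. basis_integral \<iota> \<mu> l w = H l w"
      using True by (intro AE_finite_allI) (auto intro: basis_integral_AE)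
    then have "AE w in \<mu>. F w - (\<Sum>l\<in>S. T l * basis_integral \<iota> \<mu> l w) = F w - (\<Sum>l\<in>S. T l * H l w)"
      by eventually_elim simp
    then show ?thesis by (intro n2_AE_cong) auto
  qed simp
  have sm: "(\<lambda>l. (T l)\<^sup>2) summable_on basis_words n" by (rule sym_tensorD(4)[OF T])
  have ex: "\<exists>I. I \<in> L2 \<mu> \<and> ((\<lambda>S. n2 \<mu> (\<lambda>w. I w - (\<Sum>l\<in>S. T l * H l w))) \<longlongrightarrow> 0) (finite_subsets_at_top (basis_words n))"
  proof -
    obtain I where "I \<in> L2 \<mu>" "((\<lambda>S. n2 \<mu> (\<lambda>w. I w - (\<Sum>l\<in>S. T l * H l w))) \<longlongrightarrow> 0) (finite_subsets_at_top (basis_words n))"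
    proof (rule L2_net_complete[of "basis_words n" "\<lambda>S w. \<Sum>l\<in>S. T l * H l w"])
      show "(\<lambda>w. \<Sum>l\<in>F. T l * H l w) \<in> L2 \<mu>" if "F \<subseteq> basis_words n" for F by (rule L2_partial[OF that])
      fix e :: real assume e: "0 < e"
      \<comment> \<open>Chosen so that \<open>fact n * d = e\<^sup>2 / 2\<close>, to fit the bound
        of \<open>n2_sum_H_le\<close>.\<close>
      define d where "d = e\<^sup>2 / (2 * fact n)"
      have d: "0 < d" using e by (simp add: d_def)
      have "\<forall>\<^sub>F S in finite_subsets_at_top (basis_words n). dist (\<Sum>l\<in>S. (T l)\<^sup>2) (infsum (\<lambda>l. (T l)\<^sup>2) (basis_words n)) < d"
        using tendstoD[OF infsum_tendsto[OF sm] d] .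
      then obtain S where S: "finite S" "S \<subseteq> basis_words n"
        "dist (\<Sum>l\<in>S. (T l)\<^sup>2) (infsum (\<lambda>l. (T l)\<^sup>2) (basis_words n)) < d"
        unfolding eventually_finite_subsets_at_top by blast
      have rest: "(\<Sum>l\<in>R. (T l)\<^sup>2) < d" if R: "finite R" "R \<subseteq> basis_words n" "R \<inter> S = {}" for R
      proof -
        have "(\<Sum>l\<in>R. (T l)\<^sup>2) + (\<Sum>l\<in>S. (T l)\<^sup>2) = (\<Sum>l\<in>R \<union> S. (T l)\<^sup>2)"
          using R S by (intro sum.union_disjoint[symmetric]) auto
        also have "\<dots> \<le> infsum (\<lambda>l. (T l)\<^sup>2) (basis_words n)"
          using R S by (intro finite_sum_le_infsum sm) auto
        finally show ?thesis using S(3) by (simp add: dist_real_def)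
      qed
      show "\<exists>S. finite S \<and> S \<subseteq> basis_words n \<and> (\<forall>F G. finite F \<and> S \<subseteq> F \<and> F \<subseteq> basis_words n
          \<and> finite G \<and> S \<subseteq> G \<and> G \<subseteq> basis_words n \<longrightarrow> n2 \<mu> (\<lambda>w. (\<Sum>l\<in>F. T l * H l w) - (\<Sum>l\<in>G. T l * H l w)) < e)"
      proof (intro exI[of _ S] conjI S allI impI)
        fix F G assume FG: "finite F \<and> S \<subseteq> F \<and> F \<subseteq> basis_words n \<and> finite G \<and> S \<subseteq> G \<and> G \<subseteq> basis_words n"
        \<comment> \<open>These coefficients vanish off the symmetric difference of F and G, which
          is disjoint from S.\<close>
        define a where "a l = (if l \<in> F then T l else 0) - (if l \<in> G then T l else 0)" for l
        have "(\<Sum>l\<in>F. T l * H l w) - (\<Sum>l\<in>G. T l * H l w) = (\<Sum>l\<in>F \<union> G. a l * H l w)" for w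
        proof -
          have "(\<Sum>l\<in>F. T l * H l w) = (\<Sum>l\<in>F \<union> G. (if l \<in> F then T l else 0) * H l w)"
            using FG by (intro sum.mono_neutral_cong_left) auto
          moreover have "(\<Sum>l\<in>G. T l * H l w) = (\<Sum>l\<in>F \<union> G. (if l \<in> G then T l else 0) * H l w)"
            using FG by (intro sum.mono_neutral_cong_left) auto
          ultimately show ?thesis by (simp add: a_def left_diff_distrib sum_subtractf)
        qed
        then have "(n2 \<mu> (\<lambda>w. (\<Sum>l\<in>F. T l * H l w) - (\<Sum>l\<in>G. T l * H l w)))\<^sup>2 \<le> fact n * (\<Sum>l\<in>F \<union> G. (a l)\<^sup>2)"
          using n2_sum_H_le[of "F \<union> G" n a] FG by simp
        also have "(\<Sum>l\<in>F \<union> G. (a l)\<^sup>2) = (\<Sum>l\<in>(F - G) \<union> (G - F). (T l)\<^sup>2)"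
          using FG by (intro sum.mono_neutral_cong_right) (auto simp: a_def)
        also have "fact n * \<dots> \<le> fact n * d"
          using FG by (intro mult_left_mono less_imp_le[OF rest]) auto
        also have "\<dots> < e\<^sup>2" using e by (simp add: d_def)
        finally show "n2 \<mu> (\<lambda>w. (\<Sum>l\<in>F. T l * H l w) - (\<Sum>l\<in>G. T l * H l w)) < e"
          using e by (simp add: power_less_imp_less_base)
      qed
    qed blast
    then show ?thesis by blast
  qed
  then have "\<exists>I. I \<in> L2 \<mu> \<and> ((\<lambda>S. n2 \<mu> (\<lambda>w. I w - (\<Sum>l\<in>S. T l * basis_integral \<iota> \<mu> l w))) \<longlongrightarrow> 0) (finite_subsets_at_top (basis_words n))"
    using same by auto
  from someI_ex[OF this] have "II n T \<in> L2 \<mu> \<and> ((\<lambda>S. n2 \<mu> (\<lambda>w. II n T w - (\<Sum>l\<in>S. T l * basis_integral \<iota> \<mu> l w))) \<longlongrightarrow> 0) (finite_subsets_at_top (basis_words n))"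
    unfolding multiple_integral_def .
  then show "II n T \<in> L2 \<mu>"
    "((\<lambda>S. n2 \<mu> (\<lambda>w. II n T w - (\<Sum>l\<in>S. T l * H l w))) \<longlongrightarrow> 0) (finite_subsets_at_top (basis_words n))"
    using same by auto
qed

lemma has_sum_multiple_integral:
  assumes T: "T \<in> sym_tensor n" and g: "g \<in> L2 \<mu>"
  shows "((\<lambda>l. T l * (LINT w|\<mu>. H l w * g w)) has_sum (LINT w|\<mu>. II n T w * g w)) (basis_words n)"
proof -
  have "((\<lambda>S. LINT w|\<mu>. (\<Sum>l\<in>S. T l * H l w) * g w) \<longlongrightarrow> (LINT w|\<mu>. II n T w * g w)) (finite_subsets_at_top (basis_words n))"
  proof (rule integral_mult_tendsto_L2[OF _ _ g])
    show "\<forall>\<^sub>F S in finite_subsets_at_top (basis_words n). (\<lambda>w. \<Sum>l\<in>S. T l * H l w) \<in> L2 \<mu>"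
      by (rule eventually_finite_subsets_at_top_weakI) (rule L2_partial)
  qed (rule multiple_integral_spec[OF T])+
  moreover have "\<forall>\<^sub>F S in finite_subsets_at_top (basis_words n).
      (LINT w|\<mu>. (\<Sum>l\<in>S. T l * H l w) * g w) = (\<Sum>l\<in>S. T l * (LINT w|\<mu>. H l w * g w))"
  proof (rule eventually_finite_subsets_at_top_weakI)
    fix S :: "'h list set" assume S: "finite S" "S \<subseteq> basis_words n"
    have "integrable \<mu> (\<lambda>w. T l * (H l w * g w))" if "l \<in> S" for l
      using that S by (intro integrable_mult_right L2_mult_integrable L2_H g) (auto simp: basis_words_def)
    then show "(LINT w|\<mu>. (\<Sum>l\<in>S. T l * H l w) * g w) = (\<Sum>l\<in>S. T l * (LINT w|\<mu>. H l w * g w))"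
      by (simp add: sum_distrib_right mult.assoc)
  qed
  ultimately show ?thesis unfolding has_sum_def by (rule Lim_transform_eventually)
qed

text \<open>The words that contribute are the rearrangements of l; each gives
  \<open>T l * count_fact l\<close>, and there are n! / \<open>count_fact l\<close> of them.\<close>

lemma integral_multiple_integral_H:
  assumes T: "T \<in> sym_tensor n" and l: "set l \<subseteq> hilbert_basis"
  shows "(LINT w|\<mu>. II n T w * H l w) = (if length l = n then fact n * T l else 0)"
proof -
  let ?f = "\<lambda>l'. T l' * (LINT w|\<mu>. H l' w * H l w)"
  have hs: "(?f has_sum (LINT w|\<mu>. II n T w * H l w)) (basis_words n)"
    by (rule has_sum_multiple_integral[OF T L2_H[OF l]])
  have f: "?f l' = (if mset l' = mset l then T l * real (count_fact l) else 0)" if "l' \<in> basis_words n" for l'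
  proof -
    have s: "set l' \<subseteq> hilbert_basis" using that by (auto simp: basis_words_def)
    show ?thesis
    proof (cases "mset l' = mset l")
      case True
      have "(LINT w|\<mu>. H l' w * H l w) = real (count_fact l)"
        using integral_H_H[OF l s] True by (simp add: mult.commute)
      then show ?thesis using True sym_tensorD(3)[OF T True] by simp
    qed (use integral_H_H[OF s l] in simp)
  qed
  show ?thesis
  proof (cases "length l = n")
    case True
    have sub: "{l'. mset l' = mset l} \<subseteq> basis_words n"
    proof
      fix l' assume "l' \<in> {l'. mset l' = mset l}"
      then have m: "mset l' = mset l" by simp
      then show "l' \<in> basis_words n" using True l mset_eq_length[OF m] mset_eq_setD[OF m] by (simp add: basis_words_def)
    qed
    have "(?f has_sum (\<Sum>l'\<in>{l'. mset l' = mset l}. T l * real (count_fact l))) {l'. mset l' = mset l}"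
      using f sub by (intro has_sum_finiteI finite_mset_eq sum.cong) auto
    then have "(?f has_sum (\<Sum>l'\<in>{l'. mset l' = mset l}. T l * real (count_fact l))) (basis_words n)"
      by (rule has_sum_cong_neutral[THEN iffD1, rotated 3]) (use f sub in auto)
    from has_sum_unique[OF hs this] have "(LINT w|\<mu>. II n T w * H l w) = T l * real (card {l'. mset l' = mset l} * count_fact l)"
      by (simp add: mult_ac)
    then show ?thesis using True card_permutations_times_count_fact[of l] by (simp only: of_nat_fact if_True mult.commute simp_thms)
  next
    case False
    have "?f l' = 0" if "l' \<in> basis_words n" for l'
      using f[OF that] False that mset_eq_length[of l' l] by (auto simp: basis_words_def)
    then have "(?f has_sum 0) (basis_words n)" by (intro has_sum_0) auto
    from has_sum_unique[OF hs this] False show ?thesis by simp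
  qed
qed

lemma integral_multiple_integral_mult:
  assumes S: "S \<in> sym_tensor n" and T: "T \<in> sym_tensor m"
  shows "(LINT w|\<mu>. II n S w * II m T w) = (if n = m then fact n * tensor_inner n S T else 0)"
proof -
  have hs: "((\<lambda>l. S l * (LINT w|\<mu>. H l w * II m T w)) has_sum (LINT w|\<mu>. II n S w * II m T w)) (basis_words n)"
    by (rule has_sum_multiple_integral[OF S multiple_integral_spec(1)[OF T]])
  have e: "(LINT w|\<mu>. H l w * II m T w) = (if n = m then fact n * T l else 0)" if "l \<in> basis_words n" for l
    using integral_multiple_integral_H[OF T, of l] that by (auto simp: basis_words_def mult.commute)
  have "(LINT w|\<mu>. II n S w * II m T w) = infsum (\<lambda>l. S l * (LINT w|\<mu>. H l w * II m T w)) (basis_words n)"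
    using hs by (simp add: infsumI)
  also have "\<dots> = infsum (\<lambda>l. (if n = m then fact n else 0) * (S l * T l)) (basis_words n)"
    by (intro infsum_cong) (simp add: e)
  finally show ?thesis by (simp add: infsum_cmult_right' tensor_inner_def)
qed

end

section \<open>Chaos expansions: uniqueness, Parseval's identity, closedness\<close>

context abstract_wiener_space
begin

abbreviation chaos_exp :: "('w \<Rightarrow> real) \<Rightarrow> 'h chaos \<Rightarrow> bool" where "chaos_exp \<equiv> chaos_expansion \<iota> \<mu>"

definition chaos_partial :: "'h chaos \<Rightarrow> nat \<Rightarrow> 'w \<Rightarrow> real"
  where "chaos_partial k N w = (\<Sum>n<N. II n (k n) w)"

lemma chaos_exp_iff:
  "chaos_exp f k \<longleftrightarrow> f \<in> L2 \<mu> \<and> (\<forall>n. k n \<in> sym_tensor n) \<and> (\<lambda>N. n2 \<mu> (\<lambda>w. f w - chaos_partial k N w)) \<longlonglongrightarrow> 0"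
  unfolding chaos_expansion_def chaos_partial_def by blast

lemma L2_II: "T \<in> sym_tensor n \<Longrightarrow> II n T \<in> L2 \<mu>" by (rule multiple_integral_spec)

lemma L2_chaos_partial: "(\<And>n. k n \<in> sym_tensor n) \<Longrightarrow> chaos_partial k N \<in> L2 \<mu>"
  unfolding chaos_partial_def[abs_def] by (intro L2_sum L2_II)

lemma integral_chaos_partial:
  assumes "\<And>n. k n \<in> sym_tensor n" "g \<in> L2 \<mu>"
  shows "(LINT w|\<mu>. chaos_partial k N w * g w) = (\<Sum>n<N. LINT w|\<mu>. II n (k n) w * g w)"
proof -
  have "integrable \<mu> (\<lambda>w. II n (k n) w * g w)" for n by (intro L2_mult_integrable L2_II assms)
  then show ?thesis unfolding chaos_partial_def sum_distrib_right by (intro Bochner_Integration.integral_sum)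
qed

lemma integral_chaos_partial_mult:
  assumes k: "\<And>n. k n \<in> sym_tensor n" and k': "\<And>n. k' n \<in> sym_tensor n"
  shows "(LINT w|\<mu>. chaos_partial k i w * chaos_partial k' m w) = (\<Sum>n<min i m. fact n * tensor_inner n (k n) (k' n))"
proof -
  have e: "(LINT w|\<mu>. II n (k n) w * chaos_partial k' m w) = (if n < m then fact n * tensor_inner n (k n) (k' n) else 0)" for n
  proof -
    have "(LINT w|\<mu>. II n (k n) w * chaos_partial k' m w) = (LINT w|\<mu>. chaos_partial k' m w * II n (k n) w)"
      by (simp add: mult.commute)
    also have "\<dots> = (\<Sum>r<m. LINT w|\<mu>. II r (k' r) w * II n (k n) w)" by (rule integral_chaos_partial[OF k' L2_II[OF k]])
    also have "\<dots> = (\<Sum>r<m. if r = n then fact n * tensor_inner n (k n) (k' n) else 0)"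
      by (intro sum.cong refl) (simp add: integral_multiple_integral_mult[OF k' k] tensor_inner_commute)
    finally show ?thesis by simp
  qed
  have "(LINT w|\<mu>. chaos_partial k i w * chaos_partial k' m w) = (\<Sum>n<i. if n < m then fact n * tensor_inner n (k n) (k' n) else 0)"
    unfolding integral_chaos_partial[OF k L2_chaos_partial[OF k']] e by (rule refl)
  also have "\<dots> = (\<Sum>n<min i m. fact n * tensor_inner n (k n) (k' n))"
    by (rule sum.mono_neutral_cong_right) auto
  finally show ?thesis .
qed

lemma n2_power2_diff:
  assumes "f \<in> L2 \<mu>" "g \<in> L2 \<mu>"
  shows "(n2 \<mu> (\<lambda>x. f x - g x))\<^sup>2 = (n2 \<mu> f)\<^sup>2 + (n2 \<mu> g)\<^sup>2 - 2 * (LINT x|\<mu>. f x * g x)"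
  using n2_power2_lincomb[OF assms, of 1 "-1"] by simp

lemma n2_chaos_partial:
  assumes k: "\<And>n. k n \<in> sym_tensor n"
  shows "(n2 \<mu> (chaos_partial k N))\<^sup>2 = (\<Sum>n<N. fact n * tensor_inner n (k n) (k n))"
  unfolding n2_power2 using integral_chaos_partial_mult[OF k k, of N N] by (simp add: power2_eq_square)

lemma chaos_exp_integral_sums:
  assumes "chaos_exp f k" "g \<in> L2 \<mu>"
  shows "(\<lambda>n. LINT w|\<mu>. II n (k n) w * g w) sums (LINT w|\<mu>. f w * g w)"
proof -
  have f: "f \<in> L2 \<mu>" and k: "\<And>n. k n \<in> sym_tensor n" and lim: "(\<lambda>N. n2 \<mu> (\<lambda>w. f w - chaos_partial k N w)) \<longlonglongrightarrow> 0"
    using assms(1) by (auto simp: chaos_exp_iff)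
  have "(\<lambda>N. LINT w|\<mu>. chaos_partial k N w * g w) \<longlonglongrightarrow> (LINT w|\<mu>. f w * g w)"
    by (rule integral_mult_tendsto_L2[OF _ f assms(2) lim]) (intro always_eventually allI L2_chaos_partial k)
  then show ?thesis unfolding sums_def integral_chaos_partial[OF k assms(2)] .
qed

lemma chaos_exp_L2: "chaos_exp f k \<Longrightarrow> f \<in> L2 \<mu>" by (simp add: chaos_exp_iff)
lemma chaos_exp_sym: "chaos_exp f k \<Longrightarrow> k n \<in> sym_tensor n" by (simp add: chaos_exp_iff)

text \<open>Kernels are read off by testing against Hermite functions, which is what makes an
  expansion unique.\<close>

lemma chaos_exp_coeff:
  assumes "chaos_exp f k" "l \<in> basis_words n"
  shows "(LINT w|\<mu>. f w * H l w) = fact n * k n l"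
proof -
  have l: "set l \<subseteq> hilbert_basis" "length l = n" using assms(2) by (auto simp: basis_words_def)
  have 1: "(\<lambda>m. LINT w|\<mu>. II m (k m) w * H l w) sums (LINT w|\<mu>. f w * H l w)"
    by (rule chaos_exp_integral_sums[OF assms(1) L2_H[OF l(1)]])
  have 2: "(\<lambda>m. LINT w|\<mu>. II m (k m) w * H l w) = (\<lambda>m. if m = n then fact n * k n l else 0)"
    using integral_multiple_integral_H[OF chaos_exp_sym[OF assms(1)] l(1)] l(2) by auto
  have 3: "(\<lambda>m. if m = n then fact n * k n l else 0) sums (fact n * k n l)"
    by (rule sums_single)
  show ?thesis by (rule sums_unique2[OF 1[unfolded 2] 3])
qed

lemma chaos_exp_unique: assumes "chaos_exp f k" "chaos_exp f k'" shows "k = k'"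
proof
  fix n
  show "k n = k' n"
  proof (rule sym_tensor_eqI[OF chaos_exp_sym[OF assms(1)] chaos_exp_sym[OF assms(2)]])
    fix w :: "'h list" assume "w \<in> basis_words n"
    from chaos_exp_coeff[OF assms(1) this] chaos_exp_coeff[OF assms(2) this] show "k n w = k' n w" by simp
  qed
qed

lemma chaos_of_eq: assumes "chaos_exp f k" shows "chaos_of \<iota> \<mu> f = k"
  unfolding chaos_of_def by (rule the_equality) (rule assms, rule chaos_exp_unique[OF _ assms])

lemma chaos_exp_parseval:
  assumes "chaos_exp f k" "chaos_exp g k'"
  shows "(\<lambda>n. fact n * tensor_inner n (k n) (k' n)) sums (LINT w|\<mu>. f w * g w)"
proof -
  note k = chaos_exp_sym[OF assms(1)] and k' = chaos_exp_sym[OF assms(2)]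
  have "(LINT w|\<mu>. II n (k n) w * g w) = fact n * tensor_inner n (k n) (k' n)" for n
  proof -
    have "((\<lambda>l. k n l * (LINT w|\<mu>. H l w * g w)) has_sum (LINT w|\<mu>. II n (k n) w * g w)) (basis_words n)"
      by (rule has_sum_multiple_integral[OF k chaos_exp_L2[OF assms(2)]])
    then have "(LINT w|\<mu>. II n (k n) w * g w) = infsum (\<lambda>l. k n l * (LINT w|\<mu>. H l w * g w)) (basis_words n)"
      by (simp add: infsumI)
    also have "\<dots> = infsum (\<lambda>l. fact n * (k n l * k' n l)) (basis_words n)"
      by (intro infsum_cong) (use chaos_exp_coeff[OF assms(2)] in \<open>simp add: mult.commute\<close>)
    finally show ?thesis by (simp add: infsum_cmult_right' tensor_inner_def)
  qed
  then show ?thesis using chaos_exp_integral_sums[OF assms(1) chaos_exp_L2[OF assms(2)]] by simp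
qed

lemma chaos_exp_n2: "chaos_exp f k \<Longrightarrow> (\<lambda>n. fact n * tensor_inner n (k n) (k n)) sums (n2 \<mu> f)\<^sup>2"
  unfolding n2_power2 using chaos_exp_parseval[of f k f k] by (simp add: power2_eq_square)

lemma integral_coeff_multiple_integral:
  assumes f: "f \<in> L2 \<mu>" and k: "k \<in> sym_tensor n" 
    and c: "\<And>l. l \<in> basis_words n \<Longrightarrow> (LINT w|\<mu>. f w * H l w) = fact n * k l"
  shows "(LINT w|\<mu>. II n k w * f w) = fact n * tensor_inner n k k"
proof -
  have "((\<lambda>l. k l * (LINT w|\<mu>. H l w * f w)) has_sum (LINT w|\<mu>. II n k w * f w)) (basis_words n)"
    by (rule has_sum_multiple_integral[OF k f])
  then have "(LINT w|\<mu>. II n k w * f w) = infsum (\<lambda>l. k l * (LINT w|\<mu>. H l w * f w)) (basis_words n)"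
    by (simp add: infsumI)
  also have "\<dots> = infsum (\<lambda>l. fact n * (k l * k l)) (basis_words n)"
    by (intro infsum_cong) (use c in \<open>simp add: mult.commute\<close>)
  finally show ?thesis by (simp add: infsum_cmult_right' tensor_inner_def)
qed

lemma n2_diff_chaos_partial:
  assumes f: "f \<in> L2 \<mu>" and k: "\<And>n. k n \<in> sym_tensor n"
    and c: "\<And>n l. l \<in> basis_words n \<Longrightarrow> (LINT w|\<mu>. f w * H l w) = fact n * k n l"
  shows "(n2 \<mu> (\<lambda>w. f w - chaos_partial k N w))\<^sup>2 = (n2 \<mu> f)\<^sup>2 - (\<Sum>n<N. fact n * tensor_inner n (k n) (k n))"
proof -
  have "(LINT w|\<mu>. f w * chaos_partial k N w) = (LINT w|\<mu>. chaos_partial k N w * f w)" by (simp add: mult.commute)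
  also have "\<dots> = (\<Sum>n<N. fact n * tensor_inner n (k n) (k n))"
    unfolding integral_chaos_partial[OF k f]
    by (intro sum.cong refl integral_coeff_multiple_integral f k c)
  finally show ?thesis
    using n2_power2_diff[OF f L2_chaos_partial[of k N, OF k]] n2_chaos_partial[of k N, OF k] by simp
qed

text \<open>The squared distance from f to the N-th partial sum is |f|^2 minus the partial Parseval
  sum, so matching coefficients together with Parseval's equality force convergence.\<close>

lemma chaos_expI:
  assumes f: "f \<in> L2 \<mu>" and k: "\<And>n. k n \<in> sym_tensor n"
    and c: "\<And>n l. l \<in> basis_words n \<Longrightarrow> (LINT w|\<mu>. f w * H l w) = fact n * k n l"
    and s: "(\<lambda>n. fact n * tensor_inner n (k n) (k n)) sums (n2 \<mu> f)\<^sup>2"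
  shows "chaos_exp f k"
  unfolding chaos_exp_iff
proof (intro conjI allI f k)
  have "(\<lambda>N. (n2 \<mu> f)\<^sup>2 - (\<Sum>n<N. fact n * tensor_inner n (k n) (k n))) \<longlonglongrightarrow> (n2 \<mu> f)\<^sup>2 - (n2 \<mu> f)\<^sup>2"
    using s unfolding sums_def by (intro tendsto_diff tendsto_const)
  then have "(\<lambda>N. (n2 \<mu> (\<lambda>w. f w - chaos_partial k N w))\<^sup>2) \<longlonglongrightarrow> 0"
    by (simp only: n2_diff_chaos_partial[OF f k c] diff_self)
  then have "(\<lambda>N. sqrt ((n2 \<mu> (\<lambda>w. f w - chaos_partial k N w))\<^sup>2)) \<longlonglongrightarrow> sqrt 0" by (rule tendsto_real_sqrt)
  then show "(\<lambda>N. n2 \<mu> (\<lambda>w. f w - chaos_partial k N w)) \<longlonglongrightarrow> 0" by simp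
qed

text \<open>Riesz-Fischer: squared distances between partial sums are differences of partial sums of
  the norm series.\<close>

lemma chaos_exp_exists:
  assumes k: "\<And>n. k n \<in> sym_tensor n" and s: "summable (\<lambda>n. fact n * tensor_inner n (k n) (k n))"
  shows "\<exists>f. chaos_exp f k"
proof -
  define A where "A N = (\<Sum>n<N. fact n * tensor_inner n (k n) (k n))" for N
  have A: "Cauchy A" unfolding A_def[abs_def] using s by (simp add: summable_iff_convergent Cauchy_convergent_iff)
  have d: "(n2 \<mu> (\<lambda>w. chaos_partial k i w - chaos_partial k m w))\<^sup>2 = \<bar>A i - A m\<bar>" for i m
  proof -
    have "(n2 \<mu> (\<lambda>w. chaos_partial k i w - chaos_partial k m w))\<^sup>2 = A i + A m - 2 * A (min i m)"
      using n2_power2_diff[OF L2_chaos_partial[of k i, OF k] L2_chaos_partial[of k m, OF k]]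
        n2_chaos_partial[of k, OF k] integral_chaos_partial_mult[OF k k] by (simp add: A_def)
    moreover have "0 \<le> (n2 \<mu> (\<lambda>w. chaos_partial k i w - chaos_partial k m w))\<^sup>2" by simp
    ultimately show ?thesis by (cases "i \<le> m") (auto simp: min_def)
  qed
  have "\<exists>N. \<forall>i\<ge>N. \<forall>m\<ge>N. n2 \<mu> (\<lambda>w. chaos_partial k i w - chaos_partial k m w) < e" if e: "0 < e" for e
  proof -
    have "0 < e\<^sup>2" using e by simp
    then obtain N where N: "\<And>i m. N \<le> i \<Longrightarrow> N \<le> m \<Longrightarrow> norm (A i - A m) < e\<^sup>2" using CauchyD[OF A] by blast
    show ?thesis
    proof (intro exI[of _ N] allI impI)
      fix i m assume "N \<le> i" "N \<le> m"
      then have "(n2 \<mu> (\<lambda>w. chaos_partial k i w - chaos_partial k m w))\<^sup>2 < e\<^sup>2" using N d by simp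
      then show "n2 \<mu> (\<lambda>w. chaos_partial k i w - chaos_partial k m w) < e" using e by (simp add: power_less_imp_less_base)
    qed
  qed
  from L2_complete[OF L2_chaos_partial[OF k] this] obtain F where
    "F \<in> L2 \<mu>" "(\<lambda>n. n2 \<mu> (\<lambda>x. F x - chaos_partial k n x)) \<longlonglongrightarrow> 0" by blast
  then show ?thesis using k by (auto simp: chaos_exp_iff)
qed

lemma chaos_exp_AE_cong:
  assumes "chaos_exp f k" "g \<in> borel_measurable \<mu>" "AE w in \<mu>. f w = g w"
  shows "chaos_exp g k"
proof -
  have fL: "f \<in> L2 \<mu>" by (rule chaos_exp_L2[OF assms(1)])
  have [measurable]: "f \<in> borel_measurable \<mu>" "g \<in> borel_measurable \<mu>" using fL assms(2) by (auto simp: L2_iff)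
  have [measurable]: "chaos_partial k N \<in> borel_measurable \<mu>" for N
    using L2_chaos_partial[of k N, OF chaos_exp_sym[OF assms(1)]] by (simp add: L2_iff)
  have "n2 \<mu> (\<lambda>w. g w - chaos_partial k N w) = n2 \<mu> (\<lambda>w. f w - chaos_partial k N w)" for N
    by (rule n2_AE_cong) (use assms(3) in auto)
  then show ?thesis using assms(1) L2_AE_cong[OF fL assms(2,3)] by (simp add: chaos_exp_iff)
qed

text \<open>Bessel's inequality makes the coefficients of f square summable in each degree and over
  all degrees, so they are the kernels of some g: the orthogonal projection of f onto the closed
  span of the Hermite functions.\<close>

lemma chaos_projection:
  assumes f: "f \<in> L2 \<mu>"
  obtains g k where "chaos_exp g k" "\<And>l. set l \<subseteq> hilbert_basis \<Longrightarrow> (LINT w|\<mu>. g w * H l w) = (LINT w|\<mu>. f w * H l w)"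
proof -
  define c where "c l = (LINT w|\<mu>. f w * H l w) / fact (length l)" for l
  have "\<exists>T\<in>sym_tensor n. \<forall>w\<in>basis_words n. T w = c w" for n
  proof -
    have bound: "(\<Sum>l\<in>F. (c l)\<^sup>2) \<le> (n2 \<mu> f)\<^sup>2 / fact n" if F: "F \<subseteq> basis_words n" "finite F" for F
    proof -
      have "(LINT w|\<mu>. f w * (\<Sum>l\<in>F. c l * H l w)) = (\<Sum>l\<in>F. LINT w|\<mu>. c l * (f w * H l w))"
      proof -
        have "integrable \<mu> (\<lambda>w. c l * (f w * H l w))" if "l \<in> F" for l
          using that F by (intro integrable_mult_right L2_mult_integrable f L2_H) (auto simp: basis_words_def)
        moreover have "(\<lambda>w. f w * (\<Sum>l\<in>F. c l * H l w)) = (\<lambda>w. \<Sum>l\<in>F. c l * (f w * H l w))"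
          by (simp add: sum_distrib_left mult_ac)
        ultimately show ?thesis by (simp only: Bochner_Integration.integral_sum)
      qed
      also have "\<dots> = (\<Sum>l\<in>F. fact n * (c l)\<^sup>2)"
      proof (rule sum.cong[OF refl])
        fix l assume "l \<in> F"
        then have "length l = n" using F by (auto simp: basis_words_def)
        then show "(LINT w|\<mu>. c l * (f w * H l w)) = fact n * (c l)\<^sup>2"
          by (simp add: c_def power2_eq_square)
      qed
      finally have e: "(LINT w|\<mu>. f w * (\<Sum>l\<in>F. c l * H l w)) = fact n * (\<Sum>l\<in>F. (c l)\<^sup>2)"
        by (simp add: sum_distrib_left)
      \<comment> \<open>Bessel's inequality: with S the sum of the squares, expanding gives |f|^2 -
        2 n! S plus a term that is at most n! S.\<close>
      have "0 \<le> (n2 \<mu> (\<lambda>w. f w - (\<Sum>l\<in>F. c l * H l w)))\<^sup>2" by simp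
      also have "\<dots> \<le> (n2 \<mu> f)\<^sup>2 - fact n * (\<Sum>l\<in>F. (c l)\<^sup>2)"
        using n2_power2_diff[OF f L2_partial[OF F(1)], of c] e n2_sum_H_le[OF F(2,1), of c] by simp
      finally show ?thesis by (simp add: field_simps)
    qed
    have sm: "(\<lambda>l. (c l)\<^sup>2) summable_on basis_words n"
      by (rule nonneg_bdd_above_summable_on) (use bound in \<open>auto intro!: bdd_aboveI2\<close>)
    have eq: "c w = c w'" if "w \<in> basis_words n" "mset w = mset w'" for w w'
      using H_mset_cong[OF that(2)] mset_eq_length[OF that(2)] by (simp add: c_def)
    show ?thesis
    proof (rule sym_tensor_of_coefficients[OF sm eq])
      fix T assume "T \<in> sym_tensor n" "\<And>w. w \<in> basis_words n \<Longrightarrow> T w = c w"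
      then show "\<exists>T\<in>sym_tensor n. \<forall>w\<in>basis_words n. T w = c w" by blast
    qed
  qed
  then obtain k where k: "\<And>n. k n \<in> sym_tensor n" and kc: "\<And>n w. w \<in> basis_words n \<Longrightarrow> k n w = c w" by metis
  have coeff: "(LINT w|\<mu>. f w * H l w) = fact n * k n l" if "l \<in> basis_words n" for n l
    using kc[OF that] that by (simp add: c_def basis_words_def)
  have "summable (\<lambda>n. fact n * tensor_inner n (k n) (k n))"
  proof (rule bounded_imp_summable)
    show "0 \<le> fact n * tensor_inner n (k n) (k n)" for n by (simp add: tensor_inner_self_nonneg)
    show "(\<Sum>n\<le>N. fact n * tensor_inner n (k n) (k n)) \<le> (n2 \<mu> f)\<^sup>2" for N
      using n2_diff_chaos_partial[OF f k coeff, of "Suc N"] zero_le_power2[of "n2 \<mu> (\<lambda>w. f w - chaos_partial k (Suc N) w)"]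
      by (simp add: lessThan_Suc_atMost)
  qed
  from chaos_exp_exists[OF k this] obtain g where g: "chaos_exp g k" by blast
  show ?thesis
  proof (rule that[OF g])
    fix l :: "'h list" assume "set l \<subseteq> hilbert_basis"
    then have "l \<in> basis_words (length l)" by (simp add: basis_words_def)
    from chaos_exp_coeff[OF g this] coeff[OF this]
    show "(LINT w|\<mu>. g w * H l w) = (LINT w|\<mu>. f w * H l w)" by simp
  qed
qed

lemma integral_orthogonal_H:
  assumes d: "d \<in> L2 \<mu>" "\<And>l. set l \<subseteq> hilbert_basis \<Longrightarrow> (LINT w|\<mu>. d w * H l w) = 0" and u: "chaos_exp u k"
  shows "(LINT w|\<mu>. u w * d w) = 0"
proof -
  have "(LINT w|\<mu>. II n (k n) w * d w) = 0" for n
  proof -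
    have "((\<lambda>l. k n l * (LINT w|\<mu>. H l w * d w)) has_sum (LINT w|\<mu>. II n (k n) w * d w)) (basis_words n)"
      by (rule has_sum_multiple_integral[OF chaos_exp_sym[OF u] d(1)])
    moreover have "((\<lambda>l. k n l * (LINT w|\<mu>. H l w * d w)) has_sum 0) (basis_words n)"
      using d(2) by (intro has_sum_0) (auto simp: basis_words_def mult.commute)
    ultimately show ?thesis by (rule has_sum_unique)
  qed
  then have "(\<lambda>n. 0) sums (LINT w|\<mu>. u w * d w)" using chaos_exp_integral_sums[OF u d(1)] by simp
  then show ?thesis by (rule sums_unique2[OF _ sums_zero])
qed

text \<open>The defect d between f and its projection f' is orthogonal to everything that has an
  expansion, hence to f' and to all g m, and in the limit to f; so d is orthogonal to itself. This
  provides expansions for L^2 limits of trigonometric polynomials.\<close>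

lemma chaos_exp_closed:
  assumes f: "f \<in> L2 \<mu>" and g: "\<And>m. \<exists>k. chaos_exp (g m) k" and lim: "(\<lambda>m::nat. n2 \<mu> (\<lambda>w. f w - g m w)) \<longlonglongrightarrow> 0"
  shows "\<exists>k. chaos_exp f k"
proof -
  obtain f' k where f': "chaos_exp f' k" and eq: "\<And>l. set l \<subseteq> hilbert_basis \<Longrightarrow> (LINT w|\<mu>. f' w * H l w) = (LINT w|\<mu>. f w * H l w)"
    using chaos_projection[OF f] by blast
  have f'L: "f' \<in> L2 \<mu>" by (rule chaos_exp_L2[OF f'])
  define d where "d w = f w - f' w" for w
  have d: "d \<in> L2 \<mu>" unfolding d_def by (rule L2_diff[OF f f'L])
  have dH: "(LINT w|\<mu>. d w * H l w) = 0" if l: "set l \<subseteq> hilbert_basis" for l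
  proof -
    have "(LINT w|\<mu>. d w * H l w) = (LINT w|\<mu>. f w * H l w - f' w * H l w)" by (simp add: d_def left_diff_distrib)
    also have "\<dots> = 0" using eq[OF l] L2_mult_integrable[OF f L2_H[OF l]] L2_mult_integrable[OF f'L L2_H[OF l]] by simp
    finally show ?thesis .
  qed
  have gL: "g m \<in> L2 \<mu>" for m using g[of m] chaos_exp_L2 by blast
  have g0: "(LINT w|\<mu>. g m w * d w) = 0" for m using g[of m] integral_orthogonal_H[OF d dH] by blast
  have "(\<lambda>m. LINT w|\<mu>. g m w * d w) \<longlonglongrightarrow> (LINT w|\<mu>. f w * d w)"
    by (rule integral_mult_tendsto_L2[OF _ f d lim]) (simp add: gL)
  then have "(LINT w|\<mu>. f w * d w) = 0" by (simp add: g0 LIMSEQ_const_iff)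
  moreover have "(LINT w|\<mu>. f' w * d w) = 0" by (rule integral_orthogonal_H[OF d dH f'])
  moreover have "(LINT w|\<mu>. f w * d w - f' w * d w) = (LINT w|\<mu>. f w * d w) - (LINT w|\<mu>. f' w * d w)"
    by (intro Bochner_Integration.integral_diff L2_mult_integrable f f'L d)
  moreover have "(LINT w|\<mu>. f w * d w - f' w * d w) = (n2 \<mu> d)\<^sup>2"
    unfolding n2_power2 by (simp add: d_def power2_eq_square algebra_simps)
  ultimately have "n2 \<mu> d = 0" by simp
  from n2_eq_0_AE[OF d this] have "AE w in \<mu>. f' w = f w" by (auto simp: d_def)
  then show ?thesis using chaos_exp_AE_cong[OF f'] f by (auto simp: L2_iff)
qed

lemma chaos_exp_lincomb:
  assumes f: "chaos_exp f k" and g: "chaos_exp g k'"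
  shows "chaos_exp (\<lambda>w. a * f w + b * g w) (\<lambda>n l. a * k n l + b * k' n l)"
proof (rule chaos_expI)
  note L = chaos_exp_L2[OF f] chaos_exp_L2[OF g] and S = chaos_exp_sym[OF f] chaos_exp_sym[OF g]
  show "(\<lambda>w. a * f w + b * g w) \<in> L2 \<mu>" by (rule L2_lincomb[OF L])
  show sk: "(\<lambda>l. a * k n l + b * k' n l) \<in> sym_tensor n" for n by (rule sym_tensor_lincomb[OF S])
  fix n and l :: "'h list" assume l: "l \<in> basis_words n"
  then have lb: "set l \<subseteq> hilbert_basis" by (simp add: basis_words_def)
  have "(LINT w|\<mu>. (a * f w + b * g w) * H l w) = (LINT w|\<mu>. a * (f w * H l w) + b * (g w * H l w))"
    by (simp add: algebra_simps)
  also have "\<dots> = a * (LINT w|\<mu>. f w * H l w) + b * (LINT w|\<mu>. g w * H l w)"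
    using L2_mult_integrable[OF L(1) L2_H[OF lb]] L2_mult_integrable[OF L(2) L2_H[OF lb]] by simp
  finally show "(LINT w|\<mu>. (a * f w + b * g w) * H l w) = fact n * (a * k n l + b * k' n l)"
    using chaos_exp_coeff[OF f l] chaos_exp_coeff[OF g l] by (simp add: algebra_simps)
next
  note L = chaos_exp_L2[OF f] chaos_exp_L2[OF g] and S = chaos_exp_sym[OF f] chaos_exp_sym[OF g]
  have "tensor_inner n (\<lambda>l. a * k n l + b * k' n l) (\<lambda>l. a * k n l + b * k' n l)
      = a\<^sup>2 * tensor_inner n (k n) (k n) + b\<^sup>2 * tensor_inner n (k' n) (k' n) + 2 * a * b * tensor_inner n (k n) (k' n)" for n
    unfolding tensor_inner_lincomb_left[OF S sym_tensor_lincomb[OF S]]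
      tensor_inner_commute[of n _ "\<lambda>l. a * k n l + b * k' n l"]
      tensor_inner_lincomb_left[OF S S(1)] tensor_inner_lincomb_left[OF S S(2)]
    by (simp add: tensor_inner_commute[of n "k' n" "k n"] power2_eq_square algebra_simps)
  moreover have "(\<lambda>n. a\<^sup>2 * (fact n * tensor_inner n (k n) (k n)) + b\<^sup>2 * (fact n * tensor_inner n (k' n) (k' n))
      + 2 * a * b * (fact n * tensor_inner n (k n) (k' n))) sums (a\<^sup>2 * (n2 \<mu> f)\<^sup>2 + b\<^sup>2 * (n2 \<mu> g)\<^sup>2 + 2 * a * b * (LINT w|\<mu>. f w * g w))"
    by (intro sums_add sums_mult chaos_exp_n2 chaos_exp_parseval f g)
  ultimately show "(\<lambda>n. fact n * tensor_inner n (\<lambda>l. a * k n l + b * k' n l) (\<lambda>l. a * k n l + b * k' n l))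
      sums (n2 \<mu> (\<lambda>w. a * f w + b * g w))\<^sup>2"
    unfolding n2_power2_lincomb[OF L] by (simp add: algebra_simps)
qed

lemma chaos_exp_zero: "chaos_exp (\<lambda>w. 0) (\<lambda>n l. 0)"
proof (rule chaos_expI)
  show "(\<lambda>l. 0) \<in> sym_tensor n" for n by (simp add: sym_tensor_def)
qed (auto simp: L2_zero tensor_inner_def)

text \<open>The n-th tensor power of h with the scalar found by testing the cosine against Hermite
  functions; the phase n pi / 2 encodes the n-th derivative of the cosine at a.\<close>

definition cos_kernel :: "'h \<Rightarrow> real \<Rightarrow> 'h chaos"
  where "cos_kernel h a n l = (if length l = n then
    exp (- (norm h)\<^sup>2 / 2) * cos (a + real n * (pi / 2)) / fact n * (\<Prod>x\<leftarrow>l. inner x h) else 0)"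

lemma prod_list_update:
  fixes f :: "'a \<Rightarrow> real"
  assumes "i < length l"
  shows "(\<Prod>x\<leftarrow>l[i := y]. f x) = f y * (\<Prod>x\<leftarrow>take i l @ drop (Suc i) l. f x)"
  using assms by (simp add: upd_conv_take_nth_drop mult_ac)

lemma tensor_prod_replicate:
  fixes h :: 'h
  assumes "length l = n" shows "tensor_prod (replicate n h) l = (\<Prod>x\<leftarrow>l. inner x h)"
  using assms
proof (induction l arbitrary: n)
  case (Cons b l)
  then show ?case by (cases n) (auto simp: tensor_prod_Cons inner_commute)
qed (simp add: tensor_prod_def)

lemma has_sum_prod_inner:
  fixes h :: 'h
  shows "((\<lambda>l. (\<Prod>x\<leftarrow>l. inner x h)\<^sup>2) has_sum (norm h) ^ (2 * n)) (basis_words n)"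
proof -
  have "((\<lambda>w. (tensor_prod (replicate n h) w)\<^sup>2) has_sum (\<Prod>i<n. (norm (replicate n h ! i))\<^sup>2)) (basis_words n)"
    using has_sum_tensor_prod_power2[of "replicate n h"] by simp
  moreover have "(\<Prod>i<n. (norm (replicate n h ! i))\<^sup>2) = (norm h) ^ (2 * n)"
    by (simp add: power_mult)
  ultimately have "((\<lambda>w. (tensor_prod (replicate n h) w)\<^sup>2) has_sum (norm h) ^ (2 * n)) (basis_words n)" by simp
  then show ?thesis
    by (rule has_sum_cong[THEN iffD1, rotated]) (simp add: tensor_prod_replicate basis_words_def)
qed

lemma cos_kernel_sym_tensor: "cos_kernel h a n \<in> sym_tensor n"
  unfolding sym_tensor_def
proof (intro CollectI conjI allI impI)
  show "cos_kernel h a n l = 0" if "length l \<noteq> n" for l using that by (simp add: cos_kernel_def)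
next
  fix l :: "'h list" and i assume l: "length l = n" "i < n"
  then have "(\<lambda>x. cos_kernel h a n (l[i := x])) = (\<lambda>x. (exp (- (norm h)\<^sup>2 / 2) * cos (a + real n * (pi / 2)) / fact n
      * (\<Prod>x\<leftarrow>take i l @ drop (Suc i) l. inner x h)) * inner x h)"
    by (auto simp: cos_kernel_def prod_list_update)
  then show "bounded_linear (\<lambda>x. cos_kernel h a n (l[i := x]))"
    by (simp only:) (intro bounded_linear_const_mult bounded_linear_inner_left)
next
  fix l l' :: "'h list" assume m: "mset l = mset l'"
  have "(\<Prod>x\<leftarrow>l. inner x h) = prod_mset (image_mset (\<lambda>x. inner x h) (mset l))"
    by (simp flip: prod_mset_prod_list)
  also have "\<dots> = (\<Prod>x\<leftarrow>l'. inner x h)" unfolding m by (simp flip: prod_mset_prod_list)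
  finally show "cos_kernel h a n l = cos_kernel h a n l'" using mset_eq_length[OF m] by (simp add: cos_kernel_def)
next
  have "(\<lambda>l. (exp (- (norm h)\<^sup>2 / 2) * cos (a + real n * (pi / 2)) / fact n)\<^sup>2 * (\<Prod>x\<leftarrow>l. inner x h)\<^sup>2) summable_on basis_words n"
    using has_sum_prod_inner[of h n] by (intro summable_on_cmult_right) (auto simp: summable_on_def)
  then show "(\<lambda>l. (cos_kernel h a n l)\<^sup>2) summable_on basis_words n"
    by (rule summable_on_cong[THEN iffD1, rotated]) (auto simp: cos_kernel_def basis_words_def power_mult_distrib power_divide)
qed

lemma tensor_inner_cos_kernel:
  "tensor_inner n (cos_kernel h a n) (cos_kernel h a n) = (exp (- (norm h)\<^sup>2 / 2) * cos (a + real n * (pi / 2)) / fact n)\<^sup>2 * (norm h) ^ (2 * n)"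
proof -
  have "tensor_inner n (cos_kernel h a n) (cos_kernel h a n)
      = infsum (\<lambda>l. (exp (- (norm h)\<^sup>2 / 2) * cos (a + real n * (pi / 2)) / fact n)\<^sup>2 * (\<Prod>x\<leftarrow>l. inner x h)\<^sup>2) (basis_words n)"
    unfolding tensor_inner_def
    by (intro infsum_cong) (simp add: cos_kernel_def basis_words_def power2_eq_square mult_ac)
  then show ?thesis using infsumI[OF has_sum_prod_inner[of h n]] by (simp add: infsum_cmult_right')
qed

text \<open>Verified through Parseval: with x = |h|^2, the half-angle formula splits the norm series
  into two exponential series, at x and at - x, and their sum agrees with the integral of the
  squared cosine.\<close>

lemma chaos_exp_cos: "chaos_exp (\<lambda>w. cos (Z w h + a)) (cos_kernel h a)"
proof (rule chaos_expI)
  show L: "(\<lambda>w. cos (Z w h + a)) \<in> L2 \<mu>" by (intro all_moments_L2 all_moments_cos)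
  show "cos_kernel h a n \<in> sym_tensor n" for n by (rule cos_kernel_sym_tensor)
  show "(LINT w|\<mu>. cos (Z w h + a) * H l w) = fact n * cos_kernel h a n l" if "l \<in> basis_words n" for n l
    using integral_H_cos[of l h a] that by (simp add: cos_kernel_def basis_words_def mult.commute)
  have "(n2 \<mu> (\<lambda>w. cos (Z w h + a)))\<^sup>2 = (LINT w|\<mu>. 1 / 2 + 1 / 2 * cos (Z w (2 *\<^sub>R h) + 2 * a))"
    unfolding n2_power2
  proof (intro Bochner_Integration.integral_cong refl)
    fix w
    have "cos (Z w (2 *\<^sub>R h) + 2 * a) = cos (2 * (Z w h + a))" by (simp add: Z_scale algebra_simps)
    also have "\<dots> = 2 * (cos (Z w h + a))\<^sup>2 - 1" by (rule cos_double_cos)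
    finally show "(cos (Z w h + a))\<^sup>2 = 1 / 2 + 1 / 2 * cos (Z w (2 *\<^sub>R h) + 2 * a)" by (simp add: field_simps)
  qed
  also have "\<dots> = 1 / 2 + 1 / 2 * (exp (- (2 * (norm h)\<^sup>2)) * cos (2 * a))"
    using integral_cos_Z[of "2 *\<^sub>R h" "2 * a"] all_moments_integrable[OF all_moments_cos[of "2 *\<^sub>R h" "2 * a"]]
    by (simp add: prob_space power_mult_distrib)
  finally have n2: "(n2 \<mu> (\<lambda>w. cos (Z w h + a)))\<^sup>2 = 1 / 2 + 1 / 2 * (exp (- (2 * (norm h)\<^sup>2)) * cos (2 * a))" .
  define x where "x = (norm h)\<^sup>2"
  have trm: "fact n * tensor_inner n (cos_kernel h a n) (cos_kernel h a n)
      = exp (- x) / 2 * (x ^ n /\<^sub>R fact n) + exp (- x) * cos (2 * a) / 2 * ((- x) ^ n /\<^sub>R fact n)" for n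
  proof -
    have "cos (2 * (a + real n * (pi / 2))) = cos (2 * a + real n * pi)" by (simp add: algebra_simps)
    also have "\<dots> = (- 1) ^ n * cos (2 * a)" by (simp add: cos_add mult.commute)
    finally have c: "(cos (a + real n * (pi / 2)))\<^sup>2 = (1 + (- 1) ^ n * cos (2 * a)) / 2"
      using cos_double_cos[of "a + real n * (pi / 2)"] by simp
    have ex: "(exp (- x / 2))\<^sup>2 = exp (- x)" by (simp add: exp_double[symmetric])
    have "fact n * tensor_inner n (cos_kernel h a n) (cos_kernel h a n)
        = (exp (- x / 2))\<^sup>2 * (cos (a + real n * (pi / 2)))\<^sup>2 * x ^ n / fact n"
      unfolding tensor_inner_cos_kernel x_def by (simp add: power_mult_distrib power_divide power2_eq_square[of "fact n"] power_mult)
    also have "\<dots> = exp (- x) / 2 * (x ^ n /\<^sub>R fact n) + exp (- x) * cos (2 * a) / 2 * ((- x) ^ n /\<^sub>R fact n)"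
      unfolding ex c by (simp add: field_simps power_minus[of x])
    finally show ?thesis .
  qed
  have "(\<lambda>n. exp (- x) / 2 * (x ^ n /\<^sub>R fact n) + exp (- x) * cos (2 * a) / 2 * ((- x) ^ n /\<^sub>R fact n))
      sums (exp (- x) / 2 * exp x + exp (- x) * cos (2 * a) / 2 * exp (- x))"
    by (intro sums_add sums_mult exp_converges)
  moreover have "exp (- x) / 2 * exp x + exp (- x) * cos (2 * a) / 2 * exp (- x) = 1 / 2 + 1 / 2 * (exp (- (2 * x)) * cos (2 * a))"
  proof -
    have "exp (x * 2) = exp x * exp x" by (simp add: exp_add[symmetric])
    then show ?thesis by (simp add: exp_minus field_simps)
  qed
  ultimately show "(\<lambda>n. fact n * tensor_inner n (cos_kernel h a n) (cos_kernel h a n)) sums (n2 \<mu> (\<lambda>w. cos (Z w h + a)))\<^sup>2"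
    unfolding n2 trm by (simp add: x_def)
qed

end

section \<open>The two-point hypercontractive inequality and its tensorization\<close>

text \<open>The difference of the two sides and its derivative vanish at 0. Its second derivative is
  nonnegative by the inequality of arithmetic and geometric means, since the product of (1 +
  t)^(p-2) and (1 - t)^(p-2) is (1 - t^2)^(p-2), which is at least 1 for p \<le> 2.\<close>

lemma powr_two_point_lower:
  fixes p x :: real
  assumes p: "1 < p" "p \<le> 2" and x: "0 \<le> x" "x < 1"
  shows "2 + p * (p - 1) * x\<^sup>2 \<le> (1 + x) powr p + (1 - x) powr p"
proof -
  define g where "g t = (1 + t) powr p + (1 - t) powr p - 2 - p * (p - 1) * t\<^sup>2" for t :: real
  define g' where "g' t = p * (1 + t) powr (p - 1) - p * (1 - t) powr (p - 1) - 2 * p * (p - 1) * t" for t :: real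
  have dp: "((\<lambda>t. (1 + t) powr q) has_real_derivative q * (1 + t) powr (q - 1)) (at t)"
      "((\<lambda>t. (1 - t) powr q) has_real_derivative - q * (1 - t) powr (q - 1)) (at t)" if "0 \<le> t" "t < 1" for q t :: real
    using that DERIV_fun_powr[of "\<lambda>t. 1 + t" 1 t q] DERIV_fun_powr[of "\<lambda>t. 1 - t" "-1" t q]
    by (auto intro!: derivative_eq_intros)
  have g': "(g has_real_derivative g' t) (at t)" if "0 \<le> t" "t < 1" for t
    unfolding g_def[abs_def] g'_def
    by (rule derivative_eq_intros dp[OF that] refl | simp)+
  have g'': "(g' has_real_derivative p * (p - 1) * ((1 + t) powr (p - 2) + (1 - t) powr (p - 2) - 2)) (at t)"
    if "0 \<le> t" "t < 1" for t
    unfolding g'_def[abs_def]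
    by (rule derivative_eq_intros dp[OF that] refl | simp add: algebra_simps)+
  have pos: "0 \<le> p * (p - 1) * ((1 + t) powr (p - 2) + (1 - t) powr (p - 2) - 2)" if t: "0 \<le> t" "t < 1" for t
  proof -
    define a where "a = (1 + t) powr ((p - 2) / 2)"
    define b where "b = (1 - t) powr ((p - 2) / 2)"
    have "(1 + t) powr (p - 2) = a\<^sup>2" "(1 - t) powr (p - 2) = b\<^sup>2"
      using t by (auto simp: a_def b_def power2_eq_square powr_add[symmetric])
    moreover have "2 * (a * b) \<le> a\<^sup>2 + b\<^sup>2" using sum_squares_bound[of a b] by simp
    moreover have "1 \<le> a * b"
    proof -
      have ab: "a * b = (1 - t\<^sup>2) powr ((p - 2) / 2)"
        using t unfolding a_def b_def by (subst powr_mult[symmetric]) (auto simp: power2_eq_square algebra_simps)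
      have "t\<^sup>2 < 1" using t by (simp add: power_less_one_iff abs_square_less_1)
      then have "(1::real) powr ((p - 2) / 2) \<le> (1 - t\<^sup>2) powr ((p - 2) / 2)"
        using p by (intro powr_mono2') auto
      then show ?thesis using ab by simp
    qed
    ultimately show ?thesis using p by (intro mult_nonneg_nonneg) auto
  qed
  have mono': "0 \<le> g' t" if "0 \<le> t" "t < 1" for t
  proof -
    have "g' 0 \<le> g' t"
      by (rule DERIV_nonneg_imp_nondecreasing[OF that(1)]) (use g'' pos that in fastforce)
    then show ?thesis by (simp add: g'_def)
  qed
  have "g 0 \<le> g x"
    by (rule DERIV_nonneg_imp_nondecreasing[OF x(1)]) (use g' mono' x in fastforce)
  then show ?thesis by (simp add: g_def)
qed

text \<open>Evenness covers negative x, and a left limit covers the endpoint 1, where the derivative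
  formulas break down.\<close>

lemma powr_two_point_lower':
  fixes p x :: real
  assumes p: "1 < p" "p \<le> 2" and x: "\<bar>x\<bar> \<le> 1"
  shows "2 + p * (p - 1) * x\<^sup>2 \<le> (1 + x) powr p + (1 - x) powr p"
proof -
  have lt: "2 + p * (p - 1) * y\<^sup>2 \<le> (1 + y) powr p + (1 - y) powr p" if "\<bar>y\<bar> < 1" for y
    using powr_two_point_lower[OF p, of "\<bar>y\<bar>"] that by (cases "0 \<le> y") auto
  have one: "2 + p * (p - 1) * 1\<^sup>2 \<le> (1 + 1) powr p + (1 - 1) powr p"
  proof (rule tendsto_le[of "at_left (1::real)" "\<lambda>y. (1 + y) powr p + (1 - y) powr p" _ "\<lambda>y. 2 + p * (p - 1) * y\<^sup>2"])
    show "((\<lambda>y. (1 + y) powr p + (1 - y) powr p) \<longlongrightarrow> (1 + 1) powr p + (1 - 1) powr p) (at_left (1::real))"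
    proof (intro tendsto_add tendsto_powr' tendsto_intros)
      show "(1::real) - 1 \<noteq> 0 \<or> 0 < p \<and> (\<forall>\<^sub>F y in at_left (1::real). 0 \<le> 1 - y)"
        using p by (auto simp: eventually_at_filter)
    qed auto
    show "((\<lambda>y. 2 + p * (p - 1) * y\<^sup>2) \<longlongrightarrow> 2 + p * (p - 1) * 1\<^sup>2) (at_left (1::real))"
      by (intro tendsto_intros)
    show "\<forall>\<^sub>F y in at_left (1::real). 2 + p * (p - 1) * y\<^sup>2 \<le> (1 + y) powr p + (1 - y) powr p"
      by (rule eventually_mono[OF eventually_at_left_real[of 0 1]]) (auto intro!: lt)
  qed simp
  consider "\<bar>x\<bar> < 1" | "x = 1" | "x = -1" using x by linarith
  then show ?thesis using lt one by cases auto
qed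

lemma powr_le_one_plus:
  fixes a y :: real
  assumes "0 \<le> a" "a \<le> 1" "0 \<le> y"
  shows "(1 + y) powr a \<le> 1 + a * y"
  using Youngs_inequality_0[of a "1 - a" "1 + y" 1] assms by (simp add: algebra_simps)

text \<open>Hypercontractivity from L^p to L^2 on two points, for the function with values m + d and
  m - d. After scaling to m = 1, Bernoulli's inequality with exponent p / 2 \<le> 1 on the left
  meets the quadratic lower bound on the right.\<close>

lemma two_point_norm_le:
  fixes m d p :: real
  assumes p: "1 < p" "p \<le> 2" and d: "\<bar>d\<bar> \<le> m"
  shows "sqrt (m\<^sup>2 + (p - 1) * d\<^sup>2) \<le> (((m + d) powr p + (m - d) powr p) / 2) powr (1 / p)"
proof (cases "m = 0")
  case False
  with d have m: "0 < m" by linarith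
  define x where "x = d / m"
  have x: "\<bar>x\<bar> \<le> 1" using d m by (simp add: x_def)
  have dx: "d = m * x" using m by (simp add: x_def)
  have "(1 + (p - 1) * x\<^sup>2) powr (p / 2) \<le> 1 + p / 2 * ((p - 1) * x\<^sup>2)"
    using p by (intro powr_le_one_plus) auto
  also have "\<dots> \<le> ((1 + x) powr p + (1 - x) powr p) / 2"
    using powr_two_point_lower'[OF p x] by (simp add: field_simps)
  finally have le: "(1 + (p - 1) * x\<^sup>2) powr (p / 2) \<le> ((1 + x) powr p + (1 - x) powr p) / 2" .
  have pos: "0 < 1 + (p - 1) * x\<^sup>2" using p by (simp add: add_pos_nonneg)
  have "sqrt (m\<^sup>2 + (p - 1) * d\<^sup>2) = m * sqrt (1 + (p - 1) * x\<^sup>2)"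
  proof -
    have "m\<^sup>2 + (p - 1) * d\<^sup>2 = m\<^sup>2 * (1 + (p - 1) * x\<^sup>2)" by (simp add: dx power_mult_distrib algebra_simps)
    then show ?thesis using m by (simp add: real_sqrt_mult)
  qed
  also have "sqrt (1 + (p - 1) * x\<^sup>2) = ((1 + (p - 1) * x\<^sup>2) powr (p / 2)) powr (1 / p)"
    using p pos by (simp add: powr_powr powr_half_sqrt)
  also have "m * \<dots> \<le> m * ((((1 + x) powr p + (1 - x) powr p) / 2) powr (1 / p))"
    using m p le by (intro mult_left_mono powr_mono2) auto
  also have "\<dots> = (m powr p * (((1 + x) powr p + (1 - x) powr p) / 2)) powr (1 / p)"
    by (subst powr_mult) (use m p in \<open>auto simp: powr_powr\<close>)
  also have "m powr p * (((1 + x) powr p + (1 - x) powr p) / 2) = ((m + d) powr p + (m - d) powr p) / 2"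
  proof -
    have "m + d = m * (1 + x)" "m - d = m * (1 - x)" by (simp_all add: dx algebra_simps)
    then have "(m + d) powr p = m powr p * (1 + x) powr p" "(m - d) powr p = m powr p * (1 - x) powr p"
      using m x by (simp_all only: powr_mult)
    then show ?thesis by (simp add: algebra_simps)
  qed
  finally show ?thesis .
qed (use d in auto)

text \<open>In terms of the means m, m' and the half differences e, e' the left side is m m' + r e
  e'. Cauchy-Schwarz with weight p - 1 on the second component separates the two functions.\<close>

lemma two_point_inequality:
  fixes a b c d p r :: real
  assumes p: "1 < p" "p \<le> 2" and r: "0 \<le> r" "r \<le> p - 1" and nn: "0 \<le> a" "0 \<le> b" "0 \<le> c" "0 \<le> d"
  shows "(1 + r) / 4 * (a * c + b * d) + (1 - r) / 4 * (a * d + b * c)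
    \<le> ((a powr p + b powr p) / 2) powr (1 / p) * ((c powr p + d powr p) / 2) powr (1 / p)"
proof -
  define m e where "m = (a + b) / 2" and "e = (a - b) / 2"
  define m' e' where "m' = (c + d) / 2" and "e' = (c - d) / 2"
  have ab: "a = m + e" "b = m - e" "c = m' + e'" "d = m' - e'"
    by (simp_all add: m_def e_def m'_def e'_def field_simps)
  have e: "\<bar>e\<bar> \<le> m" "\<bar>e'\<bar> \<le> m'" using nn by (auto simp: m_def e_def m'_def e'_def)
  have "(1 + r) / 4 * (a * c + b * d) + (1 - r) / 4 * (a * d + b * c) = m * m' + r * (e * e')"
    unfolding ab by (simp add: field_simps)
  also have "r * (e * e') \<le> (p - 1) * (\<bar>e\<bar> * \<bar>e'\<bar>)"
  proof -
    have "r * (e * e') \<le> r * (\<bar>e\<bar> * \<bar>e'\<bar>)" using r by (intro mult_left_mono) (auto simp: abs_mult[symmetric])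
    also have "\<dots> \<le> (p - 1) * (\<bar>e\<bar> * \<bar>e'\<bar>)" using r by (intro mult_right_mono) auto
    finally show ?thesis .
  qed
  also have "m * m' + (p - 1) * (\<bar>e\<bar> * \<bar>e'\<bar>) \<le> sqrt (m\<^sup>2 + (p - 1) * e\<^sup>2) * sqrt (m'\<^sup>2 + (p - 1) * e'\<^sup>2)"
  proof -
    define q where "q = sqrt (p - 1)"
    have q: "q\<^sup>2 = p - 1" "0 \<le> q" using p by (auto simp: q_def)
    have "(m * m' + q\<^sup>2 * (\<bar>e\<bar> * \<bar>e'\<bar>))\<^sup>2 \<le> (m\<^sup>2 + q\<^sup>2 * e\<^sup>2) * (m'\<^sup>2 + q\<^sup>2 * e'\<^sup>2)"
    proof -
      have "(m\<^sup>2 + q\<^sup>2 * e\<^sup>2) * (m'\<^sup>2 + q\<^sup>2 * e'\<^sup>2) - (m * m' + q\<^sup>2 * (\<bar>e\<bar> * \<bar>e'\<bar>))\<^sup>2 = q\<^sup>2 * (m * \<bar>e'\<bar> - m' * \<bar>e\<bar>)\<^sup>2"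
        by (simp add: power2_diff power_mult_distrib power2_sum) (simp add: power2_eq_square power4_eq_xxxx algebra_simps)
      moreover have "0 \<le> q\<^sup>2 * (m * \<bar>e'\<bar> - m' * \<bar>e\<bar>)\<^sup>2" by simp
      ultimately show ?thesis by linarith
    qed
    then have "\<bar>m * m' + q\<^sup>2 * (\<bar>e\<bar> * \<bar>e'\<bar>)\<bar> \<le> sqrt ((m\<^sup>2 + q\<^sup>2 * e\<^sup>2) * (m'\<^sup>2 + q\<^sup>2 * e'\<^sup>2))"
      by (metis real_sqrt_abs real_sqrt_le_mono)
    then show ?thesis by (simp add: q real_sqrt_mult)
  qed
  also have "\<dots> \<le> (((m + e) powr p + (m - e) powr p) / 2) powr (1 / p) * (((m' + e') powr p + (m' - e') powr p) / 2) powr (1 / p)"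
    using p e by (intro mult_mono two_point_norm_le) auto
  finally show ?thesis unfolding ab by simp
qed

section \<open>Tensorization over the discrete cube\<close>

fun cube_mean :: "nat \<Rightarrow> (bool list \<Rightarrow> real) \<Rightarrow> real" where
  "cube_mean 0 F = F []"
| "cube_mean (Suc n) F = (cube_mean n (\<lambda>l. F (True # l)) + cube_mean n (\<lambda>l. F (False # l))) / 2"

text \<open>The mean over two uniformly distributed points of the cube whose coordinates have correlation r.\<close>

fun cube_corr :: "real \<Rightarrow> nat \<Rightarrow> (bool list \<Rightarrow> bool list \<Rightarrow> real) \<Rightarrow> real" where
  "cube_corr r 0 F = F [] []"
| "cube_corr r (Suc n) F =
    (1 + r) / 4 * (cube_corr r n (\<lambda>l m. F (True # l) (True # m)) + cube_corr r n (\<lambda>l m. F (False # l) (False # m))) +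
    (1 - r) / 4 * (cube_corr r n (\<lambda>l m. F (True # l) (False # m)) + cube_corr r n (\<lambda>l m. F (False # l) (True # m)))"

lemma cube_mean_nonneg: "(\<And>l. 0 \<le> F l) \<Longrightarrow> 0 \<le> cube_mean n F"
  by (induction n arbitrary: F) auto

lemma cube_mean_mono: "(\<And>l. F l \<le> G l) \<Longrightarrow> cube_mean n F \<le> cube_mean n G"
proof (induction n arbitrary: F G)
  case (Suc n)
  show ?case using Suc.IH[of "\<lambda>l. F (True # l)" "\<lambda>l. G (True # l)"] Suc.IH[of "\<lambda>l. F (False # l)" "\<lambda>l. G (False # l)"] Suc.prems
    by simp
qed simp

lemma cube_mean_lincomb: "cube_mean n (\<lambda>l. a * F l + b * G l) = a * cube_mean n F + b * cube_mean n G"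
  by (induction n arbitrary: F G) (auto simp: field_simps)

lemma cube_mean_const: "cube_mean n (\<lambda>l. c) = c"
  by (induction n) auto

lemma cube_corr_mono:
  assumes "0 \<le> r" "r \<le> 1" shows "(\<And>l m. F l m \<le> G l m) \<Longrightarrow> cube_corr r n F \<le> cube_corr r n G"
proof (induction n arbitrary: F G)
  case (Suc n)
  show ?case unfolding cube_corr.simps
    by (intro add_mono mult_left_mono Suc.IH Suc.prems) (use assms in auto)
qed simp

lemma cube_corr_lincomb: "cube_corr r n (\<lambda>l m. a * F l m + b * G l m) = a * cube_corr r n F + b * cube_corr r n G"
proof (induction n arbitrary: F G)
  case (Suc n)
  show ?case unfolding cube_corr.simps Suc.IH by (simp add: algebra_simps)
qed simp

text \<open>The bilinear form makes the induction immediate: conditioned on the first coordinates,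
  correlations of the slices are bounded by products of their p-norms N, and these norms are
  functions on two points, to which the two-point inequality applies.\<close>

lemma cube_hypercontractive:
  fixes F G :: "bool list \<Rightarrow> real"
  assumes p: "1 < p" "p \<le> 2" and r: "0 \<le> r" "r \<le> p - 1"
  shows "(\<And>l. 0 \<le> F l) \<Longrightarrow> (\<And>l. 0 \<le> G l) \<Longrightarrow> cube_corr r n (\<lambda>l m. F l * G m)
    \<le> (cube_mean n (\<lambda>l. F l powr p)) powr (1 / p) * (cube_mean n (\<lambda>l. G l powr p)) powr (1 / p)"
proof (induction n arbitrary: F G)
  case 0
  then show ?case using p by (simp add: powr_powr)
next
  case (Suc n)
  define N where "N b F = (cube_mean n (\<lambda>l. F (b # l) powr p)) powr (1 / p)" for b and F :: "bool list \<Rightarrow> real"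
  have IH: "cube_corr r n (\<lambda>l m. F (b # l) * G (c # m)) \<le> N b F * N c G" for b c
    unfolding N_def by (rule Suc.IH) (use Suc.prems in auto)
  have Np: "N b F powr p = cube_mean n (\<lambda>l. F (b # l) powr p)" for b and F :: "bool list \<Rightarrow> real"
    using p cube_mean_nonneg[of "\<lambda>l. F (b # l) powr p" n] by (simp add: N_def powr_powr)
  have "cube_corr r (Suc n) (\<lambda>l m. F l * G m) \<le> (1 + r) / 4 * (N True F * N True G + N False F * N False G)
      + (1 - r) / 4 * (N True F * N False G + N False F * N True G)"
    unfolding cube_corr.simps using r p by (intro add_mono mult_left_mono IH) auto
  also have "\<dots> \<le> ((N True F powr p + N False F powr p) / 2) powr (1 / p) * ((N True G powr p + N False G powr p) / 2) powr (1 / p)"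
    by (rule two_point_inequality[OF p r]) (simp_all add: N_def)
  finally show ?case by (simp add: Np)
qed

lemma cube_hypercontractive_abs:
  fixes F G :: "bool list \<Rightarrow> real"
  assumes p: "1 < p" "p \<le> 2" and r: "0 \<le> r" "r \<le> p - 1"
  shows "cube_corr r n (\<lambda>l m. F l * G m)
    \<le> (cube_mean n (\<lambda>l. \<bar>F l\<bar> powr p)) powr (1 / p) * (cube_mean n (\<lambda>l. \<bar>G l\<bar> powr p)) powr (1 / p)"
proof -
  have "cube_corr r n (\<lambda>l m. F l * G m) \<le> cube_corr r n (\<lambda>l m. \<bar>F l\<bar> * \<bar>G m\<bar>)"
    by (rule cube_corr_mono) (use p r in \<open>auto simp: abs_mult[symmetric]\<close>)
  also have "\<dots> \<le> (cube_mean n (\<lambda>l. \<bar>F l\<bar> powr p)) powr (1 / p) * (cube_mean n (\<lambda>l. \<bar>G l\<bar> powr p)) powr (1 / p)"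
    by (rule cube_hypercontractive[OF p r]) auto
  finally show ?thesis .
qed

section \<open>Trigonometric polynomials\<close>

text \<open>A list of triples (c, a, h) encodes the function \<open>\<phi> \<mapsto> \<Sum> c cos (\<phi> h + a)\<close> of a linear
  functional on H. It is evaluated both at the Gaussian functional \<open>Z w\<close> and at functionals
  coming from points of the discrete cube.\<close>

type_synonym 'h trig = "(real \<times> real \<times> 'h) list"

definition tev :: "'h trig \<Rightarrow> ('h \<Rightarrow> real) \<Rightarrow> real"
  where "tev D \<phi> = (\<Sum>(c, a, h)\<leftarrow>D. c * cos (\<phi> h + a))"

text \<open>The product-to-sum formula for cosines.\<close>

definition tmult :: "'h::real_vector trig \<Rightarrow> 'h trig \<Rightarrow> 'h trig"
  where "tmult D E = concat (map (\<lambda>(c, a, h). concat (map (\<lambda>(d, b, k).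
    [(c * d / 2, a + b, h + k), (c * d / 2, a - b, h - k)]) E)) D)"

definition tscale :: "real \<Rightarrow> 'h trig \<Rightarrow> 'h trig"
  where "tscale r D = map (\<lambda>(c, a, h). (r * c, a, h)) D"

definition tmean :: "'h::real_normed_vector trig \<Rightarrow> real"
  where "tmean D = (\<Sum>(c, a, h)\<leftarrow>D. c * (exp (- (norm h)\<^sup>2 / 2) * cos a))"

text \<open>The expectation of the product of two trigonometric polynomials evaluated at standard
  Gaussian functionals with correlation r.\<close>

definition tcorr :: "real \<Rightarrow> 'h::real_inner trig \<Rightarrow> 'h trig \<Rightarrow> real"
  where "tcorr r D E = (\<Sum>(c, a, h)\<leftarrow>D. \<Sum>(d, b, k)\<leftarrow>E. c * d / 2 *
    (exp (- ((norm h)\<^sup>2 + (norm k)\<^sup>2) / 2 - r * inner h k) * cos (a + b) +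
     exp (- ((norm h)\<^sup>2 + (norm k)\<^sup>2) / 2 + r * inner h k) * cos (a - b)))"

lemma tev_Nil [simp]: "tev [] \<phi> = 0" by (simp add: tev_def)
lemma tev_Cons [simp]: "tev ((c, a, h) # D) \<phi> = c * cos (\<phi> h + a) + tev D \<phi>" by (simp add: tev_def)
lemma tev_append [simp]: "tev (D @ E) \<phi> = tev D \<phi> + tev E \<phi>" by (simp add: tev_def)

lemma tev_tscale [simp]: "tev (tscale r D) \<phi> = r * tev D \<phi>"
  by (induction D) (auto simp: tscale_def algebra_simps)

lemma tev_const: "linear \<phi> \<Longrightarrow> tev [(r, 0, 0)] \<phi> = r"
  by (simp add: linear_0)

lemma tmult_Nil [simp]: "tmult [] E = []" by (simp add: tmult_def)
lemma tmult_Cons: "tmult ((c, a, h) # D) E = concat (map (\<lambda>(d, b, k).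
    [(c * d / 2, a + b, h + k), (c * d / 2, a - b, h - k)]) E) @ tmult D E"
  by (simp add: tmult_def)

lemma tev_tmult:
  assumes "linear \<phi>" shows "tev (tmult D E) \<phi> = tev D \<phi> * tev E \<phi>"
proof (induction D)
  case (Cons x D)
  obtain c a h where x: "x = (c, a, h)" by (cases x)
  have "tev (concat (map (\<lambda>(d, b, k). [(c * d / 2, a + b, h + k), (c * d / 2, a - b, h - k)]) E)) \<phi> = c * cos (\<phi> h + a) * tev E \<phi>"
  proof (induction E)
    case (Cons y E)
    obtain d b k where y: "y = (d, b, k)" by (cases y)
    have "\<phi> (h + k) + (a + b) = (\<phi> h + a) + (\<phi> k + b)" "\<phi> (h - k) + (a - b) = (\<phi> h + a) - (\<phi> k + b)"
      using assms by (simp_all add: linear_add linear_diff)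
    then have "c * d / 2 * cos (\<phi> (h + k) + (a + b)) + c * d / 2 * cos (\<phi> (h - k) + (a - b))
        = c * cos (\<phi> h + a) * (d * cos (\<phi> k + b))"
      by (simp only: cos_add[of "\<phi> h + a"] cos_diff[of "\<phi> h + a"]) (simp add: algebra_simps)
    then show ?case using Cons by (simp add: y distrib_left add.assoc[symmetric])
  qed simp
  then show ?case using Cons by (simp add: x tmult_Cons algebra_simps)
qed simp

text \<open>Sums and products stay in the class. The identity holds at every linear functional at
  once, so E can be used both on the cube and on the Wiener space; its frequencies stay in the span,
  so one orthonormal list serves for D and E.\<close>

lemma trig_polynomial:
  fixes g :: "real \<Rightarrow> real" and D :: "'h::real_vector trig"
  assumes "real_polynomial_function g"
  shows "\<exists>E. set (map (snd \<circ> snd) E) \<subseteq> span (set (map (snd \<circ> snd) D)) \<and> (\<forall>\<phi>. linear \<phi> \<longrightarrow> tev E \<phi> = g (tev D \<phi>))"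
  using assms
proof (induction rule: real_polynomial_function.induct)
  case (linear f)
  have lin: "f 1 * x = f x" for x
    using linear_scale[OF bounded_linear.linear[OF linear.hyps], of x 1] by simp
  have "set (map (snd \<circ> snd) (tscale (f 1) D)) = set (map (snd \<circ> snd) D)"
    by (auto simp: tscale_def image_iff split: prod.split) force+
  then show ?case
    by (intro exI[of _ "tscale (f 1) D"]) (simp only: tev_tscale lin simp_thms span_superset)
next
  case (const c)
  show ?case by (intro exI[of _ "[(c, 0, 0)]"]) (auto simp: linear_0 span_zero)
next
  case (add f g)
  obtain E where E: "set (map (snd \<circ> snd) E) \<subseteq> span (set (map (snd \<circ> snd) D))" "\<forall>\<phi>. linear \<phi> \<longrightarrow> tev E \<phi> = f (tev D \<phi>)"
    using add.IH(1) by (elim exE conjE)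
  obtain F where F: "set (map (snd \<circ> snd) F) \<subseteq> span (set (map (snd \<circ> snd) D))" "\<forall>\<phi>. linear \<phi> \<longrightarrow> tev F \<phi> = g (tev D \<phi>)"
    using add.IH(2) by (elim exE conjE)
  show ?case using E F by (intro exI[of _ "E @ F"]) simp
next
  case (mult f g)
  obtain E where E: "set (map (snd \<circ> snd) E) \<subseteq> span (set (map (snd \<circ> snd) D))" "\<forall>\<phi>. linear \<phi> \<longrightarrow> tev E \<phi> = f (tev D \<phi>)"
    using mult.IH(1) by (elim exE conjE)
  obtain F where F: "set (map (snd \<circ> snd) F) \<subseteq> span (set (map (snd \<circ> snd) D))" "\<forall>\<phi>. linear \<phi> \<longrightarrow> tev F \<phi> = g (tev D \<phi>)"
    using mult.IH(2) by (elim exE conjE)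
  have "set (map (snd \<circ> snd) (tmult E F)) \<subseteq> span (set (map (snd \<circ> snd) D))"
  proof
    fix v assume "v \<in> set (map (snd \<circ> snd) (tmult E F))"
    then obtain c a h d b k where "(c, a, h) \<in> set E" "(d, b, k) \<in> set F" "v = h + k \<or> v = h - k"
      by (fastforce simp: tmult_def)
    moreover from this have "h \<in> span (set (map (snd \<circ> snd) D))" "k \<in> span (set (map (snd \<circ> snd) D))"
      using E(1) F(1) by force+
    ultimately show "v \<in> span (set (map (snd \<circ> snd) D))" by (auto intro: span_add span_diff)
  qed
  then show ?case using E(2) F(2) by (intro exI[of _ "tmult E F"]) (simp add: tev_tmult)
qed

text \<open>A Rademacher sum, the discrete counterpart of \<open>Z\<close>. Surplus entries of the
  longer list are ignored.\<close>

fun cube_functional :: "'h::real_inner list \<Rightarrow> bool list \<Rightarrow> 'h \<Rightarrow> real" where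
  "cube_functional (v # vs) (b # bs) h = (if b then 1 else -1) * inner v h + cube_functional vs bs h"
| "cube_functional _ _ h = 0"

lemma linear_cube_functional: "linear (cube_functional vs bs)"
proof (rule linearI)
  show "cube_functional vs bs (x + y) = cube_functional vs bs x + cube_functional vs bs y" for x y
    by (induction vs bs x rule: cube_functional.induct) (auto simp: inner_add_right algebra_simps)
  show "cube_functional vs bs (r *\<^sub>R x) = r *\<^sub>R cube_functional vs bs x" for r x
    by (induction vs bs x rule: cube_functional.induct) (auto simp: algebra_simps)
qed

lemma cube_mean_cos:
  "cube_mean (length vs) (\<lambda>l. cos (cube_functional vs l h + a)) = cos a * (\<Prod>v\<leftarrow>vs. cos (inner v h))"
proof (induction vs arbitrary: a)
  case (Cons v vs)
  have 1: "(\<lambda>l. cos (cube_functional (v # vs) (True # l) h + a)) = (\<lambda>l. cos (cube_functional vs l h + (a + inner v h)))"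
    and 2: "(\<lambda>l. cos (cube_functional (v # vs) (False # l) h + a)) = (\<lambda>l. cos (cube_functional vs l h + (a - inner v h)))"
    by (auto simp: algebra_simps)
  show ?case unfolding length_Cons cube_mean.simps 1 2 Cons.IH
    by (simp add: cos_add cos_diff algebra_simps)
qed simp

text \<open>For one pair of random signs with correlation r, the mean of the cosine at x + y + a
  with signed x and y is cos a (cos x cos y - r sin x sin y); the terms with sin a cancel by
  symmetry.\<close>

lemma cube_corr_cos:
  "cube_corr r (length vs) (\<lambda>l m. cos (cube_functional vs l h + cube_functional vs m k + a))
    = cos a * (\<Prod>v\<leftarrow>vs. cos (inner v h) * cos (inner v k) - r * (sin (inner v h) * sin (inner v k)))"
proof (induction vs arbitrary: a)
  case (Cons v vs)
  have e: "(\<lambda>l m. cos (cube_functional (v # vs) (b # l) h + cube_functional (v # vs) (c # m) k + a))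
      = (\<lambda>l m. cos (cube_functional vs l h + cube_functional vs m k + (a + (if b then 1 else -1) * inner v h + (if c then 1 else -1) * inner v k)))" for b c
    by (auto simp: algebra_simps)
  show ?case unfolding length_Cons cube_corr.simps e Cons.IH
    by (simp add: cos_add sin_add cos_diff sin_diff field_simps)
qed simp

lemma cube_mean_tev:
  "cube_mean n (\<lambda>l. tev D (\<phi> l)) = (\<Sum>(c, a, h)\<leftarrow>D. c * cube_mean n (\<lambda>l. cos (\<phi> l h + a)))"
proof (induction D)
  case (Cons x D)
  obtain c a h where x: "x = (c, a, h)" by (cases x)
  have "cube_mean n (\<lambda>l. tev (x # D) (\<phi> l)) = cube_mean n (\<lambda>l. c * cos (\<phi> l h + a) + 1 * tev D (\<phi> l))" by (simp add: x)
  also have "\<dots> = c * cube_mean n (\<lambda>l. cos (\<phi> l h + a)) + cube_mean n (\<lambda>l. tev D (\<phi> l))" by (subst cube_mean_lincomb) simp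
  finally show ?case using Cons by (simp add: x)
qed (simp add: cube_mean_const)

lemma cube_corr_zero: "cube_corr r n (\<lambda>l m. 0) = 0"
  by (induction n) auto

lemma cube_corr_tev:
  "cube_corr r n (\<lambda>l m. tev D (\<phi> l) * tev E (\<phi> m))
    = (\<Sum>(c, a, h)\<leftarrow>D. \<Sum>(d, b, k)\<leftarrow>E. c * d * cube_corr r n (\<lambda>l m. cos (\<phi> l h + a) * cos (\<phi> m k + b)))"
proof (induction D)
  case (Cons x D)
  obtain c a h where x: "x = (c, a, h)" by (cases x)
  have one: "cube_corr r n (\<lambda>l m. cos (\<phi> l h + a) * tev E (\<phi> m))
      = (\<Sum>(d, b, k)\<leftarrow>E. d * cube_corr r n (\<lambda>l m. cos (\<phi> l h + a) * cos (\<phi> m k + b)))"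
  proof (induction E)
    case (Cons y E)
    obtain d b k where y: "y = (d, b, k)" by (cases y)
    have "cube_corr r n (\<lambda>l m. cos (\<phi> l h + a) * tev (y # E) (\<phi> m))
        = cube_corr r n (\<lambda>l m. d * (cos (\<phi> l h + a) * cos (\<phi> m k + b)) + 1 * (cos (\<phi> l h + a) * tev E (\<phi> m)))"
      by (simp add: y algebra_simps)
    then show ?case unfolding cube_corr_lincomb using Cons by (simp add: y)
  qed (simp add: cube_corr_zero)
  have "cube_corr r n (\<lambda>l m. tev (x # D) (\<phi> l) * tev E (\<phi> m))
      = cube_corr r n (\<lambda>l m. c * (cos (\<phi> l h + a) * tev E (\<phi> m)) + 1 * (tev D (\<phi> l) * tev E (\<phi> m)))"
    by (simp add: x algebra_simps)
  then show ?case unfolding cube_corr_lincomb one using Cons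
    by (simp add: x sum_list_const_mult[symmetric] case_prod_unfold mult.assoc)
qed (simp add: cube_corr_zero)

text \<open>N copies of an orthonormal list scaled by \<open>1 / sqrt N\<close>: the central limit theorem on the cube.\<close>

definition clt_vectors :: "'h::real_inner list \<Rightarrow> nat \<Rightarrow> 'h list"
  where "clt_vectors es N = concat (replicate N (map (\<lambda>e. (1 / sqrt (real N)) *\<^sub>R e) es))"

lemma prod_list_clt_vectors:
  fixes f :: "'h::real_inner \<Rightarrow> real"
  shows "(\<Prod>v\<leftarrow>clt_vectors es N. f v) = (\<Prod>e\<leftarrow>es. f ((1 / sqrt (real N)) *\<^sub>R e) ^ N)"
proof -
  have "(\<Prod>v\<leftarrow>concat (replicate M vs). f v) = (\<Prod>v\<leftarrow>vs. f v) ^ M" for M and vs :: "'h list"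
    by (induction M) auto
  then have "(\<Prod>v\<leftarrow>clt_vectors es N. f v) = (\<Prod>e\<leftarrow>es. f ((1 / sqrt (real N)) *\<^sub>R e)) ^ N"
    by (simp add: clt_vectors_def o_def)
  also have "\<dots> = (\<Prod>e\<leftarrow>es. f ((1 / sqrt (real N)) *\<^sub>R e) ^ N)"
    by (induction es) (auto simp: power_mult_distrib)
  finally show ?thesis .
qed

text \<open>The base is 1 - ((x^2 + y^2) / 2 + r x y) / N up to terms of smaller order than 1 /
  N.\<close>

lemma clt_corr_limit:
  "(\<lambda>N. (cos (1 / sqrt (real N) * x) * cos (1 / sqrt (real N) * y)
      - r * (sin (1 / sqrt (real N) * x) * sin (1 / sqrt (real N) * y))) ^ N) \<longlonglongrightarrow> exp (- (x\<^sup>2 + y\<^sup>2) / 2 - r * (x * y))"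
proof -
  have "(\<lambda>N. (cos (1 / sqrt (real N) * x) * cos (1 / sqrt (real N) * y)
      - r * (sin (1 / sqrt (real N) * x) * sin (1 / sqrt (real N) * y))) ^ N) \<longlonglongrightarrow> exp (- (y * y / 2) - x * x / 2 - r * (x * y))"
    by real_asymp
  moreover have "- (y * y / 2) - x * x / 2 - r * (x * y) = - (x\<^sup>2 + y\<^sup>2) / 2 - r * (x * y)"
    by (simp add: power2_eq_square field_simps)
  ultimately show ?thesis by simp
qed

lemma clt_limit: "(\<lambda>N. cos (1 / sqrt (real N) * x) ^ N) \<longlonglongrightarrow> exp (- x\<^sup>2 / 2)"
  using clt_corr_limit[of x 0 0] by simp

lemma tendsto_prod_list:
  fixes f :: "'a \<Rightarrow> 'b \<Rightarrow> real"
  assumes "\<And>e. e \<in> set es \<Longrightarrow> ((\<lambda>N. f N e) \<longlongrightarrow> g e) F"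
  shows "((\<lambda>N. \<Prod>e\<leftarrow>es. f N e) \<longlongrightarrow> (\<Prod>e\<leftarrow>es. g e)) F"
  using assms by (induction es) (auto intro!: tendsto_mult)

lemma exp_sum_list: "exp (\<Sum>e\<leftarrow>es. f e) = (\<Prod>e\<leftarrow>es. exp (f e :: real))"
  by (induction es) (auto simp: exp_add)

lemma tendsto_sum_list:
  fixes f :: "'a \<Rightarrow> 'b \<Rightarrow> real"
  assumes "\<And>e. e \<in> set es \<Longrightarrow> ((\<lambda>N. f N e) \<longlongrightarrow> g e) F"
  shows "((\<lambda>N. \<Sum>e\<leftarrow>es. f N e) \<longlongrightarrow> (\<Sum>e\<leftarrow>es. g e)) F"
  using assms by (induction es) (auto intro!: tendsto_add)

text \<open>Parseval's identity on S is the property that turns limits of products over es into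
  functions of inner products.\<close>

definition parseval_list :: "'h::real_inner list \<Rightarrow> 'h set \<Rightarrow> bool"
  where "parseval_list es S \<longleftrightarrow> (\<forall>h\<in>S. \<forall>k\<in>S. (\<Sum>e\<leftarrow>es. inner e h * inner e k) = inner h k)"

lemma cube_mean_cos_tendsto:
  assumes "parseval_list es S" "h \<in> S"
  shows "(\<lambda>N. cube_mean (length (clt_vectors es N)) (\<lambda>l. cos (cube_functional (clt_vectors es N) l h + a)))
    \<longlonglongrightarrow> exp (- (norm h)\<^sup>2 / 2) * cos a"
proof -
  have "(\<lambda>N. cos a * (\<Prod>e\<leftarrow>es. cos (1 / sqrt (real N) * inner e h) ^ N)) \<longlonglongrightarrow> cos a * (\<Prod>e\<leftarrow>es. exp (- (inner e h)\<^sup>2 / 2))"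
    by (intro tendsto_mult tendsto_const tendsto_prod_list clt_limit)
  moreover have "(\<Prod>e\<leftarrow>es. exp (- (inner e h)\<^sup>2 / 2)) = exp (- (norm h)\<^sup>2 / 2)"
  proof -
    have "(\<Sum>e\<leftarrow>es. - (inner e h)\<^sup>2 / 2) = - (\<Sum>e\<leftarrow>es. inner e h * inner e h) / 2"
      by (induction es) (auto simp: power2_eq_square)
    also have "\<dots> = - (norm h)\<^sup>2 / 2" using assms by (simp add: parseval_list_def power2_norm_eq_inner)
    finally show ?thesis by (simp add: exp_sum_list[symmetric])
  qed
  ultimately show ?thesis
    unfolding cube_mean_cos prod_list_clt_vectors by (simp add: mult.commute)
qed

lemma cube_corr_cos_cos_tendsto:
  assumes "parseval_list es S" "h \<in> S" "k \<in> S"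
  shows "(\<lambda>N. cube_corr r (length (clt_vectors es N)) (\<lambda>l m. cos (cube_functional (clt_vectors es N) l h + a)
      * cos (cube_functional (clt_vectors es N) m k + b)))
    \<longlonglongrightarrow> 1 / 2 * (exp (- ((norm h)\<^sup>2 + (norm k)\<^sup>2) / 2 - r * inner h k) * cos (a + b) +
     exp (- ((norm h)\<^sup>2 + (norm k)\<^sup>2) / 2 + r * inner h k) * cos (a - b))"
proof -
  \<comment> \<open>The values s = 1 and s = - 1 give the sum and the difference of the two angles
    in the product-to-sum formula.\<close>
  have prod: "(\<lambda>N. cube_corr r (length (clt_vectors es N)) (\<lambda>l m. cos (cube_functional (clt_vectors es N) l h
      + cube_functional (clt_vectors es N) m (s *\<^sub>R k) + c)))
    \<longlonglongrightarrow> exp (- ((norm h)\<^sup>2 + (norm k)\<^sup>2) / 2 - s * (r * inner h k)) * cos c" if s: "s\<^sup>2 = 1" for s c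
  proof -
    have "(\<lambda>N. cos c * (\<Prod>e\<leftarrow>es. (cos (1 / sqrt (real N) * inner e h) * cos (1 / sqrt (real N) * inner e (s *\<^sub>R k))
        - r * (sin (1 / sqrt (real N) * inner e h) * sin (1 / sqrt (real N) * inner e (s *\<^sub>R k)))) ^ N))
      \<longlonglongrightarrow> cos c * (\<Prod>e\<leftarrow>es. exp (- ((inner e h)\<^sup>2 + (inner e (s *\<^sub>R k))\<^sup>2) / 2 - r * (inner e h * inner e (s *\<^sub>R k))))"
      by (intro tendsto_mult tendsto_const tendsto_prod_list clt_corr_limit)
    moreover have "(\<Prod>e\<leftarrow>es. exp (- ((inner e h)\<^sup>2 + (inner e (s *\<^sub>R k))\<^sup>2) / 2 - r * (inner e h * inner e (s *\<^sub>R k))))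
        = exp (- ((norm h)\<^sup>2 + (norm k)\<^sup>2) / 2 - s * (r * inner h k))"
    proof -
      have "(\<Sum>e\<leftarrow>es. - ((inner e h)\<^sup>2 + (inner e (s *\<^sub>R k))\<^sup>2) / 2 - r * (inner e h * inner e (s *\<^sub>R k)))
        = - ((\<Sum>e\<leftarrow>es. inner e h * inner e h) + s\<^sup>2 * (\<Sum>e\<leftarrow>es. inner e k * inner e k)) / 2 - s * (r * (\<Sum>e\<leftarrow>es. inner e h * inner e k))"
        by (induction es) (auto simp: power2_eq_square field_simps)
      also have "\<dots> = - ((norm h)\<^sup>2 + (norm k)\<^sup>2) / 2 - s * (r * inner h k)"
        using assms s by (simp add: parseval_list_def power2_norm_eq_inner)
      finally show ?thesis by (simp add: exp_sum_list[symmetric])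
    qed
    ultimately show ?thesis
      unfolding cube_corr_cos prod_list_clt_vectors by (simp add: mult.commute)
  qed
  have eq: "cube_corr r n (\<lambda>l m. cos (cube_functional vs l h + a) * cos (cube_functional vs m k + b))
      = 1 / 2 * cube_corr r n (\<lambda>l m. cos (cube_functional vs l h + cube_functional vs m (1 *\<^sub>R k) + (a + b)))
      + 1 / 2 * cube_corr r n (\<lambda>l m. cos (cube_functional vs l h + cube_functional vs m ((-1) *\<^sub>R k) + (a - b)))" for n vs
  proof -
    have "cube_functional vs m (- k) = - cube_functional vs m k" for m by (rule linear_neg[OF linear_cube_functional])
    then show ?thesis unfolding cube_corr_lincomb[symmetric] by (simp add: cos_times_cos algebra_simps add_divide_distrib)
  qed
  have lim: "(\<lambda>N. 1 / 2 * cube_corr r (length (clt_vectors es N)) (\<lambda>l m. cos (cube_functional (clt_vectors es N) l h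
      + cube_functional (clt_vectors es N) m (1 *\<^sub>R k) + (a + b)))
      + 1 / 2 * cube_corr r (length (clt_vectors es N)) (\<lambda>l m. cos (cube_functional (clt_vectors es N) l h
      + cube_functional (clt_vectors es N) m ((-1) *\<^sub>R k) + (a - b))))
      \<longlonglongrightarrow> 1 / 2 * (exp (- ((norm h)\<^sup>2 + (norm k)\<^sup>2) / 2 - 1 * (r * inner h k)) * cos (a + b))
        + 1 / 2 * (exp (- ((norm h)\<^sup>2 + (norm k)\<^sup>2) / 2 - (-1) * (r * inner h k)) * cos (a - b))"
    by (intro tendsto_add tendsto_mult tendsto_const prod) auto
  have R: "1 / 2 * (exp (- ((norm h)\<^sup>2 + (norm k)\<^sup>2) / 2 - 1 * (r * inner h k)) * cos (a + b))
        + 1 / 2 * (exp (- ((norm h)\<^sup>2 + (norm k)\<^sup>2) / 2 - (-1) * (r * inner h k)) * cos (a - b))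
      = 1 / 2 * (exp (- ((norm h)\<^sup>2 + (norm k)\<^sup>2) / 2 - r * inner h k) * cos (a + b) +
     exp (- ((norm h)\<^sup>2 + (norm k)\<^sup>2) / 2 + r * inner h k) * cos (a - b))" by (simp add: distrib_left)
  show ?thesis using lim unfolding eq R .
qed

text \<open>Gram-Schmidt applied to S, with zero vectors discarded before normalizing.\<close>

lemma exists_parseval_list:
  fixes S :: "'h::real_inner set"
  assumes "finite S"
  obtains es where "parseval_list es (span S)"
proof -
  obtain C where C: "finite C" "span C = span S" "pairwise orthogonal C"
    using basis_orthogonal[OF assms] by blast
  define B where "B = (\<lambda>c. (1 / norm c) *\<^sub>R c) ` (C - {0})"
  have B: "finite B" using C by (simp add: B_def)
  have ip: "inner a b = (if a = b then 1 else 0)" if ab: "a \<in> B" "b \<in> B" for a b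
  proof -
    obtain c where c: "c \<in> C" "c \<noteq> 0" "a = (1 / norm c) *\<^sub>R c" using ab(1) by (auto simp: B_def)
    obtain d where d: "d \<in> C" "d \<noteq> 0" "b = (1 / norm d) *\<^sub>R d" using ab(2) by (auto simp: B_def)
    note cd = c d
    show ?thesis
    proof (cases "c = d")
      case True
      then show ?thesis using cd by (simp add: power2_norm_eq_inner[symmetric] power2_eq_square)
    next
      case False
      then have "inner c d = 0" using C(3) cd by (auto simp: pairwise_def orthogonal_def)
      then have "inner a b = 0" using cd by simp
      moreover have "inner a a \<noteq> 0" using cd by simp
      ultimately show ?thesis by auto
    qed
  qed
  have expand: "h = (\<Sum>b\<in>B. inner b h *\<^sub>R b)" if h: "h \<in> span S" for h
  proof -
    have "h \<in> span C" using h C by simp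
    then show ?thesis
    proof (induction rule: span_induct_alt)
      case (step r x y)
      have "x = (\<Sum>b\<in>B. inner b x *\<^sub>R b)"
      proof (cases "x = 0")
        case False
        define b where "b = (1 / norm x) *\<^sub>R x"
        have b: "b \<in> B" "x = norm x *\<^sub>R b" using step(1) False by (auto simp: b_def B_def)
        have "(\<Sum>c\<in>B. inner c x *\<^sub>R c) = (\<Sum>c\<in>B. if c = b then norm x *\<^sub>R b else 0)"
        proof (rule sum.cong[OF refl])
          fix c assume "c \<in> B"
          have "inner c x = norm x * inner c b" by (subst b(2)) simp
          then show "inner c x *\<^sub>R c = (if c = b then norm x *\<^sub>R b else 0)" using ip[OF \<open>c \<in> B\<close> b(1)] by simp
        qed
        then show ?thesis using B b by simp
      qed simp
      from arg_cong2[OF arg_cong[OF this, of "\<lambda>z. r *\<^sub>R z"] step.IH, of "(+)"]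
      have "r *\<^sub>R x + y = r *\<^sub>R (\<Sum>b\<in>B. inner b x *\<^sub>R b) + (\<Sum>b\<in>B. inner b y *\<^sub>R b)" .
      also have "\<dots> = (\<Sum>b\<in>B. inner b (r *\<^sub>R x + y) *\<^sub>R b)"
        by (simp add: inner_add_right scaleR_add_left scaleR_sum_right sum.distrib)
      finally show ?case .
    qed simp
  qed
  obtain es where es: "set es = B" "distinct es" using finite_distinct_list[OF B] by blast
  have "(\<Sum>e\<leftarrow>es. inner e h * inner e k) = inner h k" if "h \<in> span S" "k \<in> span S" for h k
  proof -
    have "(\<Sum>e\<leftarrow>es. inner e h * inner e k) = (\<Sum>e\<in>B. inner e h * inner e k)"
      using es by (metis sum_list_distinct_conv_sum_set)
    also have "\<dots> = inner (\<Sum>b\<in>B. inner b h *\<^sub>R b) k" by (simp add: inner_sum_left)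
    also have "\<dots> = inner h k" using expand[OF that(1)] by simp
    finally show ?thesis .
  qed
  then have "parseval_list es (span S)" by (simp add: parseval_list_def)
  then show ?thesis by (rule that)
qed

definition trig_vectors :: "'h trig \<Rightarrow> 'h set" where "trig_vectors D = set (map (snd \<circ> snd) D)"

definition tbound :: "'h trig \<Rightarrow> real" where "tbound D = (\<Sum>(c, a, h)\<leftarrow>D. \<bar>c\<bar>)"

lemma tev_le_tbound: "\<bar>tev D \<phi>\<bar> \<le> tbound D"
proof (induction D)
  case (Cons x D)
  obtain c a h where x: "x = (c, a, h)" by (cases x)
  have "\<bar>c * cos (\<phi> h + a)\<bar> \<le> \<bar>c\<bar> * 1" unfolding abs_mult by (intro mult_left_mono) auto
  then show ?case using Cons by (simp add: x tbound_def)
qed (simp add: tbound_def)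

lemma cube_mean_tev_tendsto:
  assumes "parseval_list es S" "trig_vectors D \<subseteq> S"
  shows "(\<lambda>N. cube_mean (length (clt_vectors es N)) (\<lambda>l. tev D (cube_functional (clt_vectors es N) l))) \<longlonglongrightarrow> tmean D"
  unfolding cube_mean_tev tmean_def
proof (rule tendsto_sum_list)
  fix x assume x: "x \<in> set D"
  obtain c a h where e: "x = (c, a, h)" by (cases x)
  have "h \<in> S" using x assms(2) by (force simp: trig_vectors_def e)
  then show "(\<lambda>N. case x of (c, a, h) \<Rightarrow> c * cube_mean (length (clt_vectors es N)) (\<lambda>l. cos (cube_functional (clt_vectors es N) l h + a)))
      \<longlonglongrightarrow> (case x of (c, a, h) \<Rightarrow> c * (exp (- (norm h)\<^sup>2 / 2) * cos a))"
    unfolding e prod.case by (intro tendsto_mult tendsto_const cube_mean_cos_tendsto[OF assms(1)])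
qed

lemma cube_corr_tev_tendsto:
  assumes "parseval_list es S" "trig_vectors D \<subseteq> S" "trig_vectors E \<subseteq> S"
  shows "(\<lambda>N. cube_corr r (length (clt_vectors es N)) (\<lambda>l m. tev D (cube_functional (clt_vectors es N) l)
      * tev E (cube_functional (clt_vectors es N) m))) \<longlonglongrightarrow> tcorr r D E"
  unfolding cube_corr_tev tcorr_def
proof (rule tendsto_sum_list)
  fix x assume x: "x \<in> set D"
  obtain c a h where e: "x = (c, a, h)" by (cases x)
  have h: "h \<in> S" using x assms(2) by (force simp: trig_vectors_def e)
  show "(\<lambda>N. case x of (c, a, h) \<Rightarrow> \<Sum>(d, b, k)\<leftarrow>E. c * d * cube_corr r (length (clt_vectors es N))
        (\<lambda>l m. cos (cube_functional (clt_vectors es N) l h + a) * cos (cube_functional (clt_vectors es N) m k + b)))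
      \<longlonglongrightarrow> (case x of (c, a, h) \<Rightarrow> \<Sum>(d, b, k)\<leftarrow>E. c * d / 2 *
        (exp (- ((norm h)\<^sup>2 + (norm k)\<^sup>2) / 2 - r * inner h k) * cos (a + b) +
         exp (- ((norm h)\<^sup>2 + (norm k)\<^sup>2) / 2 + r * inner h k) * cos (a - b)))"
    unfolding e prod.case
  proof (rule tendsto_sum_list)
    fix y assume y: "y \<in> set E"
    obtain d b k where e': "y = (d, b, k)" by (cases y)
    have k: "k \<in> S" using y assms(3) by (force simp: trig_vectors_def e')
    have "(\<lambda>N. c * d * cube_corr r (length (clt_vectors es N))
        (\<lambda>l m. cos (cube_functional (clt_vectors es N) l h + a) * cos (cube_functional (clt_vectors es N) m k + b)))
      \<longlonglongrightarrow> c * d * (1 / 2 * (exp (- ((norm h)\<^sup>2 + (norm k)\<^sup>2) / 2 - r * inner h k) * cos (a + b) +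
         exp (- ((norm h)\<^sup>2 + (norm k)\<^sup>2) / 2 + r * inner h k) * cos (a - b)))"
      by (intro tendsto_mult tendsto_const cube_corr_cos_cos_tendsto[OF assms(1)] h k)
    then show "(\<lambda>N. case y of (d, b, k) \<Rightarrow> c * d * cube_corr r (length (clt_vectors es N))
        (\<lambda>l m. cos (cube_functional (clt_vectors es N) l h + a) * cos (cube_functional (clt_vectors es N) m k + b)))
      \<longlonglongrightarrow> (case y of (d, b, k) \<Rightarrow> c * d / 2 * (exp (- ((norm h)\<^sup>2 + (norm k)\<^sup>2) / 2 - r * inner h k) * cos (a + b) +
         exp (- ((norm h)\<^sup>2 + (norm k)\<^sup>2) / 2 + r * inner h k) * cos (a - b)))"
      unfolding e' prod.case by (simp only: mult_1 times_divide_eq_left times_divide_eq_right divide_divide_eq_left)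
  qed
qed

text \<open>A power of the modulus of a trigonometric polynomial is in general not a trigonometric
  polynomial, but a polynomial of it is; the range is bounded, so Weierstrass approximation
  applies.\<close>

lemma abs_powr_polynomial_approx:
  fixes p M e :: real
  assumes "0 < p" "0 < e"
  obtains g where "real_polynomial_function g" "\<And>x. \<bar>x\<bar> \<le> M \<Longrightarrow> \<bar>\<bar>x\<bar> powr p - g x\<bar> \<le> e"
proof -
  have "continuous_on {-M..M} (\<lambda>x. \<bar>x\<bar> powr p)"
    using assms by (intro continuous_on_powr' continuous_intros) auto
  then obtain g where g: "real_polynomial_function g" "\<And>x. x \<in> {-M..M} \<Longrightarrow> \<bar>\<bar>x\<bar> powr p - g x\<bar> < e"
    using Stone_Weierstrass_real_polynomial_function[of "{-M..M}" "\<lambda>x. \<bar>x\<bar> powr p" e] assms by auto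
  have "\<bar>\<bar>x\<bar> powr p - g x\<bar> \<le> e" if "\<bar>x\<bar> \<le> M" for x using g(2)[of x] that by (auto simp: abs_le_iff)
  with g(1) show ?thesis by (rule that)
qed

context abstract_wiener_space
begin

lemma measurable_tev [measurable]: "(\<lambda>w. tev D (Z w)) \<in> borel_measurable \<mu>"
proof (induction D)
  case (Cons x D)
  then show ?case by (cases x) simp
qed simp

lemma all_moments_tev: "all_moments (\<lambda>w. tev D (Z w))"
  by (rule all_moments_bounded[OF measurable_tev tev_le_tbound])

lemma L2_tev: "(\<lambda>w. tev D (Z w)) \<in> L2 \<mu>" by (rule all_moments_L2[OF all_moments_tev])

lemma integrable_tev: "integrable \<mu> (\<lambda>w. tev D (Z w))" by (rule all_moments_integrable[OF all_moments_tev])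

lemma integral_tev: "(LINT w|\<mu>. tev D (Z w)) = tmean D"
proof (induction D)
  case (Cons x D)
  obtain c a h where x: "x = (c, a, h)" by (cases x)
  have "(LINT w|\<mu>. tev (x # D) (Z w)) = c * (LINT w|\<mu>. cos (Z w h + a)) + (LINT w|\<mu>. tev D (Z w))"
    using all_moments_integrable[OF all_moments_cos[of h a]] integrable_tev[of D] by (simp add: x)
  then show ?case using Cons by (simp add: x tmean_def integral_cos_Z)
qed (simp add: tmean_def)

lemma integrable_tev_powr: "integrable \<mu> (\<lambda>w. \<bar>tev D (Z w)\<bar> powr p)" if "0 < p"
proof (rule integrable_const_bound[where B = "tbound D powr p"])
  show "AE w in \<mu>. norm (\<bar>tev D (Z w)\<bar> powr p) \<le> tbound D powr p"
    using that tev_le_tbound by (auto intro!: powr_mono2 AE_I2)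
qed measurable

text \<open>Nelson's hypercontractivity in bilinear form, by the central limit theorem on the cube.\<close>

lemma tcorr_le:
  assumes p: "1 < p" "p \<le> 2" and r: "0 \<le> r" "r \<le> p - 1"
  shows "tcorr r D E \<le> (LINT w|\<mu>. \<bar>tev D (Z w)\<bar> powr p) powr (1 / p) * (LINT w|\<mu>. \<bar>tev E (Z w)\<bar> powr p) powr (1 / p)"
proof -
  define S where "S = span (trig_vectors D \<union> trig_vectors E)"
  have DS: "trig_vectors D \<subseteq> S" and ES: "trig_vectors E \<subseteq> S" by (auto simp: S_def intro: span_base)
  have "finite (trig_vectors D \<union> trig_vectors E)" by (simp add: trig_vectors_def)
  then obtain es where es: "parseval_list es S" unfolding S_def by (rule exists_parseval_list)
  let ?V = "clt_vectors es"
  let ?I = "\<lambda>F. LINT w|\<mu>. \<bar>tev F (Z w)\<bar> powr p"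
  \<comment> \<open>The cube means of the p-th power are dominated by a N + e, where the a N are
    cube means of a trigonometric polynomial G and therefore converge. Nonnegativity is recorded
    because the bounds are later raised to the power 1 / p.\<close>
  have approx: "\<exists>a. (\<forall>N. 0 \<le> a N + e \<and> cube_mean (length (?V N)) (\<lambda>l. \<bar>tev F (cube_functional (?V N) l)\<bar> powr p) \<le> a N + e)
      \<and> (\<exists>b. a \<longlonglongrightarrow> b \<and> 0 \<le> b + e \<and> b \<le> ?I F + e)" if F: "trig_vectors F \<subseteq> S" and e: "0 < e" for F e
  proof -
    obtain g where g: "real_polynomial_function g" "\<And>x. \<bar>x\<bar> \<le> tbound F \<Longrightarrow> \<bar>\<bar>x\<bar> powr p - g x\<bar> \<le> e"
      using abs_powr_polynomial_approx[of p e "tbound F"] p e by auto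
    obtain G where G: "set (map (snd \<circ> snd) G) \<subseteq> span (set (map (snd \<circ> snd) F))" "\<And>\<phi>. linear \<phi> \<Longrightarrow> tev G \<phi> = g (tev F \<phi>)"
      using trig_polynomial[OF g(1), of F] by blast
    have GS: "trig_vectors G \<subseteq> S"
      using G(1) F unfolding trig_vectors_def[symmetric] S_def by (meson order_trans span_minimal subspace_span)
    have le: "\<bar>\<bar>tev F \<phi>\<bar> powr p - tev G \<phi>\<bar> \<le> e" if "linear \<phi>" for \<phi>
      unfolding G(2)[OF that] by (rule g(2)[OF tev_le_tbound])
    define a where "a N = cube_mean (length (?V N)) (\<lambda>l. tev G (cube_functional (?V N) l))" for N
    have le_a: "cube_mean (length (?V N)) (\<lambda>l. \<bar>tev F (cube_functional (?V N) l)\<bar> powr p) \<le> a N + e" for N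
    proof -
      have "cube_mean (length (?V N)) (\<lambda>l. \<bar>tev F (cube_functional (?V N) l)\<bar> powr p)
          \<le> cube_mean (length (?V N)) (\<lambda>l. 1 * tev G (cube_functional (?V N) l) + 1 * e)"
      proof (rule cube_mean_mono)
        fix l
        show "\<bar>tev F (cube_functional (?V N) l)\<bar> powr p \<le> 1 * tev G (cube_functional (?V N) l) + 1 * e"
          using le[OF linear_cube_functional, of "?V N" l] by linarith
      qed
      also have "\<dots> = a N + e" by (subst cube_mean_lincomb) (simp add: a_def cube_mean_const)
      finally show ?thesis .
    qed
    have nn: "0 \<le> cube_mean (length (?V N)) (\<lambda>l. \<bar>tev F (cube_functional (?V N) l)\<bar> powr p)" for N
      by (rule cube_mean_nonneg) simp
    have lim: "a \<longlonglongrightarrow> tmean G" unfolding a_def by (rule cube_mean_tev_tendsto[OF es GS])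
    have "tmean G \<le> ?I F + e"
    proof -
      have "tmean G = (LINT w|\<mu>. tev G (Z w))" by (simp add: integral_tev)
      also have "\<dots> \<le> (LINT w|\<mu>. \<bar>tev F (Z w)\<bar> powr p + e)"
      proof (rule integral_mono)
        show "integrable \<mu> (\<lambda>w. \<bar>tev F (Z w)\<bar> powr p + e)" using integrable_tev_powr[of p F] p by simp
        show "tev G (Z w) \<le> \<bar>tev F (Z w)\<bar> powr p + e" for w using le[OF linear_Z, of w] by linarith
      qed (rule integrable_tev)
      also have "\<dots> = ?I F + e" using integrable_tev_powr[of p F] p by (simp add: prob_space)
      finally show ?thesis .
    qed
    moreover have "0 \<le> tmean G + e"
    proof -
      have "(\<lambda>N. a N + e) \<longlonglongrightarrow> tmean G + e" by (intro tendsto_intros lim)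
      moreover have "0 \<le> a N + e" for N using nn[of N] le_a[of N] by linarith
      ultimately show ?thesis by (intro LIMSEQ_le_const) auto
    qed
    moreover have "0 \<le> a N + e" for N using nn[of N] le_a[of N] by linarith
    ultimately show ?thesis using le_a lim by (intro exI[of _ a] conjI allI exI[of _ "tmean G"])
  qed
  \<comment> \<open>One e is lost in the approximation on the cube, the other in the approximation
    on the Wiener space.\<close>
  have bound: "tcorr r D E \<le> (?I D + 2 * e) powr (1 / p) * (?I E + 2 * e) powr (1 / p)" if e: "0 < e" for e
  proof -
    obtain a b where a: "\<And>N. 0 \<le> a N + e" "\<And>N. cube_mean (length (?V N)) (\<lambda>l. \<bar>tev D (cube_functional (?V N) l)\<bar> powr p) \<le> a N + e"
      and b: "a \<longlonglongrightarrow> b" "0 \<le> b + e" "b \<le> ?I D + e" using approx[OF DS e] by blast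
    obtain a' b' where a': "\<And>N. 0 \<le> a' N + e" "\<And>N. cube_mean (length (?V N)) (\<lambda>l. \<bar>tev E (cube_functional (?V N) l)\<bar> powr p) \<le> a' N + e"
      and b': "a' \<longlonglongrightarrow> b'" "0 \<le> b' + e" "b' \<le> ?I E + e" using approx[OF ES e] by blast
    have "tcorr r D E \<le> (b + e) powr (1 / p) * (b' + e) powr (1 / p)"
    proof (rule LIMSEQ_le[OF cube_corr_tev_tendsto[OF es DS ES]])
      show "(\<lambda>N. (a N + e) powr (1 / p) * (a' N + e) powr (1 / p)) \<longlonglongrightarrow> (b + e) powr (1 / p) * (b' + e) powr (1 / p)"
        using a(1) a'(1) p by (intro tendsto_mult tendsto_powr2 tendsto_add tendsto_const b b') auto
      show "\<exists>N. \<forall>n\<ge>N. cube_corr r (length (?V n)) (\<lambda>l m. tev D (cube_functional (?V n) l) * tev E (cube_functional (?V n) m))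
          \<le> (a n + e) powr (1 / p) * (a' n + e) powr (1 / p)"
      proof (intro exI[of _ 0] allI impI)
        fix n
        have "cube_corr r (length (?V n)) (\<lambda>l m. tev D (cube_functional (?V n) l) * tev E (cube_functional (?V n) m))
          \<le> (cube_mean (length (?V n)) (\<lambda>l. \<bar>tev D (cube_functional (?V n) l)\<bar> powr p)) powr (1 / p)
            * (cube_mean (length (?V n)) (\<lambda>l. \<bar>tev E (cube_functional (?V n) l)\<bar> powr p)) powr (1 / p)"
          by (rule cube_hypercontractive_abs[OF p r])
        also have "\<dots> \<le> (a n + e) powr (1 / p) * (a' n + e) powr (1 / p)"
          using p by (intro mult_mono powr_mono2 a a' cube_mean_nonneg) auto
        finally show "cube_corr r (length (?V n)) (\<lambda>l m. tev D (cube_functional (?V n) l) * tev E (cube_functional (?V n) m))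
          \<le> (a n + e) powr (1 / p) * (a' n + e) powr (1 / p)" .
      qed
    qed
    also have "\<dots> \<le> (?I D + 2 * e) powr (1 / p) * (?I E + 2 * e) powr (1 / p)"
      using b b' p by (intro mult_mono powr_mono2) auto
    finally show ?thesis .
  qed
  have In: "0 \<le> ?I F" for F by simp
  have "((\<lambda>e. (?I D + 2 * e) powr (1 / p) * (?I E + 2 * e) powr (1 / p)) \<longlongrightarrow>
      (?I D + 2 * 0) powr (1 / p) * (?I E + 2 * 0) powr (1 / p)) (at_right 0)"
    using p In by (intro tendsto_mult tendsto_powr2 tendsto_add tendsto_const tendsto_ident_at)
      (auto simp: eventually_at_filter intro!: always_eventually add_nonneg_nonneg)
  then have "tcorr r D E \<le> (?I D + 2 * 0) powr (1 / p) * (?I E + 2 * 0) powr (1 / p)"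
    by (rule tendsto_lowerbound) (auto simp: eventually_at_filter bound)
  then show ?thesis by simp
qed

end

section \<open>Second quantization and the \<open>\<alpha>\<close>-product of trigonometric polynomials\<close>

text \<open>Mehler's formula for \<Gamma>(r) on cosines. On trigonometric polynomials it makes sense
  for every r, also beyond 1.\<close>

definition tgam :: "real \<Rightarrow> 'h::real_normed_vector trig \<Rightarrow> 'h trig"
  where "tgam r D = map (\<lambda>(c, a, h). (c * exp (- ((1 - r\<^sup>2) * (norm h)\<^sup>2) / 2), a, r *\<^sub>R h)) D"

text \<open>With \<open>c\<^sup>2 + s\<^sup>2 = 1\<close> this represents \<open>\<phi> \<mapsto> \<integral> D (c \<phi> + s Z b) E (c \<phi> - s Z b) d\<mu>(b)\<close>. For
  \<open>c\<^sup>2 - s\<^sup>2 = \<alpha>\<close> the \<open>\<alpha>\<close>-product of D and E is its image under \<open>\<Gamma>(1 / c)\<close>.\<close>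

definition tQ :: "real \<Rightarrow> real \<Rightarrow> 'h::real_normed_vector trig \<Rightarrow> 'h trig \<Rightarrow> 'h trig"
  where "tQ c s D E = concat (map (\<lambda>(u, a, h). concat (map (\<lambda>(v, b, k).
    [(u * v / 2 * exp (- (s\<^sup>2 * (norm (h - k))\<^sup>2) / 2), a + b, c *\<^sub>R (h + k)),
     (u * v / 2 * exp (- (s\<^sup>2 * (norm (h + k))\<^sup>2) / 2), a - b, c *\<^sub>R (h - k))]) E)) D)"

lemma tgam_concat: "tgam r (concat Ds) = concat (map (tgam r) Ds)"
  unfolding tgam_def[abs_def] by (simp add: map_concat)

lemma norm_add_power2: "(norm (h + k))\<^sup>2 = (norm h)\<^sup>2 + (norm k)\<^sup>2 + 2 * inner h k" for h k :: "'h::real_inner"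
  unfolding power2_norm_eq_inner by (simp add: inner_add_left inner_add_right inner_commute)

lemma norm_diff_power2: "(norm (h - k))\<^sup>2 = (norm h)\<^sup>2 + (norm k)\<^sup>2 - 2 * inner h k" for h k :: "'h::real_inner"
  unfolding power2_norm_eq_inner by (simp add: inner_diff_left inner_diff_right inner_commute)

lemma sum_list_concat: "(\<Sum>x\<leftarrow>concat xss. f x) = (\<Sum>xs\<leftarrow>xss. \<Sum>x\<leftarrow>xs. f x)" for f :: "'a \<Rightarrow> 'b::comm_monoid_add"
  by (induction xss) auto

lemma tmean_tmult: "tmean (tmult D E) = tcorr 1 D E" for D E :: "'h::real_inner trig"
proof -
  have 1: "exp (- (norm (h + k))\<^sup>2 / 2) = exp (- ((norm h)\<^sup>2 + (norm k)\<^sup>2) / 2 - 1 * inner h k)"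
    "exp (- (norm (h - k))\<^sup>2 / 2) = exp (- ((norm h)\<^sup>2 + (norm k)\<^sup>2) / 2 + 1 * inner h k)" for h k :: 'h
    unfolding norm_add_power2 norm_diff_power2 by (simp_all add: field_simps)
  have "(u * v / 2) * (exp (- (norm (h + k))\<^sup>2 / 2) * x) + (u * v / 2) * (exp (- (norm (h - k))\<^sup>2 / 2) * y)
      = u * v / 2 * (exp (- ((norm h)\<^sup>2 + (norm k)\<^sup>2) / 2 - 1 * inner h k) * x + exp (- ((norm h)\<^sup>2 + (norm k)\<^sup>2) / 2 + 1 * inner h k) * y)"
    for u v x y and h k :: 'h unfolding 1 by (simp only: distrib_left)
  then show ?thesis
    unfolding tmean_def tmult_def tcorr_def sum_list_concat map_map o_def case_prod_unfold
    by (simp only: list.map sum_list.Cons sum_list.Nil fst_conv snd_conv add_0_right)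
qed

text \<open>The Gaussian factors of Mehler's formula restore the norms of the unscaled frequencies,
  and only the mixed term keeps the factor r q. For equal parameters this makes the squared L^2 norm
  of \<Gamma>(r) D a correlation with parameter r^2.\<close>

lemma tcorr_tgam: "tcorr 1 (tgam r D) (tgam q E) = tcorr (r * q) D E" for D E :: "'h::real_inner trig"
proof -
  have 1: "exp (- ((1 - r\<^sup>2) * (norm h)\<^sup>2) / 2) * exp (- ((1 - q\<^sup>2) * (norm k)\<^sup>2) / 2) *
      exp (- ((norm (r *\<^sub>R h))\<^sup>2 + (norm (q *\<^sub>R k))\<^sup>2) / 2 + t * inner (r *\<^sub>R h) (q *\<^sub>R k))
      = exp (- ((norm h)\<^sup>2 + (norm k)\<^sup>2) / 2 + t * (r * q * inner h k))" for h k :: 'h and t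
    unfolding exp_add[symmetric] by (rule arg_cong[where f = exp]) (simp add: power_mult_distrib field_simps)
  have "(u * exp (- ((1 - r\<^sup>2) * (norm h)\<^sup>2) / 2)) * (v * exp (- ((1 - q\<^sup>2) * (norm k)\<^sup>2) / 2)) / 2 *
      (exp (- ((norm (r *\<^sub>R h))\<^sup>2 + (norm (q *\<^sub>R k))\<^sup>2) / 2 - 1 * inner (r *\<^sub>R h) (q *\<^sub>R k)) * x +
       exp (- ((norm (r *\<^sub>R h))\<^sup>2 + (norm (q *\<^sub>R k))\<^sup>2) / 2 + 1 * inner (r *\<^sub>R h) (q *\<^sub>R k)) * y)
     = u * v / 2 * (exp (- ((norm h)\<^sup>2 + (norm k)\<^sup>2) / 2 - r * q * inner h k) * x +
       exp (- ((norm h)\<^sup>2 + (norm k)\<^sup>2) / 2 + r * q * inner h k) * y)" (is "?l = ?r") for u v x y and h k :: 'h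
  proof -
    have "?l = u * v / 2 * ((exp (- ((1 - r\<^sup>2) * (norm h)\<^sup>2) / 2) * exp (- ((1 - q\<^sup>2) * (norm k)\<^sup>2) / 2) *
        exp (- ((norm (r *\<^sub>R h))\<^sup>2 + (norm (q *\<^sub>R k))\<^sup>2) / 2 + (-1) * inner (r *\<^sub>R h) (q *\<^sub>R k))) * x +
        (exp (- ((1 - r\<^sup>2) * (norm h)\<^sup>2) / 2) * exp (- ((1 - q\<^sup>2) * (norm k)\<^sup>2) / 2) *
        exp (- ((norm (r *\<^sub>R h))\<^sup>2 + (norm (q *\<^sub>R k))\<^sup>2) / 2 + 1 * inner (r *\<^sub>R h) (q *\<^sub>R k))) * y)"
      by (simp add: algebra_simps)
    also have "\<dots> = ?r" unfolding 1 by simp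
    finally show ?thesis .
  qed
  then show ?thesis unfolding tcorr_def tgam_def map_map o_def case_prod_unfold by (simp only: fst_conv snd_conv)
qed

text \<open>The arguments c w + s b and c w - s b are standard Gaussian with correlation c^2 -
  s^2.\<close>

lemma tmean_tQ:
  fixes D E :: "'h::real_inner trig"
  assumes "c\<^sup>2 + s\<^sup>2 = 1" "c\<^sup>2 - s\<^sup>2 = \<alpha>"
  shows "tmean (tQ c s D E) = tcorr \<alpha> D E"
proof -
  have 1: "exp (- (s\<^sup>2 * (norm (h - k))\<^sup>2) / 2) * exp (- (norm (c *\<^sub>R (h + k)))\<^sup>2 / 2) = exp (- ((norm h)\<^sup>2 + (norm k)\<^sup>2) / 2 - \<alpha> * inner h k)"
    "exp (- (s\<^sup>2 * (norm (h + k))\<^sup>2) / 2) * exp (- (norm (c *\<^sub>R (h - k)))\<^sup>2 / 2) = exp (- ((norm h)\<^sup>2 + (norm k)\<^sup>2) / 2 + \<alpha> * inner h k)" for h k :: 'h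
  proof -
    have c: "c\<^sup>2 = 1 - s\<^sup>2" "\<alpha> = 1 - 2 * s\<^sup>2" using assms by auto
    show "exp (- (s\<^sup>2 * (norm (h - k))\<^sup>2) / 2) * exp (- (norm (c *\<^sub>R (h + k)))\<^sup>2 / 2) = exp (- ((norm h)\<^sup>2 + (norm k)\<^sup>2) / 2 - \<alpha> * inner h k)"
      "exp (- (s\<^sup>2 * (norm (h + k))\<^sup>2) / 2) * exp (- (norm (c *\<^sub>R (h - k)))\<^sup>2 / 2) = exp (- ((norm h)\<^sup>2 + (norm k)\<^sup>2) / 2 + \<alpha> * inner h k)"
      unfolding exp_add[symmetric] norm_scaleR power_mult_distrib power2_abs norm_add_power2 norm_diff_power2 c
      by (rule arg_cong[where f = exp], simp add: field_simps)+
  qed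
  have "(u * v / 2 * exp (- (s\<^sup>2 * (norm (h - k))\<^sup>2) / 2)) * (exp (- (norm (c *\<^sub>R (h + k)))\<^sup>2 / 2) * x)
      + (u * v / 2 * exp (- (s\<^sup>2 * (norm (h + k))\<^sup>2) / 2)) * (exp (- (norm (c *\<^sub>R (h - k)))\<^sup>2 / 2) * y)
      = u * v / 2 * (exp (- ((norm h)\<^sup>2 + (norm k)\<^sup>2) / 2 - \<alpha> * inner h k) * x + exp (- ((norm h)\<^sup>2 + (norm k)\<^sup>2) / 2 + \<alpha> * inner h k) * y)"
    for u v x y and h k :: 'h
    unfolding 1[symmetric] by (simp only: distrib_left mult.assoc mult.left_commute)
  then show ?thesis
    unfolding tmean_def tQ_def tcorr_def sum_list_concat map_map o_def case_prod_unfold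
    by (simp only: list.map sum_list.Cons sum_list.Nil fst_conv snd_conv add_0_right)
qed

text \<open>Frequencies agree because q c = r, and the Gaussian factors because (1 - q^2) c^2 = c^2
  - r^2 = s^2. For r = sqrt \<alpha> it follows that the \<alpha>-product is \<Gamma>(1 / r)
  \<Gamma>(q) Q = \<Gamma>(1 / c) Q.\<close>

lemma tmult_tgam_eq_tgam_tQ:
  fixes D E :: "'h::real_inner trig"
  assumes cs: "c\<^sup>2 + s\<^sup>2 = 1" "c\<^sup>2 - s\<^sup>2 = r\<^sup>2" and q: "q * c = r"
  shows "tmult (tgam r D) (tgam r E) = tgam q (tQ c s D E)"
proof -
  have c: "c\<^sup>2 = 1 - s\<^sup>2" "r\<^sup>2 = 1 - 2 * s\<^sup>2" "q\<^sup>2 * c\<^sup>2 = r\<^sup>2" using cs q by (auto simp: power_mult_distrib[symmetric])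
  have q2: "(1 - q\<^sup>2) * (c\<^sup>2 * x) = s\<^sup>2 * x" for x :: real
  proof -
    have "(1 - q\<^sup>2) * (c\<^sup>2 * x) = (c\<^sup>2 - q\<^sup>2 * c\<^sup>2) * x" by (simp add: algebra_simps)
    also have "\<dots> = s\<^sup>2 * x" using c by simp
    finally show ?thesis .
  qed
  have "exp (- ((1 - r\<^sup>2) * (norm h)\<^sup>2) / 2) * exp (- ((1 - r\<^sup>2) * (norm k)\<^sup>2) / 2)
      = exp (- (s\<^sup>2 * (norm (h - k))\<^sup>2) / 2) * exp (- ((1 - q\<^sup>2) * (norm (c *\<^sub>R (h + k)))\<^sup>2) / 2)"
    "exp (- ((1 - r\<^sup>2) * (norm h)\<^sup>2) / 2) * exp (- ((1 - r\<^sup>2) * (norm k)\<^sup>2) / 2)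
      = exp (- (s\<^sup>2 * (norm (h + k))\<^sup>2) / 2) * exp (- ((1 - q\<^sup>2) * (norm (c *\<^sub>R (h - k)))\<^sup>2) / 2)" for h k :: 'h
    unfolding exp_add[symmetric] norm_scaleR power_mult_distrib power2_abs q2 norm_add_power2 norm_diff_power2
    by (rule arg_cong[where f = exp], simp add: c field_simps)+
  then have "(u * exp (- ((1 - r\<^sup>2) * (norm h)\<^sup>2) / 2)) * (v * exp (- ((1 - r\<^sup>2) * (norm k)\<^sup>2) / 2)) / 2
      = (u * v / 2 * exp (- (s\<^sup>2 * (norm (h - k))\<^sup>2) / 2)) * exp (- ((1 - q\<^sup>2) * (norm (c *\<^sub>R (h + k)))\<^sup>2) / 2)"
    "(u * exp (- ((1 - r\<^sup>2) * (norm h)\<^sup>2) / 2)) * (v * exp (- ((1 - r\<^sup>2) * (norm k)\<^sup>2) / 2)) / 2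
      = (u * v / 2 * exp (- (s\<^sup>2 * (norm (h + k))\<^sup>2) / 2)) * exp (- ((1 - q\<^sup>2) * (norm (c *\<^sub>R (h - k)))\<^sup>2) / 2)" for u v and h k :: 'h
    by (simp_all add: mult_ac)
  moreover have "r *\<^sub>R h + r *\<^sub>R k = q *\<^sub>R c *\<^sub>R (h + k)" "r *\<^sub>R h - r *\<^sub>R k = q *\<^sub>R c *\<^sub>R (h - k)" for h k :: 'h
    using q by (simp_all add: scaleR_add_right scaleR_diff_right)
  ultimately show ?thesis
    unfolding tmult_def tQ_def tgam_concat map_map o_def case_prod_unfold
    by (simp only: tgam_def map_map o_def map_concat case_prod_unfold fst_conv snd_conv list.map)
qed

lemma tev_tQ_sum:
  "tev (tQ c s D E) \<phi> = (\<Sum>(u, a, h)\<leftarrow>D. \<Sum>(v, b, k)\<leftarrow>E.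
     u * v / 2 * exp (- (s\<^sup>2 * (norm (h - k))\<^sup>2) / 2) * cos (\<phi> (c *\<^sub>R (h + k)) + (a + b)) +
     u * v / 2 * exp (- (s\<^sup>2 * (norm (h + k))\<^sup>2) / 2) * cos (\<phi> (c *\<^sub>R (h - k)) + (a - b)))"
  unfolding tev_def tQ_def sum_list_concat map_map o_def case_prod_unfold by simp

section \<open>Chaos kernels and L^2 bounds of trigonometric polynomials\<close>

context abstract_wiener_space
begin

definition tker :: "'h trig \<Rightarrow> 'h chaos"
  where "tker D n l = (\<Sum>(c, a, h)\<leftarrow>D. c * cos_kernel h a n l)"

lemma chaos_exp_tev: "chaos_exp (\<lambda>w. tev D (Z w)) (tker D)"
proof (induction D)
  case Nil
  show ?case using chaos_exp_zero by (simp add: tker_def[abs_def])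
next
  case (Cons x D)
  obtain c a h where x: "x = (c, a, h)" by (cases x)
  from chaos_exp_lincomb[OF chaos_exp_cos Cons, of c h a 1] show ?case
    by (simp add: x tker_def[abs_def])
qed

text \<open>The n inner products supply r^n, and Mehler's factor turns the Gaussian factor of r h
  into that of h.\<close>

lemma cos_kernel_scale:
  "exp (- ((1 - r\<^sup>2) * (norm h)\<^sup>2) / 2) * cos_kernel (r *\<^sub>R h) a n l = r ^ n * cos_kernel h a n l"
proof (cases "length l = n")
  case True
  have "(\<Prod>x\<leftarrow>l. inner x (r *\<^sub>R h)) = r ^ n * (\<Prod>x\<leftarrow>l. inner x h)"
    using True by (induction l arbitrary: n) auto
  moreover have "exp (- ((1 - r\<^sup>2) * (norm h)\<^sup>2) / 2) * exp (- (norm (r *\<^sub>R h))\<^sup>2 / 2) = exp (- (norm h)\<^sup>2 / 2)"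
    unfolding exp_add[symmetric] by (rule arg_cong[where f = exp]) (simp add: power_mult_distrib field_simps)
  ultimately show ?thesis using True by (simp add: cos_kernel_def mult.assoc[symmetric])
qed (simp add: cos_kernel_def)

lemma tker_tgam: "tker (tgam r D) = Gam r (tker D)"
proof (intro ext)
  fix n l
  show "tker (tgam r D) n l = Gam r (tker D) n l"
  proof (induction D)
    case (Cons x D)
    obtain c a h where x: "x = (c, a, h)" by (cases x)
    show ?case using Cons cos_kernel_scale[of r h a n l]
      by (simp add: x tker_def tgam_def Gam_def algebra_simps)
  qed (simp add: tker_def tgam_def Gam_def)
qed

lemma chaos_exp_tev_tgam: "chaos_exp (\<lambda>w. tev (tgam r D) (Z w)) (Gam r (tker D))"
  using chaos_exp_tev[of "tgam r D"] by (simp add: tker_tgam)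

lemma tensor_inner_Gam: "tensor_inner n (Gam r k n) (Gam q k' n) = (r * q) ^ n * tensor_inner n (k n) (k' n)"
  unfolding Gam_def using tensor_inner_scale[of n "r ^ n" "k n" "q ^ n" "k' n"] by (simp add: power_mult_distrib)

text \<open>Both integrals have the same Parseval series, since the powers of lam cancel in each
  degree. It moves \<Gamma>(c) between a trigonometric polynomial and the density.\<close>

lemma integral_Gam_duality:
  assumes "chaos_exp u k" "chaos_exp u' (Gam (1 / lam) k)" "chaos_exp \<xi> m" "chaos_exp \<eta> (Gam lam m)" "lam \<noteq> 0"
  shows "(LINT w|\<mu>. u' w * \<eta> w) = (LINT w|\<mu>. u w * \<xi> w)"
proof -
  have "(\<lambda>n. fact n * tensor_inner n (Gam (1 / lam) k n) (Gam lam m n)) sums (LINT w|\<mu>. u' w * \<eta> w)"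
    by (rule chaos_exp_parseval[OF assms(2,4)])
  then have "(\<lambda>n. fact n * tensor_inner n (k n) (m n)) sums (LINT w|\<mu>. u' w * \<eta> w)"
    using assms(5) by (simp add: tensor_inner_Gam)
  from sums_unique2[OF this chaos_exp_parseval[OF assms(1,3)]] show ?thesis .
qed

lemma n2_tev_power2: "(n2 \<mu> (\<lambda>w. tev D (Z w)))\<^sup>2 = tcorr 1 D D"
  unfolding n2_power2 using tev_tmult[OF linear_Z, of D D] by (simp add: power2_eq_square integral_tev tmean_tmult flip: tev_tmult[OF linear_Z])

lemma n2_tev_tgam_power2: "(n2 \<mu> (\<lambda>w. tev (tgam r D) (Z w)))\<^sup>2 = tcorr (r\<^sup>2) D D"
  unfolding n2_tev_power2 tcorr_tgam by (simp add: power2_eq_square)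

lemma linear_shift: "linear \<phi> \<Longrightarrow> linear (\<lambda>h. c * \<phi> h + s * Z b h)"
  by (rule linearI) (auto simp: linear_add linear_scale Z_add Z_scale algebra_simps)

lemma measurable_tev_shift [measurable]: "(\<lambda>b. tev D (\<lambda>h. c * \<phi> h + s * Z b h)) \<in> borel_measurable \<mu>"
proof (induction D)
  case (Cons x D)
  then show ?case by (cases x) simp
qed simp

lemma integral_tev_shift_mult:
  assumes \<phi>: "linear \<phi>"
  shows "(LINT b|\<mu>. tev D (\<lambda>h. c * \<phi> h + s * Z b h) * tev E (\<lambda>h. c * \<phi> h + (-s) * Z b h)) = tev (tQ c s D E) \<phi>"
proof -
  have intc: "integrable \<mu> (\<lambda>b. cos (c * \<phi> h + s * Z b h + a) * cos (c * \<phi> k + (-s) * Z b k + a'))" for h k a a'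
    by (rule integrable_const_bound[where B = 1]) (auto intro!: AE_I2 mult_le_one simp: abs_mult)
  have intE: "integrable \<mu> (\<lambda>b. cos (c * \<phi> h + s * Z b h + a) * tev E (\<lambda>h. c * \<phi> h + (-s) * Z b h))" for h a E
  proof (rule integrable_const_bound[where B = "tbound E"])
    show "AE b in \<mu>. norm (cos (c * \<phi> h + s * Z b h + a) * tev E (\<lambda>h. c * \<phi> h + (-s) * Z b h)) \<le> tbound E"
    proof (rule AE_I2)
      fix b
      have "\<bar>cos (c * \<phi> h + s * Z b h + a)\<bar> * \<bar>tev E (\<lambda>h. c * \<phi> h + (-s) * Z b h)\<bar> \<le> 1 * tbound E"
        by (intro mult_mono tev_le_tbound) auto
      then show "norm (cos (c * \<phi> h + s * Z b h + a) * tev E (\<lambda>h. c * \<phi> h + (-s) * Z b h)) \<le> tbound E" by (simp add: abs_mult)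
    qed
  qed measurable
  have intD: "integrable \<mu> (\<lambda>b. tev D (\<lambda>h. c * \<phi> h + s * Z b h) * tev E (\<lambda>h. c * \<phi> h + (-s) * Z b h))" for D
  proof (induction D)
    case (Cons x D)
    obtain u a h where x: "x = (u, a, h)" by (cases x)
    have "integrable \<mu> (\<lambda>b. u * (cos (c * \<phi> h + s * Z b h + a) * tev E (\<lambda>h. c * \<phi> h + (-s) * Z b h))
        + tev D (\<lambda>h. c * \<phi> h + s * Z b h) * tev E (\<lambda>h. c * \<phi> h + (-s) * Z b h))"
      by (intro Bochner_Integration.integrable_add integrable_mult_right intE Cons)
    then show ?case by (simp add: x algebra_simps)
  qed simp
  \<comment> \<open>The variable b enters the two arguments with opposite signs, so the cosine of
    the sum carries the frequency s (h - k) in b and the cosine of the difference carries s (h +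
    k).\<close>
  have single: "(LINT b|\<mu>. cos (c * \<phi> h + s * Z b h + a) * cos (c * \<phi> k + (-s) * Z b k + a'))
      = 1 / 2 * exp (- (s\<^sup>2 * (norm (h - k))\<^sup>2) / 2) * cos (\<phi> (c *\<^sub>R (h + k)) + (a + a'))
      + 1 / 2 * exp (- (s\<^sup>2 * (norm (h + k))\<^sup>2) / 2) * cos (\<phi> (c *\<^sub>R (h - k)) + (a - a'))" for h k a a'
  proof -
    have lin: "\<phi> (c *\<^sub>R (h + k)) = c * \<phi> h + c * \<phi> k" "\<phi> (c *\<^sub>R (h - k)) = c * \<phi> h - c * \<phi> k"
      using \<phi> by (simp_all add: linear_add linear_diff linear_scale algebra_simps)
    have eq: "cos (c * \<phi> h + s * Z b h + a) * cos (c * \<phi> k + (-s) * Z b k + a')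
        = 1 / 2 * cos (Z b (s *\<^sub>R (h - k)) + (\<phi> (c *\<^sub>R (h + k)) + (a + a')))
        + 1 / 2 * cos (Z b (s *\<^sub>R (h + k)) + (\<phi> (c *\<^sub>R (h - k)) + (a - a')))" for b
    proof -
      define A where "A = c * \<phi> h + s * Z b h + a"
      define B where "B = c * \<phi> k + (-s) * Z b k + a'"
      have e: "Z b (s *\<^sub>R (h - k)) + (\<phi> (c *\<^sub>R (h + k)) + (a + a')) = A + B"
        "Z b (s *\<^sub>R (h + k)) + (\<phi> (c *\<^sub>R (h - k)) + (a - a')) = A - B"
        unfolding lin A_def B_def by (simp_all add: Z_scale Z_add Z_diff algebra_simps)
      show ?thesis unfolding A_def[symmetric] B_def[symmetric] e cos_add[of A B] cos_diff[of A B] by (simp add: field_simps)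
    qed
    have i: "integrable \<mu> (\<lambda>b. cos (Z b h + a))" for h a by (intro all_moments_integrable all_moments_cos)
    show ?thesis unfolding eq
      by (subst Bochner_Integration.integral_add)
        (auto intro!: i simp: integral_cos_Z power_mult_distrib)
  qed
  have inner: "(LINT b|\<mu>. cos (c * \<phi> h + s * Z b h + a) * tev E (\<lambda>h. c * \<phi> h + (-s) * Z b h))
      = (\<Sum>(v, b, k)\<leftarrow>E. v * (1 / 2 * exp (- (s\<^sup>2 * (norm (h - k))\<^sup>2) / 2) * cos (\<phi> (c *\<^sub>R (h + k)) + (a + b))
      + 1 / 2 * exp (- (s\<^sup>2 * (norm (h + k))\<^sup>2) / 2) * cos (\<phi> (c *\<^sub>R (h - k)) + (a - b))))" for h a E
  proof (induction E)
    case (Cons y E)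
    obtain v a' k where y: "y = (v, a', k)" by (cases y)
    have "(LINT b|\<mu>. cos (c * \<phi> h + s * Z b h + a) * tev (y # E) (\<lambda>h. c * \<phi> h + (-s) * Z b h))
        = (LINT b|\<mu>. v * (cos (c * \<phi> h + s * Z b h + a) * cos (c * \<phi> k + (-s) * Z b k + a'))
          + cos (c * \<phi> h + s * Z b h + a) * tev E (\<lambda>h. c * \<phi> h + (-s) * Z b h))"
      by (simp add: y algebra_simps)
    also have "\<dots> = v * (LINT b|\<mu>. cos (c * \<phi> h + s * Z b h + a) * cos (c * \<phi> k + (-s) * Z b k + a'))
          + (LINT b|\<mu>. cos (c * \<phi> h + s * Z b h + a) * tev E (\<lambda>h. c * \<phi> h + (-s) * Z b h))"
      using intc[of h a k a'] intE[of h a E] by simp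
    finally show ?case unfolding Cons single by (simp add: y)
  qed simp
  show ?thesis
  proof (induction D)
    case (Cons x D)
    obtain u a h where x: "x = (u, a, h)" by (cases x)
    have "(LINT b|\<mu>. tev (x # D) (\<lambda>h. c * \<phi> h + s * Z b h) * tev E (\<lambda>h. c * \<phi> h + (-s) * Z b h))
        = (LINT b|\<mu>. u * (cos (c * \<phi> h + s * Z b h + a) * tev E (\<lambda>h. c * \<phi> h + (-s) * Z b h))
          + tev D (\<lambda>h. c * \<phi> h + s * Z b h) * tev E (\<lambda>h. c * \<phi> h + (-s) * Z b h))"
      by (simp add: x algebra_simps)
    also have "\<dots> = u * (LINT b|\<mu>. cos (c * \<phi> h + s * Z b h + a) * tev E (\<lambda>h. c * \<phi> h + (-s) * Z b h))
          + (LINT b|\<mu>. tev D (\<lambda>h. c * \<phi> h + s * Z b h) * tev E (\<lambda>h. c * \<phi> h + (-s) * Z b h))"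
      using intE[of h a E] intD[of D] by simp
    finally show ?case unfolding Cons inner
      by (simp add: x tev_tQ_sum sum_list_const_mult[symmetric] case_prod_unfold algebra_simps)
  qed (simp add: tev_tQ_sum)
qed

text \<open>Jensen's inequality in b bounds the square of Q (D, E) by Q (D^2, E^2) pointwise. The
  mean of the latter is a correlation with parameter \<alpha>, to which hypercontractivity
  applies.\<close>

lemma n2_tQ_power2_le:
  assumes "c\<^sup>2 + s\<^sup>2 = 1" "c\<^sup>2 - s\<^sup>2 = \<alpha>"
  shows "(n2 \<mu> (\<lambda>w. tev (tQ c s D E) (Z w)))\<^sup>2 \<le> tcorr \<alpha> (tmult D D) (tmult E E)"
proof -
  have le: "(tev (tQ c s D E) \<phi>)\<^sup>2 \<le> tev (tQ c s (tmult D D) (tmult E E)) \<phi>" if \<phi>: "linear \<phi>" for \<phi>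
  proof -
    define f where "f b = tev D (\<lambda>h. c * \<phi> h + s * Z b h) * tev E (\<lambda>h. c * \<phi> h + (-s) * Z b h)" for b
    have [measurable]: "f \<in> borel_measurable \<mu>" unfolding f_def[abs_def] by measurable
    have "\<bar>f b\<bar> \<le> tbound D * tbound E" for b
      unfolding f_def abs_mult by (intro mult_mono tev_le_tbound order_trans[OF abs_ge_zero tev_le_tbound]) simp
    then have f: "f \<in> L2 \<mu>" by (intro L2_bounded) measurable
    have "\<bar>LINT b|\<mu>. f b\<bar> \<le> n2 \<mu> f"
      using integral_abs_le_n2[OF f] integral_abs_bound[of \<mu> f] by linarith
    then have "\<bar>LINT b|\<mu>. f b\<bar>\<^sup>2 \<le> (n2 \<mu> f)\<^sup>2" by (intro power_mono) auto
    moreover have "(LINT b|\<mu>. f b) = tev (tQ c s D E) \<phi>"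
      unfolding f_def by (rule integral_tev_shift_mult[OF \<phi>])
    moreover have "(n2 \<mu> f)\<^sup>2 = tev (tQ c s (tmult D D) (tmult E E)) \<phi>"
    proof -
      have "(f b)\<^sup>2 = tev (tmult D D) (\<lambda>h. c * \<phi> h + s * Z b h) * tev (tmult E E) (\<lambda>h. c * \<phi> h + (-s) * Z b h)" for b
        unfolding tev_tmult[OF linear_shift[OF \<phi>]] f_def by (simp add: power2_eq_square mult_ac)
      then show ?thesis unfolding n2_power2 by (simp only: integral_tev_shift_mult[OF \<phi>])
    qed
    ultimately show ?thesis by simp
  qed
  have "(n2 \<mu> (\<lambda>w. tev (tQ c s D E) (Z w)))\<^sup>2 \<le> (LINT w|\<mu>. tev (tQ c s (tmult D D) (tmult E E)) (Z w))"
    unfolding n2_power2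
    by (intro integral_mono integrable_tev le linear_Z) (use L2_tev in \<open>simp add: L2_iff\<close>)
  also have "\<dots> = tcorr \<alpha> (tmult D D) (tmult E E)" by (simp add: integral_tev tmean_tQ[OF assms])
  finally show ?thesis .
qed

text \<open>Telescoping of a bilinear expression, read off from the integral representation; it is
  the source of the continuity of Q.\<close>

lemma tev_tQ_diff:
  fixes D E :: "'h trig"
  assumes \<phi>: "linear \<phi>"
  shows "tev (tQ c s D D) \<phi> - tev (tQ c s E E) \<phi>
    = tev (tQ c s (D @ tscale (-1) E) D) \<phi> + tev (tQ c s E (D @ tscale (-1) E)) \<phi>"
proof -
  let ?p = "\<lambda>b h. c * \<phi> h + s * Z b h" and ?m = "\<lambda>b h. c * \<phi> h + (-s) * Z b h"
  have i: "integrable \<mu> (\<lambda>b. tev D (?p b) * tev E (?m b))" for D E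
  proof (rule integrable_const_bound[where B = "tbound D * tbound E"])
    show "AE b in \<mu>. norm (tev D (?p b) * tev E (?m b)) \<le> tbound D * tbound E"
    proof (rule AE_I2)
      fix b
      have "\<bar>tev D (?p b)\<bar> * \<bar>tev E (?m b)\<bar> \<le> tbound D * tbound E"
        by (intro mult_mono tev_le_tbound order_trans[OF abs_ge_zero tev_le_tbound]) simp
      then show "norm (tev D (?p b) * tev E (?m b)) \<le> tbound D * tbound E" by (simp add: abs_mult)
    qed
  qed measurable
  show ?thesis
    unfolding integral_tev_shift_mult[OF \<phi>, symmetric]
    using i[of D D] i[of E E] i[of E D] by (simp add: algebra_simps)
qed

end

section \<open>The inequality for trigonometric polynomials\<close>

text \<open>Schur's argument: one factor \<open>inner (h i) (h k)\<close> is expanded over an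
  orthonormal list, and each term is absorbed into the weights u, which are therefore arbitrary in
  the induction.\<close>

lemma sum_gram_power_nonneg:
  fixes h :: "nat \<Rightarrow> 'h::real_inner"
  shows "0 \<le> (\<Sum>i<n. \<Sum>k<n. u i * u k * inner (h i) (h k) ^ m)"
proof (induction m arbitrary: u)
  case 0
  have "(\<Sum>i<n. \<Sum>k<n. u i * u k * inner (h i) (h k) ^ 0) = (\<Sum>i<n. u i) * (\<Sum>k<n. u k)"
    by (simp add: sum_product)
  then show ?case by simp
next
  case (Suc m)
  obtain es where es: "parseval_list es (span (h ` {..<n}))" by (rule exists_parseval_list[of "h ` {..<n}"]) simp_all
  have ip: "inner (h i) (h k) = (\<Sum>e\<leftarrow>es. inner e (h i) * inner e (h k))" if "i < n" "k < n" for i k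
    using es that by (simp add: parseval_list_def span_base)
  have "(\<Sum>i<n. \<Sum>k<n. u i * u k * inner (h i) (h k) ^ Suc m)
      = (\<Sum>i<n. \<Sum>k<n. \<Sum>e\<leftarrow>es. (u i * inner e (h i)) * (u k * inner e (h k)) * inner (h i) (h k) ^ m)"
  proof (intro sum.cong refl)
    fix i k assume "i \<in> {..<n}" "k \<in> {..<n}"
    then have "u i * u k * inner (h i) (h k) ^ Suc m = (u i * u k * inner (h i) (h k) ^ m) * (\<Sum>e\<leftarrow>es. inner e (h i) * inner e (h k))"
      using ip[of i k] by simp
    also have "\<dots> = (\<Sum>e\<leftarrow>es. (u i * inner e (h i)) * (u k * inner e (h k)) * inner (h i) (h k) ^ m)"
      unfolding sum_list_const_mult[symmetric] by (simp add: mult_ac)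
    finally show "u i * u k * inner (h i) (h k) ^ Suc m = (\<Sum>e\<leftarrow>es. (u i * inner e (h i)) * (u k * inner e (h k)) * inner (h i) (h k) ^ m)" .
  qed
  also have "\<dots> = (\<Sum>e\<leftarrow>es. \<Sum>i<n. \<Sum>k<n. (u i * inner e (h i)) * (u k * inner e (h k)) * inner (h i) (h k) ^ m)"
    by (induction es) (simp_all add: sum.distrib)
  also have "\<dots> \<ge> 0" by (intro sum_list_nonneg) (auto intro: Suc.IH)
  finally show ?case .
qed

lemma sum_gram_series_nonneg:
  fixes h :: "nat \<Rightarrow> 'h::real_inner"
  assumes "\<And>t. (\<lambda>m. b m * t ^ m) sums f t" "\<And>m. 0 \<le> b m"
  shows "0 \<le> (\<Sum>i<n. \<Sum>k<n. u i * u k * f (inner (h i) (h k)))"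
proof -
  have S: "(\<lambda>m. \<Sum>i<n. \<Sum>k<n. u i * u k * (b m * inner (h i) (h k) ^ m)) sums (\<Sum>i<n. \<Sum>k<n. u i * u k * f (inner (h i) (h k)))"
    by (intro sums_sum sums_mult assms(1))
  have nn: "0 \<le> (\<Sum>i<n. \<Sum>k<n. u i * u k * (b m * inner (h i) (h k) ^ m))" for m
  proof -
    have "(\<Sum>i<n. \<Sum>k<n. u i * u k * (b m * inner (h i) (h k) ^ m)) = b m * (\<Sum>i<n. \<Sum>k<n. u i * u k * inner (h i) (h k) ^ m)"
      unfolding sum_distrib_left by (simp add: mult_ac)
    then show ?thesis using assms(2) sum_gram_power_nonneg[of u h m n] by simp
  qed
  show ?thesis by (rule sums_le[OF nn sums_zero S])
qed

text \<open>The coefficients of \<open>exp (\<alpha> t) - exp t + (1 - \<alpha>) t exp t\<close> are nonnegative by Bernoulli's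
  inequality; this is the Gaussian Poincare inequality in disguise.\<close>

definition poincare_coeff :: "real \<Rightarrow> nat \<Rightarrow> real"
  where "poincare_coeff \<alpha> m = (\<alpha> ^ m - 1 + real m * (1 - \<alpha>)) / fact m"

lemma poincare_coeff_nonneg: "0 \<le> \<alpha> \<Longrightarrow> 0 \<le> poincare_coeff \<alpha> m"
  using Bernoulli_inequality[of "\<alpha> - 1" m] by (simp add: poincare_coeff_def algebra_simps)

lemma poincare_coeff_sums:
  "(\<lambda>m. poincare_coeff \<alpha> m * t ^ m) sums (exp (\<alpha> * t) - exp t + (1 - \<alpha>) * (t * exp t))"
proof -
  have 1: "(\<lambda>m. (\<alpha> * t) ^ m /\<^sub>R fact m) sums exp (\<alpha> * t)" and 2: "(\<lambda>m. t ^ m /\<^sub>R fact m) sums exp t"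
    by (rule exp_converges)+
  have "(\<lambda>m. t * (t ^ m /\<^sub>R fact m)) sums (t * exp t)" by (intro sums_mult 2)
  moreover have "t * (t ^ m /\<^sub>R fact m) = real (Suc m) * t ^ Suc m / fact (Suc m)" for m
    by (simp add: field_simps del: of_nat_Suc)
  ultimately have "(\<lambda>m. real m * t ^ m / fact m) sums (t * exp t)"
    using sums_Suc[of "\<lambda>m. real m * t ^ m / fact m" "t * exp t"] by simp
  then have "(\<lambda>m. (\<alpha> * t) ^ m /\<^sub>R fact m - t ^ m /\<^sub>R fact m + (1 - \<alpha>) * (real m * t ^ m / fact m))
      sums (exp (\<alpha> * t) - exp t + (1 - \<alpha>) * (t * exp t))"
    by (intro sums_add sums_diff sums_mult 1 2)
  moreover have "(\<alpha> * t) ^ m /\<^sub>R fact m - t ^ m /\<^sub>R fact m + (1 - \<alpha>) * (real m * t ^ m / fact m) = poincare_coeff \<alpha> m * t ^ m" for m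
    by (simp add: poincare_coeff_def power_mult_distrib divide_inverse algebra_simps)
  ultimately show ?thesis by (simp only:)
qed

definition tgrad :: "'h::real_vector trig \<Rightarrow> ('h \<Rightarrow> real) \<Rightarrow> 'h"
  where "tgrad D \<phi> = (\<Sum>(c, a, h)\<leftarrow>D. (- c * sin (\<phi> h + a)) *\<^sub>R h)"

text \<open>The squared norm of the gradient is again a trigonometric polynomial, a product of sines
  being a combination of cosines.\<close>

definition tgrad_sq :: "'h::real_inner trig \<Rightarrow> 'h trig"
  where "tgrad_sq D = concat (map (\<lambda>(u, a, h). concat (map (\<lambda>(v, b, k).
    [(- (u * v / 2 * inner h k), a + b, h + k), (u * v / 2 * inner h k, a - b, h - k)]) D)) D)"

text \<open>For d = 1 - \<alpha> this is the \<alpha>-square of D in closed form, of which Q is the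
  image under \<Gamma>(c).\<close>

definition tR :: "real \<Rightarrow> 'h::real_inner trig \<Rightarrow> 'h trig"
  where "tR d D = concat (map (\<lambda>(u, a, h). concat (map (\<lambda>(v, b, k).
    [(u * v / 2 * exp (d * inner h k), a + b, h + k), (u * v / 2 * exp (- (d * inner h k)), a - b, h - k)]) D)) D)"

lemma tev_tgrad_sq:
  fixes D :: "'h::real_inner trig"
  assumes \<phi>: "linear \<phi>" shows "tev (tgrad_sq D) \<phi> = (norm (tgrad D \<phi>))\<^sup>2"
proof -
  have e: "- (u * v / 2 * inner h k) * cos (\<phi> (h + k) + (a + b)) + u * v / 2 * inner h k * cos (\<phi> (h - k) + (a - b))
      = inner ((- u * sin (\<phi> h + a)) *\<^sub>R h) ((- v * sin (\<phi> k + b)) *\<^sub>R k)" for u v a b h k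
  proof -
    have "\<phi> (h + k) + (a + b) = (\<phi> h + a) + (\<phi> k + b)" "\<phi> (h - k) + (a - b) = (\<phi> h + a) - (\<phi> k + b)"
      using \<phi> by (simp_all add: linear_add linear_diff)
    then show ?thesis
      by (simp only: cos_add[of "\<phi> h + a"] cos_diff[of "\<phi> h + a"]) (simp add: algebra_simps)
  qed
  have "tev (tgrad_sq D) \<phi> = (\<Sum>(u, a, h)\<leftarrow>D. \<Sum>(v, b, k)\<leftarrow>D. inner ((- u * sin (\<phi> h + a)) *\<^sub>R h) ((- v * sin (\<phi> k + b)) *\<^sub>R k))"
    unfolding tev_def tgrad_sq_def sum_list_concat map_map o_def case_prod_unfold
    by (simp only: list.map sum_list.Cons sum_list.Nil fst_conv snd_conv add_0_right e)
  also have "\<dots> = (\<Sum>(u, a, h)\<leftarrow>D. inner ((- u * sin (\<phi> h + a)) *\<^sub>R h) (tgrad D \<phi>))"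
  proof -
    have *: "(\<Sum>(v, b, k)\<leftarrow>E. inner x ((- v * sin (\<phi> k + b)) *\<^sub>R k)) = inner x (tgrad E \<phi>)" for x :: 'h and E
      by (induction E) (auto simp: tgrad_def inner_add_right)
    show ?thesis by (simp only: *)
  qed
  also have "\<dots> = inner (tgrad D \<phi>) (tgrad D \<phi>)"
  proof -
    have "(\<Sum>(u, a, h)\<leftarrow>E. inner ((- u * sin (\<phi> h + a)) *\<^sub>R h) x) = inner (tgrad E \<phi>) x" for x :: 'h and E
      by (induction E) (auto simp: tgrad_def inner_add_left)
    then show ?thesis .
  qed
  finally show ?thesis by (simp add: power2_norm_eq_inner)
qed

lemma tQ_eq_tgam_tR:
  fixes D :: "'h::real_inner trig"
  assumes "c\<^sup>2 + s\<^sup>2 = 1"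
  shows "tQ c s D D = tgam c (tR (2 * s\<^sup>2) D)"
proof -
  have c: "1 - c\<^sup>2 = s\<^sup>2" using assms by simp
  have "exp (- (s\<^sup>2 * (norm (h - k))\<^sup>2) / 2) = exp (2 * s\<^sup>2 * inner h k) * exp (- ((1 - c\<^sup>2) * (norm (h + k))\<^sup>2) / 2)"
    "exp (- (s\<^sup>2 * (norm (h + k))\<^sup>2) / 2) = exp (- (2 * s\<^sup>2 * inner h k)) * exp (- ((1 - c\<^sup>2) * (norm (h - k))\<^sup>2) / 2)" for h k :: 'h
    unfolding exp_add[symmetric] norm_add_power2 norm_diff_power2 c
    by (rule arg_cong[where f = exp], simp add: field_simps)+
  then show ?thesis
    unfolding tR_def tQ_def tgam_concat map_map o_def case_prod_unfold
    by (simp only: tgam_def map_map o_def map_concat case_prod_unfold fst_conv snd_conv list.map mult.assoc)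
qed

lemma sum_list_eq_sum_nth: "(\<Sum>x\<leftarrow>D. f x) = (\<Sum>i<length D. f (D ! i))"
  by (simp add: sum_list_sum_nth atLeast0LessThan)

context abstract_wiener_space
begin

section \<open>Integrals against the density of the convolution\<close>

context
  fixes \<nu> :: "'w measure" and \<xi> :: "'w \<Rightarrow> real"
  assumes \<nu>: "prob_space \<nu>" "sets \<nu> = sets borel"
    and \<xi>: "\<xi> \<in> L2 \<mu>" "AE w in \<mu>. 0 \<le> \<xi> w"
    and conv: "convolve \<mu> \<nu> = density \<mu> (\<lambda>w. ennreal (\<xi> w))"
begin

text \<open>Fubini for the sum of a \<mu>-distributed and a \<nu>-distributed point: the integral
  over \<mu> is the characteristic function of L. Continuity of L is essential, since L is evaluated
  at \<nu>-distributed points.\<close>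

lemma integral_cos_blinfun_density:
  "(LINT w|\<mu>. cos (blinfun_apply L w + a) * \<xi> w) = exp (- (norm (j L))\<^sup>2 / 2) * (LINT y|\<nu>. cos (blinfun_apply L y + a))"
proof -
  interpret N: prob_space \<nu> by (rule \<nu>)
  interpret P: pair_prob_space \<mu> \<nu> ..
  note [measurable_cong] = sets_borel \<nu>(2)
  have [measurable]: "\<xi> \<in> borel_measurable \<mu>" using \<xi> by (simp add: L2_iff)
  have Lb [measurable]: "blinfun_apply L \<in> borel_measurable borel"
    using measurable_blinfun[of L] by (simp add: borel_measurable_eq)
  have "(LINT w|\<mu>. cos (blinfun_apply L w + a) * \<xi> w) = (LINT w|density \<mu> (\<lambda>w. ennreal (\<xi> w)). cos (blinfun_apply L w + a))"
    by (subst integral_density) (use \<xi>(2) in \<open>auto simp: mult.commute\<close>)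
  also have "\<dots> = (LINT w|distr (\<mu> \<Otimes>\<^sub>M \<nu>) borel (\<lambda>(x, y). x + y). cos (blinfun_apply L w + a))"
    unfolding conv[symmetric] convolve_eq_distr[OF prob \<nu>(1) sets_borel \<nu>(2)] ..
  also have "\<dots> = (LINT z|(\<mu> \<Otimes>\<^sub>M \<nu>). cos (blinfun_apply L (fst z + snd z) + a))"
    by (subst integral_distr) (auto simp: case_prod_unfold)
  also have "\<dots> = (LINT y|\<nu>. LINT x|\<mu>. cos (blinfun_apply L (x + y) + a))"
  proof -
    have "integrable (\<mu> \<Otimes>\<^sub>M \<nu>) (\<lambda>z. cos (blinfun_apply L (fst z + snd z) + a))"
      by (rule P.P.integrable_const_bound[where B = 1]) auto
    then have "integrable (\<mu> \<Otimes>\<^sub>M \<nu>) (\<lambda>(x, y). cos (blinfun_apply L (x + y) + a))" by (simp add: case_prod_unfold)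
    from P.integral_snd[OF this] show ?thesis by (simp add: case_prod_unfold)
  qed
  also have "\<dots> = (LINT y|\<nu>. exp (- (norm (j L))\<^sup>2 / 2) * cos (blinfun_apply L y + a))"
  proof (intro Bochner_Integration.integral_cong refl)
    fix y
    have "(LINT x|\<mu>. cos (blinfun_apply L (x + y) + a)) = (LINT x|\<mu>. cos (blinfun_apply L x + (blinfun_apply L y + a)))"
      by (simp add: blinfun.add_right add.assoc)
    then show "(LINT x|\<mu>. cos (blinfun_apply L (x + y) + a)) = exp (- (norm (j L))\<^sup>2 / 2) * cos (blinfun_apply L y + a)"
      by (simp add: centered_gaussian_cos[OF gaussian_blinfun])
  qed
  finally show ?thesis by simp
qed

definition ecos :: "'h \<Rightarrow> real \<Rightarrow> real" where "ecos h a = (LINT w|\<mu>. cos (Z w h + a) * \<xi> w)"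

lemma L2_cos_Z: "(\<lambda>w. cos (Z w h + a)) \<in> L2 \<mu>" by (intro all_moments_L2 all_moments_cos)

lemma ecos_dual_embed: "ecos (j L) a = exp (- (norm (j L))\<^sup>2 / 2) * (LINT y|\<nu>. cos (blinfun_apply L y + a))"
proof -
  have [measurable]: "\<xi> \<in> borel_measurable \<mu>" using \<xi> by (simp add: L2_iff)
  have "AE w in \<mu>. Z w (j L) = blinfun_apply L w" using Z_AE[of "j L"] X_dual_embed_AE[of L] by eventually_elim simp
  then have "ecos (j L) a = (LINT w|\<mu>. cos (blinfun_apply L w + a) * \<xi> w)"
    unfolding ecos_def by (intro integral_cong_AE) auto
  then show ?thesis by (simp add: integral_cos_blinfun_density)
qed

text \<open>The cosine is 1-Lipschitz, \<open>Z w (k - h)\<close> has L^2 norm |k - h|, and \<xi> is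
  square integrable. This carries the inequality from frequencies in the image of the dual to all of
  H.\<close>

lemma ecos_tendsto:
  assumes "(h \<longlongrightarrow> k) F" shows "((\<lambda>m. ecos (h m) a) \<longlongrightarrow> ecos k a) F"
proof -
  have "((\<lambda>m. n2 \<mu> (\<lambda>w. cos (Z w k + a) - cos (Z w (h m) + a))) \<longlongrightarrow> 0) F"
  proof (rule Lim_null_comparison)
    have "((\<lambda>m. norm (k - h m)) \<longlongrightarrow> norm (k - k)) F" by (intro tendsto_intros assms)
    then show "((\<lambda>m. norm (k - h m)) \<longlongrightarrow> 0) F" by simp
    show "\<forall>\<^sub>F m in F. norm (n2 \<mu> (\<lambda>w. cos (Z w k + a) - cos (Z w (h m) + a))) \<le> norm (k - h m)"
    proof (intro always_eventually allI)
      fix m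
      have "(n2 \<mu> (\<lambda>w. cos (Z w k + a) - cos (Z w (h m) + a)))\<^sup>2 \<le> (n2 \<mu> (\<lambda>w. Z w (k - h m)))\<^sup>2"
        unfolding n2_power2
      proof (rule integral_mono)
        show "integrable \<mu> (\<lambda>w. (cos (Z w k + a) - cos (Z w (h m) + a))\<^sup>2)" using L2_diff[OF L2_cos_Z L2_cos_Z] by (simp add: L2_iff)
        show "integrable \<mu> (\<lambda>w. (Z w (k - h m))\<^sup>2)" using L2_Z by (simp add: L2_iff)
        fix w
        have lip: "\<bar>cos x - cos y\<bar> \<le> \<bar>x - y\<bar>" for x y :: real
        proof -
          have "\<bar>cos x - cos y\<bar> = 2 * (\<bar>sin ((x + y) / 2)\<bar> * \<bar>sin ((y - x) / 2)\<bar>)"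
            by (simp add: cos_diff_cos abs_mult)
          also have "\<dots> \<le> 2 * (1 * \<bar>(y - x) / 2\<bar>)"
            by (intro mult_left_mono mult_mono abs_sin_le_one abs_sin_x_le_abs_x) auto
          finally show ?thesis by simp
        qed
        have "\<bar>cos (Z w k + a) - cos (Z w (h m) + a)\<bar> \<le> \<bar>Z w (k - h m)\<bar>"
          using lip[of "Z w k + a" "Z w (h m) + a"] by (simp add: Z_diff)
        then show "(cos (Z w k + a) - cos (Z w (h m) + a))\<^sup>2 \<le> (Z w (k - h m))\<^sup>2" by (simp add: abs_le_square_iff)
      qed
      then have "n2 \<mu> (\<lambda>w. cos (Z w k + a) - cos (Z w (h m) + a)) \<le> n2 \<mu> (\<lambda>w. Z w (k - h m))"
        by (rule power2_le_imp_le) simp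
      then show "norm (n2 \<mu> (\<lambda>w. cos (Z w k + a) - cos (Z w (h m) + a))) \<le> norm (k - h m)" by (simp add: n2_Z)
    qed
  qed
  then show ?thesis unfolding ecos_def
    by (intro integral_mult_tendsto_L2 L2_cos_Z \<xi> always_eventually allI)
qed

lemma poincare_sum_nonneg_dual:
  fixes L :: "nat \<Rightarrow> 'w \<Rightarrow>\<^sub>L real" and a u :: "nat \<Rightarrow> real"
  assumes \<alpha>: "0 \<le> \<alpha>"
  defines "t \<equiv> \<lambda>i k. (1 - \<alpha>) * inner (j (L i)) (j (L k))"
  shows "0 \<le> (\<Sum>i<n. \<Sum>k<n. u i * u k / 2 *
      (ecos (j (L i) + j (L k)) (a i + a k) * (exp (t i k) - 1 - t i k) +
       ecos (j (L i) - j (L k)) (a i - a k) * (exp (- t i k) - 1 + t i k)))"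
proof -
  interpret N: prob_space \<nu> by (rule \<nu>)
  note [measurable_cong] = \<nu>(2)
  define g where "g i = inner (j (L i))" for i
  define d where "d i = u i * exp (- (norm (j (L i)))\<^sup>2 / 2)" for i
  define E where "E x = exp (\<alpha> * x) - exp x + (1 - \<alpha>) * (x * exp x)" for x
  define th where "th i y = blinfun_apply (L i) y + a i" for i y
  have [measurable]: "th i \<in> borel_measurable \<nu>" for i
    unfolding th_def[abs_def] using measurable_blinfun[of "L i"] by (simp add: borel_measurable_eq)
  have jadd: "j (L i) + j (L k) = j (L i + L k)" for i k using dual_embed_lincomb[of 1 "L i" 1 "L k"] by simp
  have plus: "ecos (j (L i) + j (L k)) (a i + a k) = exp (- (norm (j (L i) + j (L k)))\<^sup>2 / 2) * (LINT y|\<nu>. cos (th i y + th k y))" for i k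
    unfolding jadd ecos_dual_embed by (simp add: th_def blinfun.add_left algebra_simps)
  have minus: "ecos (j (L i) - j (L k)) (a i - a k) = exp (- (norm (j (L i) - j (L k)))\<^sup>2 / 2) * (LINT y|\<nu>. cos (th i y - th k y))" for i k
    unfolding dual_embed_diff[symmetric] ecos_dual_embed by (simp add: th_def blinfun.diff_left algebra_simps)
  have ic: "integrable \<nu> (\<lambda>y. cos (th i y + th k y))" "integrable \<nu> (\<lambda>y. cos (th i y - th k y))" for i k
    by (auto intro!: N.integrable_const_bound[where B = 1])
  \<comment> \<open>The Gaussian factor of \<open>ecos\<close> splits into one factor per index,
    which goes into d, and the exponential of minus the inner product; the latter turns exp t - 1 -
    t into E at minus the inner product.\<close>
  have E_plus: "exp (- (norm (j (L i) + j (L k)))\<^sup>2 / 2) * (exp (t i k) - 1 - t i k) =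
      exp (- (norm (j (L i)))\<^sup>2 / 2) * exp (- (norm (j (L k)))\<^sup>2 / 2) * E (- inner (j (L i)) (j (L k)))" for i k
  proof -
    have "exp (- (norm (j (L i) + j (L k)))\<^sup>2 / 2) = exp (- (norm (j (L i)))\<^sup>2 / 2) * exp (- (norm (j (L k)))\<^sup>2 / 2) * exp (- inner (j (L i)) (j (L k)))"
      unfolding exp_add[symmetric] norm_add_power2 by (rule arg_cong[where f = exp]) (simp add: field_simps)
    moreover have "exp (- inner (j (L i)) (j (L k))) * exp (t i k) = exp (\<alpha> * (- inner (j (L i)) (j (L k))))"
      unfolding exp_add[symmetric] t_def by (rule arg_cong[where f = exp]) (simp add: algebra_simps)
    then have "exp (- inner (j (L i)) (j (L k))) * (exp (t i k) - 1 - t i k) = E (- inner (j (L i)) (j (L k)))"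
      by (simp add: E_def t_def algebra_simps)
    ultimately show ?thesis by (simp add: mult.assoc)
  qed
  have E_minus: "exp (- (norm (j (L i) - j (L k)))\<^sup>2 / 2) * (exp (- t i k) - 1 + t i k) =
      exp (- (norm (j (L i)))\<^sup>2 / 2) * exp (- (norm (j (L k)))\<^sup>2 / 2) * E (inner (j (L i)) (j (L k)))" for i k
  proof -
    have "exp (- (norm (j (L i) - j (L k)))\<^sup>2 / 2) = exp (- (norm (j (L i)))\<^sup>2 / 2) * exp (- (norm (j (L k)))\<^sup>2 / 2) * exp (inner (j (L i)) (j (L k)))"
      unfolding exp_add[symmetric] norm_diff_power2 by (rule arg_cong[where f = exp]) (simp add: field_simps)
    moreover have "exp (inner (j (L i)) (j (L k))) * exp (- t i k) = exp (\<alpha> * inner (j (L i)) (j (L k)))"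
      unfolding exp_add[symmetric] t_def by (rule arg_cong[where f = exp]) (simp add: algebra_simps)
    then have "exp (inner (j (L i)) (j (L k))) * (exp (- t i k) - 1 + t i k) = E (inner (j (L i)) (j (L k)))"
      by (simp add: E_def t_def algebra_simps)
    ultimately show ?thesis by (simp add: mult.assoc)
  qed
  have summand: "u i * u k / 2 * (ecos (j (L i) + j (L k)) (a i + a k) * (exp (t i k) - 1 - t i k) +
       ecos (j (L i) - j (L k)) (a i - a k) * (exp (- t i k) - 1 + t i k))
     = (LINT y|\<nu>. d i * d k / 2 * (cos (th i y + th k y) * E (- inner (j (L i)) (j (L k))) + cos (th i y - th k y) * E (inner (j (L i)) (j (L k)))))" for i k
  proof -
    have "u i * u k / 2 * (ecos (j (L i) + j (L k)) (a i + a k) * (exp (t i k) - 1 - t i k) +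
       ecos (j (L i) - j (L k)) (a i - a k) * (exp (- t i k) - 1 + t i k))
      = u i * u k / 2 * ((LINT y|\<nu>. cos (th i y + th k y)) * (exp (- (norm (j (L i) + j (L k)))\<^sup>2 / 2) * (exp (t i k) - 1 - t i k))
         + (LINT y|\<nu>. cos (th i y - th k y)) * (exp (- (norm (j (L i) - j (L k)))\<^sup>2 / 2) * (exp (- t i k) - 1 + t i k)))"
      unfolding plus minus by (simp only: mult_ac)
    also have "\<dots> = d i * d k / 2 * ((LINT y|\<nu>. cos (th i y + th k y)) * E (- inner (j (L i)) (j (L k)))
         + (LINT y|\<nu>. cos (th i y - th k y)) * E (inner (j (L i)) (j (L k))))"
      unfolding E_plus E_minus by (simp add: d_def algebra_simps)
    also have "\<dots> = (LINT y|\<nu>. d i * d k / 2 * (cos (th i y + th k y) * E (- inner (j (L i)) (j (L k))) + cos (th i y - th k y) * E (inner (j (L i)) (j (L k)))))"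
      using ic[of i k] by simp
    finally show ?thesis .
  qed
  have int: "integrable \<nu> (\<lambda>y. d i * d k / 2 * (cos (th i y + th k y) * E (- inner (j (L i)) (j (L k))) + cos (th i y - th k y) * E (inner (j (L i)) (j (L k)))))" for i k
    using ic[of i k] by simp
  have "(\<Sum>i<n. \<Sum>k<n. u i * u k / 2 *
      (ecos (j (L i) + j (L k)) (a i + a k) * (exp (t i k) - 1 - t i k) +
       ecos (j (L i) - j (L k)) (a i - a k) * (exp (- t i k) - 1 + t i k)))
     = (LINT y|\<nu>. (\<Sum>i<n. \<Sum>k<n. d i * d k / 2 * (cos (th i y + th k y) * E (- inner (j (L i)) (j (L k))) + cos (th i y - th k y) * E (inner (j (L i)) (j (L k))))))"
    unfolding summand
    by (subst Bochner_Integration.integral_sum, intro Bochner_Integration.integrable_sum int,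
        intro sum.cong refl, subst Bochner_Integration.integral_sum, intro int, rule refl)
  also have "\<dots> \<ge> 0"
  proof (rule Bochner_Integration.integral_nonneg)
    fix y
    \<comment> \<open>By the addition formulas the cosine weights p meet the even part of E and the
      sine weights q its odd part.\<close>
    define p where "p i = d i * cos (th i y)" for i
    define q where "q i = d i * sin (th i y)" for i
    have "(\<Sum>i<n. \<Sum>k<n. d i * d k / 2 * (cos (th i y + th k y) * E (- inner (j (L i)) (j (L k))) + cos (th i y - th k y) * E (inner (j (L i)) (j (L k)))))
        = (\<Sum>i<n. \<Sum>k<n. p i * p k * ((E (inner (j (L i)) (j (L k))) + E (- inner (j (L i)) (j (L k)))) / 2))
        + (\<Sum>i<n. \<Sum>k<n. q i * q k * ((E (inner (j (L i)) (j (L k))) - E (- inner (j (L i)) (j (L k)))) / 2))"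
      unfolding sum.distrib[symmetric]
      by (intro sum.cong refl) (simp add: p_def q_def cos_add cos_diff field_simps)
    moreover have "0 \<le> (\<Sum>i<n. \<Sum>k<n. p i * p k * ((E (inner (j (L i)) (j (L k))) + E (- inner (j (L i)) (j (L k)))) / 2))"
    proof (rule sum_gram_series_nonneg)
      fix x :: real
      \<comment> \<open>Taking the even part keeps the coefficients of even index and kills the
        others, so nonnegativity survives; likewise for the odd part.\<close>
      have "(\<lambda>m. (poincare_coeff \<alpha> m * x ^ m + poincare_coeff \<alpha> m * (- x) ^ m) / 2) sums ((E x + E (- x)) / 2)"
        unfolding E_def by (intro sums_divide sums_add poincare_coeff_sums)
      moreover have "(poincare_coeff \<alpha> m * x ^ m + poincare_coeff \<alpha> m * (- x) ^ m) / 2 = (poincare_coeff \<alpha> m * (1 + (-1) ^ m) / 2) * x ^ m" for m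
        by (simp add: power_minus[of x] field_simps)
      ultimately show "(\<lambda>m. (poincare_coeff \<alpha> m * (1 + (-1) ^ m) / 2) * x ^ m) sums ((E x + E (- x)) / 2)" by simp
    next
      fix m :: nat
      have "0 \<le> 1 + (-1 :: real) ^ m" by (cases "even m") auto
      then show "0 \<le> poincare_coeff \<alpha> m * (1 + (-1) ^ m) / 2" using poincare_coeff_nonneg[OF \<alpha>, of m] by simp
    qed
    moreover have "0 \<le> (\<Sum>i<n. \<Sum>k<n. q i * q k * ((E (inner (j (L i)) (j (L k))) - E (- inner (j (L i)) (j (L k)))) / 2))"
    proof (rule sum_gram_series_nonneg)
      fix x :: real
      have "(\<lambda>m. (poincare_coeff \<alpha> m * x ^ m - poincare_coeff \<alpha> m * (- x) ^ m) / 2) sums ((E x - E (- x)) / 2)"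
        unfolding E_def by (intro sums_divide sums_diff poincare_coeff_sums)
      moreover have "(poincare_coeff \<alpha> m * x ^ m - poincare_coeff \<alpha> m * (- x) ^ m) / 2 = (poincare_coeff \<alpha> m * (1 - (-1) ^ m) / 2) * x ^ m" for m
        by (simp add: power_minus[of x] field_simps)
      ultimately show "(\<lambda>m. (poincare_coeff \<alpha> m * (1 - (-1) ^ m) / 2) * x ^ m) sums ((E x - E (- x)) / 2)" by simp
    next
      fix m :: nat
      have "0 \<le> 1 - (-1 :: real) ^ m" by (cases "even m") auto
      then show "0 \<le> poincare_coeff \<alpha> m * (1 - (-1) ^ m) / 2" using poincare_coeff_nonneg[OF \<alpha>, of m] by simp
    qed
    ultimately show "0 \<le> (\<Sum>i<n. \<Sum>k<n. d i * d k / 2 * (cos (th i y + th k y) * E (- inner (j (L i)) (j (L k))) + cos (th i y - th k y) * E (inner (j (L i)) (j (L k)))))"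
      by linarith
  qed
  finally show ?thesis .
qed

lemma poincare_sum_nonneg:
  fixes h :: "nat \<Rightarrow> 'h" and a u :: "nat \<Rightarrow> real"
  assumes \<alpha>: "0 \<le> \<alpha>"
  defines "t \<equiv> \<lambda>i k. (1 - \<alpha>) * inner (h i) (h k)"
  shows "0 \<le> (\<Sum>i<n. \<Sum>k<n. u i * u k / 2 *
      (ecos (h i + h k) (a i + a k) * (exp (t i k) - 1 - t i k) +
       ecos (h i - h k) (a i - a k) * (exp (- t i k) - 1 + t i k)))"
proof -
  have "\<exists>L. (\<lambda>m. j (L m)) \<longlonglongrightarrow> h i" for i by (rule exists_dual_seq[of "h i"]) blast
  then obtain L where L: "\<And>i. (\<lambda>m. j (L i m)) \<longlonglongrightarrow> h i" by metis
  show ?thesis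
  proof (rule LIMSEQ_le_const)
    show "(\<lambda>m. \<Sum>i<n. \<Sum>k<n. u i * u k / 2 *
      (ecos (j (L i m) + j (L k m)) (a i + a k) * (exp ((1 - \<alpha>) * inner (j (L i m)) (j (L k m))) - 1 - (1 - \<alpha>) * inner (j (L i m)) (j (L k m))) +
       ecos (j (L i m) - j (L k m)) (a i - a k) * (exp (- ((1 - \<alpha>) * inner (j (L i m)) (j (L k m)))) - 1 + (1 - \<alpha>) * inner (j (L i m)) (j (L k m)))))
      \<longlonglongrightarrow> (\<Sum>i<n. \<Sum>k<n. u i * u k / 2 *
      (ecos (h i + h k) (a i + a k) * (exp (t i k) - 1 - t i k) +
       ecos (h i - h k) (a i - a k) * (exp (- t i k) - 1 + t i k)))"
      unfolding t_def by (intro tendsto_intros ecos_tendsto L)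
  qed (use poincare_sum_nonneg_dual[OF \<alpha>, of u "\<lambda>i. L i _"] in auto)
qed

lemma integral_tev_mult: "(LINT w|\<mu>. tev D (Z w) * \<xi> w) = (\<Sum>(c, a, h)\<leftarrow>D. c * ecos h a)"
proof (induction D)
  case (Cons x D)
  obtain c a h where x: "x = (c, a, h)" by (cases x)
  have "(LINT w|\<mu>. tev (x # D) (Z w) * \<xi> w) = (LINT w|\<mu>. c * (cos (Z w h + a) * \<xi> w) + tev D (Z w) * \<xi> w)"
    by (simp add: x algebra_simps)
  also have "\<dots> = c * ecos h a + (LINT w|\<mu>. tev D (Z w) * \<xi> w)"
    using L2_mult_integrable[OF L2_cos_Z \<xi>(1), of h a] L2_mult_integrable[OF L2_tev \<xi>(1), of D] by (simp add: ecos_def)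
  finally show ?case using Cons by (simp add: x)
qed simp

text \<open>All three integrals are double sums over pairs of terms of D, with \<open>ecos\<close>
  at h + k and at h - k. The coefficients of the difference combine to exp t - 1 - t and exp (- t) -
  1 + t, where t is (1 - \<alpha>) times the inner product of h and k.\<close>

theorem trig_inequality:
  assumes \<alpha>: "0 \<le> \<alpha>" and cs: "c\<^sup>2 + s\<^sup>2 = 1" "c\<^sup>2 - s\<^sup>2 = \<alpha>" "0 < c"
    and m: "chaos_exp \<xi> m" and \<eta>: "chaos_exp \<eta> (Gam (1 / c) m)"
  shows "(LINT w|\<mu>. (tev D (Z w))\<^sup>2 * \<xi> w) - (LINT w|\<mu>. tev (tQ c s D D) (Z w) * \<eta> w)
    \<le> (1 - \<alpha>) * (LINT w|\<mu>. (norm (tgrad D (Z w)))\<^sup>2 * \<xi> w)"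
proof -
  have s: "2 * s\<^sup>2 = 1 - \<alpha>" using cs by linarith
  have 1: "(LINT w|\<mu>. (tev D (Z w))\<^sup>2 * \<xi> w) = (\<Sum>(u, a, h)\<leftarrow>D. \<Sum>(v, b, k)\<leftarrow>D. u * v / 2 * (ecos (h + k) (a + b) + ecos (h - k) (a - b)))"
  proof -
    have "(LINT w|\<mu>. (tev D (Z w))\<^sup>2 * \<xi> w) = (LINT w|\<mu>. tev (tmult D D) (Z w) * \<xi> w)"
      unfolding tev_tmult[OF linear_Z] by (simp add: power2_eq_square)
    also have "\<dots> = (\<Sum>(u, a, h)\<leftarrow>D. \<Sum>(v, b, k)\<leftarrow>D. u * v / 2 * ecos (h + k) (a + b) + u * v / 2 * ecos (h - k) (a - b))"
      unfolding integral_tev_mult tmult_def sum_list_concat map_map o_def case_prod_unfold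
      by (simp only: list.map sum_list.Cons sum_list.Nil fst_conv snd_conv add_0_right)
    finally show ?thesis by (simp only: distrib_left)
  qed
  have 2: "(LINT w|\<mu>. tev (tQ c s D D) (Z w) * \<eta> w) = (\<Sum>(u, a, h)\<leftarrow>D. \<Sum>(v, b, k)\<leftarrow>D. u * v / 2 *
      (exp ((1 - \<alpha>) * inner h k) * ecos (h + k) (a + b) + exp (- ((1 - \<alpha>) * inner h k)) * ecos (h - k) (a - b)))"
  proof -
    \<comment> \<open>Q is \<Gamma>(c) applied to the closed form, and \<eta> is \<Gamma>(1 / c)
      \<xi>; by duality the two operators cancel.\<close>
    have "(LINT w|\<mu>. tev (tgam c (tR (2 * s\<^sup>2) D)) (Z w) * \<eta> w) = (LINT w|\<mu>. tev (tR (2 * s\<^sup>2) D) (Z w) * \<xi> w)"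
      by (rule integral_Gam_duality[OF chaos_exp_tev _ m \<eta>]) (use cs chaos_exp_tev_tgam in auto)
    also have "\<dots> = (\<Sum>(u, a, h)\<leftarrow>D. \<Sum>(v, b, k)\<leftarrow>D. u * v / 2 * exp ((1 - \<alpha>) * inner h k) * ecos (h + k) (a + b)
        + u * v / 2 * exp (- ((1 - \<alpha>) * inner h k)) * ecos (h - k) (a - b))"
      unfolding s integral_tev_mult tR_def sum_list_concat map_map o_def case_prod_unfold
      by (simp only: list.map sum_list.Cons sum_list.Nil fst_conv snd_conv add_0_right)
    finally show ?thesis unfolding tQ_eq_tgam_tR[OF cs(1)] by (simp only: distrib_left mult.assoc)
  qed
  have 3: "(LINT w|\<mu>. (norm (tgrad D (Z w)))\<^sup>2 * \<xi> w) = (\<Sum>(u, a, h)\<leftarrow>D. \<Sum>(v, b, k)\<leftarrow>D. u * v / 2 *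
      (inner h k * (ecos (h - k) (a - b) - ecos (h + k) (a + b))))"
  proof -
    have "(LINT w|\<mu>. (norm (tgrad D (Z w)))\<^sup>2 * \<xi> w) = (LINT w|\<mu>. tev (tgrad_sq D) (Z w) * \<xi> w)"
      unfolding tev_tgrad_sq[OF linear_Z] ..
    also have "\<dots> = (\<Sum>(u, a, h)\<leftarrow>D. \<Sum>(v, b, k)\<leftarrow>D. - (u * v / 2 * inner h k) * ecos (h + k) (a + b) + u * v / 2 * inner h k * ecos (h - k) (a - b))"
      unfolding integral_tev_mult tgrad_sq_def sum_list_concat map_map o_def case_prod_unfold
      by (simp only: list.map sum_list.Cons sum_list.Nil fst_conv snd_conv add_0_right)
    moreover have "- (u * v / 2 * i) * x + u * v / 2 * i * y = u * v / 2 * (i * (y - x))" for u v i x y :: real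
      by (simp add: algebra_simps)
    ultimately show ?thesis by (simp only:)
  qed
  define h where "h i = snd (snd (D ! i))" for i
  define a where "a i = fst (snd (D ! i))" for i
  define u where "u i = fst (D ! i)" for i
  define t where "t i k = (1 - \<alpha>) * inner (h i) (h k)" for i k
  let ?n = "length D"
  have e: "r * (p * (x - 1 - (1 - \<alpha>) * i) + q * (y - 1 + (1 - \<alpha>) * i))
      = (1 - \<alpha>) * (r * (i * (q - p))) - r * (p + q) + r * (x * p + y * q)" for r p q x y i
    by (simp add: algebra_simps)
  have "0 \<le> (\<Sum>i<?n. \<Sum>k<?n. u i * u k / 2 *
      (ecos (h i + h k) (a i + a k) * (exp (t i k) - 1 - t i k) +
       ecos (h i - h k) (a i - a k) * (exp (- t i k) - 1 + t i k)))"
    unfolding t_def by (rule poincare_sum_nonneg[OF \<alpha>])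
  also have "\<dots> = (1 - \<alpha>) * (\<Sum>i<?n. \<Sum>k<?n. u i * u k / 2 * (inner (h i) (h k) * (ecos (h i - h k) (a i - a k) - ecos (h i + h k) (a i + a k))))
      - (\<Sum>i<?n. \<Sum>k<?n. u i * u k / 2 * (ecos (h i + h k) (a i + a k) + ecos (h i - h k) (a i - a k)))
      + (\<Sum>i<?n. \<Sum>k<?n. u i * u k / 2 * (exp ((1 - \<alpha>) * inner (h i) (h k)) * ecos (h i + h k) (a i + a k)
        + exp (- ((1 - \<alpha>) * inner (h i) (h k))) * ecos (h i - h k) (a i - a k)))"
    unfolding sum_distrib_left sum_subtractf[symmetric] sum.distrib[symmetric] t_def
    by (intro sum.cong refl) (rule e)
  also have "\<dots> = (1 - \<alpha>) * (LINT w|\<mu>. (norm (tgrad D (Z w)))\<^sup>2 * \<xi> w) - (LINT w|\<mu>. (tev D (Z w))\<^sup>2 * \<xi> w)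
      + (LINT w|\<mu>. tev (tQ c s D D) (Z w) * \<eta> w)"
    unfolding 1 2 3 sum_list_eq_sum_nth case_prod_unfold h_def a_def u_def ..
  finally show ?thesis by simp
qed

end

end

section \<open>Approximation of smooth cylindrical functions\<close>

text \<open>Bernstein polynomials in de Casteljau form: \<open>\<Sum>k\<le>n. a k * (n choose k) u\<^sup>k (1 - u)\<^sup>n\<^sup>-\<^sup>k\<close>.\<close>

fun bernstein_sum :: "nat \<Rightarrow> (nat \<Rightarrow> 'a::real_vector) \<Rightarrow> real \<Rightarrow> 'a" where
  "bernstein_sum 0 a u = a 0"
| "bernstein_sum (Suc n) a u = u *\<^sub>R bernstein_sum n (\<lambda>k. a (Suc k)) u + (1 - u) *\<^sub>R bernstein_sum n a u"

lemma bernstein_sum_add: "bernstein_sum n (\<lambda>k. a k + b k) u = bernstein_sum n a u + bernstein_sum n b u"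
  by (induction n arbitrary: a b) (simp_all add: scaleR_add_right)

lemma bernstein_sum_scaleR: "bernstein_sum n (\<lambda>k. c *\<^sub>R a k) u = c *\<^sub>R bernstein_sum n a u"
  by (induction n arbitrary: a) (simp_all add: scaleR_add_right mult.commute)

lemma bernstein_sum_diff: "bernstein_sum n (\<lambda>k. a k - b k) u = bernstein_sum n a u - bernstein_sum n b u"
  using bernstein_sum_add[of n "\<lambda>k. a k - b k" b u] by simp

lemma bernstein_sum_const: "bernstein_sum n (\<lambda>k. c) u = c"
  by (induction n) (simp_all add: scaleR_left_diff_distrib)

lemma norm_bernstein_sum_le:
  fixes a :: "nat \<Rightarrow> 'a::real_normed_vector"
  assumes "0 \<le> u" "u \<le> 1" "\<And>k. k \<le> n \<Longrightarrow> norm (a k) \<le> b k"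
  shows "norm (bernstein_sum n a u) \<le> bernstein_sum n b u"
  using assms(3)
proof (induction n arbitrary: a b)
  case (Suc n)
  have "norm (bernstein_sum n (\<lambda>k. a (Suc k)) u) \<le> bernstein_sum n (\<lambda>k. b (Suc k)) u" "norm (bernstein_sum n a u) \<le> bernstein_sum n b u"
    by (auto intro!: Suc)
  then have "u * norm (bernstein_sum n (\<lambda>k. a (Suc k)) u) + (1 - u) * norm (bernstein_sum n a u)
      \<le> u * bernstein_sum n (\<lambda>k. b (Suc k)) u + (1 - u) * bernstein_sum n b u"
    using assms by (intro add_mono mult_left_mono) auto
  moreover have "norm (bernstein_sum (Suc n) a u) \<le> u * norm (bernstein_sum n (\<lambda>k. a (Suc k)) u) + (1 - u) * norm (bernstein_sum n a u)"
    using norm_triangle_ineq[of "u *\<^sub>R bernstein_sum n (\<lambda>k. a (Suc k)) u" "(1 - u) *\<^sub>R bernstein_sum n a u"] assms(1,2) by simp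
  ultimately show ?case by simp
qed (use assms in auto)

text \<open>The second moment about c of the binomial law with parameters n and u: squared bias plus
  variance.\<close>

lemma bernstein_sum_square:
  "bernstein_sum n (\<lambda>k. (real k - c)\<^sup>2) u = (real n * u - c)\<^sup>2 + real n * (u * (1 - u))"
proof (induction n arbitrary: c)
  case (Suc n)
  have "bernstein_sum n (\<lambda>k. (real (Suc k) - c)\<^sup>2) u = (real n * u - (c - 1))\<^sup>2 + real n * (u * (1 - u))"
    using Suc[of "c - 1"] by (simp add: algebra_simps)
  then show ?case unfolding bernstein_sum.simps Suc[of c] by (simp only:) (simp add: power2_eq_square algebra_simps)
qed simp

text \<open>The mean deviation of k / N from u under the binomial law is controlled by the variance.
  The case N = n + 1 is included because the derivative of a Bernstein polynomial of degree N is a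
  Bernstein sum of degree N - 1 over the same grid.\<close>

lemma bernstein_sum_approx:
  fixes a :: "nat \<Rightarrow> 'a::real_normed_vector"
  assumes u: "0 \<le> u" "u \<le> 1" and N: "n \<le> N" "N \<le> Suc n" "0 < N" and L: "0 \<le> L"
    and a: "\<And>k. k \<le> n \<Longrightarrow> norm (a k - z) \<le> L * \<bar>real k / real N - u\<bar> + e"
  shows "norm (bernstein_sum n a u - z) \<le> L / sqrt (real N) + e"
proof -
  define q where "q = sqrt (real N)"
  have q: "0 < q" "q\<^sup>2 = real N" using N by (auto simp: q_def)
  \<comment> \<open>A quadratic majorant of the modulus, balanced by q = sqrt N; it reduces the mean
    deviation to the second moment.\<close>
  have le: "\<bar>x\<bar> \<le> 1 / (2 * q) + q * x\<^sup>2 / 2" for x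
  proof -
    have "0 \<le> (q * \<bar>x\<bar> - 1)\<^sup>2 / (2 * q)" using q by simp
    also have "(q * \<bar>x\<bar> - 1)\<^sup>2 / (2 * q) = q * x\<^sup>2 / 2 + 1 / (2 * q) - \<bar>x\<bar>"
      using q(1) by (simp add: power2_diff power_mult_distrib field_simps) (simp add: power2_eq_square)
    finally show ?thesis by simp
  qed
  have "norm (a k - z) \<le> (L / (2 * q) + e) + (L * q / (2 * (real N)\<^sup>2)) * (real k - real N * u)\<^sup>2" if "k \<le> n" for k
  proof -
    have "L * \<bar>real k / real N - u\<bar> \<le> L * (1 / (2 * q) + q * (real k / real N - u)\<^sup>2 / 2)"
      by (intro mult_left_mono le L)
    also have "(real k / real N - u)\<^sup>2 = (real k - real N * u)\<^sup>2 / (real N)\<^sup>2"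
      using N by (simp add: power_divide[symmetric] diff_divide_distrib)
    finally show ?thesis using a[OF that] by (simp add: algebra_simps)
  qed
  then have "norm (bernstein_sum n (\<lambda>k. a k - z) u)
      \<le> bernstein_sum n (\<lambda>k. (L / (2 * q) + e) + (L * q / (2 * (real N)\<^sup>2)) * (real k - real N * u)\<^sup>2) u"
    by (intro norm_bernstein_sum_le u)
  also have "\<dots> = (L / (2 * q) + e) + (L * q / (2 * (real N)\<^sup>2)) * ((real n * u - real N * u)\<^sup>2 + real n * (u * (1 - u)))"
    using bernstein_sum_scaleR[of n "L * q / (2 * (real N)\<^sup>2)" "\<lambda>k. (real k - real N * u)\<^sup>2" u]
    by (simp add: bernstein_sum_add bernstein_sum_const bernstein_sum_square)
  also have "\<dots> \<le> (L / (2 * q) + e) + (L * q / (2 * (real N)\<^sup>2)) * real N"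
  proof (intro add_left_mono mult_left_mono)
    \<comment> \<open>For N = n the bias vanishes; for N = n + 1 its square is u^2 \<le> u, which
      still fits because n u + u \<le> N.\<close>
    have "N = n \<or> N = Suc n" using N by auto
    then have "(real n * u - real N * u)\<^sup>2 \<le> (real N - real n) * u\<^sup>2" by (auto simp: algebra_simps)
    moreover have "u\<^sup>2 \<le> u" using u by (simp add: power2_eq_square mult_left_le)
    moreover have "(real N - real n) * u\<^sup>2 \<le> (real N - real n) * u" using N calculation(2) by (intro mult_left_mono) auto
    moreover have "real n * (u * (1 - u)) \<le> real n * u" using u by (intro mult_left_mono mult_left_le) auto
    moreover have "(real N - real n) * u + real n * u \<le> real N" using u mult_left_le[of u "real N"] by (simp add: algebra_simps)
    ultimately show "(real n * u - real N * u)\<^sup>2 + real n * (u * (1 - u)) \<le> real N" by linarith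
  qed (use L q in auto)
  also have "\<dots> = L / q + e"
    unfolding q(2)[symmetric] using q(1) by (simp add: field_simps power2_eq_square)
  finally show ?thesis by (simp add: bernstein_sum_diff bernstein_sum_const q_def)
qed

section \<open>Bernstein polynomials with trigonometric polynomials as coefficients\<close>

lemma tgrad_Nil [simp]: "tgrad [] \<phi> = 0" by (simp add: tgrad_def)
lemma tgrad_Cons [simp]: "tgrad ((c, a, h) # D) \<phi> = (- c * sin (\<phi> h + a)) *\<^sub>R h + tgrad D \<phi>" by (simp add: tgrad_def)
lemma tgrad_append [simp]: "tgrad (D @ E) \<phi> = tgrad D \<phi> + tgrad E \<phi>" by (simp add: tgrad_def)

lemma tgrad_tscale [simp]: "tgrad (tscale r D) \<phi> = r *\<^sub>R tgrad D \<phi>"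
  by (induction D) (auto simp: tscale_def algebra_simps)

lemma tgrad_tmult:
  fixes D E :: "'a::real_vector trig"
  assumes \<phi>: "linear \<phi>"
  shows "tgrad (tmult D E) \<phi> = tev D \<phi> *\<^sub>R tgrad E \<phi> + tev E \<phi> *\<^sub>R tgrad D \<phi>"
proof (induction D)
  case (Cons x D)
  obtain c a h where x: "x = (c, a, h)" by (cases x)
  have "tgrad (concat (map (\<lambda>(d, b, k). [(c * d / 2, a + b, h + k), (c * d / 2, a - b, h - k)]) E)) \<phi>
      = (c * cos (\<phi> h + a)) *\<^sub>R tgrad E \<phi> + tev E \<phi> *\<^sub>R ((- c * sin (\<phi> h + a)) *\<^sub>R h)"
  proof (induction E)
    case (Cons y E)
    obtain d b k where y: "y = (d, b, k)" by (cases y)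
    have e: "\<phi> (h + k) + (a + b) = (\<phi> h + a) + (\<phi> k + b)" "\<phi> (h - k) + (a - b) = (\<phi> h + a) - (\<phi> k + b)"
      using \<phi> by (simp_all add: linear_add linear_diff)
    define p q P Q where "p = cos (\<phi> h + a)" "q = sin (\<phi> h + a)" "P = cos (\<phi> k + b)" "Q = sin (\<phi> k + b)"
    have "(- (c * d / 2) * sin (\<phi> (h + k) + (a + b))) *\<^sub>R (h + k) + (- (c * d / 2) * sin (\<phi> (h - k) + (a - b))) *\<^sub>R (h - k)
       = (- (c * d / 2) * (q * P + p * Q)) *\<^sub>R (h + k) + (- (c * d / 2) * (q * P - p * Q)) *\<^sub>R (h - k)"
      unfolding e sin_add[of "\<phi> h + a"] sin_diff[of "\<phi> h + a"] p_q_P_Q_def ..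
    also have "\<dots> = (- (c * d / 2) * (q * P + p * Q) + - (c * d / 2) * (q * P - p * Q)) *\<^sub>R h
        + (- (c * d / 2) * (q * P + p * Q) - - (c * d / 2) * (q * P - p * Q)) *\<^sub>R k"
      by (simp only: scaleR_add_right scaleR_diff_right scaleR_add_left scaleR_left_diff_distrib) simp
    also have "- (c * d / 2) * (q * P + p * Q) + - (c * d / 2) * (q * P - p * Q) = (d * P) * (- c * q)" by (simp add: field_simps)
    also have "- (c * d / 2) * (q * P + p * Q) - - (c * d / 2) * (q * P - p * Q) = (c * p) * (- d * Q)" by (simp add: field_simps)
    finally have 1: "(- (c * d / 2) * sin (\<phi> (h + k) + (a + b))) *\<^sub>R (h + k) + (- (c * d / 2) * sin (\<phi> (h - k) + (a - b))) *\<^sub>R (h - k)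
       = (d * P) *\<^sub>R ((- c * q) *\<^sub>R h) + (c * p) *\<^sub>R ((- d * Q) *\<^sub>R k)" by simp
    have gen: "A + (B + (x *\<^sub>R G + e *\<^sub>R w)) = x *\<^sub>R (z + G) + (v + e) *\<^sub>R w"
      if "A + B = v *\<^sub>R w + x *\<^sub>R z" for A B G w z :: 'a and x e v :: real
    proof -
      have "A + (B + (x *\<^sub>R G + e *\<^sub>R w)) = (A + B) + (x *\<^sub>R G + e *\<^sub>R w)" by (simp only: add.assoc)
      then show ?thesis unfolding that by (simp add: scaleR_add_right scaleR_add_left)
    qed
    show ?case
      unfolding y list.map concat.simps prod.case tgrad_append Cons.IH tgrad_Cons tgrad_Nil append_Cons append_Nil add_0_right tev_Cons
      by (rule gen[OF 1[unfolded p_q_P_Q_def]])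
  qed simp
  then show ?case using Cons by (simp add: x tmult_Cons algebra_simps)
qed simp

text \<open>De Casteljau's scheme with the trigonometric polynomial U as variable and U' in the role
  of 1 - U.\<close>

fun tbern :: "'h::real_vector trig \<Rightarrow> 'h trig \<Rightarrow> nat \<Rightarrow> (nat \<Rightarrow> 'h trig) \<Rightarrow> 'h trig" where
  "tbern U U' 0 A = A 0"
| "tbern U U' (Suc n) A = tmult U (tbern U U' n (\<lambda>k. A (Suc k))) @ tmult U' (tbern U U' n A)"

lemma tev_tbern:
  assumes "linear \<phi>" "tev U' \<phi> = 1 - tev U \<phi>"
  shows "tev (tbern U U' n A) \<phi> = bernstein_sum n (\<lambda>k. tev (A k) \<phi>) (tev U \<phi>)"
  by (induction n arbitrary: A) (simp_all add: tev_tmult assms)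

text \<open>The Leibniz rule, combined with the classical derivative of a Bernstein polynomial: n
  times the Bernstein polynomial of degree n - 1 of the forward differences.\<close>

lemma tgrad_tbern:
  assumes "linear \<phi>" "tev U' \<phi> = 1 - tev U \<phi>" "tgrad U' \<phi> = - tgrad U \<phi>"
  shows "tgrad (tbern U U' n A) \<phi> = bernstein_sum n (\<lambda>k. tgrad (A k) \<phi>) (tev U \<phi>)
    + (real n * bernstein_sum (n - 1) (\<lambda>k. tev (A (Suc k)) \<phi> - tev (A k) \<phi>) (tev U \<phi>)) *\<^sub>R tgrad U \<phi>"
proof (induction n arbitrary: A)
  case (Suc n)
  let ?b = "\<lambda>A. bernstein_sum n (\<lambda>k. tev (A k) \<phi>) (tev U \<phi>)"
  let ?d = "\<lambda>n A. bernstein_sum n (\<lambda>k. tev (A (Suc k)) \<phi> - tev (A k) \<phi>) (tev U \<phi>)"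
  have *: "real (Suc n) * ?d n A = tev U \<phi> * (real n * ?d (n - 1) (\<lambda>k. A (Suc k))) + (1 - tev U \<phi>) * (real n * ?d (n - 1) A)
      + (?b (\<lambda>k. A (Suc k)) - ?b A)"
  proof -
    have "?d n A = ?b (\<lambda>k. A (Suc k)) - ?b A" by (simp add: bernstein_sum_diff)
    moreover have "real n * ?d n A = real n * (tev U \<phi> * ?d (n - 1) (\<lambda>k. A (Suc k)) + (1 - tev U \<phi>) * ?d (n - 1) A)"
      by (cases n) simp_all
    moreover have "real (Suc n) * x = real n * x + x" for x by (simp add: algebra_simps)
    ultimately have "real (Suc n) * ?d n A = real n * (tev U \<phi> * ?d (n - 1) (\<lambda>k. A (Suc k)) + (1 - tev U \<phi>) * ?d (n - 1) A)
      + (?b (\<lambda>k. A (Suc k)) - ?b A)" by presburger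
    then show ?thesis by (simp only: distrib_left mult.left_commute)
  qed
  show ?case
    unfolding tbern.simps tgrad_append tgrad_tmult[OF assms(1)] tev_tbern[OF assms(1,2)] assms(2,3) Suc.IH diff_Suc_1 *
    by (simp add: algebra_simps)
qed simp

text \<open>Differentiability is only required along the first m coordinate axes.\<close>

definition C11_fun :: "nat \<Rightarrow> real \<Rightarrow> ((nat \<Rightarrow> real) \<Rightarrow> real) \<Rightarrow> (nat \<Rightarrow> (nat \<Rightarrow> real) \<Rightarrow> real) \<Rightarrow> bool"
  where "C11_fun m L g g' \<longleftrightarrow> (\<forall>x y. (\<forall>i<m. x i = y i) \<longrightarrow> g x = g y) \<and>
    (\<forall>i<m. \<forall>x t. ((\<lambda>t. g (x(i := t))) has_real_derivative g' i (x(i := t))) (at t)) \<and>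
    (\<forall>i<m. \<forall>x. \<bar>g' i x\<bar> \<le> L) \<and>
    (\<forall>i<m. \<forall>j<m. \<forall>x s t. \<bar>g' j (x(i := s)) - g' j (x(i := t))\<bar> \<le> L * \<bar>s - t\<bar>)"

lemma C11_fun_freeze:
  assumes "C11_fun (Suc m) L g g'"
  shows "C11_fun m L (\<lambda>x. g (x(m := t))) (\<lambda>i x. g' i (x(m := t)))"
proof -
  have tw: "i < m \<Longrightarrow> x(i := s, m := t) = x(m := t, i := s)" for i s and x :: "nat \<Rightarrow> real" by (auto simp: fun_upd_twist)
  show ?thesis
    unfolding C11_fun_def
  proof (intro conjI allI impI)
    fix x y :: "nat \<Rightarrow> real" assume "\<forall>i<m. x i = y i"
    then show "g (x(m := t)) = g (y(m := t))" using assms unfolding C11_fun_def by (auto simp: less_Suc_eq)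
  next
    fix i x s assume "i < m"
    then show "((\<lambda>s. g (x(i := s, m := t))) has_real_derivative g' i (x(i := s, m := t))) (at s)"
      unfolding tw[OF \<open>i < m\<close>] using assms unfolding C11_fun_def by simp
  next
    fix i x assume "i < m"
    then show "\<bar>g' i (x(m := t))\<bar> \<le> L" using assms unfolding C11_fun_def by simp
  next
    fix i j x s s' assume "i < m" "j < m"
    then show "\<bar>g' j (x(i := s, m := t)) - g' j (x(i := s', m := t))\<bar> \<le> L * \<bar>s - s'\<bar>"
      unfolding tw[OF \<open>i < m\<close>] using assms unfolding C11_fun_def by simp
  qed
qed

lemma C11_fun_lipschitz:
  assumes "C11_fun m L g g'" "i < m"
  shows "\<bar>g (x(i := s)) - g (x(i := t))\<bar> \<le> L * \<bar>s - t\<bar>"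
proof -
  have "norm (g (x(i := s)) - g (x(i := t))) \<le> L * norm (s - t)"
    by (rule field_differentiable_bound[of UNIV "\<lambda>t. g (x(i := t))" "\<lambda>t. g' i (x(i := t))"])
       (use assms in \<open>auto simp: C11_fun_def\<close>)
  then show ?thesis by simp
qed

text \<open>The mean value theorem yields the slope at some point between s and t, and the Lipschitz
  bound moves it to y. It compares difference quotients on a grid with the partial
  derivative.\<close>

lemma C11_fun_mvt:
  assumes C: "C11_fun m L g g'" and i: "i < m" and st: "s < t"
  shows "\<bar>g (x(i := t)) - g (x(i := s)) - (t - s) * g' i (x(i := y))\<bar> \<le> (t - s) * (L * (\<bar>s - y\<bar> + (t - s)))"
proof -
  obtain z where z: "s < z" "z < t" "g (x(i := t)) - g (x(i := s)) = (t - s) * g' i (x(i := z))"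
    using MVT2[OF st, of "\<lambda>t. g (x(i := t))" "\<lambda>t. g' i (x(i := t))"] C i unfolding C11_fun_def by auto
  have L: "0 \<le> L" using C i unfolding C11_fun_def by (meson abs_ge_zero order_trans)
  have "\<bar>g' i (x(i := z)) - g' i (x(i := y))\<bar> \<le> L * \<bar>z - y\<bar>" using C i unfolding C11_fun_def by simp
  also have "\<dots> \<le> L * (\<bar>s - y\<bar> + (t - s))" using z by (intro mult_left_mono L) linarith
  finally have "(t - s) * \<bar>g' i (x(i := z)) - g' i (x(i := y))\<bar> \<le> (t - s) * (L * (\<bar>s - y\<bar> + (t - s)))"
    using st by (intro mult_left_mono) auto
  then show ?thesis unfolding z(3) right_diff_distrib[symmetric] abs_mult using st by simp
qed

text \<open>Bernstein polynomials in the variables \<open>T sin (x / T)\<close>, which range over the bounded box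
  \<open>[-T, T]\<^sup>m\<close>; letting T tend to infinity removes the distortion.\<close>

lemma trig_C1_approx:
  fixes h :: "nat \<Rightarrow> 'h::real_normed_vector"
  assumes "0 < T" "C11_fun m L g g'" "0 < \<epsilon>"
  shows "\<exists>D. \<forall>\<psi>. linear \<psi> \<longrightarrow> \<bar>tev D \<psi> - g (\<lambda>i. T * sin (\<psi> (h i) / T))\<bar> \<le> \<epsilon> \<and>
    norm (tgrad D \<psi> - (\<Sum>j<m. (g' j (\<lambda>i. T * sin (\<psi> (h i) / T)) * cos (\<psi> (h j) / T)) *\<^sub>R h j)) \<le> \<epsilon>"
  using assms(2,3)
proof (induction m arbitrary: g g' \<epsilon>)
  case 0
  then have g0: "g x = g (\<lambda>_. 0)" for x unfolding C11_fun_def by blast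
  have "\<bar>tev [(g (\<lambda>_. 0), 0, 0)] \<psi> - g x\<bar> \<le> \<epsilon>" if "linear \<psi>" for \<psi> :: "'h \<Rightarrow> real" and x
    unfolding tev_const[OF that] g0[of x] using 0(2) by simp
  then show ?case using 0(2) by (intro exI[of _ "[(g (\<lambda>_. 0), 0, 0)]"]) simp
next
  case (Suc m)
  have L: "0 \<le> L" using Suc.prems(1) unfolding C11_fun_def by (meson abs_ge_zero order_trans zero_less_Suc)
  \<comment> \<open>K bounds the variation of the first m gradient terms in the last variable,
    measured in units of k / N; B collects every constant that ends up divided by sqrt N.\<close>
  define K where "K = 2 * T * L * (\<Sum>j<m. norm (h j))"
  define B where "B = K + 2 * T * L + 4 * T * L * norm (h m)"
  have K: "0 \<le> K" and B: "0 \<le> B" using L assms(1) by (auto simp: B_def K_def intro!: add_nonneg_nonneg mult_nonneg_nonneg sum_nonneg)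
  obtain n where n: "(2 * B / \<epsilon>)\<^sup>2 < real n" using reals_Archimedean2 by blast
  define N where "N = Suc n"
  have N: "0 < N" "1 \<le> real N" by (auto simp: N_def)
  have sN: "1 \<le> sqrt (real N)" using N by simp
  have BN: "B / sqrt (real N) \<le> \<epsilon> / 2"
  proof -
    have "2 * B / \<epsilon> \<le> sqrt (real N)" by (rule real_le_rsqrt) (use n in \<open>simp add: N_def\<close>)
    then show ?thesis using sN Suc.prems(2) by (simp add: field_simps)
  qed
  \<comment> \<open>The accuracy demanded from the induction hypothesis is fixed after N, because
    difference quotients of the coefficients magnify it by N / T and the norm of h m.\<close>
  define e where "e = \<epsilon> / (2 * (1 + real N * norm (h m) / T))"
  have den: "0 < 1 + real N * norm (h m) / T" using assms(1) by (intro add_pos_nonneg) auto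
  have e: "0 < e" using den Suc.prems(2) by (simp add: e_def)
  have eN: "e + e * (real N * norm (h m) / T) = \<epsilon> / 2" 
  proof -
    have "\<epsilon> / (2 * (1 + q)) + \<epsilon> / (2 * (1 + q)) * q = \<epsilon> / 2" if "0 < 1 + q" for q
    proof -
      have "\<epsilon> / (2 * (1 + q)) + \<epsilon> / (2 * (1 + q)) * q = \<epsilon> / (2 * (1 + q)) * (1 + q)" by (simp only: distrib_left mult_1_right)
      moreover have "\<epsilon> / (2 * r) * r = \<epsilon> / 2" if "0 < r" for r using that by simp
      ultimately show ?thesis using that by metis
    qed
    from this[OF den] show ?thesis unfolding e_def .
  qed
  define t where "t k = T * (2 * (real k / real N) - 1)" for k
  define Y where "Y \<psi> = (\<lambda>i. T * sin (\<psi> (h i) / T))" for \<psi> :: "'h \<Rightarrow> real"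
  \<comment> \<open>The last coordinate is frozen at the grid point t k, and the induction
    hypothesis approximates the resulting function of m variables.\<close>
  have ex: "\<exists>D. \<forall>\<psi>. linear \<psi> \<longrightarrow> \<bar>tev D \<psi> - g ((Y \<psi>)(m := t k))\<bar> \<le> e \<and>
    norm (tgrad D \<psi> - (\<Sum>j<m. (g' j ((Y \<psi>)(m := t k)) * cos (\<psi> (h j) / T)) *\<^sub>R h j)) \<le> e" for k
    unfolding Y_def by (rule Suc.IH[OF C11_fun_freeze[OF Suc.prems(1)] e])
  obtain A where A0: "\<forall>k. \<forall>\<psi>. linear \<psi> \<longrightarrow> \<bar>tev (A k) \<psi> - g ((Y \<psi>)(m := t k))\<bar> \<le> e \<and>
    norm (tgrad (A k) \<psi> - (\<Sum>j<m. (g' j ((Y \<psi>)(m := t k)) * cos (\<psi> (h j) / T)) *\<^sub>R h j)) \<le> e"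
    using choice[OF allI[OF ex]] by (rule exE)
  have A: "\<And>k \<psi>. linear \<psi> \<Longrightarrow> \<bar>tev (A k) \<psi> - g ((Y \<psi>)(m := t k))\<bar> \<le> e"
    "\<And>k \<psi>. linear \<psi> \<Longrightarrow> norm (tgrad (A k) \<psi> - (\<Sum>j<m. (g' j ((Y \<psi>)(m := t k)) * cos (\<psi> (h j) / T)) *\<^sub>R h j)) \<le> e"
    using A0 by simp_all
  \<comment> \<open>The sine is written as a cosine with phase - pi / 2: U is (1 + sin (\<psi> (h m)
    / T)) / 2, the last coordinate of the box rescaled to [0, 1].\<close>
  define U :: "'h trig" where "U = [(1 / 2, 0, 0), (1 / 2, - (pi / 2), h m /\<^sub>R T)]"
  define U' :: "'h trig" where "U' = [(1 / 2, 0, 0), (- (1 / 2), - (pi / 2), h m /\<^sub>R T)]"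
  show ?case
  proof (intro exI[of _ "tbern U U' N A"] allI impI conjI)
    fix \<psi> :: "'h \<Rightarrow> real" assume \<psi>: "linear \<psi>"
    define y where "y = Y \<psi>"
    define c where "c = cos (\<psi> (h m) / T)"
    define u where "u = tev U \<psi>"
    have \<psi>h: "\<psi> (h m /\<^sub>R T) = \<psi> (h m) / T" "\<psi> 0 = 0" using \<psi> by (simp_all add: linear_scale linear_0 divide_inverse mult.commute)
    have sc: "cos (x + - (pi / 2)) = sin x" "sin (x + - (pi / 2)) = - cos x" for x
      using cos_add[of x "- (pi / 2)"] sin_add[of x "- (pi / 2)"] by simp_all
    have u_eq: "u = (1 + sin (\<psi> (h m) / T)) / 2" by (simp only: u_def U_def tev_Cons tev_Nil \<psi>h sc) simp
    have U': "tev U' \<psi> = 1 - tev U \<psi>" by (simp only: U_def U'_def tev_Cons tev_Nil \<psi>h sc) (simp add: field_simps)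
    have gU: "tgrad U \<psi> = (c / (2 * T)) *\<^sub>R h m"
    proof -
      have "(- (1 / 2) * - x) *\<^sub>R (h m /\<^sub>R T) = (x / (2 * T)) *\<^sub>R h m" for x
        unfolding scaleR_scaleR by (rule arg_cong[where f = "\<lambda>r. r *\<^sub>R h m"]) (use assms(1) in \<open>simp add: field_simps\<close>)
      then show ?thesis by (simp only: U_def tgrad_Cons tgrad_Nil \<psi>h sc c_def scaleR_zero_right add_0_left add_0_right)
    qed
    have gU': "tgrad U' \<psi> = - tgrad U \<psi>"
      by (simp only: U_def U'_def tgrad_Cons tgrad_Nil \<psi>h sc c_def) simp
    have "0 \<le> (1 + x) / 2 \<and> (1 + x) / 2 \<le> 1" if "- 1 \<le> x" "x \<le> 1" for x :: real using that by simp
    from this[OF sin_ge_minus_one sin_le_one] have u01: "0 \<le> u \<and> u \<le> 1" unfolding u_eq .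
    note u01 = conjunct1[OF u01] conjunct2[OF u01]
    have "2 * ((1 + x) / 2) - 1 = x" for x :: real by (simp add: field_simps)
    then have ym: "y m = T * (2 * u - 1)" by (simp only: y_def Y_def u_eq)
    have ty: "\<bar>t k - y m\<bar> = 2 * T * \<bar>real k / real N - u\<bar>" for k
    proof -
      have "t k - y m = (2 * T) * (real k / real N - u)" by (simp add: t_def ym algebra_simps)
      then show ?thesis using assms(1) by (simp add: abs_mult)
    qed
    have lip: "\<bar>g (y(m := t k)) - g y\<bar> \<le> (2 * T * L) * \<bar>real k / real N - u\<bar>" for k
      using C11_fun_lipschitz[OF Suc.prems(1) lessI, of y "t k" "y m"] unfolding ty fun_upd_triv by (simp only: mult_ac)
    have lip': "\<bar>g' j (y(m := t k)) - g' j y\<bar> \<le> (2 * T * L) * \<bar>real k / real N - u\<bar>" if "j < m" for j k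
    proof -
      have "\<bar>g' j (y(m := t k)) - g' j (y(m := y m))\<bar> \<le> L * \<bar>t k - y m\<bar>"
        using Suc.prems(1) that unfolding C11_fun_def by (meson less_Suc_eq)
      then show ?thesis unfolding ty fun_upd_triv by (simp only: mult_ac)
    qed
    have 1: "norm (tev (A k) \<psi> - g y) \<le> (2 * T * L) * \<bar>real k / real N - u\<bar> + e" for k
      using lip[of k] A(1)[OF \<psi>, of k] unfolding y_def[symmetric] by simp
    have "norm (bernstein_sum N (\<lambda>k. tev (A k) \<psi>) u - g y) \<le> (2 * T * L) / sqrt (real N) + e"
      by (rule bernstein_sum_approx[OF u01 _ _ N(1) _ 1]) (use L assms(1) in auto)
    moreover have "(2 * T * L) / sqrt (real N) \<le> B / sqrt (real N)"
      using L assms(1) K sN by (intro divide_right_mono) (auto simp: B_def)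
    moreover have "e \<le> \<epsilon> / 2" unfolding eN[symmetric] using e assms(1) by simp
    ultimately show "\<bar>tev (tbern U U' N A) \<psi> - g (\<lambda>i. T * sin (\<psi> (h i) / T))\<bar> \<le> \<epsilon>"
      using BN unfolding tev_tbern[OF \<psi> U'] u_def[symmetric] Y_def[symmetric] y_def[symmetric] real_norm_def by linarith
    define z where "z = (\<Sum>j<m. (g' j y * cos (\<psi> (h j) / T)) *\<^sub>R h j)"
    have 2: "norm (tgrad (A k) \<psi> - z) \<le> K * \<bar>real k / real N - u\<bar> + e" for k
    proof -
      have "norm ((\<Sum>j<m. (g' j (y(m := t k)) * cos (\<psi> (h j) / T)) *\<^sub>R h j) - z)
          = norm (\<Sum>j<m. ((g' j (y(m := t k)) - g' j y) * cos (\<psi> (h j) / T)) *\<^sub>R h j)"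
        by (simp add: z_def sum_subtractf[symmetric] scaleR_left_diff_distrib[symmetric] left_diff_distrib)
      also have "\<dots> \<le> (\<Sum>j<m. ((2 * T * L) * \<bar>real k / real N - u\<bar>) * norm (h j))"
      proof (rule sum_norm_le)
        fix j assume "j \<in> {..<m}"
        then have "\<bar>g' j (y(m := t k)) - g' j y\<bar> * \<bar>cos (\<psi> (h j) / T)\<bar> \<le> (2 * T * L) * \<bar>real k / real N - u\<bar> * 1"
          using L assms(1) by (intro mult_mono lip') auto
        then show "norm (((g' j (y(m := t k)) - g' j y) * cos (\<psi> (h j) / T)) *\<^sub>R h j) \<le> ((2 * T * L) * \<bar>real k / real N - u\<bar>) * norm (h j)"
          by (simp only: norm_scaleR abs_mult mult_1_right) (rule mult_right_mono, auto)
      qed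
      also have "\<dots> = K * \<bar>real k / real N - u\<bar>" by (simp only: K_def sum_distrib_left sum_distrib_right mult_ac)
      finally have *: "norm ((\<Sum>j<m. (g' j (y(m := t k)) * cos (\<psi> (h j) / T)) *\<^sub>R h j) - z) \<le> K * \<bar>real k / real N - u\<bar>" .
      show ?thesis
        using norm_triangle_mono[OF A(2)[OF \<psi>, of k, folded y_def] *] by (simp add: add.commute)
    qed
    have g2: "norm (bernstein_sum N (\<lambda>k. tgrad (A k) \<psi>) u - z) \<le> K / sqrt (real N) + e"
      by (rule bernstein_sum_approx[OF u01 _ _ N(1) K 2]) auto
    \<comment> \<open>Difference quotients of the coefficients; neighbouring grid points are 2 T / N
      apart.\<close>
    define d where "d k = real N / (2 * T) * (tev (A (Suc k)) \<psi> - tev (A k) \<psi>)" for k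
    have 3: "norm (d k - g' m y) \<le> (2 * T * L) * \<bar>real k / real N - u\<bar> + (real N * e / T + 2 * T * L / real N)" for k
    proof -
      have step: "t (Suc k) - t k = 2 * T / real N" by (simp add: t_def add_divide_distrib algebra_simps)
      have "t k < t (Suc k)" using step assms(1) N by (simp add: algebra_simps)
      from C11_fun_mvt[OF Suc.prems(1) lessI this, of y "y m"]
      have "\<bar>g (y(m := t (Suc k))) - g (y(m := t k)) - (2 * T / real N) * g' m y\<bar> \<le> (2 * T / real N) * (L * (\<bar>t k - y m\<bar> + 2 * T / real N))"
        unfolding step fun_upd_triv .
      moreover have "\<bar>tev (A (Suc k)) \<psi> - g (y(m := t (Suc k)))\<bar> \<le> e" "\<bar>tev (A k) \<psi> - g (y(m := t k))\<bar> \<le> e"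
        using A(1)[OF \<psi>] by (auto simp: y_def)
      ultimately have "\<bar>(tev (A (Suc k)) \<psi> - tev (A k) \<psi>) - (2 * T / real N) * g' m y\<bar> \<le> 2 * e + (2 * T / real N) * (L * (\<bar>t k - y m\<bar> + 2 * T / real N))"
        by linarith
      then have "real N / (2 * T) * \<bar>(tev (A (Suc k)) \<psi> - tev (A k) \<psi>) - (2 * T / real N) * g' m y\<bar>
          \<le> real N / (2 * T) * (2 * e + (2 * T / real N) * (L * (\<bar>t k - y m\<bar> + 2 * T / real N)))"
        using assms(1) by (intro mult_left_mono) auto
      also have "\<dots> = real N * e / T + L * (\<bar>t k - y m\<bar> + 2 * T / real N)" using assms(1) N by (simp add: distrib_left)
      also have "real N / (2 * T) * \<bar>(tev (A (Suc k)) \<psi> - tev (A k) \<psi>) - (2 * T / real N) * g' m y\<bar> = \<bar>d k - g' m y\<bar>"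
      proof -
        have "d k - g' m y = real N / (2 * T) * ((tev (A (Suc k)) \<psi> - tev (A k) \<psi>) - (2 * T / real N) * g' m y)"
          using assms(1) N by (simp add: d_def right_diff_distrib)
        then show ?thesis using assms(1) by (simp add: abs_mult)
      qed
      finally show ?thesis unfolding ty by (simp add: algebra_simps)
    qed
    have g3: "norm (bernstein_sum n d u - g' m y) \<le> (2 * T * L) / sqrt (real N) + (real N * e / T + 2 * T * L / real N)"
      by (rule bernstein_sum_approx[OF u01 _ _ N(1) _ 3]) (use L assms(1) in \<open>auto simp: N_def\<close>)
    have "tgrad (tbern U U' N A) \<psi> = bernstein_sum N (\<lambda>k. tgrad (A k) \<psi>) u + (bernstein_sum n d u * c) *\<^sub>R h m"
    proof -
      have "bernstein_sum n d u = real N / (2 * T) * bernstein_sum n (\<lambda>k. tev (A (Suc k)) \<psi> - tev (A k) \<psi>) u"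
        using bernstein_sum_scaleR[of n "real N / (2 * T)" "\<lambda>k. tev (A (Suc k)) \<psi> - tev (A k) \<psi>" u] by (simp add: d_def[abs_def])
      then show ?thesis unfolding tgrad_tbern[OF \<psi> U' gU'] gU u_def[symmetric] by (simp add: N_def)
    qed
    then have "tgrad (tbern U U' N A) \<psi> - (\<Sum>j<Suc m. (g' j y * cos (\<psi> (h j) / T)) *\<^sub>R h j)
        = (bernstein_sum N (\<lambda>k. tgrad (A k) \<psi>) u - z) + ((bernstein_sum n d u - g' m y) * c) *\<^sub>R h m"
      by (simp add: z_def c_def algebra_simps)
    moreover have "norm (((bernstein_sum n d u - g' m y) * c) *\<^sub>R h m) \<le> ((2 * T * L) / sqrt (real N) + (real N * e / T + 2 * T * L / real N)) * 1 * norm (h m)"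
      unfolding norm_scaleR abs_mult by (intro mult_right_mono mult_mono g3[unfolded real_norm_def] order_trans[OF abs_ge_zero g3[unfolded real_norm_def]]) (auto simp: c_def)
    ultimately have "norm (tgrad (tbern U U' N A) \<psi> - (\<Sum>j<Suc m. (g' j y * cos (\<psi> (h j) / T)) *\<^sub>R h j))
        \<le> (K / sqrt (real N) + e) + ((2 * T * L) / sqrt (real N) + (real N * e / T + 2 * T * L / real N)) * norm (h m)"
      using g2 norm_triangle_mono[OF g2] by simp
    also have "\<dots> \<le> (K / sqrt (real N) + e) + ((2 * T * L) / sqrt (real N) + (real N * e / T + 2 * T * L / sqrt (real N))) * norm (h m)"
    proof (intro add_left_mono mult_right_mono divide_left_mono)
      show "sqrt (real N) \<le> real N" using N by (intro real_le_lsqrt) (auto simp: power2_eq_square)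
    qed (use L assms(1) N in auto)
    also have "\<dots> = (e + e * (real N * norm (h m) / T)) + (K + 4 * T * L * norm (h m)) / sqrt (real N)"
      by (simp add: add_divide_distrib algebra_simps)
    also have "\<dots> \<le> \<epsilon> / 2 + B / sqrt (real N)"
      unfolding eN using L assms(1) sN by (intro add_left_mono divide_right_mono) (auto simp: B_def)
    also have "\<dots> \<le> \<epsilon>" using BN by linarith
    finally show "norm (tgrad (tbern U U' N A) \<psi> - (\<Sum>j<Suc m. (g' j (\<lambda>i. T * sin (\<psi> (h i) / T)) * cos (\<psi> (h j) / T)) *\<^sub>R h j)) \<le> \<epsilon>"
      by (simp only: y_def Y_def)
  qed
qed

section \<open>Bounds for smooth functions of compact support\<close>

definition supported_in_cube :: "nat \<Rightarrow> real \<Rightarrow> ((nat \<Rightarrow> real) \<Rightarrow> real) \<Rightarrow> bool"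
  where "supported_in_cube n R \<phi> \<longleftrightarrow> (\<forall>x y. (\<forall>i<n. x i = y i) \<longrightarrow> \<phi> x = \<phi> y) \<and> (\<forall>x. (\<exists>i<n. R < \<bar>x i\<bar>) \<longrightarrow> \<phi> x = 0)"

text \<open>Outside the cube the function vanishes near x along the axis of differentiation, either
  on the whole line or on an open part of it.\<close>

lemma supported_in_cube_partial_deriv:
  assumes \<phi>: "supported_in_cube n R \<phi>"
  shows "supported_in_cube n R (partial_deriv j \<phi>)"
  unfolding supported_in_cube_def
proof (intro conjI allI impI)
  fix x y :: "nat \<Rightarrow> real" assume xy: "\<forall>i<n. x i = y i"
  show "partial_deriv j \<phi> x = partial_deriv j \<phi> y"
  proof (cases "j < n")
    case True
    have "(\<lambda>t. \<phi> (x(j := t))) = (\<lambda>t. \<phi> (y(j := t)))" using \<phi> xy unfolding supported_in_cube_def by (intro ext) auto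
    then show ?thesis using True xy by (simp add: partial_deriv_def)
  next
    case False
    have "(\<lambda>t. \<phi> (z(j := t))) = (\<lambda>t. \<phi> z)" for z using \<phi> False unfolding supported_in_cube_def by (intro ext) auto
    then show ?thesis by (simp add: partial_deriv_def)
  qed
next
  fix x :: "nat \<Rightarrow> real" assume "\<exists>i<n. R < \<bar>x i\<bar>"
  then obtain i where i: "i < n" "R < \<bar>x i\<bar>" by blast
  have "((\<lambda>t. \<phi> (x(j := t))) has_real_derivative 0) (at (x j))"
  proof (cases "i = j")
    case False
    then have "(\<lambda>t. \<phi> (x(j := t))) = (\<lambda>t. 0)" using \<phi> i unfolding supported_in_cube_def by (intro ext) (metis fun_upd_other)
    then show ?thesis by simp
  next
    case True
    have op: "open {t :: real. R < \<bar>t\<bar>}" by (intro open_Collect_less continuous_intros)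
    have z: "\<phi> (x(j := t)) = 0" if "t \<in> {t. R < \<bar>t\<bar>}" for t
      using \<phi> i True that unfolding supported_in_cube_def by (metis fun_upd_same mem_Collect_eq)
    show ?thesis
    proof (rule has_field_derivative_transform_within_open[OF _ op])
      show "((\<lambda>t. 0) has_real_derivative 0) (at (x j))" by simp
      show "x j \<in> {t. R < \<bar>t\<bar>}" using i True by simp
      show "0 = \<phi> (x(j := t))" if "t \<in> {t. R < \<bar>t\<bar>}" for t using z[OF that] by simp
    qed
  qed
  then show "partial_deriv j \<phi> x = 0" unfolding partial_deriv_def by (rule DERIV_imp_deriv)
qed

text \<open>The domain is a space of sequences, where boxes in n coordinates are not compact.
  Freezing the remaining coordinates at 0 gives a set that is compact by Tychonoff and on which all
  nonzero values are attained.\<close>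

lemma supported_in_cube_bounded:
  assumes \<phi>: "supported_in_cube n R \<phi>" and cont: "continuous_on UNIV \<phi>"
  shows "\<exists>M. \<forall>x. \<bar>\<phi> x\<bar> \<le> M"
proof -
  define K where "K = PiE UNIV (\<lambda>i. if i < n then {- R..R} else {0 :: real})"
  have "compact K"
    unfolding compactin_euclidean_iff[symmetric] K_def
    by (subst euclidean_product_topology[symmetric]) (auto simp: compactin_PiE compactin_euclidean_iff)
  then have "compact (\<phi> ` K)" by (intro compact_continuous_image continuous_on_subset[OF cont]) auto
  then obtain M where M: "\<And>v. v \<in> \<phi> ` K \<Longrightarrow> norm v \<le> M" unfolding compact_eq_bounded_closed bounded_iff by blast
  have "\<bar>\<phi> x\<bar> \<le> max M 0" for x
  proof (cases "\<exists>i<n. R < \<bar>x i\<bar>")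
    case True
    then show ?thesis using \<phi> unfolding supported_in_cube_def by auto
  next
    case False
    define y where "y i = (if i < n then x i else 0)" for i
    have "- R \<le> x i \<and> x i \<le> R" if "i < n" for i
    proof -
      have "\<bar>x i\<bar> \<le> R" using False that by force
      then show ?thesis by linarith
    qed
    then have "y \<in> K" by (auto simp: K_def y_def PiE_iff)
    moreover have "\<phi> x = \<phi> y" using \<phi> unfolding supported_in_cube_def y_def by auto
    ultimately show ?thesis using M[of "\<phi> x"] by auto
  qed
  then show ?thesis by blast
qed

lemma C0_infinity_supported: "\<phi> \<in> C0_infinity n \<Longrightarrow> \<exists>R. supported_in_cube n R \<phi>"
  unfolding C0_infinity_def supported_in_cube_def by (clarsimp simp: not_less) (meson not_le)

lemma C0_infinity_C11_fun:
  assumes \<phi>: "\<phi> \<in> C0_infinity n"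
  shows "\<exists>L. C11_fun n L \<phi> (\<lambda>j. partial_deriv j \<phi>) \<and> (\<forall>x. \<bar>\<phi> x\<bar> \<le> L)"
proof -
  obtain R where R: "supported_in_cube n R \<phi>" using C0_infinity_supported[OF \<phi>] by blast
  have supp: "supported_in_cube n R (iterated_partial is \<phi>)" for "is"
    unfolding iterated_partial_def using R by (induction "is" arbitrary: \<phi>) (auto intro: supported_in_cube_partial_deriv)
  have bdd: "\<exists>M. \<forall>x. \<bar>iterated_partial is \<phi> x\<bar> \<le> M" if "set is \<subseteq> {..<n}" for "is"
    by (rule supported_in_cube_bounded[OF supp]) (use \<phi> that in \<open>simp add: C0_infinity_def\<close>)
  have der: "((\<lambda>t. iterated_partial is \<phi> (x(i := t))) has_real_derivative iterated_partial (is @ [i]) \<phi> (x(i := t))) (at t)"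
    if "set is \<subseteq> {..<n}" "i < n" for "is" i x t
  proof -
    have "(\<lambda>s. iterated_partial is \<phi> ((x(i := t))(i := s))) differentiable at ((x(i := t)) i)"
      using \<phi> that unfolding C0_infinity_def by blast
    then have "(\<lambda>s. iterated_partial is \<phi> (x(i := s))) differentiable at t" by simp
    then have "((\<lambda>s. iterated_partial is \<phi> (x(i := s))) has_real_derivative deriv (\<lambda>s. iterated_partial is \<phi> (x(i := s))) t) (at t)"
      by (simp add: DERIV_deriv_iff_real_differentiable)
    then show ?thesis by (simp add: iterated_partial_def partial_deriv_def)
  qed
  \<comment> \<open>Words of length at most two: bounds for the function, for its gradient, and for
    the second derivatives, which give the Lipschitz constant of the gradient.\<close>
  define Ls where "Ls = {[]} \<union> (\<lambda>i. [i]) ` {..<n} \<union> (\<lambda>(i, j). [i, j]) ` ({..<n} \<times> {..<n})"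
  have "finite Ls" by (simp add: Ls_def)
  have "\<exists>M. \<forall>is\<in>Ls. \<forall>x. \<bar>iterated_partial is \<phi> x\<bar> \<le> M is"
    by (rule bchoice) (use bdd in \<open>auto simp: Ls_def\<close>)
  then obtain M where M: "\<And>is x. is \<in> Ls \<Longrightarrow> \<bar>iterated_partial is \<phi> x\<bar> \<le> M is" by blast
  define L where "L = Max (M ` Ls)"
  have L: "\<bar>iterated_partial is \<phi> x\<bar> \<le> L" if "is \<in> Ls" for "is" x
    unfolding L_def by (rule order_trans[OF M[OF that] Max_ge]) (use \<open>finite Ls\<close> that in auto)
  have ip: "iterated_partial [] \<phi> = \<phi>" "\<And>i. iterated_partial [i] \<phi> = partial_deriv i \<phi>"
    by (simp_all add: iterated_partial_def)
  show ?thesis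
  proof (intro exI[of _ L] conjI)
    show "\<forall>x. \<bar>\<phi> x\<bar> \<le> L" using L[of "[]"] by (simp add: Ls_def ip)
    show "C11_fun n L \<phi> (\<lambda>j. partial_deriv j \<phi>)"
      unfolding C11_fun_def
    proof (intro conjI allI impI)
      fix x y :: "nat \<Rightarrow> real" assume "\<forall>i<n. x i = y i"
      then show "\<phi> x = \<phi> y" using R unfolding supported_in_cube_def by blast
    next
      fix i x t assume "i < n"
      then show "((\<lambda>t. \<phi> (x(i := t))) has_real_derivative partial_deriv i \<phi> (x(i := t))) (at t)"
        using der[of "[]" i x t] by (simp add: ip)
    next
      fix i x assume "i < n"
      then show "\<bar>partial_deriv i \<phi> x\<bar> \<le> L" using L[of "[i]" x] by (auto simp: Ls_def ip)
    next
      fix i j x s t assume ij: "i < n" "j < n"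
      have "norm (partial_deriv j \<phi> (x(i := s)) - partial_deriv j \<phi> (x(i := t))) \<le> L * norm (s - t)"
      proof (rule field_differentiable_bound[of UNIV "\<lambda>t. partial_deriv j \<phi> (x(i := t))"])
        fix t show "((\<lambda>t. partial_deriv j \<phi> (x(i := t))) has_real_derivative iterated_partial [j, i] \<phi> (x(i := t))) (at t within UNIV)"
          using der[of "[j]" i x t] ij by (simp add: ip)
        show "norm (iterated_partial [j, i] \<phi> (x(i := t))) \<le> L" 
        proof -
          have "[j, i] \<in> Ls" using ij unfolding Ls_def by (auto simp: image_iff)
          then show ?thesis using L by simp
        qed
      qed auto
      then show "\<bar>partial_deriv j \<phi> (x(i := s)) - partial_deriv j \<phi> (x(i := t))\<bar> \<le> L * \<bar>s - t\<bar>" by simp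
    qed
  qed
qed

lemma norm_tgrad_bounded: "\<exists>M. \<forall>\<phi>. norm (tgrad D \<phi>) \<le> M"
proof (induction D)
  case (Cons x D)
  obtain c a h where x: "x = (c, a, h)" by (cases x)
  obtain M where M: "\<And>\<phi>. norm (tgrad D \<phi>) \<le> M" using Cons by blast
  have "norm (tgrad (x # D) \<phi>) \<le> \<bar>c\<bar> * norm h + M" for \<phi>
  proof -
    have "norm ((- c * sin (\<phi> h + a)) *\<^sub>R h) \<le> \<bar>c\<bar> * 1 * norm h"
      unfolding norm_scaleR abs_mult abs_minus_cancel by (intro mult_right_mono mult_left_mono) auto
    from norm_triangle_mono[OF this M] show ?thesis unfolding x tgrad_Cons by simp
  qed
  then show ?case by blast
qed auto

lemma tendsto_scaled_sin: "(\<lambda>k. real (Suc k) * sin (x / real (Suc k))) \<longlonglongrightarrow> x"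
proof (cases "x = 0")
  case False
  have "((\<lambda>h. sin h / h) \<longlongrightarrow> 1) (at (0 :: real))"
    using DERIV_sin[of "0 :: real"] by (simp add: has_field_derivative_iff)
  moreover have "filterlim (\<lambda>k. x / real (Suc k)) (at 0) sequentially"
    unfolding filterlim_at using False by (intro conjI LIMSEQ_Suc[OF lim_const_over_n]) auto
  ultimately have "(\<lambda>k. sin (x / real (Suc k)) / (x / real (Suc k))) \<longlonglongrightarrow> 1"
    by (rule filterlim_compose)
  then have "(\<lambda>k. x * (sin (x / real (Suc k)) / (x / real (Suc k)))) \<longlonglongrightarrow> x * 1" by (rule tendsto_mult_left)
  moreover have "x * (sin (x / real (Suc k)) / (x / real (Suc k))) = real (Suc k) * sin (x / real (Suc k))" for k
    using False by (simp add: mult.commute)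
  ultimately show ?thesis by simp
qed simp

lemma tendsto_fun_coordinatewise:
  fixes f :: "'a \<Rightarrow> 'b \<Rightarrow> 'c::topological_space"
  assumes "\<And>i. ((\<lambda>k. f k i) \<longlongrightarrow> l i) F" shows "(f \<longlongrightarrow> l) F"
proof -
  have "limitin (product_topology (\<lambda>_. euclidean) UNIV) f l F"
    unfolding limitin_componentwise using assms by auto
  then show ?thesis unfolding euclidean_product_topology by simp
qed

context abstract_wiener_space
begin

lemma measurable_tgrad [measurable]: "(\<lambda>w. tgrad D (Z w)) \<in> borel_measurable \<mu>"
proof (induction D)
  case (Cons x D)
  then show ?case by (cases x) simp
qed simp

lemma tendsto_integral_powr:
  fixes f :: "nat \<Rightarrow> 'w \<Rightarrow> 'b::{real_normed_vector, second_countable_topology}"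
  assumes [measurable]: "\<And>k. f k \<in> borel_measurable \<mu>" and "\<And>k w. norm (f k w) \<le> M" "AE w in \<mu>. (\<lambda>k. f k w) \<longlonglongrightarrow> 0" and p: "0 < p"
  shows "(\<lambda>k. LINT w|\<mu>. norm (f k w) powr p) \<longlonglongrightarrow> 0"
proof -
  have "(\<lambda>k. LINT w|\<mu>. norm (f k w) powr p) \<longlonglongrightarrow> (LINT w|\<mu>. 0)"
  proof (rule integral_dominated_convergence[where w = "\<lambda>_. M powr p"])
    show "AE w in \<mu>. (\<lambda>k. norm (f k w) powr p) \<longlonglongrightarrow> 0"
      using assms(3)
    proof eventually_elim
      case (elim w)
      then have "(\<lambda>k. norm (f k w)) \<longlonglongrightarrow> 0" by (rule tendsto_norm_zero)
      then show ?case by (rule tendsto_zero_powrI[OF _ tendsto_const]) (use p in auto)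
    qed
    show "AE w in \<mu>. norm (norm (f k w) powr p) \<le> M powr p" for k
      using assms(2) p by (auto intro!: powr_mono2)
  qed auto
  then show ?thesis by simp
qed

text \<open>The box size T = k + 1 and the accuracy 1 / (k + 1) are taken together. The approximants
  converge almost everywhere and stay uniformly bounded, so dominated convergence works for every
  exponent.\<close>

lemma smooth_cylindrical_trig_approx:
  assumes sc: "smooth_cylindrical \<iota> \<mu> F DF" and p: "0 < p"
  shows "F \<in> borel_measurable \<mu>" "DF \<in> borel_measurable \<mu>" "\<exists>M. \<forall>w. norm (F w) \<le> M" "\<exists>M. \<forall>w. norm (DF w) \<le> M"
    "\<exists>D. (\<lambda>k. LINT w|\<mu>. \<bar>F w - tev (D k) (Z w)\<bar> powr p) \<longlonglongrightarrow> 0 \<and> (\<lambda>k. LINT w|\<mu>. norm (DF w - tgrad (D k) (Z w)) powr p) \<longlonglongrightarrow> 0"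
proof -
  obtain n \<phi> and h :: "nat \<Rightarrow> 'h" where \<phi>: "\<phi> \<in> C0_infinity n" and F: "F = (\<lambda>w. \<phi> (\<lambda>i. X (h i) w))"
    and DF: "DF = (\<lambda>w. \<Sum>j<n. partial_deriv j \<phi> (\<lambda>i. X (h i) w) *\<^sub>R h j)"
    using sc unfolding smooth_cylindrical_def by blast
  obtain L where L: "C11_fun n L \<phi> (\<lambda>j. partial_deriv j \<phi>)" "\<And>x. \<bar>\<phi> x\<bar> \<le> L" using C0_infinity_C11_fun[OF \<phi>] by blast
  have cont: "continuous_on UNIV \<phi>" "\<And>j. j < n \<Longrightarrow> continuous_on UNIV (partial_deriv j \<phi>)"
  proof -
    have c: "set is \<subseteq> {..<n} \<Longrightarrow> continuous_on UNIV (iterated_partial is \<phi>)" for "is" using \<phi> unfolding C0_infinity_def by blast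
    show "continuous_on UNIV \<phi>" using c[of "[]"] by (simp add: iterated_partial_def)
    show "\<And>j. j < n \<Longrightarrow> continuous_on UNIV (partial_deriv j \<phi>)" subgoal for j using c[of "[j]"] by (simp add: iterated_partial_def) done
  qed
  have X_meas: "(\<lambda>w i. X (h i) w) \<in> borel_measurable \<mu>" by (rule measurable_coordinatewise_then_product) simp
  show [measurable]: "F \<in> borel_measurable \<mu>" unfolding F
    by (rule measurable_compose[OF X_meas borel_measurable_continuous_onI[OF cont(1)]])
  show [measurable]: "DF \<in> borel_measurable \<mu>" unfolding DF
    by (intro borel_measurable_sum borel_measurable_scaleR borel_measurable_const
      measurable_compose[OF X_meas borel_measurable_continuous_onI[OF cont(2)]]) auto
  have bF: "norm (F w) \<le> L" for w using L(2) by (simp add: F)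
  define B where "B = L * (\<Sum>j<n. norm (h j))"
  have pd: "\<bar>partial_deriv j \<phi> x\<bar> \<le> L" if "j < n" for j x using L(1) that unfolding C11_fun_def by blast
  have bsum: "norm (\<Sum>j<n. (partial_deriv j \<phi> x * c j) *\<^sub>R h j) \<le> B" if c: "\<And>j. \<bar>c j\<bar> \<le> 1" for x and c :: "nat \<Rightarrow> real"
    unfolding B_def sum_distrib_left
  proof (rule sum_norm_le)
    fix j assume "j \<in> {..<n}"
    then have "\<bar>partial_deriv j \<phi> x\<bar> * \<bar>c j\<bar> * norm (h j) \<le> L * 1 * norm (h j)"
      by (intro mult_right_mono mult_mono pd c) (use order_trans[OF abs_ge_zero L(2)] in auto)
    then show "norm ((partial_deriv j \<phi> x * c j) *\<^sub>R h j) \<le> L * norm (h j)" by (simp add: abs_mult)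
  qed
  have bDF: "norm (DF w) \<le> B" for w using bsum[of "\<lambda>_. 1"] by (simp add: DF)
  show "\<exists>M. \<forall>w. norm (F w) \<le> M" "\<exists>M. \<forall>w. norm (DF w) \<le> M" using bF bDF by blast+
  define Y where "Y k \<psi> = (\<lambda>i. real (Suc k) * sin (\<psi> (h i) / real (Suc k)))" for k and \<psi> :: "'h \<Rightarrow> real"
  have ex: "\<exists>D. \<forall>\<psi>. linear \<psi> \<longrightarrow> \<bar>tev D \<psi> - \<phi> (Y k \<psi>)\<bar> \<le> 1 / real (Suc k) \<and>
    norm (tgrad D \<psi> - (\<Sum>j<n. (partial_deriv j \<phi> (Y k \<psi>) * cos (\<psi> (h j) / real (Suc k))) *\<^sub>R h j)) \<le> 1 / real (Suc k)" for k
    unfolding Y_def by (rule trig_C1_approx[OF _ L(1)]) auto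
  obtain D where D0: "\<forall>k. \<forall>\<psi>. linear \<psi> \<longrightarrow> \<bar>tev (D k) \<psi> - \<phi> (Y k \<psi>)\<bar> \<le> 1 / real (Suc k) \<and>
    norm (tgrad (D k) \<psi> - (\<Sum>j<n. (partial_deriv j \<phi> (Y k \<psi>) * cos (\<psi> (h j) / real (Suc k))) *\<^sub>R h j)) \<le> 1 / real (Suc k)"
    using choice[OF allI[OF ex]] by (rule exE)
  define G where "G k \<psi> = (\<Sum>j<n. (partial_deriv j \<phi> (Y k \<psi>) * cos (\<psi> (h j) / real (Suc k))) *\<^sub>R h j)" for k and \<psi> :: "'h \<Rightarrow> real"
  have D: "\<bar>tev (D k) (Z w) - \<phi> (Y k (Z w))\<bar> \<le> 1 / real (Suc k)" "norm (tgrad (D k) (Z w) - G k (Z w)) \<le> 1 / real (Suc k)" for k w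
    using D0 linear_Z unfolding G_def by blast+
  have inv0: "(\<lambda>k. 1 / real (Suc k)) \<longlonglongrightarrow> 0" by (rule LIMSEQ_Suc[OF lim_const_over_n])
  have inv1: "1 / real (Suc k) \<le> 1" for k by simp
  \<comment> \<open>The vectors h i are countably many, so one null set serves for all of
    them.\<close>
  have "AE w in \<mu>. \<forall>i. Z w (h i) = X (h i) w" unfolding AE_all_countable using Z_AE by blast
  then have lim: "AE w in \<mu>. (\<lambda>k. tev (D k) (Z w)) \<longlonglongrightarrow> F w \<and> (\<lambda>k. tgrad (D k) (Z w)) \<longlonglongrightarrow> DF w"
  proof eventually_elim
    case (elim w)
    define x where "x = (\<lambda>i. X (h i) w)"
    have Y: "(\<lambda>k. Y k (Z w)) \<longlonglongrightarrow> x"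
    proof (rule tendsto_fun_coordinatewise)
      show "(\<lambda>k. Y k (Z w) i) \<longlonglongrightarrow> x i" for i
        unfolding x_def Y_def using elim tendsto_scaled_sin[of "X (h i) w"] by (simp del: of_nat_Suc)
    qed
    have comp: "(\<lambda>k. g (Y k (Z w))) \<longlonglongrightarrow> g x" if "continuous_on UNIV g" for g :: "(nat \<Rightarrow> real) \<Rightarrow> real"
    proof -
      have "isCont g x" using that by (simp add: continuous_on_eq_continuous_at)
      from isCont_tendsto_compose[OF this Y] show ?thesis .
    qed
    have cos1: "(\<lambda>k. cos (Z w (h j) / real (Suc k))) \<longlonglongrightarrow> 1" for j
    proof -
      have "(\<lambda>k. Z w (h j) / real (Suc k)) \<longlonglongrightarrow> 0" by (rule LIMSEQ_Suc[OF lim_const_over_n])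
      from tendsto_cos[OF this] show ?thesis by simp
    qed
    have "(\<lambda>k. (tev (D k) (Z w) - \<phi> (Y k (Z w))) + \<phi> (Y k (Z w))) \<longlonglongrightarrow> 0 + \<phi> x"
      by (intro tendsto_add comp cont Lim_null_comparison[OF _ inv0]) (use D in auto)
    moreover have "(\<lambda>k. (tgrad (D k) (Z w) - G k (Z w)) + G k (Z w)) \<longlonglongrightarrow> 0 + (\<Sum>j<n. (partial_deriv j \<phi> x * 1) *\<^sub>R h j)"
    proof (intro tendsto_add)
      show "(\<lambda>k. tgrad (D k) (Z w) - G k (Z w)) \<longlonglongrightarrow> 0" by (rule Lim_null_comparison[OF _ inv0]) (use D in auto)
      show "(\<lambda>k. G k (Z w)) \<longlonglongrightarrow> (\<Sum>j<n. (partial_deriv j \<phi> x * 1) *\<^sub>R h j)"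
        unfolding G_def by (intro tendsto_sum tendsto_scaleR tendsto_mult comp cont cos1 tendsto_const) auto
    qed
    ultimately show ?case by (simp add: F DF x_def)
  qed
  have "(\<lambda>k. LINT w|\<mu>. norm (F w - tev (D k) (Z w)) powr p) \<longlonglongrightarrow> 0"
  proof (rule tendsto_integral_powr[OF _ _ _ p, where M = "L + (1 + L)"])
    fix k w
    have "norm (tev (D k) (Z w)) \<le> 1 + L" using D(1)[of k w] inv1[of k] L(2)[of "Y k (Z w)"] unfolding real_norm_def by linarith
    then show "norm (F w - tev (D k) (Z w)) \<le> L + (1 + L)" using norm_triangle_ineq4[of "F w" "tev (D k) (Z w)"] bF[of w] by linarith
  next
    show "AE w in \<mu>. (\<lambda>k. F w - tev (D k) (Z w)) \<longlonglongrightarrow> 0"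
      using lim
    proof eventually_elim
      case (elim w)
      then show ?case using tendsto_diff[OF tendsto_const[of "F w"], of "\<lambda>k. tev (D k) (Z w)" "F w" sequentially] by simp
    qed
  qed measurable
  moreover have "(\<lambda>k. LINT w|\<mu>. norm (DF w - tgrad (D k) (Z w)) powr p) \<longlonglongrightarrow> 0"
  proof (rule tendsto_integral_powr[OF _ _ _ p, where M = "B + (1 + B)"])
    fix k w
    have "norm (G k (Z w)) \<le> B" unfolding G_def by (rule bsum) simp
    moreover have "norm (tgrad (D k) (Z w)) \<le> norm (tgrad (D k) (Z w) - G k (Z w)) + norm (G k (Z w))"
      using norm_triangle_ineq[of "tgrad (D k) (Z w) - G k (Z w)" "G k (Z w)"] by simp
    ultimately have "norm (tgrad (D k) (Z w)) \<le> 1 + B"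
      using D(2)[of k w] inv1[of k] by linarith
    then show "norm (DF w - tgrad (D k) (Z w)) \<le> B + (1 + B)" using norm_triangle_ineq4[of "DF w" "tgrad (D k) (Z w)"] bDF[of w] by linarith
  next
    show "AE w in \<mu>. (\<lambda>k. DF w - tgrad (D k) (Z w)) \<longlonglongrightarrow> 0"
      using lim
    proof eventually_elim
      case (elim w)
      then show ?case using tendsto_diff[OF tendsto_const[of "DF w"], of "\<lambda>k. tgrad (D k) (Z w)" "DF w" sequentially] by simp
    qed
  qed measurable
  ultimately show "\<exists>D. (\<lambda>k. LINT w|\<mu>. \<bar>F w - tev (D k) (Z w)\<bar> powr p) \<longlonglongrightarrow> 0 \<and> (\<lambda>k. LINT w|\<mu>. norm (DF w - tgrad (D k) (Z w)) powr p) \<longlonglongrightarrow> 0"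
    by (intro exI[of _ D] conjI) simp_all
qed

end

section \<open>Passage to the limit\<close>

text \<open>The sum is at most twice the larger of a and b. The constant is harmless, since the
  estimate serves convergence arguments.\<close>

lemma powr_add_le:
  fixes a b :: real
  assumes "0 \<le> a" "0 \<le> b" "0 < p"
  shows "(a + b) powr p \<le> 2 powr p * (a powr p + b powr p)"
proof -
  have "(a + b) powr p \<le> (2 * max a b) powr p" using assms by (intro powr_mono2) auto
  also have "\<dots> = 2 powr p * (max a b) powr p" by (rule powr_mult)
  also have "\<dots> \<le> 2 powr p * (a powr p + b powr p)" by (intro mult_left_mono) (auto simp: max_def)
  finally show ?thesis .
qed

lemma Lp_space_diff:
  fixes f g :: "'w \<Rightarrow> 'b::{real_normed_vector, second_countable_topology}"
  assumes f: "f \<in> Lp_space M p" and g: "g \<in> Lp_space M p" and p: "0 < p"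
  shows "(\<lambda>x. f x - g x) \<in> Lp_space M p"
proof -
  have [measurable]: "f \<in> borel_measurable M" "g \<in> borel_measurable M" using f g by (auto simp: Lp_space_def)
  have "integrable M (\<lambda>x. norm (f x - g x) powr p)"
  proof (rule Bochner_Integration.integrable_bound)
    show "integrable M (\<lambda>x. 2 powr p * (norm (f x) powr p + norm (g x) powr p))"
      using f g by (auto simp: Lp_space_def)
    have "norm (f x - g x) powr p \<le> 2 powr p * (norm (f x) powr p + norm (g x) powr p)" for x
      by (rule order_trans[OF powr_mono2 powr_add_le]) (use p norm_triangle_ineq4 in auto)
    then show "AE x in M. norm (norm (f x - g x) powr p) \<le> norm (2 powr p * (norm (f x) powr p + norm (g x) powr p))"
      by (auto simp: abs_of_nonneg)
  qed measurable
  then show ?thesis by (simp add: Lp_space_def)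
qed

lemma Lp_triangle:
  fixes f g h :: "'w \<Rightarrow> 'b::{real_normed_vector, second_countable_topology}"
  assumes "f \<in> Lp_space M p" "g \<in> Lp_space M p" "h \<in> Lp_space M p" "0 < p"
  shows "(LINT x|M. norm (f x - h x) powr p) \<le> 2 powr p * ((LINT x|M. norm (f x - g x) powr p) + (LINT x|M. norm (g x - h x) powr p))"
proof -
  have i: "integrable M (\<lambda>x. norm (f x - h x) powr p)" "integrable M (\<lambda>x. norm (f x - g x) powr p)" "integrable M (\<lambda>x. norm (g x - h x) powr p)"
    using Lp_space_diff assms unfolding Lp_space_def by blast+
  have "(LINT x|M. norm (f x - h x) powr p) \<le> (LINT x|M. 2 powr p * (norm (f x - g x) powr p + norm (g x - h x) powr p))"
  proof (rule integral_mono[OF i(1)])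
    show "integrable M (\<lambda>x. 2 powr p * (norm (f x - g x) powr p + norm (g x - h x) powr p))" using i by simp
    show "norm (f x - h x) powr p \<le> 2 powr p * (norm (f x - g x) powr p + norm (g x - h x) powr p)" for x
      by (rule order_trans[OF powr_mono2 powr_add_le]) (use assms norm_triangle_ineq[of "f x - g x" "g x - h x"] in auto)
  qed
  then show ?thesis using i by simp
qed

lemma (in prob_space) Lp_space_bounded:
  fixes f :: "'a \<Rightarrow> 'b::{real_normed_vector, second_countable_topology}"
  assumes [measurable]: "f \<in> borel_measurable M" and "\<And>x. norm (f x) \<le> K" "0 < p"
  shows "f \<in> Lp_space M p"
proof -
  have "integrable M (\<lambda>x. norm (f x) powr p)"
    by (rule integrable_const_bound[where B = "K powr p"]) (use assms in \<open>auto intro!: AE_I2 powr_mono2\<close>)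
  then show ?thesis by (simp add: Lp_space_def)
qed

lemma (in prob_space) Lp_space_L2:
  assumes f: "f \<in> Lp_space M p" and p: "2 \<le> p" shows "f \<in> L2 M"
proof -
  have [measurable]: "f \<in> borel_measurable M" using f by (simp add: Lp_space_def)
  have "integrable M (\<lambda>x. \<bar>f x\<bar> powr 2)"
  proof (rule Bochner_Integration.integrable_bound)
    show "integrable M (\<lambda>x. 1 + \<bar>f x\<bar> powr p)" using f by (simp add: Lp_space_def)
    have "\<bar>x\<bar> powr 2 \<le> 1 + \<bar>x\<bar> powr p" for x :: real
    proof (cases "\<bar>x\<bar> \<le> 1")
      case True
      then have "\<bar>x\<bar> powr 2 \<le> 1 powr 2" by (intro powr_mono2) auto
      moreover have "0 \<le> \<bar>x\<bar> powr p" by simp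
      ultimately show ?thesis unfolding powr_one_eq_one by linarith
    next
      case False
      then have "\<bar>x\<bar> powr 2 \<le> \<bar>x\<bar> powr p" by (intro powr_mono p) auto
      then show ?thesis by simp
    qed
    then show "AE x in M. norm (\<bar>f x\<bar> powr 2) \<le> norm (1 + \<bar>f x\<bar> powr p)" by (auto simp: abs_of_nonneg)
  qed measurable
  then show ?thesis by (simp add: Lp_space_def)
qed

lemma (in prob_space) n2_power2_le_Lp:
  assumes f: "f \<in> Lp_space M p" and p: "2 \<le> p"
  shows "(n2 M f)\<^sup>2 \<le> (LINT x|M. \<bar>f x\<bar> powr p) powr (2 / p)"
proof (cases "(LINT x|M. \<bar>f x\<bar> powr p) = 0")
  case True
  have i: "integrable M (\<lambda>x. \<bar>f x\<bar> powr p)" using f by (simp add: Lp_space_def)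
  have [measurable]: "f \<in> borel_measurable M" using f by (simp add: Lp_space_def)
  have "AE x in M. \<bar>f x\<bar> powr p = 0" using True integral_nonneg_eq_0_iff_AE[OF i] by simp
  then have "n2 M f = n2 M (\<lambda>x. 0)" by (intro n2_AE_cong) auto
  then show ?thesis by simp
next
  case False
  define I where "I = (LINT x|M. \<bar>f x\<bar> powr p)"
  have i: "integrable M (\<lambda>x. \<bar>f x\<bar> powr p)" using f by (simp add: Lp_space_def)
  have fL: "f \<in> L2 M" by (rule Lp_space_L2[OF f p])
  have "0 \<le> I" unfolding I_def by simp
  then have I: "0 < I" using False unfolding I_def by linarith
  define t where "t = I powr (2 / p)"
  have t: "0 < t" "t powr (p / 2) = I" using I p by (auto simp: t_def powr_powr)
  text \<open>Young's inequality applied to \<open>f\<^sup>2 / t\<close>.\<close>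
  have young: "y \<le> (2 / p) * y powr (p / 2) + (1 - 2 / p)" if "0 \<le> y" for y :: real
  proof (cases "y = 0")
    case True
    then show ?thesis using p by simp
  next
    case False
    then have "(y powr (p / 2)) powr (2 / p) * 1 powr (1 - 2 / p) \<le> (2 / p) * y powr (p / 2) + (1 - 2 / p) * 1"
      using that p by (intro Youngs_inequality_0) auto
    then show ?thesis using False that p by (simp add: powr_powr)
  qed
  have "(f x)\<^sup>2 \<le> t * ((2 / p) * (\<bar>f x\<bar> powr p / I) + (1 - 2 / p))" for x
  proof -
    have "((f x)\<^sup>2 / t) powr (p / 2) = \<bar>f x\<bar> powr p / I"
    proof -
      have "(f x)\<^sup>2 powr (p / 2) = (\<bar>f x\<bar> powr 2) powr (p / 2)" by (simp only: powr_2_abs)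
      also have "\<dots> = \<bar>f x\<bar> powr p" unfolding powr_powr by simp
      finally show ?thesis using t by (simp add: powr_divide)
    qed
    then show ?thesis using young[of "(f x)\<^sup>2 / t"] t by (simp add: field_simps)
  qed
  then have "(LINT x|M. (f x)\<^sup>2) \<le> (LINT x|M. t * ((2 / p) * (\<bar>f x\<bar> powr p / I) + (1 - 2 / p)))"
    using fL i by (intro integral_mono) (auto simp: L2_iff)
  also have "\<dots> = t * ((2 / p) * (I / I) + (1 - 2 / p))" using i by (simp add: I_def prob_space)
  finally show ?thesis using I by (simp add: n2_power2 t_def I_def)
qed

context abstract_wiener_space
begin

lemma Lp_space_tev: "0 < p \<Longrightarrow> (\<lambda>w. tev D (Z w)) \<in> Lp_space \<mu> p"
  by (rule Lp_space_bounded[OF measurable_tev]) (use tev_le_tbound in auto)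

lemma Lp_space_tgrad: assumes "0 < p" shows "(\<lambda>w. tgrad D (Z w)) \<in> Lp_space \<mu> p"
proof -
  obtain M where "\<And>\<phi>. norm (tgrad D \<phi>) \<le> M" using norm_tgrad_bounded[of D] by blast
  then show ?thesis by (intro Lp_space_bounded[OF measurable_tgrad _ assms])
qed

text \<open>Smooth cylindrical functions approximate f together with the chosen version of its
  derivative, and each of them is approximated by a trigonometric polynomial within 1 / (k + 1); the
  quasi-triangle inequality adds the two errors.\<close>

lemma malliavin_derivative_trig_approx:
  assumes f: "f \<in> sobolev_space \<iota> \<mu> p" and p: "0 < p"
  defines "G \<equiv> malliavin_derivative \<iota> \<mu> p f"
  obtains D where "f \<in> Lp_space \<mu> p" "G \<in> Lp_space \<mu> p"
    "(\<lambda>k. LINT w|\<mu>. \<bar>f w - tev (D k) (Z w)\<bar> powr p) \<longlonglongrightarrow> 0"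
    "(\<lambda>k. LINT w|\<mu>. norm (G w - tgrad (D k) (Z w)) powr p) \<longlonglongrightarrow> 0"
proof -
  have "has_malliavin_derivative \<iota> \<mu> p f G"
    unfolding G_def malliavin_derivative_def using f by (intro someI_ex[of "has_malliavin_derivative \<iota> \<mu> p f"]) (simp add: sobolev_space_def)
  then obtain F DF where fG: "f \<in> Lp_space \<mu> p" "G \<in> Lp_space \<mu> p" and sc: "\<And>k::nat. smooth_cylindrical \<iota> \<mu> (F k) (DF k)"
    and lim: "(\<lambda>k. sobolev_norm \<mu> p (\<lambda>w. F k w - f w) (\<lambda>w. DF k w - G w)) \<longlonglongrightarrow> 0"
    unfolding has_malliavin_derivative_def by blast
  note A = smooth_cylindrical_trig_approx[OF sc p]
  have FL: "F k \<in> Lp_space \<mu> p" for k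
  proof -
    obtain M where "\<And>w. norm (F k w) \<le> M" using A(3)[of k] by blast
    then show ?thesis by (rule Lp_space_bounded[OF A(1) _ p])
  qed
  have DFL: "DF k \<in> Lp_space \<mu> p" for k
  proof -
    obtain M where "\<And>w. norm (DF k w) \<le> M" using A(4)[of k] by blast
    then show ?thesis by (rule Lp_space_bounded[OF A(2) _ p])
  qed
  define a where "a k = (LINT w|\<mu>. norm (F k w - f w) powr p)" for k
  define b where "b k = (LINT w|\<mu>. norm (DF k w - G w) powr p)" for k
  have ab0: "0 \<le> a k" "0 \<le> b k" for k by (auto simp: a_def b_def)
  have "(\<lambda>k. ((a k + b k) powr (1 / p)) powr p) \<longlonglongrightarrow> 0"
    by (rule tendsto_zero_powrI[OF _ tendsto_const _ p]) (use lim in \<open>simp_all add: sobolev_norm_def a_def b_def\<close>)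
  then have "(\<lambda>k. a k + b k) \<longlonglongrightarrow> 0" using p ab0 by (simp add: powr_powr)
  note ab = this
  have a0: "a \<longlonglongrightarrow> 0" by (rule tendsto_sandwich[OF _ _ tendsto_const ab]) (use ab0 in \<open>auto intro!: always_eventually\<close>)
  have b0: "b \<longlonglongrightarrow> 0" by (rule tendsto_sandwich[OF _ _ tendsto_const ab]) (use ab0 in \<open>auto intro!: always_eventually\<close>)
  have "\<exists>D. (LINT w|\<mu>. norm (F k w - tev D (Z w)) powr p) < 1 / real (Suc k) \<and> (LINT w|\<mu>. norm (DF k w - tgrad D (Z w)) powr p) < 1 / real (Suc k)" for k
  proof -
    obtain D where D: "(\<lambda>m. LINT w|\<mu>. \<bar>F k w - tev (D m) (Z w)\<bar> powr p) \<longlonglongrightarrow> 0" "(\<lambda>m. LINT w|\<mu>. norm (DF k w - tgrad (D m) (Z w)) powr p) \<longlonglongrightarrow> 0"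
      using A(5)[of k] by blast
    have "\<forall>\<^sub>F m in sequentially. (LINT w|\<mu>. \<bar>F k w - tev (D m) (Z w)\<bar> powr p) < 1 / real (Suc k) \<and> (LINT w|\<mu>. norm (DF k w - tgrad (D m) (Z w)) powr p) < 1 / real (Suc k)"
      by (intro eventually_conj order_tendstoD(2)[OF D(1)] order_tendstoD(2)[OF D(2)]) auto
    then show ?thesis using eventually_happens' sequentially_bot by fastforce
  qed
  from choice[OF allI[OF this]] obtain D where D: "\<forall>k. (LINT w|\<mu>. norm (F k w - tev (D k) (Z w)) powr p) < 1 / real (Suc k) \<and> (LINT w|\<mu>. norm (DF k w - tgrad (D k) (Z w)) powr p) < 1 / real (Suc k)"
    by (rule exE)
  have inv0: "(\<lambda>k. 1 / real (Suc k)) \<longlonglongrightarrow> 0" by (rule LIMSEQ_Suc[OF lim_const_over_n])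
  have bnd: "(\<lambda>k. 2 powr p * (c k + 1 / real (Suc k))) \<longlonglongrightarrow> 0" if "c \<longlonglongrightarrow> 0" for c :: "nat \<Rightarrow> real"
    using tendsto_mult_left[OF tendsto_add[OF that inv0], of "2 powr p"] by simp
  have 1: "(LINT w|\<mu>. norm (f w - tev (D k) (Z w)) powr p) \<le> 2 powr p * (a k + 1 / real (Suc k))" for k
  proof -
    have "(LINT w|\<mu>. norm (f w - tev (D k) (Z w)) powr p) \<le> 2 powr p * ((LINT w|\<mu>. norm (f w - F k w) powr p) + (LINT w|\<mu>. norm (F k w - tev (D k) (Z w)) powr p))"
      by (rule Lp_triangle[OF fG(1) FL Lp_space_tev p]) (rule p)
    also have "\<dots> \<le> 2 powr p * (a k + 1 / real (Suc k))"
      unfolding a_def using D by (intro mult_left_mono add_mono) (auto simp: abs_minus_commute less_imp_le)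
    finally show ?thesis .
  qed
  have 2: "(LINT w|\<mu>. norm (G w - tgrad (D k) (Z w)) powr p) \<le> 2 powr p * (b k + 1 / real (Suc k))" for k
  proof -
    have "(LINT w|\<mu>. norm (G w - tgrad (D k) (Z w)) powr p) \<le> 2 powr p * ((LINT w|\<mu>. norm (G w - DF k w) powr p) + (LINT w|\<mu>. norm (DF k w - tgrad (D k) (Z w)) powr p))"
      by (rule Lp_triangle[OF fG(2) DFL Lp_space_tgrad p]) (rule p)
    also have "\<dots> \<le> 2 powr p * (b k + 1 / real (Suc k))"
      unfolding b_def using D by (intro mult_left_mono add_mono) (auto simp: norm_minus_commute less_imp_le)
    finally show ?thesis .
  qed
  show ?thesis
  proof (rule that[OF fG])
    have "(\<lambda>k. LINT w|\<mu>. norm (f w - tev (D k) (Z w)) powr p) \<longlonglongrightarrow> 0"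
      by (rule tendsto_sandwich[OF _ _ tendsto_const bnd[OF a0]]) (use 1 in \<open>auto intro!: always_eventually\<close>)
    then show "(\<lambda>k. LINT w|\<mu>. \<bar>f w - tev (D k) (Z w)\<bar> powr p) \<longlonglongrightarrow> 0" by simp
    show "(\<lambda>k. LINT w|\<mu>. norm (G w - tgrad (D k) (Z w)) powr p) \<longlonglongrightarrow> 0"
      by (rule tendsto_sandwich[OF _ _ tendsto_const bnd[OF b0]]) (use 2 in \<open>auto intro!: always_eventually\<close>)
  qed
qed

end

text \<open>To be used for M = \<rho>, while convergence to g is known under \<mu> and hence almost
  everywhere along a subsequence. Fatou's lemma bounds the distance of g to u n by the Cauchy bound;
  norms are then compared by the reverse triangle inequality.\<close>

lemma tendsto_L2_norm_of_cauchy: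
  fixes g :: "'w \<Rightarrow> 'b::{real_normed_vector, second_countable_topology}" and u :: "nat \<Rightarrow> 'w \<Rightarrow> 'b"
  assumes [measurable]: "g \<in> borel_measurable M" "\<And>n. u n \<in> borel_measurable M"
    and u2: "\<And>n. (\<lambda>x. norm (u n x)) \<in> L2 M"
    and r: "strict_mono r" "AE x in M. (\<lambda>k. u (r k) x) \<longlonglongrightarrow> g x"
    and cauchy: "\<And>e. 0 < e \<Longrightarrow> \<exists>N. \<forall>m\<ge>N. \<forall>n\<ge>N. (LINT x|M. (norm (u m x - u n x))\<^sup>2) \<le> e"
  shows "(\<lambda>n. LINT x|M. (norm (u n x))\<^sup>2) \<longlonglongrightarrow> (LINT x|M. (norm (g x))\<^sup>2)"
proof -
  have du: "(\<lambda>x. norm (u m x - u n x)) \<in> L2 M" for m n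
  proof -
    have "integrable M (\<lambda>x. (norm (u m x - u n x))\<^sup>2)"
    proof (rule Bochner_Integration.integrable_bound)
      show "integrable M (\<lambda>x. (norm (u m x) + norm (u n x))\<^sup>2)" using L2_add[OF u2 u2] by (simp add: L2_iff)
      show "AE x in M. norm ((norm (u m x - u n x))\<^sup>2) \<le> norm ((norm (u m x) + norm (u n x))\<^sup>2)"
        by (auto intro!: AE_I2 power_mono norm_triangle_ineq4)
    qed measurable
    then show ?thesis by (simp add: L2_iff)
  qed
  have fatou: "integrable M (\<lambda>x. (norm (g x - u n x))\<^sup>2) \<and> (LINT x|M. (norm (g x - u n x))\<^sup>2) \<le> e"
    if e: "0 \<le> e" and N: "\<And>m. N \<le> m \<Longrightarrow> (LINT x|M. (norm (u m x - u n x))\<^sup>2) \<le> e" for n e N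
  proof -
    have "(\<integral>\<^sup>+x. ennreal ((norm (g x - u n x))\<^sup>2) \<partial>M) = (\<integral>\<^sup>+x. liminf (\<lambda>k. ennreal ((norm (u (r k) x - u n x))\<^sup>2)) \<partial>M)"
    proof (rule nn_integral_cong_AE)
      show "AE x in M. ennreal ((norm (g x - u n x))\<^sup>2) = liminf (\<lambda>k. ennreal ((norm (u (r k) x - u n x))\<^sup>2))"
        using r(2)
      proof eventually_elim
        case (elim x)
        then have "(\<lambda>k. ennreal ((norm (u (r k) x - u n x))\<^sup>2)) \<longlonglongrightarrow> ennreal ((norm (g x - u n x))\<^sup>2)"
          by (intro tendsto_ennrealI tendsto_intros)
        then show ?case by (rule lim_imp_Liminf[OF sequentially_bot, symmetric])
      qed
    qed
    also have "\<dots> \<le> liminf (\<lambda>k. \<integral>\<^sup>+x. ennreal ((norm (u (r k) x - u n x))\<^sup>2) \<partial>M)" by (rule nn_integral_liminf) measurable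
    also have "\<dots> = liminf (\<lambda>k. ennreal (LINT x|M. (norm (u (r k) x - u n x))\<^sup>2))"
      using du by (subst nn_integral_eq_integral) (auto simp: L2_iff)
    also have "\<dots> \<le> ennreal e"
    proof (rule Liminf_le)
      show "\<forall>\<^sub>F k in sequentially. ennreal (LINT x|M. (norm (u (r k) x - u n x))\<^sup>2) \<le> ennreal e"
        using eventually_ge_at_top[of N]
      proof eventually_elim
        case (elim k)
        then show ?case using seq_suble[OF r(1), of k] by (intro ennreal_leI N) simp
      qed
    qed (rule sequentially_bot)
    finally have le: "(\<integral>\<^sup>+x. ennreal ((norm (g x - u n x))\<^sup>2) \<partial>M) \<le> ennreal e" .
    have i: "integrable M (\<lambda>x. (norm (g x - u n x))\<^sup>2)"
      by (rule integrableI_bounded) (use le in \<open>auto simp: order.strict_trans1 ennreal_less_top\<close>)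
    have "ennreal (LINT x|M. (norm (g x - u n x))\<^sup>2) \<le> ennreal e"
      using le by (subst (asm) nn_integral_eq_integral[OF i]) auto
    then show ?thesis using i e by (simp add: ennreal_le_iff)
  qed
  have gu: "(\<lambda>x. norm (g x - u n x)) \<in> L2 M" if "\<exists>N e. 0 \<le> e \<and> (\<forall>m\<ge>N. (LINT x|M. (norm (u m x - u n x))\<^sup>2) \<le> e)" for n
    using that fatou by (auto simp: L2_iff)
  obtain N1 where N1: "\<And>m n. N1 \<le> m \<Longrightarrow> N1 \<le> n \<Longrightarrow> (LINT x|M. (norm (u m x - u n x))\<^sup>2) \<le> 1" using cauchy[of 1] by auto
  have gu1: "(\<lambda>x. norm (g x - u N1 x)) \<in> L2 M"
    by (rule gu, rule exI[of _ N1], rule exI[of _ 1]) (simp add: N1)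
  have gN: "(\<lambda>x. norm (g x)) \<in> L2 M"
  proof -
    have "integrable M (\<lambda>x. (norm (g x))\<^sup>2)"
    proof (rule Bochner_Integration.integrable_bound)
      show "integrable M (\<lambda>x. (norm (g x - u N1 x) + norm (u N1 x))\<^sup>2)"
        using L2_add[OF gu1 u2[of N1]] by (simp add: L2_iff)
      show "AE x in M. norm ((norm (g x))\<^sup>2) \<le> norm ((norm (g x - u N1 x) + norm (u N1 x))\<^sup>2)"
        using norm_triangle_sub[of "g _" "u N1 _"] by (auto intro!: AE_I2 power_mono simp: add.commute)
    qed measurable
    then show ?thesis by (simp add: L2_iff)
  qed
  have "(\<lambda>n. n2 M (\<lambda>x. norm (g x) - norm (u n x))) \<longlonglongrightarrow> 0"
  proof (rule LIMSEQ_I)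
    fix e :: real assume e: "0 < e"
    obtain N where N: "\<And>m n. N \<le> m \<Longrightarrow> N \<le> n \<Longrightarrow> (LINT x|M. (norm (u m x - u n x))\<^sup>2) \<le> (e / 2)\<^sup>2"
      using cauchy[of "(e / 2)\<^sup>2"] e by auto
    have "norm (n2 M (\<lambda>x. norm (g x) - norm (u n x)) - 0) < e" if n: "N \<le> n" for n
    proof -
      note F = fatou[of "(e / 2)\<^sup>2" N n, OF _ N[OF _ n]]
      have "(n2 M (\<lambda>x. norm (g x) - norm (u n x)))\<^sup>2 \<le> (LINT x|M. (norm (g x - u n x))\<^sup>2)"
        unfolding n2_power2
      proof (rule integral_mono)
        show "integrable M (\<lambda>x. (norm (g x) - norm (u n x))\<^sup>2)" using L2_diff[OF gN u2] by (simp add: L2_iff)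
        show "integrable M (\<lambda>x. (norm (g x - u n x))\<^sup>2)" using F by simp
        show "(norm (g x) - norm (u n x))\<^sup>2 \<le> (norm (g x - u n x))\<^sup>2" for x
          using norm_triangle_ineq3[of "g x" "u n x"] by (simp add: abs_le_square_iff[symmetric])
      qed
      also have "\<dots> \<le> (e / 2)\<^sup>2" using F by simp
      finally have "n2 M (\<lambda>x. norm (g x) - norm (u n x)) \<le> e / 2" by (rule power2_le_imp_le) (use e in simp)
      then show ?thesis using e by simp
    qed
    then show "\<exists>N. \<forall>n\<ge>N. norm (n2 M (\<lambda>x. norm (g x) - norm (u n x)) - 0) < e" by blast
  qed
  from tendsto_power[OF n2_tendsto[OF u2 gN this], of 2] show ?thesis unfolding n2_power2 by simp
qed

context abstract_wiener_space
begin

lemma Lp_AE_subseq: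
  fixes g :: "'w \<Rightarrow> 'b::{real_normed_vector, second_countable_topology}"
  assumes g: "g \<in> Lp_space \<mu> p" "\<And>n. u n \<in> Lp_space \<mu> p" and p: "0 < p"
    and lim: "(\<lambda>n. LINT w|\<mu>. norm (g w - u n w) powr p) \<longlonglongrightarrow> 0"
  obtains r where "strict_mono r" "AE w in \<mu>. (\<lambda>k. u (r k) w) \<longlonglongrightarrow> g w"
proof -
  have i: "integrable \<mu> (\<lambda>w. norm (g w - u n w) powr p)" for n
    using Lp_space_diff[OF g(1) g(2) p] by (simp add: Lp_space_def)
  have "\<exists>r::nat\<Rightarrow>nat. strict_mono r \<and> (AE w in \<mu>. (\<lambda>n. norm (g w - u (r n) w) powr p) \<longlonglongrightarrow> 0)"
    by (rule tendsto_L1_AE_subseq[OF i]) (use lim in simp)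
  then obtain r where r: "strict_mono r" "AE w in \<mu>. (\<lambda>n. norm (g w - u (r n) w) powr p) \<longlonglongrightarrow> 0" by blast
  have "AE w in \<mu>. (\<lambda>k. u (r k) w) \<longlonglongrightarrow> g w"
    using r(2)
  proof eventually_elim
    case (elim w)
    have "(\<lambda>n. (norm (g w - u (r n) w) powr p) powr (1 / p)) \<longlonglongrightarrow> 0"
      by (rule tendsto_zero_powrI[OF elim tendsto_const]) (use p in auto)
    then have "(\<lambda>n. norm (g w - u (r n) w)) \<longlonglongrightarrow> 0" using p by (simp add: powr_powr)
    then have "(\<lambda>n. g w - u (r n) w) \<longlonglongrightarrow> 0" by (rule tendsto_norm_zero_cancel)
    from tendsto_diff[OF tendsto_const[of "g w"] this] show ?case by simp
  qed
  then show ?thesis using that r(1) by blast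
qed

lemma n2_Gam_le:
  assumes "chaos_exp u k" "chaos_exp u' (Gam r k)" "0 \<le> r" "r \<le> 1"
  shows "n2 \<mu> u' \<le> n2 \<mu> u"
proof -
  have "fact n * tensor_inner n (Gam r k n) (Gam r k n) \<le> fact n * tensor_inner n (k n) (k n)" for n
  proof -
    have "r * r \<le> 1" using assms by (simp add: mult_le_one)
    then have "(r * r) ^ n \<le> 1" by (intro power_le_one) (use assms in auto)
    then have "(r * r) ^ n * tensor_inner n (k n) (k n) \<le> 1 * tensor_inner n (k n) (k n)"
      by (intro mult_right_mono tensor_inner_self_nonneg)
    then show ?thesis unfolding tensor_inner_Gam by (intro mult_left_mono) auto
  qed
  from sums_le[OF this chaos_exp_n2[OF assms(2)] chaos_exp_n2[OF assms(1)]] have "(n2 \<mu> u')\<^sup>2 \<le> (n2 \<mu> u)\<^sup>2" .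
  then show ?thesis by (rule power2_le_imp_le) simp
qed

lemma chaos_exp_Gam_exists:
  assumes "\<And>n. k n \<in> sym_tensor n" "summable (\<lambda>n. fact n * r ^ (2 * n) * (tensor_norm n (k n))\<^sup>2)"
  shows "\<exists>u. chaos_exp u (Gam r k)"
proof (rule chaos_exp_exists)
  show "Gam r k n \<in> sym_tensor n" for n unfolding Gam_def by (rule sym_tensor_scale[OF assms(1)])
  have *: "fact n * tensor_inner n (Gam r k n) (Gam r k n) = fact n * r ^ (2 * n) * (tensor_norm n (k n))\<^sup>2" for n
    unfolding tensor_inner_Gam tensor_norm_power2 by (simp add: power_mult power2_eq_square)
  show "summable (\<lambda>n. fact n * tensor_inner n (Gam r k n) (Gam r k n))" unfolding * by (rule assms(2))
qed

lemma chaos_exp_Gam_contraction: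
  assumes u: "chaos_exp u k" and r: "0 \<le> r" "r \<le> 1"
  shows "\<exists>u'. chaos_exp u' (Gam r k)"
proof (rule chaos_exp_Gam_exists[OF chaos_exp_sym[OF u]])
  show "summable (\<lambda>n. fact n * r ^ (2 * n) * (tensor_norm n (k n))\<^sup>2)"
  proof (rule summable_comparison_test')
    show "summable (\<lambda>n. fact n * tensor_inner n (k n) (k n))" using chaos_exp_n2[OF u] by (rule sums_summable)
    have "r ^ (2 * n) * (fact n * tensor_inner n (k n) (k n)) \<le> 1 * (fact n * tensor_inner n (k n) (k n))" for n
      by (intro mult_right_mono power_le_one r mult_nonneg_nonneg tensor_inner_self_nonneg) auto
    then show "norm (fact n * r ^ (2 * n) * (tensor_norm n (k n))\<^sup>2) \<le> fact n * tensor_inner n (k n) (k n)" if "0 \<le> n" for n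
      using tensor_inner_self_nonneg[of n "k n"] r by (simp add: tensor_norm_power2 abs_mult mult_ac)
  qed
qed

lemma chaos_exp_diff: "chaos_exp f k \<Longrightarrow> chaos_exp g k' \<Longrightarrow> chaos_exp (\<lambda>w. f w - g w) (\<lambda>n l. k n l - k' n l)"
  using chaos_exp_lincomb[of f k g k' 1 "-1"] by simp

lemma Gam_diff: "Gam r (\<lambda>n l. k n l - k' n l) = (\<lambda>n l. Gam r k n l - Gam r k' n l)"
  by (simp add: Gam_def right_diff_distrib)

lemma n2_Gam_diff_le:
  assumes "chaos_exp u k" "chaos_exp v l" "chaos_exp u' (Gam r k)" "chaos_exp v' (Gam r l)" "0 \<le> r" "r \<le> 1"
  shows "n2 \<mu> (\<lambda>w. u' w - v' w) \<le> n2 \<mu> (\<lambda>w. u w - v w)"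
  by (rule n2_Gam_le[OF chaos_exp_diff[OF assms(1,2)] _ assms(5,6)])
     (unfold Gam_diff, rule chaos_exp_diff[OF assms(3,4)])

text \<open>A priori the square of F is merely integrable. The squares of F' converge to it in L^1,
  by Cauchy-Schwarz on (F - F') (F + F'), and they converge to R in L^2; so both limits coincide
  almost everywhere.\<close>

lemma chaos_exp_square_limit:
  assumes F: "F \<in> L2 \<mu>" "\<And>m. F' m \<in> L2 \<mu>" "(\<lambda>m::nat. n2 \<mu> (\<lambda>w. F w - F' m w)) \<longlonglongrightarrow> 0"
    and R: "chaos_exp R k" "(\<lambda>m. n2 \<mu> (\<lambda>w. R w - F' m w * F' m w)) \<longlonglongrightarrow> 0"
    and F2: "\<And>m. (\<lambda>w. F' m w * F' m w) \<in> L2 \<mu>"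
  shows "chaos_exp (\<lambda>w. F w * F w) k"
proof (rule chaos_exp_AE_cong[OF R(1)])
  have [measurable]: "F \<in> borel_measurable \<mu>" "R \<in> borel_measurable \<mu>" "\<And>m. F' m \<in> borel_measurable \<mu>"
    using F R chaos_exp_L2[OF R(1)] by (auto simp: L2_iff)
  note RL = chaos_exp_L2[OF R(1)]
  have iF: "integrable \<mu> (\<lambda>w. F w * F w)" by (rule L2_mult_integrable[OF F(1) F(1)])
  have iR: "integrable \<mu> R" by (rule L2_integrable[OF RL])
  show "(\<lambda>w. F w * F w) \<in> borel_measurable \<mu>" by measurable
  have b: "(LINT w|\<mu>. \<bar>R w - F w * F w\<bar>) \<le> n2 \<mu> (\<lambda>w. R w - F' m w * F' m w) + n2 \<mu> (\<lambda>w. F w - F' m w) * (n2 \<mu> F + n2 \<mu> (F' m))" for m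
  proof -
    let ?a = "\<lambda>w. \<bar>F w - F' m w\<bar>" and ?b = "\<lambda>w. \<bar>F w + F' m w\<bar>"
    have ab: "?a \<in> L2 \<mu>" "?b \<in> L2 \<mu>" using L2_diff[OF F(1) F(2)[of m]] L2_add[OF F(1) F(2)[of m]] by (simp_all add: L2_iff)
    have iRF: "integrable \<mu> (\<lambda>w. \<bar>R w - F' m w * F' m w\<bar>)" using L2_integrable[OF L2_diff[OF RL F2]] by simp
    have iab: "integrable \<mu> (\<lambda>w. ?a w * ?b w)" by (rule L2_mult_integrable[OF ab])
    have "(LINT w|\<mu>. \<bar>R w - F w * F w\<bar>) \<le> (LINT w|\<mu>. \<bar>R w - F' m w * F' m w\<bar> + ?a w * ?b w)"
    proof (rule integral_mono)
      show "integrable \<mu> (\<lambda>w. \<bar>R w - F w * F w\<bar>)" using iF iR by simp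
      show "integrable \<mu> (\<lambda>w. \<bar>R w - F' m w * F' m w\<bar> + ?a w * ?b w)" using iRF iab by simp
      show "\<bar>R w - F w * F w\<bar> \<le> \<bar>R w - F' m w * F' m w\<bar> + ?a w * ?b w" for w
      proof -
        have "R w - F w * F w = (R w - F' m w * F' m w) - (F w - F' m w) * (F w + F' m w)" by (simp add: algebra_simps)
        then show ?thesis unfolding abs_mult[symmetric] by linarith
      qed
    qed
    also have "\<dots> = (LINT w|\<mu>. \<bar>R w - F' m w * F' m w\<bar>) + (LINT w|\<mu>. ?a w * ?b w)" using iRF iab by simp
    also have "\<dots> \<le> n2 \<mu> (\<lambda>w. R w - F' m w * F' m w) + n2 \<mu> ?a * n2 \<mu> ?b"
      by (intro add_mono integral_abs_le_n2 L2_diff RL F2 order_trans[OF abs_ge_self cauchy_schwarz_L2[OF ab]])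
    also have "n2 \<mu> ?a = n2 \<mu> (\<lambda>w. F w - F' m w)" by (simp add: n2_eq)
    also have "n2 \<mu> ?b = n2 \<mu> (\<lambda>w. F w + F' m w)" by (simp add: n2_eq)
    also have "n2 \<mu> (\<lambda>w. R w - F' m w * F' m w) + n2 \<mu> (\<lambda>w. F w - F' m w) * n2 \<mu> (\<lambda>w. F w + F' m w)
        \<le> n2 \<mu> (\<lambda>w. R w - F' m w * F' m w) + n2 \<mu> (\<lambda>w. F w - F' m w) * (n2 \<mu> F + n2 \<mu> (F' m))"
      by (intro add_left_mono mult_left_mono n2_triangle F) auto
    finally show ?thesis .
  qed
  have "(\<lambda>m. n2 \<mu> (\<lambda>w. R w - F' m w * F' m w) + n2 \<mu> (\<lambda>w. F w - F' m w) * (n2 \<mu> F + n2 \<mu> (F' m))) \<longlonglongrightarrow> 0 + 0 * (n2 \<mu> F + n2 \<mu> F)"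
    by (intro tendsto_intros R F n2_tendsto)
  then have "(LINT w|\<mu>. \<bar>R w - F w * F w\<bar>) \<le> 0" by (intro LIMSEQ_le_const) (use b in auto)
  moreover have "0 \<le> (LINT w|\<mu>. \<bar>R w - F w * F w\<bar>)" by simp
  ultimately have "(LINT w|\<mu>. \<bar>R w - F w * F w\<bar>) = 0" by linarith
  then have "AE w in \<mu>. \<bar>R w - F w * F w\<bar> = 0" using iF iR by (subst (asm) integral_nonneg_eq_0_iff_AE) auto
  then show "AE w in \<mu>. R w = F w * F w" by eventually_elim simp
qed

end

lemma tendsto_powr_0: "(a \<longlongrightarrow> 0) F \<Longrightarrow> (\<And>n. 0 \<le> a n) \<Longrightarrow> 0 < (r::real) \<Longrightarrow> ((\<lambda>n. a n powr r) \<longlongrightarrow> 0) F"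
  by (rule tendsto_zero_powrI[OF _ tendsto_const]) auto

lemma Lp_cauchy_powr:
  fixes g :: "'w \<Rightarrow> 'b::{real_normed_vector, second_countable_topology}" and u :: "nat \<Rightarrow> 'w \<Rightarrow> 'b"
  assumes g: "g \<in> Lp_space M p" "\<And>n. u n \<in> Lp_space M p" and p: "0 < p" and r: "0 < r" and e: "0 < e"
    and lim: "(\<lambda>n. LINT x|M. norm (g x - u n x) powr p) \<longlonglongrightarrow> 0"
  shows "\<exists>N. \<forall>m\<ge>N. \<forall>n\<ge>N. (LINT x|M. norm (u m x - u n x) powr p) powr r \<le> e"
proof -
  let ?a = "\<lambda>n. LINT x|M. norm (g x - u n x) powr p"
  define d where "d = e powr (1 / r) / (2 * 2 powr p)"
  have d: "0 < d" using e by (simp add: d_def)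
  from order_tendstoD(2)[OF lim d] obtain N where N: "\<And>n. N \<le> n \<Longrightarrow> ?a n < d" unfolding eventually_sequentially by blast
  show ?thesis
  proof (intro exI[of _ N] allI impI)
    fix m n assume mn: "N \<le> m" "N \<le> n"
    have "(LINT x|M. norm (u m x - u n x) powr p) \<le> 2 powr p * ((LINT x|M. norm (u m x - g x) powr p) + ?a n)"
      by (rule Lp_triangle[OF g(2,1,2) p])
    also have "\<dots> \<le> 2 powr p * (d + d)"
      using N[OF mn(1)] N[OF mn(2)] by (intro mult_left_mono add_mono) (auto simp: norm_minus_commute)
    also have "\<dots> = e powr (1 / r)" by (simp add: d_def)
    finally have "(LINT x|M. norm (u m x - u n x) powr p) powr r \<le> (e powr (1 / r)) powr r"
      using r by (intro powr_mono2) auto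
    then show "(LINT x|M. norm (u m x - u n x) powr p) powr r \<le> e" using e r by (simp add: powr_powr)
  qed
qed

lemma Lp_bounded_powr:
  fixes g :: "'w \<Rightarrow> 'b::{real_normed_vector, second_countable_topology}" and u :: "nat \<Rightarrow> 'w \<Rightarrow> 'b"
  assumes g: "g \<in> Lp_space M p" "\<And>n. u n \<in> Lp_space M p" and p: "0 < p" and r: "0 < r"
    and lim: "(\<lambda>n. LINT x|M. norm (g x - u n x) powr p) \<longlonglongrightarrow> 0"
  shows "\<exists>K>0. \<forall>n. (LINT x|M. norm (u n x) powr p) powr r \<le> K"
proof -
  let ?a = "\<lambda>n. LINT x|M. norm (g x - u n x) powr p"
  obtain A where A: "\<And>n. norm (?a n) \<le> A" using convergent_imp_Bseq[OF convergentI[OF lim]] unfolding Bseq_def by blast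
  define B where "B = 2 powr p * (A + (LINT x|M. norm (g x) powr p))"
  have z: "(\<lambda>x. 0) \<in> Lp_space M p" using p by (simp add: Lp_space_def)
  have "(LINT x|M. norm (u n x) powr p) powr r \<le> max 1 (B powr r)" for n
  proof -
    have "(LINT x|M. norm (u n x - 0) powr p) \<le> 2 powr p * ((LINT x|M. norm (u n x - g x) powr p) + (LINT x|M. norm (g x - 0) powr p))"
      by (rule Lp_triangle[OF g(2,1) z p])
    also have "\<dots> \<le> B" unfolding B_def using A[of n] by (intro mult_left_mono add_mono) (auto simp: norm_minus_commute)
    finally have "(LINT x|M. norm (u n x) powr p) powr r \<le> B powr r" using r by (intro powr_mono2) auto
    then show ?thesis by simp
  qed
  then show ?thesis by (intro exI[of _ "max 1 (B powr r)"]) auto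
qed

section \<open>Continuity of the terms of the inequality\<close>

context abstract_wiener_space
begin

lemma tev_tmult_powr:
  "\<bar>tev (tmult D D) (Z w)\<bar> powr (p / 2) = \<bar>tev D (Z w)\<bar> powr p"
proof -
  have "\<bar>tev (tmult D D) (Z w)\<bar> powr (p / 2) = (\<bar>tev D (Z w)\<bar> powr 2) powr (p / 2)"
    unfolding tev_tmult[OF linear_Z] powr_2_abs by (simp add: power2_eq_square)
  then show ?thesis unfolding powr_powr by simp
qed

lemma tev_tgrad_sq_powr:
  "\<bar>tev (tgrad_sq D) (Z w)\<bar> powr (p / 2) = norm (tgrad D (Z w)) powr p"
proof -
  have "\<bar>tev (tgrad_sq D) (Z w)\<bar> powr (p / 2) = (\<bar>norm (tgrad D (Z w))\<bar> powr 2) powr (p / 2)"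
    unfolding tev_tgrad_sq[OF linear_Z] powr_2_abs by simp
  then show ?thesis unfolding powr_powr by simp
qed

text \<open>Hypercontractivity with exponent p / 2 is applied to the squares of D and E, which is
  why the Sobolev exponent is twice the hypercontractive one.\<close>

lemma n2_tQ_le:
  assumes cs: "c\<^sup>2 + s\<^sup>2 = 1" "c\<^sup>2 - s\<^sup>2 = \<alpha>" and p: "2 < p" "p \<le> 4" and \<alpha>: "0 \<le> \<alpha>" "\<alpha> \<le> p / 2 - 1"
  shows "n2 \<mu> (\<lambda>w. tev (tQ c s D E) (Z w))
    \<le> sqrt ((LINT w|\<mu>. \<bar>tev D (Z w)\<bar> powr p) powr (2 / p) * (LINT w|\<mu>. \<bar>tev E (Z w)\<bar> powr p) powr (2 / p))"
proof (rule real_le_rsqrt)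
  have "(n2 \<mu> (\<lambda>w. tev (tQ c s D E) (Z w)))\<^sup>2 \<le> tcorr \<alpha> (tmult D D) (tmult E E)" by (rule n2_tQ_power2_le[OF cs])
  also have "\<dots> \<le> (LINT w|\<mu>. \<bar>tev (tmult D D) (Z w)\<bar> powr (p / 2)) powr (1 / (p / 2)) * (LINT w|\<mu>. \<bar>tev (tmult E E) (Z w)\<bar> powr (p / 2)) powr (1 / (p / 2))"
    by (rule tcorr_le) (use p \<alpha> in auto)
  finally show "(n2 \<mu> (\<lambda>w. tev (tQ c s D E) (Z w)))\<^sup>2
    \<le> (LINT w|\<mu>. \<bar>tev D (Z w)\<bar> powr p) powr (2 / p) * (LINT w|\<mu>. \<bar>tev E (Z w)\<bar> powr p) powr (2 / p)"
    unfolding tev_tmult_powr by simp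
qed

text \<open>With \<xi> = \<Gamma>(c) \<eta>, the operator \<Gamma>(c) is moved to U, and
  hypercontractivity bounds \<Gamma>(c) U in L^2 by the norm of U in L^(p/2); this is where c^2
  \<le> p / 2 - 1 enters. Integrals against \<rho> are thus controlled by norms under \<mu>.\<close>

lemma integral_tev_density_le:
  assumes m: "chaos_exp \<xi> m" "chaos_exp \<eta> (Gam (1 / c) m)" and c: "0 < c" "c\<^sup>2 \<le> p / 2 - 1" and p: "2 < p" "p \<le> 4"
  shows "(LINT w|\<mu>. tev U (Z w) * \<xi> w) \<le> (LINT w|\<mu>. \<bar>tev U (Z w)\<bar> powr (p / 2)) powr (2 / p) * n2 \<mu> \<eta>"
proof -
  let ?A = "(LINT w|\<mu>. \<bar>tev U (Z w)\<bar> powr (p / 2)) powr (2 / p)"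
  have "(n2 \<mu> (\<lambda>w. tev (tgam c U) (Z w)))\<^sup>2 \<le> ?A * ?A"
    unfolding n2_tev_tgam_power2 using tcorr_le[of "p / 2" "c\<^sup>2" U U] c p by simp
  then have "(n2 \<mu> (\<lambda>w. tev (tgam c U) (Z w)))\<^sup>2 \<le> ?A\<^sup>2" by (simp only: power2_eq_square[of ?A])
  then have le: "n2 \<mu> (\<lambda>w. tev (tgam c U) (Z w)) \<le> ?A" by (rule power2_le_imp_le) (rule powr_ge_zero)
  have "chaos_exp (\<lambda>w. tev (tgam c U) (Z w)) (Gam (1 / (1 / c)) (tker U))" using chaos_exp_tev_tgam[of c U] by simp
  from integral_Gam_duality[OF chaos_exp_tev this m] c
  have "(LINT w|\<mu>. tev U (Z w) * \<xi> w) = (LINT w|\<mu>. tev (tgam c U) (Z w) * \<eta> w)" by simp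
  also have "\<dots> \<le> n2 \<mu> (\<lambda>w. tev (tgam c U) (Z w)) * n2 \<mu> \<eta>"
    by (rule order_trans[OF abs_ge_self cauchy_schwarz_L2[OF L2_tev chaos_exp_L2[OF m(2)]]])
  also have "\<dots> \<le> ?A * n2 \<mu> \<eta>" by (intro mult_right_mono le) simp
  finally show ?thesis .
qed

text \<open>An abstract v covers both the function (v from \<open>tev\<close>) and its derivative (v
  from \<open>tgrad\<close>); S D is the trigonometric polynomial that equals the squared norm of v
  D. The approximants are Cauchy in L^2 of \<rho> by the preceding bound applied to S of a
  difference.\<close>

lemma tendsto_L2_density:
  fixes g :: "'w \<Rightarrow> 'b::{real_normed_vector, second_countable_topology}" and v :: "'h trig \<Rightarrow> 'w \<Rightarrow> 'b" and S :: "'h trig \<Rightarrow> 'h trig"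
  assumes m: "chaos_exp \<xi> m" "chaos_exp \<eta> (Gam (1 / c) m)" and c: "0 < c" "c\<^sup>2 \<le> p / 2 - 1" and p: "2 < p" "p \<le> 4"
    and \<xi>: "AE w in \<mu>. 0 \<le> \<xi> w"
    and g: "g \<in> Lp_space \<mu> p" "\<And>D. v D \<in> Lp_space \<mu> p"
    and lim: "(\<lambda>k. LINT w|\<mu>. norm (g w - v (D k) w) powr p) \<longlonglongrightarrow> 0"
    and v: "\<And>D E w. v (D @ tscale (-1) E) w = v D w - v E w"
    and S: "\<And>D w. tev (S D) (Z w) = (norm (v D w))\<^sup>2" "\<And>D w. \<bar>tev (S D) (Z w)\<bar> powr (p / 2) = norm (v D w) powr p"
  shows "(\<lambda>k. LINT w|\<mu>. (norm (v (D k) w))\<^sup>2 * \<xi> w) \<longlonglongrightarrow> (LINT w|density \<mu> (\<lambda>w. ennreal (\<xi> w)). (norm (g w))\<^sup>2)"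
proof -
  note \<xi>L = chaos_exp_L2[OF m(1)]
  have [measurable]: "\<xi> \<in> borel_measurable \<mu>" using \<xi>L by (simp add: L2_iff)
  have [measurable]: "g \<in> borel_measurable \<mu>" "\<And>D. v D \<in> borel_measurable \<mu>" using g by (auto simp: Lp_space_def)
  let ?\<rho> = "density \<mu> (\<lambda>w. ennreal (\<xi> w))"
  have \<rho>: "(LINT w|?\<rho>. (norm (v D w))\<^sup>2) = (LINT w|\<mu>. tev (S D) (Z w) * \<xi> w)" for D
    by (subst integral_density) (use \<xi> in \<open>auto simp: S(1) mult.commute\<close>)
  have p0: "0 < p" using p by simp
  obtain r where r: "strict_mono r" "AE w in \<mu>. (\<lambda>k. v (D (r k)) w) \<longlonglongrightarrow> g w" by (rule Lp_AE_subseq[OF g p0 lim])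
  have "(\<lambda>k. LINT w|?\<rho>. (norm (v (D k) w))\<^sup>2) \<longlonglongrightarrow> (LINT w|?\<rho>. (norm (g w))\<^sup>2)"
  proof (rule tendsto_L2_norm_of_cauchy[OF _ _ _ r(1)])
    show "(\<lambda>w. norm (v (D n) w)) \<in> L2 ?\<rho>" for n
    proof -
      have "integrable \<mu> (\<lambda>w. \<xi> w *\<^sub>R (norm (v (D n) w))\<^sup>2)"
        using L2_mult_integrable[OF \<xi>L L2_tev[of "S (D n)"]] by (simp add: S(1))
      then have "integrable ?\<rho> (\<lambda>w. (norm (v (D n) w))\<^sup>2)" by (subst integrable_density) (use \<xi> in auto)
      then show ?thesis by (simp add: L2_iff)
    qed
    show "AE w in ?\<rho>. (\<lambda>k. v (D (r k)) w) \<longlonglongrightarrow> g w" using r(2) by (subst AE_density) auto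
    fix e :: real assume e: "0 < e"
    \<comment> \<open>The summand 1 keeps the denominator positive when \<eta> has norm 0.\<close>
    have pos: "0 < n2 \<mu> \<eta> + 1" by (simp add: add_nonneg_pos)
    then have "0 < e / (n2 \<mu> \<eta> + 1)" using e by simp
    from Lp_cauchy_powr[OF g(1) g(2) p0 _ this lim, of "2 / p"]
    obtain N where N: "\<And>m n. N \<le> m \<Longrightarrow> N \<le> n \<Longrightarrow> (LINT w|\<mu>. norm (v (D m) w - v (D n) w) powr p) powr (2 / p) \<le> e / (n2 \<mu> \<eta> + 1)"
      using p0 by auto
    show "\<exists>N. \<forall>m\<ge>N. \<forall>n\<ge>N. (LINT w|?\<rho>. (norm (v (D m) w - v (D n) w))\<^sup>2) \<le> e"
    proof (intro exI[of _ N] allI impI)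
      fix m' n assume mn: "N \<le> m'" "N \<le> n"
      let ?D = "D m' @ tscale (-1) (D n)"
      have "(LINT w|?\<rho>. (norm (v (D m') w - v (D n) w))\<^sup>2) = (LINT w|\<mu>. tev (S ?D) (Z w) * \<xi> w)"
        unfolding v[symmetric] by (rule \<rho>)
      also have "\<dots> \<le> (LINT w|\<mu>. \<bar>tev (S ?D) (Z w)\<bar> powr (p / 2)) powr (2 / p) * n2 \<mu> \<eta>"
        by (rule integral_tev_density_le[OF m c p])
      also have "\<dots> = (LINT w|\<mu>. norm (v (D m') w - v (D n) w) powr p) powr (2 / p) * n2 \<mu> \<eta>" unfolding S(2) v ..
      also have "\<dots> \<le> e / (n2 \<mu> \<eta> + 1) * (n2 \<mu> \<eta> + 1)" using e pos by (intro mult_mono N mn) auto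
      also have "\<dots> = e" using pos by simp
      finally show "(LINT w|?\<rho>. (norm (v (D m') w - v (D n) w))\<^sup>2) \<le> e" .
    qed
  qed measurable
  then show ?thesis unfolding \<rho> S(1) .
qed

end

section \<open>The inequality on the Sobolev space\<close>

context abstract_wiener_space
begin

lemma tev_tgrad_diff:
  "tev (D @ tscale (-1) E) \<phi> = tev D \<phi> - tev E \<phi>"
  "tgrad (D @ tscale (-1) E) \<phi> = tgrad D \<phi> - tgrad E \<phi>"
  by simp_all

text \<open>The telescoping identity and hypercontractivity make Q of the approximants Cauchy in
  L^2; the limit has a chaos expansion because expandable functions form a closed set.\<close>

lemma exists_tQ_limit:
  assumes cs: "c\<^sup>2 + s\<^sup>2 = 1" "c\<^sup>2 - s\<^sup>2 = \<alpha>" and p: "2 < p" "p \<le> 4" and \<alpha>: "0 \<le> \<alpha>" "\<alpha> \<le> p / 2 - 1"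
    and f: "f \<in> Lp_space \<mu> p" and lim: "(\<lambda>k. LINT w|\<mu>. \<bar>f w - tev (D k) (Z w)\<bar> powr p) \<longlonglongrightarrow> 0"
  obtains Q q where "chaos_exp Q q" "(\<lambda>k. n2 \<mu> (\<lambda>w. Q w - tev (tQ c s (D k) (D k)) (Z w))) \<longlonglongrightarrow> 0"
proof -
  have p0: "0 < p" "0 < 2 / p" using p by auto
  let ?N = "\<lambda>D. (LINT w|\<mu>. \<bar>tev D (Z w)\<bar> powr p) powr (2 / p)"
  have lim': "(\<lambda>k. LINT w|\<mu>. norm (f w - tev (D k) (Z w)) powr p) \<longlonglongrightarrow> 0" using lim by simp
  from Lp_bounded_powr[OF f Lp_space_tev[OF p0(1)] p0 lim']
  obtain K where K: "0 < K" "\<And>n. ?N (D n) \<le> K" by auto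
  have "\<exists>N. \<forall>i\<ge>N. \<forall>j\<ge>N. n2 \<mu> (\<lambda>w. tev (tQ c s (D i) (D i)) (Z w) - tev (tQ c s (D j) (D j)) (Z w)) < e" if e: "0 < e" for e
  proof -
    \<comment> \<open>With this d each of the two telescoped terms is at most sqrt (d K) = e /
      3.\<close>
    define d where "d = (e / 3)\<^sup>2 / K"
    have d: "0 < d" "d * K = (e / 3)\<^sup>2" using e K by (auto simp: d_def)
    from Lp_cauchy_powr[OF f Lp_space_tev[OF p0(1)] p0 d(1) lim']
    obtain N where N: "\<And>i j. N \<le> i \<Longrightarrow> N \<le> j \<Longrightarrow> (LINT w|\<mu>. norm (tev (D i) (Z w) - tev (D j) (Z w)) powr p) powr (2 / p) \<le> d" by blast
    show ?thesis
    proof (intro exI[of _ N] allI impI)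
      fix i j assume ij: "N \<le> i" "N \<le> j"
      let ?D = "D i @ tscale (-1) (D j)"
      have ND: "?N ?D \<le> d" using N[OF ij] by (simp only: tev_tgrad_diff real_norm_def)
      have "n2 \<mu> (\<lambda>w. tev (tQ c s (D i) (D i)) (Z w) - tev (tQ c s (D j) (D j)) (Z w))
          = n2 \<mu> (\<lambda>w. tev (tQ c s ?D (D i)) (Z w) + tev (tQ c s (D j) ?D) (Z w))"
        unfolding tev_tQ_diff[OF linear_Z] ..
      also have "\<dots> \<le> n2 \<mu> (\<lambda>w. tev (tQ c s ?D (D i)) (Z w)) + n2 \<mu> (\<lambda>w. tev (tQ c s (D j) ?D) (Z w))"
        by (intro n2_triangle L2_tev)
      also have "\<dots> \<le> sqrt (?N ?D * ?N (D i)) + sqrt (?N (D j) * ?N ?D)"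
        by (intro add_mono n2_tQ_le[OF cs p \<alpha>])
      also have "\<dots> \<le> sqrt (d * K) + sqrt (K * d)"
        using K(1) d(1) by (intro add_mono real_sqrt_le_mono mult_mono ND K(2)) auto
      also have "\<dots> = 2 * (e / 3)" using e unfolding mult.commute[of K d] d(2) by simp
      also have "\<dots> < e" using e by simp
      finally show "n2 \<mu> (\<lambda>w. tev (tQ c s (D i) (D i)) (Z w) - tev (tQ c s (D j) (D j)) (Z w)) < e" .
    qed
  qed
  from L2_complete[OF L2_tev this] obtain Q where Q: "Q \<in> L2 \<mu>" "(\<lambda>k. n2 \<mu> (\<lambda>w. Q w - tev (tQ c s (D k) (D k)) (Z w))) \<longlonglongrightarrow> 0"
    by blast
  obtain q where "chaos_exp Q q" using chaos_exp_closed[OF Q(1) _ Q(2)] chaos_exp_tev by blast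
  then show ?thesis using that Q(2) by blast
qed

lemma exists_chaos_exp_Lp:
  assumes p: "2 \<le> p" and f: "f \<in> Lp_space \<mu> p" and lim: "(\<lambda>k. LINT w|\<mu>. \<bar>f w - tev (D k) (Z w)\<bar> powr p) \<longlonglongrightarrow> 0"
  obtains k where "chaos_exp f k" "(\<lambda>m. n2 \<mu> (\<lambda>w. f w - tev (D m) (Z w))) \<longlonglongrightarrow> 0"
proof -
  have p0: "0 < p" using p by simp
  have "(\<lambda>m. (LINT w|\<mu>. \<bar>f w - tev (D m) (Z w)\<bar> powr p) powr (2 / p)) \<longlonglongrightarrow> 0"
    by (rule tendsto_powr_0[OF lim]) (use p in auto)
  then have sq: "(\<lambda>m. sqrt ((LINT w|\<mu>. \<bar>f w - tev (D m) (Z w)\<bar> powr p) powr (2 / p))) \<longlonglongrightarrow> 0"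
    using tendsto_real_sqrt by fastforce
  have l: "(\<lambda>m. n2 \<mu> (\<lambda>w. f w - tev (D m) (Z w))) \<longlonglongrightarrow> 0"
  proof (rule tendsto_sandwich[OF _ _ tendsto_const sq])
    show "\<forall>\<^sub>F m in sequentially. n2 \<mu> (\<lambda>w. f w - tev (D m) (Z w)) \<le> sqrt ((LINT w|\<mu>. \<bar>f w - tev (D m) (Z w)\<bar> powr p) powr (2 / p))"
      by (intro always_eventually allI real_le_rsqrt n2_power2_le_Lp[OF Lp_space_diff[OF f Lp_space_tev] p] p0)
  qed simp
  have "\<exists>k. chaos_exp f k" by (rule chaos_exp_closed[OF Lp_space_L2[OF f p] _ l]) (use chaos_exp_tev in blast)
  then show ?thesis using that l by blast
qed

text \<open>For trigonometric polynomials the square of \<Gamma>(r) D is \<Gamma>(b) Q by the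
  product formula. Since \<Gamma>(r) and \<Gamma>(b) are contractions of L^2, both sides pass to the
  limit.\<close>

lemma chaos_exp_Gam_fun_square:
  assumes cs: "c\<^sup>2 + s\<^sup>2 = 1" "c\<^sup>2 - s\<^sup>2 = r\<^sup>2" "b * c = r" and r: "0 \<le> r" "r \<le> 1" and b: "0 \<le> b" "b \<le> 1"
    and k: "chaos_exp f k" and flim: "(\<lambda>m. n2 \<mu> (\<lambda>w. f w - tev (D m) (Z w))) \<longlonglongrightarrow> 0"
    and q: "chaos_exp Q q" and Qlim: "(\<lambda>m. n2 \<mu> (\<lambda>w. Q w - tev (tQ c s (D m) (D m)) (Z w))) \<longlonglongrightarrow> 0"
  shows "chaos_exp (\<lambda>w. Gam_fun \<iota> \<mu> r f w * Gam_fun \<iota> \<mu> r f w) (Gam b q)"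
proof -
  have F: "chaos_exp (Gam_fun \<iota> \<mu> r f) (Gam r k)"
    unfolding Gam_fun_def fun_of_chaos_def chaos_of_eq[OF k] by (rule someI_ex[OF chaos_exp_Gam_contraction[OF k r]])
  obtain R where R: "chaos_exp R (Gam b q)" using chaos_exp_Gam_contraction[OF q b] by blast
  have sq: "tev (tgam r (D m)) (Z w) * tev (tgam r (D m)) (Z w) = tev (tgam b (tQ c s (D m) (D m))) (Z w)" for m w
    unfolding tev_tmult[OF linear_Z, symmetric] tmult_tgam_eq_tgam_tQ[OF cs] ..
  show ?thesis
  proof (rule chaos_exp_square_limit[where F' = "\<lambda>m w. tev (tgam r (D m)) (Z w)", OF chaos_exp_L2[OF F] L2_tev _ R])
    show "(\<lambda>m. n2 \<mu> (\<lambda>w. Gam_fun \<iota> \<mu> r f w - tev (tgam r (D m)) (Z w))) \<longlonglongrightarrow> 0"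
      by (rule tendsto_sandwich[OF _ _ tendsto_const flim])
         (intro always_eventually allI n2_nonneg n2_Gam_diff_le[OF k chaos_exp_tev F chaos_exp_tev_tgam r])+
    show "(\<lambda>m. n2 \<mu> (\<lambda>w. R w - tev (tgam r (D m)) (Z w) * tev (tgam r (D m)) (Z w))) \<longlonglongrightarrow> 0"
      unfolding sq
      by (rule tendsto_sandwich[OF _ _ tendsto_const Qlim])
         (intro always_eventually allI n2_nonneg n2_Gam_diff_le[OF q chaos_exp_tev R chaos_exp_tev_tgam b])+
    show "(\<lambda>w. tev (tgam r (D m)) (Z w) * tev (tgam r (D m)) (Z w)) \<in> L2 \<mu>" for m unfolding sq by (rule L2_tev)
  qed
qed

text \<open>The powers of a may sit on either side of the pairing. With a b = 1 / c both forms of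
  the pairing term become the integral of Q \<eta>, which is the equivalence of the two
  inequalities.\<close>

lemma chaos_pairing_Gam_eq:
  assumes "chaos_exp Q q" "chaos_exp \<eta> (Gam (a * b) m)"
  shows "chaos_pairing (Gam a (Gam b q)) m = (LINT w|\<mu>. Q w * \<eta> w)"
    and "chaos_pairing (Gam b q) (Gam a m) = (LINT w|\<mu>. Q w * \<eta> w)"
proof -
  have S: "(\<lambda>n. fact n * ((a * b) ^ n * tensor_inner n (q n) (m n))) sums (LINT w|\<mu>. Q w * \<eta> w)"
    using chaos_exp_parseval[OF assms] tensor_inner_Gam[of _ 1 q "a * b" m] by (simp add: Gam_def)
  have "Gam a (Gam b q) = Gam (a * b) q" by (simp add: Gam_def power_mult_distrib mult.assoc)
  then have "tensor_inner n (Gam a (Gam b q) n) (m n) = (a * b) ^ n * tensor_inner n (q n) (m n)" for n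
    using tensor_inner_Gam[of n "a * b" q 1 m] by (simp add: Gam_def)
  then show "chaos_pairing (Gam a (Gam b q)) m = (LINT w|\<mu>. Q w * \<eta> w)"
    unfolding chaos_pairing_def using sums_unique[OF S] by simp
  show "chaos_pairing (Gam b q) (Gam a m) = (LINT w|\<mu>. Q w * \<eta> w)"
    unfolding chaos_pairing_def tensor_inner_Gam using sums_unique[OF S] by (simp add: mult.commute)
qed

theorem alpha_product_inequality:
  assumes \<nu>: "prob_space \<nu>" "sets \<nu> = sets borel" and \<alpha>: "0 < \<alpha>" "\<alpha> \<le> 1"
    and \<xi>: "AE w in \<mu>. 0 \<le> \<xi> w" "convolve \<mu> \<nu> = density \<mu> (\<lambda>w. ennreal (\<xi> w))" "fun_in_G \<iota> \<mu> (sqrt (2 / (1 + \<alpha>))) \<xi>"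
    and f: "f \<in> sobolev_space \<iota> \<mu> (3 + \<alpha>)"
  defines "\<rho> \<equiv> density \<mu> (\<lambda>w. ennreal (\<xi> w))" and "F \<equiv> Gam_fun \<iota> \<mu> (sqrt \<alpha>) f" and "G \<equiv> malliavin_derivative \<iota> \<mu> (3 + \<alpha>) f"
  shows "(LINT w|\<rho>. (f w)\<^sup>2) - chaos_pairing (Gam (1 / sqrt \<alpha>) (chaos_of \<iota> \<mu> (\<lambda>w. F w * F w))) (chaos_of \<iota> \<mu> \<xi>)
      \<le> (1 - \<alpha>) * (LINT w|\<rho>. (norm (G w))\<^sup>2)"
    and "(LINT w|\<rho>. (f w)\<^sup>2) - chaos_pairing (chaos_of \<iota> \<mu> (\<lambda>w. F w * F w)) (Gam (1 / sqrt \<alpha>) (chaos_of \<iota> \<mu> \<xi>))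
      \<le> (1 - \<alpha>) * (LINT w|\<rho>. (norm (G w))\<^sup>2)"
proof -
  \<comment> \<open>This exponent makes p / 2 - 1 = c^2, exactly the threshold at which \<Gamma>(c)
    maps L^(p/2) to L^2.\<close>
  define p where "p = 3 + \<alpha>"
  define c where "c = sqrt ((1 + \<alpha>) / 2)"
  define s where "s = sqrt ((1 - \<alpha>) / 2)"
  \<comment> \<open>\<Gamma>(sqrt \<alpha>) factors as \<Gamma>(b) \<Gamma>(c) with b \<le> 1, so
    the square of \<Gamma>(sqrt \<alpha>) f will be \<Gamma>(b) of the square integrable Q.\<close>
  define b where "b = sqrt \<alpha> / c"
  have p: "2 < p" "p \<le> 4" "0 < p" "\<alpha> \<le> p / 2 - 1" using \<alpha> by (auto simp: p_def field_simps)
  have c: "0 < c" "c\<^sup>2 = p / 2 - 1" using \<alpha> by (auto simp: c_def p_def field_simps)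
  have cs: "c\<^sup>2 + s\<^sup>2 = 1" "c\<^sup>2 - s\<^sup>2 = \<alpha>" using \<alpha> by (auto simp: c_def s_def field_simps)
  have lam: "sqrt (2 / (1 + \<alpha>)) = 1 / c" by (simp add: c_def real_sqrt_divide)
  have b: "b * c = sqrt \<alpha>" "0 \<le> b" "b \<le> 1" "1 / sqrt \<alpha> * b = 1 / c"
  proof -
    have "sqrt \<alpha> \<le> c" unfolding c_def using \<alpha> by (intro real_sqrt_le_mono) auto
    then show "b * c = sqrt \<alpha>" "0 \<le> b" "b \<le> 1" "1 / sqrt \<alpha> * b = 1 / c" using c \<alpha> by (auto simp: b_def)
  qed
  obtain m where m: "chaos_exp \<xi> m" "m \<in> G_space (1 / c)" using \<xi>(3) unfolding lam fun_in_G_def by blast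
  \<comment> \<open>The hypothesis on the density says that \<Gamma>(1 / c) \<xi> is an actual
    square integrable function.\<close>
  obtain \<eta> where \<eta>: "chaos_exp \<eta> (Gam (1 / c) m)"
    using chaos_exp_Gam_exists[of m "1 / c"] m(2) unfolding G_space_def by blast
  obtain D where fL: "f \<in> Lp_space \<mu> p" and GL: "G \<in> Lp_space \<mu> p"
    and flim: "(\<lambda>k. LINT w|\<mu>. \<bar>f w - tev (D k) (Z w)\<bar> powr p) \<longlonglongrightarrow> 0"
    and Glim: "(\<lambda>k. LINT w|\<mu>. norm (G w - tgrad (D k) (Z w)) powr p) \<longlonglongrightarrow> 0"
    unfolding G_def p_def[symmetric] by (rule malliavin_derivative_trig_approx[OF f[folded p_def] p(3)])
  obtain Q q where q: "chaos_exp Q q" and Qlim: "(\<lambda>k. n2 \<mu> (\<lambda>w. Q w - tev (tQ c s (D k) (D k)) (Z w))) \<longlonglongrightarrow> 0"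
    by (rule exists_tQ_limit[OF cs p(1,2) _ p(4) fL flim]) (use \<alpha> in auto)
  obtain k where k: "chaos_exp f k" and f2: "(\<lambda>m. n2 \<mu> (\<lambda>w. f w - tev (D m) (Z w))) \<longlonglongrightarrow> 0"
    by (rule exists_chaos_exp_Lp[OF _ fL flim]) (use p in auto)
  have "chaos_exp (\<lambda>w. F w * F w) (Gam b q)"
    unfolding F_def by (rule chaos_exp_Gam_fun_square[OF cs(1) _ b(1) _ _ b(2,3) k f2 q Qlim]) (use cs \<alpha> in auto)
  note K = chaos_of_eq[OF this]
  have pair: "chaos_pairing (Gam (1 / sqrt \<alpha>) (chaos_of \<iota> \<mu> (\<lambda>w. F w * F w))) (chaos_of \<iota> \<mu> \<xi>) = (LINT w|\<mu>. Q w * \<eta> w)"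
    "chaos_pairing (chaos_of \<iota> \<mu> (\<lambda>w. F w * F w)) (Gam (1 / sqrt \<alpha>) (chaos_of \<iota> \<mu> \<xi>)) = (LINT w|\<mu>. Q w * \<eta> w)"
    unfolding K chaos_of_eq[OF m(1)] by (rule chaos_pairing_Gam_eq[OF q \<eta>[folded b(4)]])+
  have 1: "(\<lambda>n. LINT w|\<mu>. (tev (D n) (Z w))\<^sup>2 * \<xi> w) \<longlonglongrightarrow> (LINT w|\<rho>. (f w)\<^sup>2)"
  proof -
    have S: "tev (tmult D D) (Z w) = (norm (tev D (Z w)))\<^sup>2" "\<bar>tev (tmult D D) (Z w)\<bar> powr (p / 2) = norm (tev D (Z w)) powr p" for D w
      unfolding tev_tmult_powr by (simp_all add: tev_tmult[OF linear_Z] power2_eq_square)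
    have flim': "(\<lambda>k. LINT w|\<mu>. norm (f w - tev (D k) (Z w)) powr p) \<longlonglongrightarrow> 0" using flim by simp
    from tendsto_L2_density[OF m(1) \<eta> c(1) eq_refl[OF c(2)] p(1,2) \<xi>(1) fL Lp_space_tev[OF p(3)] flim' tev_tgrad_diff(1) S]
    show ?thesis unfolding \<rho>_def real_norm_def power2_abs .
  qed
  have 2: "(\<lambda>n. LINT w|\<mu>. (norm (tgrad (D n) (Z w)))\<^sup>2 * \<xi> w) \<longlonglongrightarrow> (LINT w|\<rho>. (norm (G w))\<^sup>2)"
    unfolding \<rho>_def
    by (rule tendsto_L2_density[OF m(1) \<eta> c(1) eq_refl[OF c(2)] p(1,2) \<xi>(1) GL Lp_space_tgrad[OF p(3)] Glim tev_tgrad_diff(2) tev_tgrad_sq[OF linear_Z] tev_tgrad_sq_powr])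
  have 3: "(\<lambda>n. LINT w|\<mu>. tev (tQ c s (D n) (D n)) (Z w) * \<eta> w) \<longlonglongrightarrow> (LINT w|\<mu>. Q w * \<eta> w)"
    by (rule integral_mult_tendsto_L2[OF _ chaos_exp_L2[OF q] chaos_exp_L2[OF \<eta>] Qlim]) (simp add: L2_tev)
  have ineq: "(LINT w|\<rho>. (f w)\<^sup>2) - (LINT w|\<mu>. Q w * \<eta> w) \<le> (1 - \<alpha>) * (LINT w|\<rho>. (norm (G w))\<^sup>2)"
  proof (rule LIMSEQ_le[OF tendsto_diff[OF 1 3] tendsto_mult_left[OF 2]])
    show "\<exists>N. \<forall>n\<ge>N. (LINT w|\<mu>. (tev (D n) (Z w))\<^sup>2 * \<xi> w) - (LINT w|\<mu>. tev (tQ c s (D n) (D n)) (Z w) * \<eta> w)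
        \<le> (1 - \<alpha>) * (LINT w|\<mu>. (norm (tgrad (D n) (Z w)))\<^sup>2 * \<xi> w)"
      using trig_inequality[OF \<nu> chaos_exp_L2[OF m(1)] \<xi>(1,2) _ cs c(1) m(1) \<eta>] \<alpha> by auto
  qed
  show "(LINT w|\<rho>. (f w)\<^sup>2) - chaos_pairing (Gam (1 / sqrt \<alpha>) (chaos_of \<iota> \<mu> (\<lambda>w. F w * F w))) (chaos_of \<iota> \<mu> \<xi>)
      \<le> (1 - \<alpha>) * (LINT w|\<rho>. (norm (G w))\<^sup>2)"
    and "(LINT w|\<rho>. (f w)\<^sup>2) - chaos_pairing (chaos_of \<iota> \<mu> (\<lambda>w. F w * F w)) (Gam (1 / sqrt \<alpha>) (chaos_of \<iota> \<mu> \<xi>))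
      \<le> (1 - \<alpha>) * (LINT w|\<rho>. (norm (G w))\<^sup>2)"
    unfolding pair by (rule ineq)+
qed

end

theorem theorem3p7:
  fixes \<iota> :: "'h::{real_inner, banach, second_countable_topology}
              \<Rightarrow> 'w::{banach, second_countable_topology}"
    and \<mu> \<nu> \<rho> :: "'w measure"
    and \<alpha> :: real
    and \<xi> f :: "'w \<Rightarrow> real"
  assumes "abstract_wiener_space \<iota> \<mu>"
    and "prob_space \<nu>" and "sets \<nu> = sets borel"
    and "0 < \<alpha>" and "\<alpha> \<le> 1"
    and "\<rho> = convolve \<mu> \<nu>"
    and "\<xi> \<in> borel_measurable \<mu>" and "AE w in \<mu>. 0 \<le> \<xi> w"
    and "\<rho> = density \<mu> (\<lambda>w. ennreal (\<xi> w))"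
    and "fun_in_G \<iota> \<mu> (sqrt (2 / (1 + \<alpha>))) \<xi>"
    and "f \<in> sobolev_space \<iota> \<mu> (3 + \<alpha>)"
  shows "(LINT w|\<rho>. \<bar>f w\<bar>\<^sup>2)
           - chaos_pairing (alpha_product \<iota> \<mu> \<alpha> f f) (chaos_of \<iota> \<mu> \<xi>)
         \<le> (1 - \<alpha>) * (LINT w|\<rho>. (norm (malliavin_derivative \<iota> \<mu> (3 + \<alpha>) f w))\<^sup>2)
       \<and> (LINT w|\<rho>. \<bar>f w\<bar>\<^sup>2)
           - chaos_pairing (chaos_of \<iota> \<mu> (\<lambda>w. \<bar>Gam_fun \<iota> \<mu> (sqrt \<alpha>) f w\<bar>\<^sup>2))
               (Gam (1 / sqrt \<alpha>) (chaos_of \<iota> \<mu> \<xi>))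
         \<le> (1 - \<alpha>) * (LINT w|\<rho>. (norm (malliavin_derivative \<iota> \<mu> (3 + \<alpha>) f w))\<^sup>2)"
proof -
  interpret abstract_wiener_space \<iota> \<mu> by fact
  have conv: "convolve \<mu> \<nu> = density \<mu> (\<lambda>w. ennreal (\<xi> w))" using assms(6,9) by simp
  note I = alpha_product_inequality[OF assms(2-5,8) conv assms(10,11)]
  show ?thesis
    unfolding assms(9) alpha_product_def power2_abs power2_eq_square[of "Gam_fun \<iota> \<mu> (sqrt \<alpha>) f _"]
    by (intro conjI I)
qed

end
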